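(* Let $0<\beta\le 1$, $0<p\le1$, $1<q<\infty$, $\alpha\in\mathbb R$, and let $w_1\in A_{q_1}$ and $w_2\in A_{q_2}$ be weights on $\mathbb R^n$. If $1\le q_1<\infty$, $1\le q_2\le q$ and $\alpha q_1=n(1-q_2/q)$, then the intrinsic Littlewood-Paley $\mathcal G$-function $\mathcal G_\beta$ is bounded from $\dot K^{\alpha,p}_q(w_1,w_2)$ into $W\dot K^{\alpha,p}_q(w_1,w_2)$ and from $K^{\alpha,p}_q(w_1,w_2)$ into $WK^{\alpha,p}_q(w_1,w_2)$; that is, there is a constant $C>0$ independent of $f$ such that $$\|\mathcal G_\beta(f)\|_{W\dot K^{\alpha,p}_q(w_1,w_2)}\le C\|f\|_{\dot K^{\alpha,p}_q(w_1,w_2)}\quad\text{for all } f\in\dot K^{\alpha,p}_q(w_1,w_2),$$ and $$\|\mathcal G_\beta(f)\|_{WK^{\alpha,p}_q(w_1,w_2)}\le C\|f\|_{K^{\alpha,p}_q(w_1,w_2)}\quad\text{for all } f\in K^{\alpha,p}_q(w_1,w_2).$$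
   Context: **Weights.** A weight $w$ is a nonnegative, locally integrable function on $\mathbb R^n$, not identically zero (a.e.); $w(E)=\int_E w(x)\,dx$. For $1<s<\infty$, $w\in A_s$ means there is $C>0$ such that for every ball $B\subseteq\mathbb R^n$, $\big(\frac1{|B|}\int_B w\,dx\big)\big(\frac1{|B|}\int_B w^{-1/(s-1)}\,dx\big)^{s-1}\le C$; $w\in A_1$ means there is $C>0$ with $\frac1{|B|}\int_B w\,dx\le C\,\operatorname{ess\,inf}_{x\in B}w(x)$ for every ball $B$. $\|f\|_{L^q_w}=\big(\int_{\mathbb R^n}|f|^q w\,dx\big)^{1/q}$. **Weighted Herz spaces.** Let $B_k=\{x\in\mathbb R^n:|x|\le 2^k\}$, $C_k=B_k\setminus B_{k-1}$ for $k\in\mathbb Z$, $\chi_k=\chi_{C_k}$ (characteristic function), $\widetilde\chi_k=\chi_k$ for integers $k\ge1$ and $\widetilde\chi_0=\chi_{B_0}$. The homogeneous space $\dot K^{\alpha,p}_q(w_1,w_2)$ consists of all $f\in L^q_{loc}(\mathbb R^n\setminus\{0\},w_2)$ with $$\|f\|_{\dot K^{\alpha,p}_q(w_1,w_2)}=\Big(\sum_{k\in\mathbb Z}[w_1(B_k)]^{\alpha p/n}\|f\chi_k\|_{L^q_{w_2}}^p\Big)^{1/p}<\infty,$$ and the non-homogeneous space $K^{\alpha,p}_q(w_1,w_2)$ consists of all $f\in L^q_{loc}(\mathbb R^n,w_2)$ with $$\|f\|_{K^{\alpha,p}_q(w_1,w_2)}=\Big(\sum_{k=0}^\infty[w_1(B_k)]^{\alpha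 p/n}\|f\widetilde\chi_k\|_{L^q_{w_2}}^p\Big)^{1/p}<\infty.$$ **Weighted weak Herz spaces.** For $\sigma>0$ and measurable $f$, let $E_k(\sigma,f)=\{x\in C_k:|f(x)|>\sigma\}$ for $k\in\mathbb Z$, $\widetilde E_k(\sigma,f)=E_k(\sigma,f)$ for integers $k\ge1$, and $\widetilde E_0(\sigma,f)=\{x\in B_0:|f(x)|>\sigma\}$. The spaces $W\dot K^{\alpha,p}_q(w_1,w_2)$ and $WK^{\alpha,p}_q(w_1,w_2)$ consist of the measurable $f$ for which, respectively, $$\|f\|_{W\dot K^{\alpha,p}_q(w_1,w_2)}=\sup_{\sigma>0}\sigma\Big(\sum_{k\in\mathbb Z}[w_1(B_k)]^{\alpha p/n}[w_2(E_k(\sigma,f))]^{p/q}\Big)^{1/p}<\infty,$$ $$\|f\|_{WK^{\alpha,p}_q(w_1,w_2)}=\sup_{\sigma>0}\sigma\Big(\sum_{k=0}^\infty[w_1(B_k)]^{\alpha p/n}[w_2(\widetilde E_k(\sigma,f))]^{p/q}\Big)^{1/p}<\infty.$$ **Intrinsic $\mathcal G$-function.** For $0<\beta\le1$, $\mathcal C_\beta$ is the family of functions $\varphi$ on $\mathbb R^n$ with support contained in $\{|x|\le1\}$, $\int_{\mathbb R^n}\varphi\,dx=0$, and $|\varphi(x)-\varphi(x')|\le|x-x'|^\beta$ for all $x,x'\in\mathbb R^n$. With $\varphi_t(x)=t^{-n}\varphi(x/t)$, for $f\in L^1_{loc}(\mathbb R^n)$ and $(y,t)\in\mathbb R^n\times(0,\infty)$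 put $A_\beta(f)(y,t)=\sup_{\varphi\in\mathcal C_\beta}|f*\varphi_t(y)|$. Then $$\mathcal G_\beta(f)(x)=\Big(\int_0^\infty\big(A_\beta(f)(x,t)\big)^2\frac{dt}{t}\Big)^{1/2}.$$ *)

theory Defs
  imports "HOL-Analysis.Analysis"
begin

text \<open>
  Real powers of extended nonnegative reals.  Unlike \<^const>\<open>powr\<close> on the reals (where
  \<open>0 powr r = 0\<close> for every \<open>r\<close>), we have \<open>0\<^sup>0 = 1\<close> and \<open>0\<^sup>r = \<infinity>\<close> for \<open>r < 0\<close>.  The latter
  matters in the Muckenhoupt condition, where \<open>w\<close> may vanish a priori.
\<close>

definition ennpow :: "ennreal \<Rightarrow> real \<Rightarrow> ennreal" where
  "ennpow x r =
     (if r = 0 then 1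
      else if x = 0 then (if r < 0 then top else 0)
      else if x = top then (if r < 0 then 0 else top)
      else ennreal (enn2real x powr r))"


definition weight :: "('a::euclidean_space \<Rightarrow> real) \<Rightarrow> bool" where
  "weight w \<longleftrightarrow>
     (\<forall>x. 0 \<le> w x) \<and>
     (\<forall>K. compact K \<longrightarrow> set_integrable lebesgue K w) \<and>
     \<not> (AE x in lebesgue. w x = 0)"

definition wmeas :: "('a::euclidean_space \<Rightarrow> real) \<Rightarrow> 'a set \<Rightarrow> ennreal" where
  "wmeas w E = (\<integral>\<^sup>+x\<in>E. ennreal (w x) \<partial>lebesgue)"

definition average :: "'a::euclidean_space set \<Rightarrow> ('a \<Rightarrow> ennreal) \<Rightarrow> ennreal" where
  "average B g = (\<integral>\<^sup>+x\<in>B. g x \<partial>lebesgue) / emeasure lebesgue B"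

text \<open>
  The limes inferior along the almost-everywhere filter is the largest almost-everywhere lower
  bound (dually to the library's definition of \<open>esssup\<close>).
\<close>

definition essinf_on :: "'a::euclidean_space set \<Rightarrow> ('a \<Rightarrow> ennreal) \<Rightarrow> ennreal" where
  "essinf_on B g = Liminf (ae_filter (restrict_space lebesgue B)) g"

text \<open>The class \<open>A\<^sub>s\<close>; meaningful for \<open>1 \<le> s\<close> only.\<close>

definition muckenhoupt :: "real \<Rightarrow> ('a::euclidean_space \<Rightarrow> real) set" where
  "muckenhoupt s = {w. weight w \<and>
     (\<exists>C::real. C > 0 \<and> (\<forall>c r. r > 0 \<longrightarrow>
        (if s = 1
         then average (ball c r) (\<lambda>x. ennreal (w x))
                \<le> ennreal C * essinf_on (ball c r) (\<lambda>x. ennreal (w x))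
         else average (ball c r) (\<lambda>x. ennreal (w x)) *
                ennpow (average (ball c r) (\<lambda>x. ennpow (ennreal (w x)) (- 1 / (s - 1)))) (s - 1)
                \<le> ennreal C)))}"


definition Lq_norm :: "real \<Rightarrow> ('a::euclidean_space \<Rightarrow> real) \<Rightarrow> ('a \<Rightarrow> complex) \<Rightarrow> ennreal" where
  "Lq_norm q w f = ennpow (\<integral>\<^sup>+x. ennreal (norm (f x) powr q * w x) \<partial>lebesgue) (1 / q)"

definition Lq_loc ::
    "real \<Rightarrow> 'a::euclidean_space set \<Rightarrow> ('a \<Rightarrow> real) \<Rightarrow> ('a \<Rightarrow> complex) set" where
  "Lq_loc q U w = {f \<in> borel_measurable lebesgue.
     \<forall>K. compact K \<and> K \<subseteq> U \<longrightarrow> (\<integral>\<^sup>+x\<in>K. ennreal (norm (f x) powr q * w x) \<partial>lebesgue) < top}"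

definition restr :: "'a set \<Rightarrow> ('a \<Rightarrow> complex) \<Rightarrow> 'a \<Rightarrow> complex" where
  "restr E f = (\<lambda>x. f x * indicator E x)"

definition dyadic_ball :: "int \<Rightarrow> 'a::euclidean_space set" where
  "dyadic_ball k = cball 0 (2 powi k)"

definition annulus :: "int \<Rightarrow> 'a::euclidean_space set" where
  "annulus k = dyadic_ball k - dyadic_ball (k - 1)"

text \<open>The sets carrying the non-homogeneous cut-offs: \<open>B\<^sub>0\<close> for \<open>k = 0\<close>, \<open>C\<^sub>k\<close> for \<open>k \<ge> 1\<close>.\<close>

definition nh_annulus :: "nat \<Rightarrow> 'a::euclidean_space set" where
  "nh_annulus k = (if k = 0 then dyadic_ball 0 else annulus (int k))"


definition herz_hom_norm ::
    "real \<Rightarrow> real \<Rightarrow> real \<Rightarrow> ('a::euclidean_space \<Rightarrow> real) \<Rightarrow> ('a \<Rightarrow> real) \<Rightarrow>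
     ('a \<Rightarrow> complex) \<Rightarrow> ennreal" where
  "herz_hom_norm \<alpha> p q w1 w2 f =
     ennpow (\<Sum>\<^sub>\<infinity>k\<in>(UNIV::int set).
       ennpow (wmeas w1 (dyadic_ball k)) (\<alpha> * p / real DIM('a)) *
       ennpow (Lq_norm q w2 (restr (annulus k) f)) p) (1 / p)"

definition herz_hom ::
    "real \<Rightarrow> real \<Rightarrow> real \<Rightarrow> ('a::euclidean_space \<Rightarrow> real) \<Rightarrow> ('a \<Rightarrow> real) \<Rightarrow>
     ('a \<Rightarrow> complex) set" where
  "herz_hom \<alpha> p q w1 w2 = {f \<in> Lq_loc q (UNIV - {0}) w2. herz_hom_norm \<alpha> p q w1 w2 f < top}"

definition herz_nonhom_norm ::
    "real \<Rightarrow> real \<Rightarrow> real \<Rightarrow> ('a::euclidean_space \<Rightarrow> real) \<Rightarrow> ('a \<Rightarrow> real) \<Rightarrow>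
     ('a \<Rightarrow> complex) \<Rightarrow> ennreal" where
  "herz_nonhom_norm \<alpha> p q w1 w2 f =
     ennpow (\<Sum>\<^sub>\<infinity>k\<in>(UNIV::nat set).
       ennpow (wmeas w1 (dyadic_ball (int k))) (\<alpha> * p / real DIM('a)) *
       ennpow (Lq_norm q w2 (restr (nh_annulus k) f)) p) (1 / p)"

definition herz_nonhom ::
    "real \<Rightarrow> real \<Rightarrow> real \<Rightarrow> ('a::euclidean_space \<Rightarrow> real) \<Rightarrow> ('a \<Rightarrow> real) \<Rightarrow>
     ('a \<Rightarrow> complex) set" where
  "herz_nonhom \<alpha> p q w1 w2 = {f \<in> Lq_loc q UNIV w2. herz_nonhom_norm \<alpha> p q w1 w2 f < top}"

text \<open>
  The weak quasi-norms involve only \<open>\<bar>g\<bar>\<close>, so they are set up for \<open>[0,\<infinity>]\<close>-valued \<open>g\<close>: the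
  intrinsic \<open>\<G>\<close>-function is such a function, and may a priori be infinite.
\<close>

definition weak_herz_hom_norm ::
    "real \<Rightarrow> real \<Rightarrow> real \<Rightarrow> ('a::euclidean_space \<Rightarrow> real) \<Rightarrow> ('a \<Rightarrow> real) \<Rightarrow>
     ('a \<Rightarrow> ennreal) \<Rightarrow> ennreal" where
  "weak_herz_hom_norm \<alpha> p q w1 w2 g =
     (SUP \<sigma>\<in>{0::real<..}. ennreal \<sigma> *
        ennpow (\<Sum>\<^sub>\<infinity>k\<in>(UNIV::int set).
          ennpow (wmeas w1 (dyadic_ball k)) (\<alpha> * p / real DIM('a)) *
          ennpow (wmeas w2 {x \<in> annulus k. g x > ennreal \<sigma>}) (p / q)) (1 / p))"

definition weak_herz_hom ::
    "real \<Rightarrow> real \<Rightarrow> real \<Rightarrow> ('a::euclidean_space \<Rightarrow> real) \<Rightarrow> ('a \<Rightarrow> real) \<Rightarrow>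
     ('a \<Rightarrow> ennreal) set" where
  "weak_herz_hom \<alpha> p q w1 w2 =
     {g \<in> borel_measurable lebesgue. weak_herz_hom_norm \<alpha> p q w1 w2 g < top}"

definition weak_herz_nonhom_norm ::
    "real \<Rightarrow> real \<Rightarrow> real \<Rightarrow> ('a::euclidean_space \<Rightarrow> real) \<Rightarrow> ('a \<Rightarrow> real) \<Rightarrow>
     ('a \<Rightarrow> ennreal) \<Rightarrow> ennreal" where
  "weak_herz_nonhom_norm \<alpha> p q w1 w2 g =
     (SUP \<sigma>\<in>{0::real<..}. ennreal \<sigma> *
        ennpow (\<Sum>\<^sub>\<infinity>k\<in>(UNIV::nat set).
          ennpow (wmeas w1 (dyadic_ball (int k))) (\<alpha> * p / real DIM('a)) *
          ennpow (wmeas w2 {x \<in> nh_annulus k. g x > ennreal \<sigma>}) (p / q)) (1 / p))"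

definition weak_herz_nonhom ::
    "real \<Rightarrow> real \<Rightarrow> real \<Rightarrow> ('a::euclidean_space \<Rightarrow> real) \<Rightarrow> ('a \<Rightarrow> real) \<Rightarrow>
     ('a \<Rightarrow> ennreal) set" where
  "weak_herz_nonhom \<alpha> p q w1 w2 =
     {g \<in> borel_measurable lebesgue. weak_herz_nonhom_norm \<alpha> p q w1 w2 g < top}"


definition test_class :: "real \<Rightarrow> ('a::euclidean_space \<Rightarrow> complex) set" where
  "test_class \<beta> = {\<phi>.
     closure {x. \<phi> x \<noteq> 0} \<subseteq> cball 0 1 \<and>
     (LINT x|lebesgue. \<phi> x) = 0 \<and>
     (\<forall>x x'. norm (\<phi> x - \<phi> x') \<le> norm (x - x') powr \<beta>)}"

definition dilate :: "real \<Rightarrow> ('a::euclidean_space \<Rightarrow> complex) \<Rightarrow> 'a \<Rightarrow> complex" where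
  "dilate t \<phi> x = \<phi> (x /\<^sub>R t) /\<^sub>R t ^ DIM('a)"

definition convol ::
    "('a::euclidean_space \<Rightarrow> complex) \<Rightarrow> ('a \<Rightarrow> complex) \<Rightarrow> 'a \<Rightarrow> complex" where
  "convol f g y = (LINT x|lebesgue. f x * g (y - x))"

text \<open>
  Functions are complex-valued, both \<open>f\<close> and the test functions.  For real \<open>f\<close> the supremum is
  the same as the one over real test functions, as one may rotate \<open>\<phi>\<close> by a unimodular constant
  and pass to its real part.
\<close>

definition A_fun ::
    "real \<Rightarrow> ('a::euclidean_space \<Rightarrow> complex) \<Rightarrow> 'a \<Rightarrow> real \<Rightarrow> ennreal" where
  "A_fun \<beta> f y t = (SUP \<phi>\<in>test_class \<beta>. ennreal (norm (convol f (dilate t \<phi>) y)))"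

definition G_fun :: "real \<Rightarrow> ('a::euclidean_space \<Rightarrow> complex) \<Rightarrow> 'a \<Rightarrow> ennreal" where
  "G_fun \<beta> f x = ennpow (\<integral>\<^sup>+t\<in>{0<..}. (A_fun \<beta> f x t)\<^sup>2 / ennreal t \<partial>lebesgue) (1 / 2)"

end

theory Submission
  imports Defs
begin

text \<open>
  Split \<open>f\<close> on \<open>C\<^sub>k\<close> into an inner, a middle and an outer part.  The inner and outer parts are
  controlled by the size estimate \<open>\<G>\<^sub>\<beta> f(x) \<le> 3 \<integral> |f(y)| |x - y|\<^sup>-\<^sup>n dy\<close> and by geometric growth of
  \<open>w\<^sub>1(B\<^sub>k)\<^bsup>\<alpha>/n\<^esup> w\<^sub>2(B\<^sub>k)\<^bsup>1/q\<^esup>\<close>, the middle part by a weak type \<open>(q,q)\<close> bound for \<open>\<G>\<^sub>\<beta>\<close> with \<open>A\<^sub>q\<close>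
  weights.  For the latter, \<open>\<G>\<^sub>\<beta>\<close> is dominated by a dyadic square function
  \<open>\<Sum>\<^sub>Q \<langle>f, \<psi>\<^sub>Q\<rangle>\<^sup>2 1\<^sub>Q\<close>, where \<open>\<psi>\<^sub>Q\<close> is a nearly optimal test function at the cube \<open>Q\<close>.  Almost
  orthogonality of the \<open>\<psi>\<^sub>Q\<close> gives the unweighted \<open>L\<^sup>2\<close> bound, a Calderon--Zygmund decomposition
  the weak type \<open>(1,1)\<close> bound, and a good-\<open>\<lambda>\<close> inequality on the maximal cubes of the level sets
  the weighted bound: the partial sums over large cubes stay constant on each such cube, so
  no smoothness of the operator enters there.
\<close>

section \<open>Integrals over countable partitions\<close>

text \<open>The condition \<alpha> q1 = n (1 - q2/q) is an endpoint. With a k = w1(B_k)^(\<alpha>/n)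
  w2(B_k)^(1/q), doubling of both weights gives a k / a j at most a constant times 2^((k-j)n) for j
  \<le> k, with no slack in the exponent. Hence the inner cells bound G on C_k by a constant over a
  k, without decay in the distance of the cells; weighted by a k this is constant in k, so it cannot
  be summed to a strong estimate. A weak one survives: at a given height only those k count for
  which a k lies below a threshold, and geometric growth of a k makes the sum over them comparable
  to its largest term. The outer cells do have decay. The supremum over test functions makes G
  nonlinear. Fixing one nearly optimal function per cube linearises it, but these functions then
  depend on f and are unrelated from cube to cube. So all bounds are uniform over families of atoms,
  and orthogonality uses only size, cancellation and Hoelder continuity of single atoms.\<close>

lemma nn_integral_UN_countable:
  fixes u :: "'a \<Rightarrow> ennreal"
  assumes "countable I" "\<And>i. i \<in> I \<Longrightarrow> X i \<in> sets M" "disjoint_family_on X I"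
    and u: "u \<in> borel_measurable M"
  shows "(\<integral>\<^sup>+x\<in>(\<Union>i\<in>I. X i). u x \<partial>M) = (\<integral>\<^sup>+i. (\<integral>\<^sup>+x\<in>X i. u x \<partial>M) \<partial>count_space I)"
proof -
  have U: "(\<Union>i\<in>I. X i) \<in> sets M"
    using assms by (intro sets.countable_UN') auto
  have "emeasure (density M u) (\<Union>i\<in>I. X i) = (\<integral>\<^sup>+i. emeasure (density M u) (X i) \<partial>count_space I)"
    using assms by (intro emeasure_UN_countable) auto
  also have "\<dots> = (\<integral>\<^sup>+i. (\<integral>\<^sup>+x\<in>X i. u x \<partial>M) \<partial>count_space I)"
    using assms by (intro nn_integral_cong) (auto simp: emeasure_density)
  finally show ?thesis
    using U u by (simp add: emeasure_density)
qed

lemma nn_integral_UN_countable_le: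
  fixes u v :: "'a \<Rightarrow> ennreal"
  assumes "countable I" "\<And>i. i \<in> I \<Longrightarrow> X i \<in> sets M" "disjoint_family_on X I"
    and "u \<in> borel_measurable M" "v \<in> borel_measurable M"
    and le: "\<And>i. i \<in> I \<Longrightarrow> (\<integral>\<^sup>+x\<in>X i. u x \<partial>M) \<le> c * (\<integral>\<^sup>+x\<in>X i. v x \<partial>M)"
  shows "(\<integral>\<^sup>+x\<in>(\<Union>i\<in>I. X i). u x \<partial>M) \<le> c * (\<integral>\<^sup>+x\<in>(\<Union>i\<in>I. X i). v x \<partial>M)"
proof -
  have "(\<integral>\<^sup>+i. (\<integral>\<^sup>+x\<in>X i. u x \<partial>M) \<partial>count_space I)
      \<le> (\<integral>\<^sup>+i. c * (\<integral>\<^sup>+x\<in>X i. v x \<partial>M) \<partial>count_space I)"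
    using le by (intro nn_integral_mono) auto
  also have "\<dots> = c * (\<integral>\<^sup>+i. (\<integral>\<^sup>+x\<in>X i. v x \<partial>M) \<partial>count_space I)"
    by (intro nn_integral_cmult) auto
  finally show ?thesis
    using assms by (simp add: nn_integral_UN_countable)
qed

lemma emeasure_UN_countable_le:
  assumes I: "countable I" and X: "\<And>i. i \<in> I \<Longrightarrow> X i \<in> sets M"
  shows "emeasure M (\<Union>i\<in>I. X i) \<le> (\<integral>\<^sup>+i. emeasure M (X i) \<partial>count_space I)"
proof -
  have U: "(\<Union>i\<in>I. X i) \<in> sets M"
    using I X by (intro sets.countable_UN') auto
  have "emeasure M (\<Union>i\<in>I. X i) = (\<integral>\<^sup>+x. indicator (\<Union>i\<in>I. X i) x \<partial>M)"
    using U by simp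
  also have "\<dots> \<le> (\<integral>\<^sup>+x. (\<integral>\<^sup>+i. indicator (X i) x \<partial>count_space I) \<partial>M)"
  proof (intro nn_integral_mono)
    fix x
    show "indicator (\<Union>i\<in>I. X i) x \<le> (\<integral>\<^sup>+i. indicator (X i) x \<partial>count_space I)"
    proof (cases "\<exists>i\<in>I. x \<in> X i")
      case True
      then obtain i where i: "i \<in> I" "x \<in> X i" by auto
      have "1 = (\<integral>\<^sup>+k. indicator {i} k \<partial>count_space I)"
        using i by (subst nn_integral_indicator) (auto simp: one_ennreal_def)
      also have "\<dots> \<le> (\<integral>\<^sup>+k. indicator (X k) x \<partial>count_space I)"
        using i by (intro nn_integral_mono) (auto split: split_indicator)
      finally show ?thesis using i by (auto split: split_indicator)
    qed auto
  qed
  also have "\<dots> = (\<integral>\<^sup>+i. (\<integral>\<^sup>+x. indicator (X i) x \<partial>M) \<partial>count_space I)"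
    using I X by (intro nn_integral_count_space_nn_integral) auto
  also have "\<dots> = (\<integral>\<^sup>+i. emeasure M (X i) \<partial>count_space I)"
    using X by (intro nn_integral_cong) auto
  finally show ?thesis .
qed

text \<open>Serves the bad part of the Calderon-Zygmund decomposition, whose cancellation is known
  cube by cube. The cells are renumbered by naturals, with empty sets as padding, so that additivity
  along a sequence applies.\<close>

lemma integral_partition_zero:
  fixes u :: "'a \<Rightarrow> real"
  assumes u: "integrable M u" and I: "countable I" and X: "\<And>i. i \<in> I \<Longrightarrow> X i \<in> sets M"
    and disj: "disjoint_family_on X I" and cover: "(\<Union>i\<in>I. X i) = space M"
    and zero: "\<And>i. i \<in> I \<Longrightarrow> (\<integral>x. indicator (X i) x * u x \<partial>M) = 0"
  shows "integral\<^sup>L M u = 0"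
proof -
  define A where "A n = (if n \<in> to_nat_on I ` I then X (from_nat_into I n) else {})" for n
  have mem: "from_nat_into I n \<in> I" if "n \<in> to_nat_on I ` I" for n
    using that I by auto
  have UN: "(\<Union>n. A n) = space M"
  proof -
    have "(\<Union>n. A n) = (\<Union>i\<in>I. X i)"
    proof safe
      fix x n assume "x \<in> A n" then show "x \<in> (\<Union>i\<in>I. X i)"
        using mem by (auto simp: A_def split: if_splits)
    next
      fix x i assume "i \<in> I" "x \<in> X i"
      then have "x \<in> A (to_nat_on I i)" using I by (auto simp: A_def)
      then show "x \<in> (\<Union>n. A n)" by blast
    qed
    then show ?thesis using cover by simp
  qed
  have inj: "A i \<inter> A j = {}" if "i \<noteq> j" for i j
  proof (cases "i \<in> to_nat_on I ` I \<and> j \<in> to_nat_on I ` I")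
    case True
    then have "from_nat_into I i \<noteq> from_nat_into I j"
      using that I by auto
    then show ?thesis
      using disj True mem[of i] mem[of j] by (auto simp: A_def disjoint_family_on_def)
  qed (auto simp: A_def)
  have sets: "A i \<in> sets M" for i
    using X mem by (auto simp: A_def)
  have "(LINT x:(\<Union>i. A i)|M. u x) = (\<Sum>i. (LINT x:(A i)|M. u x))"
  proof (rule lebesgue_integral_countable_add[OF sets inj])
    have "integrable M (\<lambda>x. indicator (space M) x *\<^sub>R u x) = integrable M u"
      by (rule Bochner_Integration.integrable_cong) auto
    then show "set_integrable M (\<Union>i. A i) u" using u by (simp add: UN set_integrable_def)
  qed auto
  moreover have "(LINT x:(A i)|M. u x) = 0" for i
    using zero mem by (auto simp: A_def set_lebesgue_integral_def)
  moreover have "(LINT x:(\<Union>i. A i)|M. u x) = integral\<^sup>L M u"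
    unfolding UN set_lebesgue_integral_def by (rule Bochner_Integration.integral_cong) auto
  ultimately show ?thesis by simp
qed

section \<open>Two integral inequalities\<close>

text \<open>Young's inequality, applied pointwise to u and v scaled by a^(1/p) and b^(1/q). If one
  of the bounds a, b is 0 the scaling fails, but then the product vanishes almost
  everywhere.\<close>

lemma nn_integral_Holder:
  fixes u v :: "'a \<Rightarrow> real"
  assumes [measurable]: "u \<in> borel_measurable M" "v \<in> borel_measurable M"
    and nonneg: "\<And>x. 0 \<le> u x" "\<And>x. 0 \<le> v x"
    and p: "1 < p" "1 < q" "1 / p + 1 / q = 1"
    and a: "(\<integral>\<^sup>+x. ennreal (u x powr p) \<partial>M) \<le> ennreal a" "0 \<le> a"
    and b: "(\<integral>\<^sup>+x. ennreal (v x powr q) \<partial>M) \<le> ennreal b" "0 \<le> b"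
  shows "(\<integral>\<^sup>+x. ennreal (u x * v x) \<partial>M) \<le> ennreal (a powr (1 / p) * b powr (1 / q))"
proof (cases "a = 0 \<or> b = 0")
  case True
  have "AE x in M. u x * v x = 0"
  proof (cases "a = 0")
    case True
    then have "AE x in M. ennreal (u x powr p) = 0"
      using a by (intro nn_integral_0_iff_AE[THEN iffD1]) auto
    then show ?thesis by eventually_elim (auto simp: ennreal_eq_0_iff)
  next
    case False
    then have "AE x in M. ennreal (v x powr q) = 0"
      using True b by (intro nn_integral_0_iff_AE[THEN iffD1]) auto
    then show ?thesis by eventually_elim (auto simp: ennreal_eq_0_iff)
  qed
  then have "(\<integral>\<^sup>+x. ennreal (u x * v x) \<partial>M) = 0"
    by (intro nn_integral_0_iff_AE[THEN iffD2]) (auto elim: eventually_mono)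
  then show ?thesis by simp
next
  case False
  then have ab: "0 < a" "0 < b" using a b by auto
  define k where "k = a powr (1 / p) * b powr (1 / q)"
  have k: "0 < k" using ab by (simp add: k_def)
  have le: "u x * v x \<le> k * (u x powr p / (a * p) + v x powr q / (b * q))" for x
  proof -
    have "(u x / a powr (1/p)) * (v x / b powr (1/q))
        \<le> (u x / a powr (1/p)) powr p / p + (v x / b powr (1/q)) powr q / q"
      using p nonneg by (intro Youngs_inequality) auto
    also have "\<dots> = u x powr p / (a * p) + v x powr q / (b * q)"
      using ab p nonneg by (simp add: powr_divide powr_powr)
    finally have "k * ((u x / a powr (1/p)) * (v x / b powr (1/q)))
       \<le> k * (u x powr p / (a * p) + v x powr q / (b * q))" using k by (intro mult_left_mono) auto
    moreover have "k * ((u x / a powr (1/p)) * (v x / b powr (1/q))) = u x * v x"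
      using ab by (simp add: k_def)
    ultimately show ?thesis by simp
  qed
  have "(\<integral>\<^sup>+x. ennreal (u x * v x) \<partial>M)
      \<le> (\<integral>\<^sup>+x. ennreal (k / (a * p)) * ennreal (u x powr p) + ennreal (k / (b * q)) * ennreal (v x powr q) \<partial>M)"
    using le k ab p
    by (intro nn_integral_mono)
       (auto simp: ennreal_mult[symmetric] ennreal_plus[symmetric] algebra_simps simp del: ennreal_plus intro!: ennreal_leI)
  also have "\<dots> = ennreal (k / (a * p)) * (\<integral>\<^sup>+x. ennreal (u x powr p) \<partial>M)
       + ennreal (k / (b * q)) * (\<integral>\<^sup>+x. ennreal (v x powr q) \<partial>M)"
    by (simp add: nn_integral_add nn_integral_cmult)
  also have "\<dots> \<le> ennreal (k / (a * p)) * ennreal a + ennreal (k / (b * q)) * ennreal b"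
    using a b by (intro add_mono mult_left_mono) auto
  also have "\<dots> = ennreal (k * (1/p + 1/q))"
    using k ab p by (simp add: ennreal_mult[symmetric] ennreal_plus[symmetric] field_simps del: ennreal_plus)
  finally show ?thesis using p by (simp add: k_def)
qed

text \<open>A Schur test on the weighted Gram matrix of a family that is only almost orthogonal.
  With T the sum of v_i c_i psi_i, where c_i is the inner product of g and psi_i, the row bound
  controls the squared norm of T by C X. The inner product of g and T is X, so expanding the squared
  norm of g - T/C, which is nonnegative, gives the claim.\<close>

lemma weighted_Bessel_inequality:
  fixes \<psi> :: "'i \<Rightarrow> 'a \<Rightarrow> real" and g :: "'a \<Rightarrow> real"
  assumes F: "finite F" and v: "\<And>i. i \<in> F \<Longrightarrow> 0 \<le> v i" and C: "0 < C"
    and gram: "\<And>i. i \<in> F \<Longrightarrow> (\<Sum>j\<in>F. v j * \<bar>\<integral>x. \<psi> i x * \<psi> j x \<partial>M\<bar>) \<le> C"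
    and gg: "integrable M (\<lambda>x. (g x)\<^sup>2)"
    and g\<psi>: "\<And>i. i \<in> F \<Longrightarrow> integrable M (\<lambda>x. g x * \<psi> i x)"
    and \<psi>\<psi>: "\<And>i j. i \<in> F \<Longrightarrow> j \<in> F \<Longrightarrow> integrable M (\<lambda>x. \<psi> i x * \<psi> j x)"
  shows "(\<Sum>i\<in>F. v i * (\<integral>x. g x * \<psi> i x \<partial>M)\<^sup>2) \<le> C * (\<integral>x. (g x)\<^sup>2 \<partial>M)"
proof -
  define c where "c i = (\<integral>x. g x * \<psi> i x \<partial>M)" for i
  define X where "X = (\<Sum>i\<in>F. v i * (c i)\<^sup>2)"
  define T where "T x = (\<Sum>i\<in>F. v i * c i * \<psi> i x)" for x
  have gT: "has_bochner_integral M (\<lambda>x. g x * T x) X"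
  proof -
    have "has_bochner_integral M (\<lambda>x. \<Sum>i\<in>F. v i * c i * (g x * \<psi> i x)) (\<Sum>i\<in>F. v i * c i * c i)"
      using g\<psi> by (intro has_bochner_integral_sum has_bochner_integral_mult_right)
        (auto simp: c_def has_bochner_integral_iff)
    then show ?thesis
      by (simp add: T_def X_def sum_distrib_left power2_eq_square mult_ac)
  qed
  define Y where "Y = (\<Sum>i\<in>F. \<Sum>j\<in>F. v i * c i * (v j * c j) * (\<integral>x. \<psi> i x * \<psi> j x \<partial>M))"
  have TT: "has_bochner_integral M (\<lambda>x. (T x)\<^sup>2) Y"
  proof -
    have "has_bochner_integral M (\<lambda>x. \<Sum>i\<in>F. \<Sum>j\<in>F. v i * c i * (v j * c j) * (\<psi> i x * \<psi> j x)) Y"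
      unfolding Y_def using \<psi>\<psi>
      by (intro has_bochner_integral_sum has_bochner_integral_mult_right)
        (auto simp: has_bochner_integral_iff)
    then show ?thesis
      by (simp add: T_def power2_eq_square sum_product mult_ac)
  qed
  have Y: "Y \<le> C * X"
  proof -
    define G where "G i j = \<bar>\<integral>x. \<psi> i x * \<psi> j x \<partial>M\<bar>" for i j
    have sym: "G i j = G j i" for i j by (simp add: G_def mult.commute)
    \<comment> \<open>The product c_i c_j is split by the arithmetic-geometric mean; afterwards the
      symmetric matrix \<open>G\<close> enters only through its row sums.\<close>
    have "Y \<le> (\<Sum>i\<in>F. \<Sum>j\<in>F. v i * v j * G i j * (((c i)\<^sup>2 + (c j)\<^sup>2) / 2))"
      unfolding Y_def
    proof (intro sum_mono)
      fix i j assume ij: "i \<in> F" "j \<in> F"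
      have "c i * c j * (\<integral>x. \<psi> i x * \<psi> j x \<partial>M) \<le> \<bar>c i * c j\<bar> * G i j"
        unfolding G_def abs_mult[symmetric] by (rule abs_ge_self)
      also have "\<dots> \<le> ((c i)\<^sup>2 + (c j)\<^sup>2) / 2 * G i j"
      proof (rule mult_right_mono)
        show "\<bar>c i * c j\<bar> \<le> ((c i)\<^sup>2 + (c j)\<^sup>2) / 2"
          using sum_squares_bound[of "\<bar>c i\<bar>" "\<bar>c j\<bar>"] by (simp add: abs_mult)
      qed (simp add: G_def)
      finally have "(v i * v j) * (c i * c j * (\<integral>x. \<psi> i x * \<psi> j x \<partial>M)) \<le> (v i * v j) * (((c i)\<^sup>2 + (c j)\<^sup>2) / 2 * G i j)"
        using v ij by (intro mult_left_mono) auto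
      then show "v i * c i * (v j * c j) * (\<integral>x. \<psi> i x * \<psi> j x \<partial>M)
          \<le> v i * v j * G i j * (((c i)\<^sup>2 + (c j)\<^sup>2) / 2)"
        by (simp add: mult_ac)
    qed
    also have "\<dots> = (\<Sum>i\<in>F. \<Sum>j\<in>F. v i * (c i)\<^sup>2 * (v j * G i j)) / 2
        + (\<Sum>i\<in>F. \<Sum>j\<in>F. v j * (c j)\<^sup>2 * (v i * G i j)) / 2"
      by (simp add: sum_divide_distrib sum.distrib[symmetric] field_simps)
    also have "(\<Sum>i\<in>F. \<Sum>j\<in>F. v j * (c j)\<^sup>2 * (v i * G i j)) = (\<Sum>i\<in>F. \<Sum>j\<in>F. v i * (c i)\<^sup>2 * (v j * G i j))"
      by (subst sum.swap) (simp add: sym)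
    also have "(\<Sum>i\<in>F. \<Sum>j\<in>F. v i * (c i)\<^sup>2 * (v j * G i j)) \<le> (\<Sum>i\<in>F. v i * (c i)\<^sup>2 * C)"
      unfolding sum_distrib_left[symmetric] using gram v
      by (intro sum_mono mult_left_mono) (auto simp: G_def)
    finally show ?thesis by (simp add: X_def sum_distrib_left mult_ac)
  qed
  have "0 \<le> (\<integral>x. (g x - T x / C)\<^sup>2 \<partial>M)" by simp
  also have "\<dots> = (\<integral>x. (g x)\<^sup>2 - (2 / C) * (g x * T x) + (1 / C\<^sup>2) * (T x)\<^sup>2 \<partial>M)"
    using C by (intro Bochner_Integration.integral_cong) (auto simp: power2_eq_square field_simps)
  also have "\<dots> = (\<integral>x. (g x)\<^sup>2 \<partial>M) - (2 / C) * X + (1 / C\<^sup>2) * Y"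
    using gT TT gg by (simp add: has_bochner_integral_iff)
  also have "\<dots> \<le> (\<integral>x. (g x)\<^sup>2 \<partial>M) - (2 / C) * X + (1 / C\<^sup>2) * (C * X)"
    using Y C by (intro add_left_mono mult_left_mono) auto
  also have "\<dots> = (\<integral>x. (g x)\<^sup>2 \<partial>M) - X / C"
    using C by (simp add: power2_eq_square field_simps)
  finally have "X / C \<le> (\<integral>x. (g x)\<^sup>2 \<partial>M)" by simp
  then show ?thesis using C by (simp add: X_def c_def field_simps)
qed

section \<open>Dyadic cubes\<close>

text \<open>A dyadic cube is encoded by its scale j and its lower corner: the fixed points of
  \<open>corner j\<close> are the corners of scale j, and \<open>corner j x\<close> names the cube
  containing x. A function constant on the cubes of scale j is thus a function of
  \<open>corner j x\<close>.\<close>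

definition corner :: "int \<Rightarrow> 'a::euclidean_space \<Rightarrow> 'a" where
  "corner j x = (\<Sum>b\<in>Basis. (2 powi j * of_int \<lfloor>(x \<bullet> b) / 2 powi j\<rfloor>) *\<^sub>R b)"

text \<open>The floor makes the cubes half-open, so those of one scale partition the space. Since
  \<open>corner j\<close> is idempotent, the set is empty when z is not a corner.\<close>

definition dcube :: "int \<Rightarrow> 'a::euclidean_space \<Rightarrow> 'a set" where
  "dcube j z = {x. corner j x = z}"

lemma corner_inner:
  "b \<in> Basis \<Longrightarrow> corner j x \<bullet> b = 2 powi j * of_int \<lfloor>(x \<bullet> b) / 2 powi j\<rfloor>"
  by (simp add: corner_def inner_sum_left_Basis)

text \<open>Nestedness of dyadic cubes. It rests on the identity floor(floor(v) / 2^k) = floor(v /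
  2^k) in each coordinate.\<close>

lemma corner_corner:
  assumes "i \<le> j" shows "corner j (corner i x) = corner j x"
proof (rule euclidean_eqI)
  fix b :: 'a assume b: "b \<in> Basis"
  define k where "k = nat (j - i)"
  have j: "(2::real) powi j = 2 powi i * of_int (2 ^ k)"
    using assms by (simp add: k_def power_int_add[symmetric] flip: power_int_of_nat)
  define v where "v = (x \<bullet> b) / 2 powi i"
  have "\<lfloor>(corner i x \<bullet> b) / 2 powi j\<rfloor> = \<lfloor>of_int \<lfloor>v\<rfloor> / of_int (2 ^ k) :: real\<rfloor>"
    using b unfolding j by (simp add: corner_inner v_def)
  also have "\<dots> = \<lfloor>v\<rfloor> div 2 ^ k"
    by (rule floor_divide_of_int_eq)
  also have "\<dots> = \<lfloor>v / of_int (2 ^ k)\<rfloor>"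
    by (rule floor_divide_real_eq_div[symmetric]) simp
  also have "v / of_int (2 ^ k) = (x \<bullet> b) / 2 powi j"
    unfolding j by (simp add: v_def)
  finally show "corner j (corner i x) \<bullet> b = corner j x \<bullet> b"
    using b by (simp add: corner_inner)
qed

lemma corner_idem [simp]: "corner j (corner j x) = corner j x"
  by (rule corner_corner) simp

lemma corner_bounds:
  assumes "b \<in> Basis"
  shows "corner j x \<bullet> b \<le> x \<bullet> b" "x \<bullet> b < corner j x \<bullet> b + 2 powi j"
proof -
  have pos: "(0::real) < 2 powi j" by simp
  have "2 powi j * of_int \<lfloor>(x \<bullet> b) / 2 powi j\<rfloor> \<le> 2 powi j * ((x \<bullet> b) / 2 powi j)"
    by (intro mult_left_mono) auto
  then show "corner j x \<bullet> b \<le> x \<bullet> b"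
    unfolding corner_inner[OF assms] using pos by simp
  have "(x \<bullet> b) / 2 powi j < of_int \<lfloor>(x \<bullet> b) / 2 powi j\<rfloor> + 1"
    by linarith
  then show "x \<bullet> b < corner j x \<bullet> b + 2 powi j"
    unfolding corner_inner[OF assms] using pos by (simp add: pos_divide_less_eq algebra_simps)
qed

lemma norm_diff_corner:
  fixes x :: "'a::euclidean_space"
  shows "norm (x - corner j x) \<le> real DIM('a) * 2 powi j"
proof -
  have "norm (x - corner j x) \<le> (\<Sum>b\<in>Basis. \<bar>(x - corner j x) \<bullet> b\<bar>)"
    by (rule norm_le_l1)
  also have "\<dots> \<le> (\<Sum>b\<in>(Basis::'a set). 2 powi j)"
  proof (intro sum_mono)
    fix b :: 'a assume "b \<in> Basis"
    from corner_bounds[OF this, where j=j and x=x] show "\<bar>(x - corner j x) \<bullet> b\<bar> \<le> 2 powi j"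
      by (simp add: inner_diff_left)
  qed
  finally show ?thesis by simp
qed

lemma corner_measurable [measurable]: "corner j \<in> borel_measurable borel"
  unfolding corner_def[abs_def] by measurable

lemma dcube_borel [measurable, simp]: "dcube j z \<in> sets borel"
proof -
  have "corner j -` {z} \<inter> space borel \<in> sets borel"
    by (rule measurable_sets[OF corner_measurable]) simp
  then show ?thesis by (simp add: dcube_def vimage_def)
qed

lemma dcube_lebesgue [measurable, simp]: "dcube j z \<in> sets lebesgue"
  by (simp add: sets_completionI_sets)

lemma countable_corners: "countable {z::'a::euclidean_space. corner j z = z}"
proof (rule countable_subset)
  let ?f = "\<lambda>k. \<Sum>b\<in>(Basis::'a set). (2 powi j * of_int (k b)) *\<^sub>R b"
  show "{z. corner j z = z} \<subseteq> ?f ` (PiE Basis (\<lambda>_. UNIV))"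
  proof
    fix z :: 'a assume "z \<in> {z. corner j z = z}"
    then have "z = ?f (restrict (\<lambda>b. \<lfloor>(z \<bullet> b) / 2 powi j\<rfloor>) Basis)"
      by (simp add: corner_def)
    then show "z \<in> ?f ` (PiE Basis (\<lambda>_. UNIV))"
      by (rule image_eqI[where x="restrict (\<lambda>b. \<lfloor>(z \<bullet> b) / 2 powi j\<rfloor>) Basis"]) simp
  qed
  show "countable (?f ` (PiE Basis (\<lambda>_. UNIV)))"
    by (intro countable_image countable_PiE) auto
qed

lemma dcube_subset_cball:
  fixes z :: "'a::euclidean_space"
  shows "dcube j z \<subseteq> cball z (real DIM('a) * 2 powi j)"
  using norm_diff_corner by (auto simp: dcube_def dist_norm norm_minus_commute)

lemma emeasure_dcube:
  fixes z :: "'a::euclidean_space"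
  assumes z: "corner j z = z"
  shows "emeasure lebesgue (dcube j z) = ennreal ((2 powi j) ^ DIM('a))"
proof (rule antisym)
  have pos: "(0::real) < 2 powi j" by simp
  have inner: "(z + 2 powi j *\<^sub>R One) \<bullet> b = z \<bullet> b + 2 powi j" if "b \<in> Basis" for b
    using that by (simp add: inner_add_left)
  have zfl: "z \<bullet> b = 2 powi j * of_int \<lfloor>(z \<bullet> b) / 2 powi j\<rfloor>" if "b \<in> Basis" for b
    using corner_inner[OF that, of j z] z by simp
  have 1: "box z (z + 2 powi j *\<^sub>R One) \<subseteq> dcube j z"
  proof
    fix x assume x: "x \<in> box z (z + 2 powi j *\<^sub>R One)"
    have "corner j x = z"
    proof (rule euclidean_eqI)
      fix b :: 'a assume b: "b \<in> Basis"
      have lt: "z \<bullet> b < x \<bullet> b" "x \<bullet> b < z \<bullet> b + 2 powi j"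
        using x b by (auto simp: mem_box inner)
      have "\<lfloor>(x \<bullet> b) / 2 powi j\<rfloor> = \<lfloor>(z \<bullet> b) / 2 powi j\<rfloor>"
        using lt pos zfl[OF b] by (intro floor_unique) (simp_all add: field_simps)
      then show "corner j x \<bullet> b = z \<bullet> b"
        using b zfl[OF b] by (simp add: corner_inner)
    qed
    then show "x \<in> dcube j z" by (simp add: dcube_def)
  qed
  have 2: "dcube j z \<subseteq> cbox z (z + 2 powi j *\<^sub>R One)"
  proof
    fix x assume "x \<in> dcube j z"
    then have "corner j x = z" by (simp add: dcube_def)
    then show "x \<in> cbox z (z + 2 powi j *\<^sub>R One)"
      using corner_bounds[where j=j and x=x] by (auto simp: mem_box inner intro!: less_imp_le)
  qed
  have diff: "(z + 2 powi j *\<^sub>R One - z) \<bullet> b = 2 powi j" if "b \<in> Basis" for b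
    using that by simp
  have bx: "emeasure lborel (box z (z + 2 powi j *\<^sub>R One)) = ennreal ((2 powi j) ^ DIM('a))"
    using pos by (subst emeasure_lborel_box) (auto simp: inner less_imp_le)
  have cbx: "emeasure lborel (cbox z (z + 2 powi j *\<^sub>R One)) = ennreal ((2 powi j) ^ DIM('a))"
    using pos by (subst emeasure_lborel_cbox) (auto simp: inner less_imp_le)
  show "emeasure lebesgue (dcube j z) \<le> ennreal ((2 powi j) ^ DIM('a))"
    using emeasure_mono[OF 2, of lborel] cbx by simp
  show "ennreal ((2 powi j) ^ DIM('a)) \<le> emeasure lebesgue (dcube j z)"
    using emeasure_mono[OF 1, of lborel] bx by simp
qed

section \<open>Maximal cubes\<close>

text \<open>The maximal cubes with property P. The cubes above \<open>dcube j z\<close> are named by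
  \<open>corner i z\<close> with i > j, so maximality only speaks about these ancestors.\<close>

definition stopped :: "(int \<Rightarrow> 'a \<Rightarrow> bool) \<Rightarrow> (int \<times> 'a::euclidean_space) set" where
  "stopped P = {(j, z). corner j z = z \<and> P j z \<and> (\<forall>i>j. \<not> P i (corner i z))}"

lemma countable_stopped: "countable (stopped P)"
proof (rule countable_subset)
  show "stopped P \<subseteq> (SIGMA j:UNIV. {z. corner j z = z})"
    by (auto simp: stopped_def)
qed (intro countable_SIGMA countable_corners, auto)

text \<open>Two dyadic cubes with a common point are nested, and the larger one would be an ancestor
  of the smaller.\<close>

lemma stopped_unique:
  assumes "(j, z) \<in> stopped P" "x \<in> dcube j z" "(i, y) \<in> stopped P" "x \<in> dcube i y"
  shows "j = i" "z = y"
proof -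
  have *: "\<not> i < j" if "(j, z) \<in> stopped P" "x \<in> dcube j z" "(i, y) \<in> stopped P" "x \<in> dcube i y" for i j z y
  proof
    assume "i < j"
    then have "corner j y = z"
      using that corner_corner[of i j x] by (auto simp: dcube_def)
    then show False using that \<open>i < j\<close> by (auto simp: stopped_def)
  qed
  show "j = i" using *[OF assms] *[OF assms(3,4,1,2)] by simp
  then show "z = y" using assms by (auto simp: dcube_def)
qed

lemma disjoint_stopped: "disjoint_family_on (\<lambda>(j, z). dcube j z) (stopped P)"
  unfolding disjoint_family_on_def using stopped_unique by fastforce

text \<open>The bound M on the scales makes a maximal cube exist above every cube with P. In the
  applications it comes from integrability of f or from a truncation of the scales.\<close>

lemma stopped_cover:
  assumes bdd: "\<And>j z. corner j z = z \<Longrightarrow> P j z \<Longrightarrow> j \<le> M"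
  shows "(\<Union>(j, z)\<in>stopped P. dcube j z) = {x. \<exists>j. P j (corner j x)}"
proof (intro set_eqI iffI)
  fix x assume "x \<in> (\<Union>(j, z)\<in>stopped P. dcube j z)"
  then show "x \<in> {x. \<exists>j. P j (corner j x)}" by (auto simp: stopped_def dcube_def)
next
  fix x assume "x \<in> {x. \<exists>j. P j (corner j x)}"
  then obtain j where j: "P j (corner j x)" by auto
  have jM: "i \<le> M" if "P i (corner i x)" for i using bdd[OF corner_idem that] .
  define S where "S = {i\<in>{j..M}. P i (corner i x)}"
  have "finite S"
    by (rule finite_subset[of _ "{j..M}"]) (auto simp: S_def)
  moreover have "j \<in> S" using j jM by (auto simp: S_def)
  ultimately obtain m where m: "m \<in> S" and max: "\<And>i. i \<in> S \<Longrightarrow> i \<le> m"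
    using Max_in[of S] Max_ge[of S] by blast
  have "\<not> P i (corner i x)" if "i > m" for i
    using max[of i] that jM[of i] m by (auto simp: S_def)
  then have "(m, corner m x) \<in> stopped P"
    using m corner_corner[of m _ x] by (auto simp: stopped_def S_def)
  then show "x \<in> (\<Union>(j, z)\<in>stopped P. dcube j z)"
    by (force simp: dcube_def)
qed

section \<open>Atoms\<close>

lemma sigma_finite_lebesgue: "sigma_finite_measure (lebesgue :: 'a::euclidean_space measure)"
proof
  show "\<exists>A::'a set set. countable A \<and> A \<subseteq> sets lebesgue \<and> \<Union> A = space lebesgue \<and> (\<forall>a\<in>A. emeasure lebesgue a \<noteq> \<infinity>)"
    by (intro exI[of _ "range (\<lambda>n::nat. ball 0 (real n))"])
       (auto simp: emeasure_ball ennreal_mult_eq_top_iff intro: reals_Archimedean2)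
qed

lemma pair_sigma_finite_lebesgue:
  "pair_sigma_finite (lebesgue :: 'a::euclidean_space measure) (lebesgue :: 'b::euclidean_space measure)"
  by (simp add: pair_sigma_finite_def sigma_finite_lebesgue)

lemma measurable_id_lebesgue: "(\<lambda>x. x) \<in> borel_measurable lebesgue"
  by (rule measurable_completion) simp

lemma measurable_fst_lebesgue [measurable]:
  "fst \<in> borel_measurable ((lebesgue :: 'a::euclidean_space measure) \<Otimes>\<^sub>M N)"
  by (rule measurable_compose[OF measurable_fst measurable_id_lebesgue])

lemma measurable_snd_lebesgue [measurable]:
  "snd \<in> borel_measurable (N \<Otimes>\<^sub>M (lebesgue :: 'a::euclidean_space measure))"
  by (rule measurable_compose[OF measurable_snd measurable_id_lebesgue])

abbreviation vol :: "'a::euclidean_space itself \<Rightarrow> real" where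
  "vol _ \<equiv> unit_ball_vol (real DIM('a))"

lemma emeasure_lebesgue_cball:
  "0 \<le> r \<Longrightarrow> emeasure lebesgue (cball (c::'a::euclidean_space) r) = ennreal (vol TYPE('a) * r ^ DIM('a))"
  by (simp add: emeasure_cball)

lemma emeasure_lebesgue_ball:
  "0 \<le> r \<Longrightarrow> emeasure lebesgue (ball (c::'a::euclidean_space) r) = ennreal (vol TYPE('a) * r ^ DIM('a))"
  by (simp add: emeasure_ball)

text \<open>Up to a constant, the common shape of all y -> \<phi>_t(x - y) with x in the cube of
  corner z and t comparable to 2^j. The radius (n + 1) 2^j is n 2^j for the distance from x to the
  corner, plus 2^j for the support of the dilate.\<close>

definition atom :: "real \<Rightarrow> int \<Rightarrow> 'a \<Rightarrow> ('a::euclidean_space \<Rightarrow> real) \<Rightarrow> bool" where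
  "atom \<beta> j z \<psi> \<longleftrightarrow>
     (\<forall>y. (real DIM('a) + 1) * 2 powi j < norm (y - z) \<longrightarrow> \<psi> y = 0) \<and>
     (\<integral>y. \<psi> y \<partial>lebesgue) = 0 \<and>
     (\<forall>y y'. \<bar>\<psi> y - \<psi> y'\<bar> \<le> (norm (y - y') / 2 powi j) powr \<beta> / (2 powi j) ^ DIM('a))"

lemma atom_support:
  fixes \<psi> :: "'a::euclidean_space \<Rightarrow> real"
  assumes "atom \<beta> j z \<psi>" "(real DIM('a) + 1) * 2 powi j < norm (y - z)" shows "\<psi> y = 0"
  using assms by (auto simp: atom_def)

lemma atom_Holder:
  fixes \<psi> :: "'a::euclidean_space \<Rightarrow> real"
  assumes "atom \<beta> j z \<psi>"
  shows "\<bar>\<psi> y - \<psi> y'\<bar> \<le> (norm (y - y') / 2 powi j) powr \<beta> / (2 powi j) ^ DIM('a)"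
  using assms by (auto simp: atom_def)

lemma Holder_imp_continuous:
  fixes \<psi> :: "'a::euclidean_space \<Rightarrow> 'b::real_normed_vector"
  assumes "0 < \<beta>" and H: "\<And>y y'. norm (\<psi> y - \<psi> y') \<le> c * norm (y - y') powr \<beta>"
  shows "continuous_on UNIV \<psi>"
proof -
  have "(\<psi> \<longlongrightarrow> \<psi> x) (at x)" for x
  proof (rule Lim_transform2)
    show "((\<lambda>_. \<psi> x) \<longlongrightarrow> \<psi> x) (at x)" by simp
    have "((\<lambda>y. c * norm (y - x) powr \<beta>) \<longlongrightarrow> c * 0) (at x)"
      using assms by (intro tendsto_mult tendsto_const tendsto_zero_powrI[where b=\<beta>]) (auto intro!: tendsto_eq_intros)
    then have lim: "((\<lambda>y. c * norm (y - x) powr \<beta>) \<longlongrightarrow> 0) (at x)" by simp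
    have "((\<lambda>y. \<psi> y - \<psi> x) \<longlongrightarrow> 0) (at x)"
      by (rule Lim_null_comparison[OF _ lim]) (auto intro!: H always_eventually)
    then show "((\<lambda>y. \<psi> x - \<psi> y) \<longlongrightarrow> 0) (at x)"
      using tendsto_minus by fastforce
  qed
  then show ?thesis by (simp add: continuous_on_def)
qed

lemma atom_continuous:
  assumes "0 < \<beta>" "atom \<beta> j z \<psi>" shows "continuous_on UNIV \<psi>"
proof (rule Holder_imp_continuous[OF assms(1)])
  fix y y'
  show "norm (\<psi> y - \<psi> y') \<le> (1 / (2 powi j) powr \<beta> / (2 powi j) ^ DIM('a)) * norm (y - y') powr \<beta>"
    using atom_Holder[OF assms(2), of y y'] by (simp add: powr_divide)
qed

lemma atom_measurable: 
  assumes "0 < \<beta>" "atom \<beta> j z \<psi>" shows "\<psi> \<in> borel_measurable lebesgue"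
  using borel_measurable_continuous_onI[OF atom_continuous[OF assms]] by (simp add: measurable_completion)

text \<open>A point of the support ball is compared with a point outside it: their distance is at
  most (2 (n + 1) + 1) 2^j, and (2n + 3)^\<beta> \<le> 2n + 3.\<close>

lemma atom_bound:
  fixes \<psi> :: "'a::euclidean_space \<Rightarrow> real"
  assumes \<beta>: "0 < \<beta>" "\<beta> \<le> 1" and a: "atom \<beta> j z \<psi>"
  shows "\<bar>\<psi> y\<bar> \<le> (2 * real DIM('a) + 3) / (2 powi j) ^ DIM('a)"
proof (cases "(real DIM('a) + 1) * 2 powi j < norm (y - z)")
  case True
  then show ?thesis using atom_support[OF a] by auto
next
  case False
  define l where "l = (2::real) powi j"
  have l: "0 < l" by (simp add: l_def)
  let ?K = "real DIM('a) + 1"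
  obtain b :: 'a where b: "b \<in> Basis" using nonempty_Basis by blast
  define y' where "y' = z + ((?K + 1) * l) *\<^sub>R b"
  have "norm (y' - z) = (?K + 1) * l" using b l by (simp add: y'_def)
  then have y'0: "\<psi> y' = 0" and ny': "norm (y' - z) \<le> (?K + 1) * l"
    using l by (auto intro!: atom_support[OF a] simp: l_def)
  have "norm (y - y') \<le> norm (y - z) + norm (y' - z)"
    by (metis norm_minus_commute norm_triangle_sub norm_triangle_ineq4 add_diff_cancel diff_add_cancel diff_diff_eq2 norm_triangle_le_diff order_refl)
  also have "\<dots> \<le> (2 * ?K + 1) * l"
    using False ny' by (simp add: l_def algebra_simps)
  finally have "norm (y - y') / l \<le> 2 * ?K + 1" using l by (simp add: field_simps)
  then have "(norm (y - y') / l) powr \<beta> \<le> (2 * ?K + 1) powr \<beta>"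
    using \<beta> l by (intro powr_mono2) auto
  also have "\<dots> \<le> (2 * ?K + 1) powr 1"
    using \<beta> by (intro powr_mono) auto
  finally have "(norm (y - y') / l) powr \<beta> / l ^ DIM('a) \<le> (2 * ?K + 1) / l ^ DIM('a)"
    using l by (intro divide_right_mono) auto
  then show ?thesis
    using atom_Holder[OF a, of y y'] y'0 by (simp add: l_def algebra_simps)
qed

lemma atom_integrable_mult:
  fixes \<psi> :: "'a::euclidean_space \<Rightarrow> real"
  assumes \<beta>: "0 < \<beta>" "\<beta> \<le> 1" and a: "atom \<beta> j z \<psi>" and f: "integrable lebesgue f"
  shows "integrable lebesgue (\<lambda>y. f y * \<psi> y)"
proof -
  let ?B = "(2 * real DIM('a) + 3) / (2 powi j) ^ DIM('a)"
  have [measurable]: "\<psi> \<in> borel_measurable lebesgue" by (rule atom_measurable) fact+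
  have [measurable]: "f \<in> borel_measurable lebesgue" using f by auto
  show ?thesis
  proof (rule Bochner_Integration.integrable_bound)
    show "integrable lebesgue (\<lambda>y. ?B * f y)" using f by auto
    show "AE y in lebesgue. norm (f y * \<psi> y) \<le> norm (?B * f y)"
    proof (intro AE_I2)
      fix y
      have "\<bar>f y\<bar> * \<bar>\<psi> y\<bar> \<le> \<bar>f y\<bar> * ?B"
        by (intro mult_left_mono atom_bound[OF \<beta> a]) auto
      then show "norm (f y * \<psi> y) \<le> norm (?B * f y)"
        by (simp add: abs_mult mult.commute)
    qed
  qed measurable
qed

lemma integrable_indicator_cball: "integrable lebesgue (\<lambda>x. indicator (cball (c::'a::euclidean_space) r) x :: real)"
  using emeasure_lborel_cball_finite[of c r]
  by (intro integrable_real_indicator) auto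

lemma atom_integrable:
  fixes \<psi> :: "'a::euclidean_space \<Rightarrow> real"
  assumes \<beta>: "0 < \<beta>" "\<beta> \<le> 1" and a: "atom \<beta> j z \<psi>"
  shows "integrable lebesgue \<psi>"
proof -
  have "integrable lebesgue (\<lambda>y. indicator (cball z ((real DIM('a) + 1) * 2 powi j)) y * \<psi> y)"
    by (rule atom_integrable_mult[OF assms integrable_indicator_cball])
  also have "(\<lambda>y. indicator (cball z ((real DIM('a) + 1) * 2 powi j)) y * \<psi> y) = \<psi>"
    using atom_support[OF a] by (auto simp: fun_eq_iff dist_norm norm_minus_commute split: split_indicator)
  finally show ?thesis .
qed

text \<open>The finer atom \<phi> has mean zero, so the value of \<psi> at its centre y may be
  subtracted; Hoelder continuity of \<psi> over the support of \<phi> yields the decay (2^i /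
  2^j)^\<beta>. For distant centres the supports are disjoint.\<close>

lemma atom_inner_bound:
  fixes \<phi> \<psi> :: "'a::euclidean_space \<Rightarrow> real"
  defines "K \<equiv> real DIM('a) + 1"
  assumes \<beta>: "0 < \<beta>" "\<beta> \<le> 1" and a: "atom \<beta> i y \<phi>" "atom \<beta> j z \<psi>" and ij: "i \<le> j"
  shows "\<bar>\<integral>x. \<phi> x * \<psi> x \<partial>lebesgue\<bar>
      \<le> (2 * K + 1) * vol TYPE('a) * K ^ DIM('a) * K * (2 powi i / 2 powi j) powr \<beta> / (2 powi j) ^ DIM('a)" (is "_ \<le> ?R")
    and "2 * K * 2 powi j < norm (y - z) \<Longrightarrow> (\<integral>x. \<phi> x * \<psi> x \<partial>lebesgue) = 0"
proof -
  let ?n = "DIM('a)"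
  define l where "l = (2::real) powi i"
  define m where "m = (2::real) powi j"
  have l: "0 < l" and m: "0 < m" and lm: "l \<le> m"
    using ij by (auto simp: l_def m_def intro: power_int_increasing)
  have K: "1 \<le> K" by (simp add: K_def)
  note int = atom_integrable[OF \<beta> a(1)] atom_integrable_mult[OF \<beta> a(2) atom_integrable[OF \<beta> a(1)]]
  have [measurable]: "\<psi> \<in> borel_measurable lebesgue" "\<phi> \<in> borel_measurable lebesgue"
    using \<beta> a by (auto intro: atom_measurable)
  have "(\<integral>x. \<phi> x * \<psi> x \<partial>lebesgue) = (\<integral>x. \<phi> x * \<psi> x \<partial>lebesgue) - (\<integral>x. \<phi> x * \<psi> y \<partial>lebesgue)"
    using a(1) by (simp add: atom_def)
  also have "\<dots> = (\<integral>x. \<phi> x * (\<psi> x - \<psi> y) \<partial>lebesgue)"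
    using int by (simp add: algebra_simps)
  finally have eq: "(\<integral>x. \<phi> x * \<psi> x \<partial>lebesgue) = (\<integral>x. \<phi> x * (\<psi> x - \<psi> y) \<partial>lebesgue)" .
  let ?c = "(2 * K + 1) / l ^ ?n * (K * (l / m) powr \<beta> / m ^ ?n)"
  have le: "norm (\<phi> x * (\<psi> x - \<psi> y)) \<le> ?c * indicator (cball y (K * l)) x" for x
  proof (cases "K * l < norm (x - y)")
    case True
    then have "\<phi> x = 0" using atom_support[OF a(1)] by (simp add: K_def l_def)
    then show ?thesis using K l m by simp
  next
    case False
    have "\<bar>\<psi> x - \<psi> y\<bar> \<le> (norm (x - y) / m) powr \<beta> / m ^ ?n"
      using atom_Holder[OF a(2)] by (simp add: m_def)
    also have "\<dots> \<le> (K * (l / m)) powr \<beta> / m ^ ?n"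
      using False l m \<beta> by (intro divide_right_mono powr_mono2) (auto simp: divide_right_mono)
    also have "\<dots> = K powr \<beta> * (l / m) powr \<beta> / m ^ ?n"
      using K l m by (subst powr_mult) auto
    also have "\<dots> \<le> K powr 1 * (l / m) powr \<beta> / m ^ ?n"
      using K \<beta> l m by (intro divide_right_mono mult_right_mono powr_mono) auto
    finally have "\<bar>\<psi> x - \<psi> y\<bar> \<le> K * (l / m) powr \<beta> / m ^ ?n" using K by simp
    moreover have "\<bar>\<phi> x\<bar> \<le> (2 * K + 1) / l ^ ?n"
      using atom_bound[OF \<beta> a(1), of x] by (simp add: K_def l_def algebra_simps)
    ultimately have "\<bar>\<phi> x\<bar> * \<bar>\<psi> x - \<psi> y\<bar> \<le> ?c"
      using K l by (intro mult_mono) auto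
    then show ?thesis using False by (simp add: abs_mult dist_norm norm_minus_commute)
  qed
  have "norm (\<integral>x. \<phi> x * (\<psi> x - \<psi> y) \<partial>lebesgue) \<le> (\<integral>x. ?c * indicator (cball y (K * l)) x \<partial>lebesgue)"
  proof (rule order_trans[OF integral_norm_bound])
    have "integrable lebesgue (\<lambda>x. \<phi> x * (\<psi> x - \<psi> y))"
      using int by (simp add: algebra_simps)
    moreover have "integrable lebesgue (\<lambda>x. ?c * indicator (cball y (K * l)) x)"
      by (intro integrable_mult_right integrable_indicator_cball)
    ultimately show "(\<integral>x. norm (\<phi> x * (\<psi> x - \<psi> y)) \<partial>lebesgue) \<le> (\<integral>x. ?c * indicator (cball y (K * l)) x \<partial>lebesgue)"
      by (intro integral_mono integrable_norm le)
  qed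
  also have "\<dots> = ?c * measure lebesgue (cball y (K * l))"
    by simp
  also have "measure lebesgue (cball y (K * l)) = vol TYPE('a) * (K * l) ^ ?n"
    using K l by (simp add: measure_def emeasure_cball)
  also have "?c * (vol TYPE('a) * (K * l) ^ ?n) = ?R"
    using l m by (simp add: l_def m_def power_mult_distrib field_simps)
  finally show "\<bar>\<integral>x. \<phi> x * \<psi> x \<partial>lebesgue\<bar> \<le> ?R" using eq by simp
  show "(\<integral>x. \<phi> x * \<psi> x \<partial>lebesgue) = 0" if far: "2 * K * 2 powi j < norm (y - z)"
  proof -
    have zero: "\<phi> x * \<psi> x = 0" for x
    proof (rule ccontr)
      assume "\<phi> x * \<psi> x \<noteq> 0"
      then have "norm (x - y) \<le> K * l" "norm (x - z) \<le> K * m"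
        using atom_support[OF a(1), of x] atom_support[OF a(2), of x] by (auto simp: K_def l_def m_def not_less[symmetric])
      moreover have "norm (y - z) \<le> norm (x - y) + norm (x - z)"
        by (metis norm_minus_commute norm_triangle_sub norm_triangle_ineq add.commute diff_add_cancel add_diff_eq)
      moreover have "K * l \<le> K * m" using K lm by simp
      ultimately show False using far by (simp add: m_def)
    qed
    show ?thesis unfolding zero by simp
  qed
qed

lemma powi_ratio_powr:
  assumes "i \<le> j" shows "((2::real) powi i / 2 powi j) powr \<beta> = (2 powr - \<beta>) ^ nat (j - i)"
proof -
  have "(2::real) powi i / 2 powi j = 2 powr (real_of_int (i - j))"
    by (simp add: powr_diff flip: powr_real_of_int')
  then have "((2::real) powi i / 2 powi j) powr \<beta> = 2 powr (real_of_int (i - j) * \<beta>)"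
    by (simp add: powr_powr)
  also have "real_of_int (i - j) * \<beta> = - \<beta> * real (nat (j - i))"
    using assms by (simp add: algebra_simps)
  also have "2 powr (- \<beta> * real (nat (j - i))) = (2 powr - \<beta>) ^ nat (j - i)"
    by (simp only: powr_powr[symmetric]) (simp add: powr_realpow)
  finally show ?thesis .
qed

text \<open>On each side of j the exponents are distinct, so each side stays below one geometric
  series.\<close>

lemma sum_geometric_abs_le:
  fixes S :: "int set" and r :: real
  assumes "finite S" "0 \<le> r" "r < 1"
  shows "(\<Sum>k\<in>S. r ^ nat \<bar>k - j\<bar>) \<le> 2 / (1 - r)"
proof -
  have half: "(\<Sum>k\<in>T. r ^ h k) \<le> 1 / (1 - r)" if "finite T" "inj_on h T" for T :: "int set" and h :: "int \<Rightarrow> nat"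
  proof -
    have "(\<Sum>k\<in>T. r ^ h k) = (\<Sum>n\<in>h ` T. r ^ n)"
      using that by (simp add: sum.reindex)
    also have "\<dots> \<le> (\<Sum>n. r ^ n)"
      using assms that by (intro sum_le_suminf summable_geometric) auto
    also have "\<dots> = 1 / (1 - r)" using assms by (intro suminf_geometric) auto
    finally show ?thesis .
  qed
  have "(\<Sum>k\<in>S. r ^ nat \<bar>k - j\<bar>) = (\<Sum>k\<in>S\<inter>{..j}. r ^ nat \<bar>k - j\<bar>) + (\<Sum>k\<in>S-{..j}. r ^ nat \<bar>k - j\<bar>)"
    using assms by (subst sum.Int_Diff[of S _ "{..j}"]) auto
  also have "\<dots> \<le> 1 / (1 - r) + 1 / (1 - r)"
    using assms by (intro add_mono half) (auto simp: inj_on_def)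
  finally show ?thesis by simp
qed

text \<open>Volume comparison for disjoint cubes of equal size.\<close>

lemma card_dcubes_le:
  fixes Z :: "'a::euclidean_space set"
  assumes Z: "finite Z" "\<And>z. z \<in> Z \<Longrightarrow> corner k z = z" "\<And>z. z \<in> Z \<Longrightarrow> dcube k z \<subseteq> cball c R" and R: "0 \<le> R"
  shows "real (card Z) * (2 powi k) ^ DIM('a) \<le> vol TYPE('a) * R ^ DIM('a)"
proof -
  have "ennreal (real (card Z) * (2 powi k) ^ DIM('a)) = (\<Sum>z\<in>Z. emeasure lebesgue (dcube k z))"
    using Z(2) by (simp add: ennreal_mult ennreal_of_nat_eq_real_of_nat emeasure_dcube cong: sum.cong del: emeasure_completion)
  also have "\<dots> = emeasure lebesgue (\<Union>z\<in>Z. dcube k z)"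
    using Z by (intro sum_emeasure) (auto simp: disjoint_family_on_def dcube_def)
  also have "\<dots> \<le> emeasure lebesgue (cball c R)"
    using Z by (intro emeasure_mono) auto
  also have "\<dots> = ennreal (vol TYPE('a) * R ^ DIM('a))"
    using R by (rule emeasure_lebesgue_cball)
  finally show ?thesis
    using R by (subst (asm) ennreal_le_iff) auto
qed

section \<open>The \<open>L\<^sup>2\<close> bound\<close>

definition atoms :: "real \<Rightarrow> (int \<Rightarrow> 'a \<Rightarrow> 'a::euclidean_space \<Rightarrow> real) \<Rightarrow> bool" where
  "atoms \<beta> \<psi> \<longleftrightarrow> (\<forall>j z. corner j z = z \<longrightarrow> atom \<beta> j z (\<psi> j z))"

definition coef :: "(int \<Rightarrow> 'a \<Rightarrow> 'a::euclidean_space \<Rightarrow> real) \<Rightarrow> ('a \<Rightarrow> real) \<Rightarrow> int \<Rightarrow> 'a \<Rightarrow> real" where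
  "coef \<psi> f j z = (\<integral>y. f y * \<psi> j z y \<partial>lebesgue)"

text \<open>The dyadic square function, before the root, truncated to the scales m..M. It is
  constant on cubes of side 2^m, so stopping-time arguments on it are exact and need no
  continuity.\<close>

definition sqsum :: "(int \<Rightarrow> 'a \<Rightarrow> 'a::euclidean_space \<Rightarrow> real) \<Rightarrow> ('a \<Rightarrow> real) \<Rightarrow> int \<Rightarrow> int \<Rightarrow> 'a \<Rightarrow> real" where
  "sqsum \<psi> f m M x = (\<Sum>j=m..M. (coef \<psi> f j (corner j x))\<^sup>2)"

text \<open>The product of the bound on inner products (the first four factors), the volume
  available to the cubes of one scale that interact with a given cube (vol T (3K)^n), and a
  two-sided geometric series in 2^(-\<beta>).\<close>

definition gram_const :: "real \<Rightarrow> 'a::euclidean_space itself \<Rightarrow> real" where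
  "gram_const \<beta> T = (let n = DIM('a); K = real n + 1 in
     (2 * K + 1) * vol T * K ^ n * K * vol T * (3 * K) ^ n * (2 / (1 - 2 powr - \<beta>)))"

lemma atomsD: "atoms \<beta> \<psi> \<Longrightarrow> corner j z = z \<Longrightarrow> atom \<beta> j z (\<psi> j z)"
  by (simp add: atoms_def)

lemma two_powr_minus_less_one: "0 < \<beta> \<Longrightarrow> (2::real) powr - \<beta> < 1"
  using powr_less_mono[of "-\<beta>" 0 2] by simp

lemma gram_const_pos: "0 < \<beta> \<Longrightarrow> 0 < gram_const \<beta> TYPE('a::euclidean_space)"
  using two_powr_minus_less_one[of \<beta>] by (simp add: gram_const_def Let_def)

text \<open>Row sums of the Gram matrix, scale by scale. Let h be the larger of 2^j and 2^k. Each
  inner product is at most \<open>C0\<close> r^|k-j| / h^n, and only cubes with corners within 2K h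
  interact; their total volume is at most that of a ball of radius 3K h, which cancels h^n.\<close>

lemma gram_sum_le:
  fixes \<psi> :: "int \<Rightarrow> 'a::euclidean_space \<Rightarrow> 'a \<Rightarrow> real"
  assumes \<beta>: "0 < \<beta>" "\<beta> \<le> 1" and at: "atoms \<beta> \<psi>" and F: "finite F" "\<And>k z. (k, z) \<in> F \<Longrightarrow> corner k z = z"
    and z0: "corner j z0 = z0"
  shows "(\<Sum>(k, z)\<in>F. (2 powi k) ^ DIM('a) * \<bar>\<integral>x. \<psi> j z0 x * \<psi> k z x \<partial>lebesgue\<bar>) \<le> gram_const \<beta> TYPE('a)"
proof -
  let ?n = "DIM('a)"
  define K where "K = real ?n + 1"
  define r where "r = 2 powr - \<beta>"
  define C0 where "C0 = (2 * K + 1) * vol TYPE('a) * K ^ ?n * K"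
  have r: "0 \<le> r" "r < 1" using two_powr_minus_less_one[of \<beta>] \<beta> by (auto simp: r_def)
  have K: "1 \<le> K" by (simp add: K_def)
  have C0: "0 \<le> C0" using K by (simp add: C0_def)
  define Fk where "Fk k = {z. (k, z) \<in> F}" for k
  have Feq: "F = (SIGMA k:fst ` F. Fk k)" by (force simp: Fk_def)
  have finFk: "finite (Fk k)" for k
    by (rule finite_subset[OF _ finite_imageI[OF F(1), of snd]]) (force simp: Fk_def)
  define G where "G k z = \<bar>\<integral>x. \<psi> j z0 x * \<psi> k z x \<partial>lebesgue\<bar>" for k z
  have one: "(\<Sum>z\<in>Fk k. (2 powi k) ^ ?n * G k z) \<le> C0 * (vol TYPE('a) * (3 * K) ^ ?n) * r ^ nat \<bar>k - j\<bar>" for k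
  proof -
    define h where "h = (2::real) powi (max j k)"
    have h: "0 < h" and kh: "2 powi k \<le> h" by (auto simp: h_def intro: power_int_increasing)
    define Z where "Z = {z \<in> Fk k. norm (z - z0) \<le> 2 * K * h}"
    have cz: "corner k z = z" if "z \<in> Fk k" for z using that F by (auto simp: Fk_def)
    have zero: "G k z = 0" if z: "z \<in> Fk k - Z" for z
    proof -
      have "2 * K * h < norm (z - z0)" using z by (auto simp: Z_def)
      then show ?thesis
        using atom_inner_bound(2)[OF \<beta> atomsD[OF at z0] atomsD[OF at cz[of z]]]
          atom_inner_bound(2)[OF \<beta> atomsD[OF at cz[of z]] atomsD[OF at z0]] z
        by (cases "k \<le> j") (auto simp: G_def h_def K_def max_def norm_minus_commute mult.commute)
    qed
    have le: "G k z \<le> C0 * r ^ nat \<bar>k - j\<bar> / h ^ ?n" if z: "z \<in> Fk k" for z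
    proof (cases "k \<le> j")
      case True
      have "\<bar>\<integral>x. \<psi> k z x * \<psi> j z0 x \<partial>lebesgue\<bar> \<le> C0 * (2 powi k / 2 powi j) powr \<beta> / (2 powi j) ^ ?n"
        using atom_inner_bound(1)[OF \<beta> atomsD[OF at cz[OF z]] atomsD[OF at z0] True] by (simp add: C0_def K_def)
      moreover have "max j k = j" "nat \<bar>k - j\<bar> = nat (j - k)" using True by auto
      ultimately show ?thesis
        using True by (simp add: G_def powi_ratio_powr r_def h_def mult.commute)
    next
      case False
      have "\<bar>\<integral>x. \<psi> j z0 x * \<psi> k z x \<partial>lebesgue\<bar> \<le> C0 * (2 powi j / 2 powi k) powr \<beta> / (2 powi k) ^ ?n"
        using atom_inner_bound(1)[OF \<beta> atomsD[OF at z0] atomsD[OF at cz[OF z]]] False by (simp add: C0_def K_def)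
      then show ?thesis
        using False by (simp add: G_def powi_ratio_powr r_def h_def max_def)
    qed
    have sub: "dcube k z \<subseteq> cball z0 (3 * K * h)" if "z \<in> Z" for z
    proof
      fix y assume "y \<in> dcube k z"
      then have "dist z y \<le> real ?n * 2 powi k" using dcube_subset_cball[of k z] by auto
      also have "\<dots> \<le> K * h" using kh K by (intro mult_mono) (auto simp: K_def)
      finally have "dist z y \<le> K * h" .
      moreover have "dist z0 z \<le> 2 * K * h" using that by (simp add: Z_def dist_norm norm_minus_commute)
      moreover have "dist z0 y \<le> dist z0 z + dist z y" by (rule dist_triangle)
      ultimately show "y \<in> cball z0 (3 * K * h)" by simp
    qed
    have "(\<Sum>z\<in>Fk k. (2 powi k) ^ ?n * G k z) = (\<Sum>z\<in>Z. (2 powi k) ^ ?n * G k z)"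
      using zero finFk by (intro sum.mono_neutral_right) (auto simp: Z_def)
    also have "\<dots> \<le> (\<Sum>z\<in>Z. (2 powi k) ^ ?n * (C0 * r ^ nat \<bar>k - j\<bar> / h ^ ?n))"
      using le by (intro sum_mono mult_left_mono) (auto simp: Z_def)
    also have "\<dots> = real (card Z) * (2 powi k) ^ ?n * (C0 * r ^ nat \<bar>k - j\<bar> / h ^ ?n)"
      by simp
    also have "\<dots> \<le> vol TYPE('a) * (3 * K * h) ^ ?n * (C0 * r ^ nat \<bar>k - j\<bar> / h ^ ?n)"
    proof (intro mult_right_mono card_dcubes_le)
      show "finite Z" using finFk by (simp add: Z_def)
      show "corner k z = z" if "z \<in> Z" for z using that cz by (simp add: Z_def)
    qed (use sub K h C0 r in auto)
    also have "\<dots> = C0 * (vol TYPE('a) * (3 * K) ^ ?n) * r ^ nat \<bar>k - j\<bar>"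
      using h by (simp add: power_mult_distrib field_simps)
    finally show ?thesis .
  qed
  have "(\<Sum>(k, z)\<in>F. (2 powi k) ^ ?n * G k z) = (\<Sum>k\<in>fst ` F. \<Sum>z\<in>Fk k. (2 powi k) ^ ?n * G k z)"
    by (subst Feq, subst sum.Sigma) (use F finFk in auto)
  also have "\<dots> \<le> (\<Sum>k\<in>fst ` F. C0 * (vol TYPE('a) * (3 * K) ^ ?n) * r ^ nat \<bar>k - j\<bar>)"
    by (intro sum_mono one)
  also have "\<dots> = C0 * (vol TYPE('a) * (3 * K) ^ ?n) * (\<Sum>k\<in>fst ` F. r ^ nat \<bar>k - j\<bar>)"
    by (simp add: sum_distrib_left)
  also have "\<dots> \<le> C0 * (vol TYPE('a) * (3 * K) ^ ?n) * (2 / (1 - r))"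
    using F r C0 K by (intro mult_left_mono sum_geometric_abs_le) auto
  also have "\<dots> = gram_const \<beta> TYPE('a)"
    unfolding gram_const_def Let_def C0_def K_def[symmetric] r_def by (simp only: mult_ac)
  finally show ?thesis by (simp add: G_def)
qed

text \<open>The Bessel weights are the volumes of the cubes, because these appear when a squared
  coefficient is integrated over its cube.\<close>

lemma coef_L2_sum_le:
  fixes \<psi> :: "int \<Rightarrow> 'a::euclidean_space \<Rightarrow> 'a \<Rightarrow> real"
  assumes \<beta>: "0 < \<beta>" "\<beta> \<le> 1" and at: "atoms \<beta> \<psi>" and F: "finite F" "\<And>k z. (k, z) \<in> F \<Longrightarrow> corner k z = z"
    and g: "g \<in> borel_measurable lebesgue" "integrable lebesgue (\<lambda>x. (g x)\<^sup>2)"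
  shows "(\<Sum>(k, z)\<in>F. (2 powi k) ^ DIM('a) * (coef \<psi> g k z)\<^sup>2) \<le> gram_const \<beta> TYPE('a) * (\<integral>x. (g x)\<^sup>2 \<partial>lebesgue)"
proof -
  note [measurable] = g(1)
  have a: "atom \<beta> (fst i) (snd i) (\<psi> (fst i) (snd i))" if "i \<in> F" for i
    using F that by (intro atomsD[OF at]) auto
  have int: "integrable lebesgue (\<lambda>x. \<psi> (fst i) (snd i) x * \<psi> (fst k) (snd k) x)" if "i \<in> F" "k \<in> F" for i k
    by (rule atom_integrable_mult[OF \<beta> a[OF that(2)] atom_integrable[OF \<beta> a[OF that(1)]]])
  have "(\<Sum>i\<in>F. (2 powi (fst i)) ^ DIM('a) * (\<integral>x. g x * \<psi> (fst i) (snd i) x \<partial>lebesgue)\<^sup>2) \<le> gram_const \<beta> TYPE('a) * (\<integral>x. (g x)\<^sup>2 \<partial>lebesgue)"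
  proof (rule weighted_Bessel_inequality)
    fix i assume i: "i \<in> F"
    have z: "corner (fst i) (snd i) = snd i" using F i by auto
    show "(\<Sum>k\<in>F. (2 powi (fst k)) ^ DIM('a) * \<bar>\<integral>x. \<psi> (fst i) (snd i) x * \<psi> (fst k) (snd k) x \<partial>lebesgue\<bar>) \<le> gram_const \<beta> TYPE('a)"
      using gram_sum_le[OF \<beta> at F z] by (simp add: case_prod_unfold)
    have [measurable]: "\<psi> (fst i) (snd i) \<in> borel_measurable lebesgue" 
      using a[OF i] \<beta> by (intro atom_measurable)
    show "integrable lebesgue (\<lambda>x. g x * \<psi> (fst i) (snd i) x)"
    proof (rule Bochner_Integration.integrable_bound)
      show "integrable lebesgue (\<lambda>x. (g x)\<^sup>2 + (\<psi> (fst i) (snd i) x)\<^sup>2)"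
        using g(2) int[OF i i] by (simp add: power2_eq_square)
      show "AE x in lebesgue. norm (g x * \<psi> (fst i) (snd i) x) \<le> norm ((g x)\<^sup>2 + (\<psi> (fst i) (snd i) x)\<^sup>2)"
      proof (intro AE_I2)
        fix x
        have "2 * (\<bar>g x\<bar> * \<bar>\<psi> (fst i) (snd i) x\<bar>) \<le> (g x)\<^sup>2 + (\<psi> (fst i) (snd i) x)\<^sup>2"
          using sum_squares_bound[of "\<bar>g x\<bar>" "\<bar>\<psi> (fst i) (snd i) x\<bar>"] by (simp add: mult_ac)
        moreover have "0 \<le> \<bar>g x\<bar> * \<bar>\<psi> (fst i) (snd i) x\<bar>" by simp
        ultimately show "norm (g x * \<psi> (fst i) (snd i) x) \<le> norm ((g x)\<^sup>2 + (\<psi> (fst i) (snd i) x)\<^sup>2)"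
          unfolding real_norm_def abs_mult by linarith
      qed
    qed measurable
  qed (use F g int gram_const_pos[OF \<beta>(1)] in auto)
  then show ?thesis by (simp add: coef_def case_prod_unfold)
qed

lemma nn_integral_count_space_le:
  fixes f :: "'i \<Rightarrow> ennreal"
  assumes I: "countable I" and le: "\<And>F. finite F \<Longrightarrow> F \<subseteq> I \<Longrightarrow> sum f F \<le> B"
  shows "(\<integral>\<^sup>+i. f i \<partial>count_space I) \<le> B"
proof (cases "finite I")
  case True
  then show ?thesis using le[of I] by (simp add: nn_integral_count_space_finite)
next
  case False
  note bij = bij_betw_from_nat_into[OF I False]
  have "(\<integral>\<^sup>+i. f i \<partial>count_space I) = (\<integral>\<^sup>+n. f (from_nat_into I n) \<partial>count_space UNIV)"
    using bij by (rule nn_integral_bij_count_space[symmetric])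
  also have "\<dots> = (\<Sum>n. f (from_nat_into I n))" by (rule nn_integral_count_space_nat)
  also have "\<dots> \<le> B"
  proof (rule suminf_le_const)
    fix n
    have "(\<Sum>k<n. f (from_nat_into I k)) = sum f (from_nat_into I ` {..<n})"
      using bij by (subst sum.reindex) (auto simp: bij_betw_def inj_on_def)
    also have "\<dots> \<le> B" using bij by (intro le) (auto simp: bij_betw_def)
    finally show "(\<Sum>k<n. f (from_nat_into I k)) \<le> B" .
  qed simp
  finally show ?thesis .
qed

lemma borel_measurable_const_on_partition:
  assumes "countable I" "\<And>i. i \<in> I \<Longrightarrow> X i \<in> sets M" "(\<Union>i\<in>I. X i) = space M"
    and "\<And>i x. i \<in> I \<Longrightarrow> x \<in> X i \<Longrightarrow> f x = c i"
  shows "f \<in> borel_measurable M"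
proof (rule measurableI)
  fix A
  have "f -` A \<inter> space M = (\<Union>i\<in>{i\<in>I. c i \<in> A}. X i)"
    using assms(4) unfolding assms(3)[symmetric] by auto
  also have "\<dots> \<in> sets M"
    using assms(1,2) by (intro sets.countable_UN') (auto intro: countable_subset)
  finally show "f -` A \<inter> space M \<in> sets M" .
qed auto

text \<open>The map \<open>corner j\<close> takes countably many values, each on a measurable cube.
  This is what permits an arbitrary choice of atoms from cube to cube.\<close>

lemma borel_measurable_corner_comp: "(\<lambda>x. h (corner j x)) \<in> borel_measurable lebesgue"
proof (rule borel_measurable_const_on_partition[OF countable_corners])
  show "(\<Union>z\<in>{z. corner j z = z}. dcube j z) = space lebesgue"
    by (auto simp: dcube_def)
  show "h (corner j x) = h z" if "x \<in> dcube j z" for x z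
    using that by (simp add: dcube_def)
qed (rule dcube_lebesgue)

lemma borel_measurable_sqsum [measurable]: "sqsum \<psi> f m M \<in> borel_measurable lebesgue"
  unfolding sqsum_def[abs_def] by (intro borel_measurable_sum borel_measurable_power borel_measurable_corner_comp)

text \<open>Fubini turns the integral into the sum of volume times squared coefficient over
  countably many cubes; the Bessel bound is uniform over finite subfamilies, which suffices.\<close>

lemma sqsum_L2_le:
  fixes \<psi> :: "int \<Rightarrow> 'a::euclidean_space \<Rightarrow> 'a \<Rightarrow> real"
  assumes \<beta>: "0 < \<beta>" "\<beta> \<le> 1" and at: "atoms \<beta> \<psi>"
    and g: "g \<in> borel_measurable lebesgue" "integrable lebesgue (\<lambda>x. (g x)\<^sup>2)"
  shows "(\<integral>\<^sup>+x. ennreal (sqsum \<psi> g m M x) \<partial>lebesgue) \<le> ennreal (gram_const \<beta> TYPE('a) * (\<integral>x. (g x)\<^sup>2 \<partial>lebesgue))"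
proof -
  define I where "I = (SIGMA j:{m..M}. {z::'a. corner j z = z})"
  have cI: "countable I" by (auto simp: I_def intro: countable_SIGMA countable_corners)
  define h where "h p = ennreal ((coef \<psi> g (fst p) (snd p))\<^sup>2)" for p
  have "(\<integral>\<^sup>+x. ennreal (sqsum \<psi> g m M x) \<partial>lebesgue)
      \<le> (\<integral>\<^sup>+x. (\<integral>\<^sup>+p. h p * indicator (dcube (fst p) (snd p)) x \<partial>count_space I) \<partial>lebesgue)"
  proof (rule nn_integral_mono)
    fix x :: 'a
    define A where "A = (\<lambda>j. (j, corner j x)) ` {m..M}"
    have "ennreal (sqsum \<psi> g m M x) = (\<Sum>p\<in>A. h p)"
      unfolding A_def by (subst sum.reindex) (auto simp: inj_on_def sqsum_def h_def sum_ennreal)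
    also have "\<dots> = (\<integral>\<^sup>+p. h p * indicator A p \<partial>count_space I)"
      by (subst nn_integral_count_space'[where A=A]) (auto simp: A_def I_def)
    also have "\<dots> \<le> (\<integral>\<^sup>+p. h p * indicator (dcube (fst p) (snd p)) x \<partial>count_space I)"
      by (intro nn_integral_mono) (auto simp: A_def dcube_def split: split_indicator)
    finally show "ennreal (sqsum \<psi> g m M x) \<le> (\<integral>\<^sup>+p. h p * indicator (dcube (fst p) (snd p)) x \<partial>count_space I)" .
  qed
  also have "\<dots> = (\<integral>\<^sup>+p. (\<integral>\<^sup>+x. h p * indicator (dcube (fst p) (snd p)) x \<partial>lebesgue) \<partial>count_space I)"
    by (rule nn_integral_count_space_nn_integral[OF cI]) measurable
  also have "\<dots> = (\<integral>\<^sup>+p. h p * emeasure lebesgue (dcube (fst p) (snd p)) \<partial>count_space I)"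
    by (intro nn_integral_cong nn_integral_cmult_indicator dcube_lebesgue)
  also have "\<dots> = (\<integral>\<^sup>+p. h p * ennreal ((2 powi (fst p)) ^ DIM('a)) \<partial>count_space I)"
    by (intro nn_integral_cong arg_cong2[where f="(*)"] refl emeasure_dcube) (auto simp: I_def)
  also have "\<dots> \<le> ennreal (gram_const \<beta> TYPE('a) * (\<integral>x. (g x)\<^sup>2 \<partial>lebesgue))"
  proof (rule nn_integral_count_space_le[OF cI])
    fix F assume F: "finite F" "F \<subseteq> I"
    have "(\<Sum>p\<in>F. h p * ennreal ((2 powi (fst p)) ^ DIM('a)))
        = ennreal (\<Sum>(k, z)\<in>F. (2 powi k) ^ DIM('a) * (coef \<psi> g k z)\<^sup>2)"
      by (subst sum_ennreal[symmetric]) (auto simp: h_def ennreal_mult[symmetric] mult.commute case_prod_unfold intro!: sum.cong)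
    also have "\<dots> \<le> ennreal (gram_const \<beta> TYPE('a) * (\<integral>x. (g x)\<^sup>2 \<partial>lebesgue))"
      using F by (intro ennreal_leI coef_L2_sum_le[OF \<beta> at F(1) _ g]) (auto simp: I_def)
    finally show "(\<Sum>p\<in>F. h p * ennreal ((2 powi (fst p)) ^ DIM('a))) \<le> ennreal (gram_const \<beta> TYPE('a) * (\<integral>x. (g x)\<^sup>2 \<partial>lebesgue))" .
  qed
  finally show ?thesis .
qed

section \<open>The weak type (1,1) bound\<close>

text \<open>A cube whose integral of |f| exceeds s times its volume has volume below N / s when N is
  the total integral. This bounds its scale from above and so yields maximal cubes.\<close>

lemma scale_bounded:
  fixes s N :: real assumes s: "0 < s" shows "\<exists>M. \<forall>j. s * (2 powi j) ^ DIM('a::euclidean_space) < N \<longrightarrow> j \<le> M"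
proof -
  obtain k where k: "N / s < 2 ^ k" using real_arch_pow[of 2 "N / s"] by auto
  have "j \<le> int k" if "s * (2 powi j) ^ DIM('a) < N" for j
  proof (rule ccontr)
    assume "\<not> j \<le> int k"
    then have j: "int k \<le> j" by simp
    have "(2::real) ^ k = 2 powi (int k)" by simp
    also have "\<dots> \<le> 2 powi j" using j by (intro power_int_increasing) auto
    finally have le: "(2::real) ^ k \<le> 2 powi j" .
    have "(1::real) \<le> 2 powi j" by (rule order_trans[OF _ le]) simp
    then have "(2::real) powi j \<le> (2 powi j) ^ DIM('a)"
      by (intro self_le_power) auto
    with le k have "N / s < (2 powi j) ^ DIM('a)" by linarith
    then show False using that s by (simp add: field_simps)
  qed
  then show ?thesis by blast
qed

lemma stopped_subset_UN:
  "I \<subseteq> stopped P \<Longrightarrow> countable I \<and> disjoint_family_on (\<lambda>(j, z). dcube j z) I"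
  using countable_subset[OF _ countable_stopped] disjoint_family_on_mono[OF _ disjoint_stopped] by blast

text \<open>The cubes before enlargement are disjoint, so the integrals of h over them add up to at
  most the full integral and the overlap of the balls does not matter. \<open>W\<close> is Lebesgue
  measure for the Calderon-Zygmund cubes and w dx for the exceptional set.\<close>

lemma enlarged_cubes_le:
  fixes h :: "'a::euclidean_space \<Rightarrow> ennreal"
  assumes I: "I \<subseteq> stopped P" and W: "sets W = sets lebesgue" and h: "h \<in> borel_measurable lebesgue"
    and le: "\<And>j z. (j, z) \<in> I \<Longrightarrow> emeasure W (cball z (K * 2 powi j)) \<le> c * (\<integral>\<^sup>+x\<in>dcube j z. h x \<partial>lebesgue)"
  shows "emeasure W (\<Union>(j, z)\<in>I. cball z (K * 2 powi j)) \<le> c * (\<integral>\<^sup>+x. h x \<partial>lebesgue)"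
proof -
  note cI = stopped_subset_UN[OF I]
  have "emeasure W (\<Union>(j, z)\<in>I. cball z (K * 2 powi j))
      \<le> (\<integral>\<^sup>+i. emeasure W ((\<lambda>(j, z). cball z (K * 2 powi j)) i) \<partial>count_space I)"
    using cI by (intro emeasure_UN_countable_le) (auto simp: W)
  also have "\<dots> \<le> (\<integral>\<^sup>+i. c * (\<integral>\<^sup>+x\<in>(\<lambda>(j, z). dcube j z) i. h x \<partial>lebesgue) \<partial>count_space I)"
    using le by (intro nn_integral_mono) auto
  also have "\<dots> = c * (\<integral>\<^sup>+i. (\<integral>\<^sup>+x\<in>(\<lambda>(j, z). dcube j z) i. h x \<partial>lebesgue) \<partial>count_space I)"
    by (rule nn_integral_cmult) simp
  also have "(\<integral>\<^sup>+i. (\<integral>\<^sup>+x\<in>(\<lambda>(j, z). dcube j z) i. h x \<partial>lebesgue) \<partial>count_space I)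
      = (\<integral>\<^sup>+x\<in>(\<Union>i\<in>I. (\<lambda>(j, z). dcube j z) i). h x \<partial>lebesgue)"
    using cI h by (intro nn_integral_UN_countable[symmetric]) auto
  also have "\<dots> \<le> (\<integral>\<^sup>+x. h x \<partial>lebesgue)"
    by (intro nn_integral_mono) (auto split: split_indicator)
  finally show ?thesis by (simp add: mult_left_mono)
qed

section \<open>Calderon-Zygmund cubes and decomposition\<close>

definition cz_stop :: "('a::euclidean_space \<Rightarrow> real) \<Rightarrow> real \<Rightarrow> int \<Rightarrow> int \<Rightarrow> 'a \<Rightarrow> bool" where
  "cz_stop f s m j z \<longleftrightarrow> m \<le> j \<and> (j = m \<or>
     ennreal (s * (2 powi j) ^ DIM('a)) < (\<integral>\<^sup>+y\<in>dcube j z. ennreal \<bar>f y\<bar> \<partial>lebesgue))"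

text \<open>
  A Calderon--Zygmund decomposition whose cubes are also stopped at a finest scale \<open>m\<close>.
  The cubes then cover the whole space, so that the bound on the good part needs no
  differentiation theorem; the cubes of side \<open>2\<^sup>m\<close> need not be removed later, since only
  scales \<open>\<ge> m\<close> are tested.
\<close>

lemma Calderon_Zygmund:
  fixes f :: "'a::euclidean_space \<Rightarrow> real"
  assumes f: "integrable lebesgue f" and s: "0 < s"
  obtains g :: "'a \<Rightarrow> real" and \<tau> :: "'a \<Rightarrow> int" where
    "g \<in> borel_measurable lebesgue" "\<And>x. \<bar>g x\<bar> \<le> 2 ^ DIM('a) * s"
    "(\<integral>\<^sup>+x. ennreal \<bar>g x\<bar> \<partial>lebesgue) \<le> (\<integral>\<^sup>+x. ennreal \<bar>f x\<bar> \<partial>lebesgue)"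
    "\<And>x. m \<le> \<tau> x"
    "\<And>h :: int \<Rightarrow> 'a \<Rightarrow> real. (\<lambda>x. h (\<tau> x) (corner (\<tau> x) x)) \<in> borel_measurable lebesgue"
    "\<And>h. integrable lebesgue (\<lambda>x. (f x - g x) * h (\<tau> x) (corner (\<tau> x) x)) \<Longrightarrow>
       (\<integral>x. (f x - g x) * h (\<tau> x) (corner (\<tau> x) x) \<partial>lebesgue) = 0"
    "\<And>K. 0 \<le> K \<Longrightarrow> (\<Union>x\<in>{x. m < \<tau> x}. cball (corner (\<tau> x) x) (K * 2 powi (\<tau> x))) \<in> sets lebesgue"
    "\<And>K. 0 \<le> K \<Longrightarrow> emeasure lebesgue (\<Union>x\<in>{x. m < \<tau> x}. cball (corner (\<tau> x) x) (K * 2 powi (\<tau> x)))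
       \<le> ennreal (vol TYPE('a) * K ^ DIM('a) / s) * (\<integral>\<^sup>+x. ennreal \<bar>f x\<bar> \<partial>lebesgue)"
proof -
  let ?n = "DIM('a)"
  define P where "P = cz_stop f s m"
  define S where "S = stopped P"
  have [measurable]: "f \<in> borel_measurable lebesgue" using f by auto
  define N where "N = (\<integral>x. \<bar>f x\<bar> \<partial>lebesgue)"
  have N: "(\<integral>\<^sup>+x. ennreal \<bar>f x\<bar> \<partial>lebesgue) = ennreal N" "0 \<le> N"
    unfolding N_def using f by (auto intro!: nn_integral_eq_integral)
  \<comment> \<open>Integrability of f bounds the scales at which a large average can occur.\<close>
  obtain M where M: "\<And>j. s * (2 powi j) ^ ?n < N \<Longrightarrow> j \<le> M"
    using scale_bounded[OF s, where 'a='a] by blast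
  have bdd: "j \<le> max m M" if "P j z" for j z
  proof (cases "j = m")
    case False
    then have "ennreal (s * (2 powi j) ^ ?n) < (\<integral>\<^sup>+y\<in>dcube j z. ennreal \<bar>f y\<bar> \<partial>lebesgue)"
      using that by (auto simp: P_def cz_stop_def)
    also have "\<dots> \<le> (\<integral>\<^sup>+y. ennreal \<bar>f y\<bar> \<partial>lebesgue)"
      by (intro nn_integral_mono) (auto split: split_indicator)
    finally have "s * (2 powi j) ^ ?n < N"
      using N s by (simp add: ennreal_less_iff)
    then show ?thesis using M by fastforce
  qed simp
  have cover: "(\<Union>i\<in>S. (\<lambda>(j, z). dcube j z) i) = UNIV"
  proof -
    have "P m (corner m x)" for x by (simp add: P_def cz_stop_def)
    then have "{x. \<exists>j. P j (corner j x)} = UNIV" by auto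
    then show ?thesis using stopped_cover[of P "max m M"] bdd by (simp add: S_def)
  qed
  have ex: "\<exists>j. (j, corner j x) \<in> S" for x
  proof -
    have "x \<in> (\<Union>i\<in>S. (\<lambda>(j, z). dcube j z) i)" by (simp add: cover)
    then show ?thesis by (auto simp: dcube_def)
  qed
  \<comment> \<open>\<tau> x is the scale of the one stopped cube containing x. The decomposition is
    handed on through this function instead of an indexed family of cubes.\<close>
  define \<tau> where "\<tau> x = (SOME j. (j, corner j x) \<in> S)" for x
  have \<tau>S: "(\<tau> x, corner (\<tau> x) x) \<in> S" for x
    unfolding \<tau>_def by (rule someI_ex[OF ex])
  have uniq: "\<tau> x = j" "corner (\<tau> x) x = z" if "(j, z) \<in> S" "x \<in> dcube j z" for j z x
    using stopped_unique[of "\<tau> x" "corner (\<tau> x) x" P x j z] \<tau>S[of x] that by (auto simp: S_def dcube_def)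
  have SP: "m \<le> j" "corner j z = z" "P j z" if "(j, z) \<in> S" for j z
    using that by (auto simp: S_def stopped_def P_def cz_stop_def)
  have cS: "countable S" and dS: "disjoint_family_on (\<lambda>(j, z). dcube j z) S"
    by (auto simp: S_def countable_stopped disjoint_stopped)
  define avg where "avg j z = (\<integral>y. indicator (dcube j z) y * f y \<partial>lebesgue) / (2 powi j) ^ ?n" for j z
  define g where "g x = avg (\<tau> x) (corner (\<tau> x) x)" for x
  have intf: "integrable lebesgue (\<lambda>y. indicator (dcube j z) y * f y)" for j z
    using integrable_mult_indicator[OF dcube_lebesgue f] by simp
  have setS: "(\<lambda>(j, z). dcube j z) i \<in> sets lebesgue" for i :: "int \<times> 'a"
    by (cases i) simp
  have meas: "(\<lambda>x. h (\<tau> x) (corner (\<tau> x) x)) \<in> borel_measurable lebesgue" for h :: "int \<Rightarrow> 'a \<Rightarrow> real"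
    by (rule borel_measurable_const_on_partition[OF cS setS, where c="\<lambda>(j, z). h j z"])
       (use cover uniq in auto)
  have gm [measurable]: "g \<in> borel_measurable lebesgue"
    unfolding g_def by (rule meas)
  have absle: "ennreal (\<bar>avg j z\<bar> * (2 powi j) ^ ?n) \<le> (\<integral>\<^sup>+y\<in>dcube j z. ennreal \<bar>f y\<bar> \<partial>lebesgue)" for j z
  proof -
    have "\<bar>avg j z\<bar> * (2 powi j) ^ ?n = norm (\<integral>y. indicator (dcube j z) y * f y \<partial>lebesgue)"
      by (simp add: avg_def abs_divide)
    also have "ennreal \<dots> \<le> (\<integral>\<^sup>+y. norm (indicator (dcube j z) y * f y) \<partial>lebesgue)"
      by (rule integral_norm_bound_ennreal[OF intf])
    also have "\<dots> = (\<integral>\<^sup>+y\<in>dcube j z. ennreal \<bar>f y\<bar> \<partial>lebesgue)"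
      by (intro nn_integral_cong) (auto split: split_indicator)
    finally show ?thesis .
  qed
  have avg_le: "\<bar>avg j z\<bar> \<le> 2 ^ ?n * s" if jz: "(j, z) \<in> S" for j z
  proof -
    \<comment> \<open>The dyadic parent of a stopped cube is not stopped, so its average of |f| is
      at most s; passing down to the child costs the ratio 2^n of the volumes.\<close>
    have "\<not> P (j + 1) (corner (j + 1) z)" using jz by (simp add: S_def stopped_def)
    then have le: "(\<integral>\<^sup>+y\<in>dcube (j + 1) (corner (j + 1) z). ennreal \<bar>f y\<bar> \<partial>lebesgue) \<le> ennreal (s * (2 powi (j + 1)) ^ ?n)"
      using SP[OF jz] by (auto simp: P_def cz_stop_def not_less)
    have "ennreal (\<bar>avg j z\<bar> * (2 powi j) ^ ?n) \<le> (\<integral>\<^sup>+y\<in>dcube j z. ennreal \<bar>f y\<bar> \<partial>lebesgue)"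
      by (rule absle)
    also have "\<dots> \<le> (\<integral>\<^sup>+y\<in>dcube (j + 1) (corner (j + 1) z). ennreal \<bar>f y\<bar> \<partial>lebesgue)"
    proof (intro nn_integral_mono mult_left_mono)
      fix y
      have "y \<in> dcube j z \<Longrightarrow> y \<in> dcube (j + 1) (corner (j + 1) z)"
        using corner_corner[of j "j + 1" y] by (auto simp: dcube_def)
      then show "indicator (dcube j z) y \<le> (indicator (dcube (j + 1) (corner (j + 1) z)) y :: ennreal)"
        by (auto split: split_indicator)
    qed simp
    also note le
    finally have "\<bar>avg j z\<bar> * (2 powi j) ^ ?n \<le> s * (2 powi (j + 1)) ^ ?n"
      using s by (subst (asm) ennreal_le_iff) auto
    also have "\<dots> = 2 ^ ?n * s * (2 powi j) ^ ?n"
      by (simp add: power_int_add power_mult_distrib mult_ac)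
    finally show ?thesis by simp
  qed
  have gb: "\<bar>g x\<bar> \<le> 2 ^ ?n * s" for x
    unfolding g_def by (rule avg_le[OF \<tau>S])
  have gX: "g y = avg j z" if "(j, z) \<in> S" "y \<in> dcube j z" for j z y
    using uniq[OF that] by (simp add: g_def)
  have gint: "(\<integral>\<^sup>+x. ennreal \<bar>g x\<bar> \<partial>lebesgue) \<le> (\<integral>\<^sup>+x. ennreal \<bar>f x\<bar> \<partial>lebesgue)"
  proof -
    have "(\<integral>\<^sup>+x\<in>(\<Union>i\<in>S. (\<lambda>(j, z). dcube j z) i). ennreal \<bar>g x\<bar> \<partial>lebesgue)
        \<le> 1 * (\<integral>\<^sup>+x\<in>(\<Union>i\<in>S. (\<lambda>(j, z). dcube j z) i). ennreal \<bar>f x\<bar> \<partial>lebesgue)"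
    proof (rule nn_integral_UN_countable_le[OF cS setS dS])
      fix i assume i: "i \<in> S"
      obtain j z where jz: "i = (j, z)" by (cases i)
      have "(\<integral>\<^sup>+x\<in>dcube j z. ennreal \<bar>g x\<bar> \<partial>lebesgue) = (\<integral>\<^sup>+x\<in>dcube j z. ennreal \<bar>avg j z\<bar> \<partial>lebesgue)"
        using gX i jz by (intro nn_integral_cong) (auto split: split_indicator)
      also have "\<dots> = ennreal \<bar>avg j z\<bar> * emeasure lebesgue (dcube j z)"
        by (rule nn_integral_cmult_indicator[OF dcube_lebesgue])
      also have "\<dots> = ennreal \<bar>avg j z\<bar> * ennreal ((2 powi j) ^ ?n)"
        using SP i jz by (subst emeasure_dcube) auto
      also have "\<dots> = ennreal (\<bar>avg j z\<bar> * (2 powi j) ^ ?n)"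
        by (simp add: ennreal_mult)
      also note absle
      finally show "(\<integral>\<^sup>+x\<in>(\<lambda>(j, z). dcube j z) i. ennreal \<bar>g x\<bar> \<partial>lebesgue)
          \<le> 1 * (\<integral>\<^sup>+x\<in>(\<lambda>(j, z). dcube j z) i. ennreal \<bar>f x\<bar> \<partial>lebesgue)"
        by (simp add: jz)
    qed auto
    then show ?thesis by (simp add: cover)
  qed
  have zero: "(\<integral>x. (f x - g x) * h (\<tau> x) (corner (\<tau> x) x) \<partial>lebesgue) = 0"
    if int: "integrable lebesgue (\<lambda>x. (f x - g x) * h (\<tau> x) (corner (\<tau> x) x))" for h :: "int \<Rightarrow> 'a \<Rightarrow> real"
  proof (rule integral_partition_zero[OF int cS setS dS])
    show "(\<Union>i\<in>S. (\<lambda>(j, z). dcube j z) i) = space lebesgue" by (simp add: cover)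
    fix i assume i: "i \<in> S"
    obtain j z where jz: "i = (j, z)" by (cases i)
    have fin: "integrable lebesgue (\<lambda>x. indicator (dcube j z) x :: real)"
      using emeasure_dcube[of j z] SP[of j z] i jz
      by (intro integrable_real_indicator dcube_lebesgue) (auto simp del: emeasure_completion)
    have md: "measure lebesgue (dcube j z) = (2 powi j) ^ ?n"
      using emeasure_dcube[of j z] SP[of j z] i jz unfolding measure_def by simp
    have "(\<integral>x. indicator (dcube j z) x * ((f x - g x) * h (\<tau> x) (corner (\<tau> x) x)) \<partial>lebesgue)
       = (\<integral>x. h j z * (indicator (dcube j z) x * f x - avg j z * indicator (dcube j z) x) \<partial>lebesgue)"
      using gX uniq i jz by (intro Bochner_Integration.integral_cong) (auto split: split_indicator)
    also have "\<dots> = h j z * ((\<integral>x. indicator (dcube j z) x * f x \<partial>lebesgue) - avg j z * measure lebesgue (dcube j z))"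
      using intf fin by (simp del: measure_completion)
    also have "\<dots> = 0" unfolding md by (simp add: avg_def)
    finally show "(\<integral>x. indicator ((\<lambda>(j, z). dcube j z) i) x * ((f x - g x) * h (\<tau> x) (corner (\<tau> x) x)) \<partial>lebesgue) = 0"
      by (simp add: jz)
  qed
  \<comment> \<open>Only cubes coarser than m are sure to satisfy the strict inequality on averages;
    those of scale m may be stopped merely by the truncation.\<close>
  define I where "I = {i \<in> S. m < fst i}"
  have I: "I \<subseteq> stopped P" by (auto simp: I_def S_def)
  have eqI: "(\<Union>x\<in>{x. m < \<tau> x}. cball (corner (\<tau> x) x) (K * 2 powi (\<tau> x))) = (\<Union>(j, z)\<in>I. cball z (K * 2 powi j))" for K
  proof (intro set_eqI iffI)
    fix y assume "y \<in> (\<Union>x\<in>{x. m < \<tau> x}. cball (corner (\<tau> x) x) (K * 2 powi (\<tau> x)))"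
    then obtain x where "m < \<tau> x" "y \<in> cball (corner (\<tau> x) x) (K * 2 powi (\<tau> x))" by blast
    then show "y \<in> (\<Union>(j, z)\<in>I. cball z (K * 2 powi j))"
      using \<tau>S[of x] by (intro UN_I[of "(\<tau> x, corner (\<tau> x) x)"]) (auto simp: I_def)
  next
    fix y assume "y \<in> (\<Union>(j, z)\<in>I. cball z (K * 2 powi j))"
    then obtain j z where jz: "(j, z) \<in> S" "m < j" "y \<in> cball z (K * 2 powi j)" by (auto simp: I_def)
    then have "\<tau> z = j" "corner (\<tau> z) z = z" using uniq[of j z z] SP[of j z] by (auto simp: dcube_def)
    then show "y \<in> (\<Union>x\<in>{x. m < \<tau> x}. cball (corner (\<tau> x) x) (K * 2 powi (\<tau> x)))"
      using jz by auto
  qed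
  show ?thesis
  proof (rule that[of g \<tau>])
    fix K :: real assume K: "0 \<le> K"
    show "(\<Union>x\<in>{x. m < \<tau> x}. cball (corner (\<tau> x) x) (K * 2 powi (\<tau> x))) \<in> sets lebesgue"
      unfolding eqI using stopped_subset_UN[OF I] by (intro sets.countable_UN') auto
    show "emeasure lebesgue (\<Union>x\<in>{x. m < \<tau> x}. cball (corner (\<tau> x) x) (K * 2 powi (\<tau> x)))
       \<le> ennreal (vol TYPE('a) * K ^ ?n / s) * (\<integral>\<^sup>+x. ennreal \<bar>f x\<bar> \<partial>lebesgue)"
      unfolding eqI
    proof (rule enlarged_cubes_le[OF I refl])
      fix j z assume jz: "(j, z) \<in> I"
      then have lt: "ennreal (s * (2 powi j) ^ ?n) < (\<integral>\<^sup>+y\<in>dcube j z. ennreal \<bar>f y\<bar> \<partial>lebesgue)"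
        using SP(3)[of j z] by (auto simp: I_def P_def cz_stop_def)
      have "emeasure lebesgue (cball z (K * 2 powi j)) = ennreal (vol TYPE('a) * (K * 2 powi j) ^ ?n)"
        using K by (intro emeasure_lebesgue_cball) auto
      also have "\<dots> = ennreal (vol TYPE('a) * K ^ ?n / s) * ennreal (s * (2 powi j) ^ ?n)"
        using s K by (simp add: ennreal_mult[symmetric] power_mult_distrib mult_ac)
      also have "\<dots> \<le> ennreal (vol TYPE('a) * K ^ ?n / s) * (\<integral>\<^sup>+y\<in>dcube j z. ennreal \<bar>f y\<bar> \<partial>lebesgue)"
        using lt by (intro mult_left_mono) auto
      finally show "emeasure lebesgue (cball z (K * 2 powi j)) \<le> ennreal (vol TYPE('a) * K ^ ?n / s) * (\<integral>\<^sup>+y\<in>dcube j z. ennreal \<bar>f y\<bar> \<partial>lebesgue)" .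
    qed auto
  next
    show "m \<le> \<tau> x" for x by (rule SP(1)[OF \<tau>S])
  qed (fact gm gb gint meas zero)+
qed

text \<open>\<open>b\<close> integrates to zero against every function constant on the cells, so
  \<psi> may be replaced by its difference to its value at the corner of the cell. For x off the
  enlarged cubes, cells larger than 2^j are too far away to matter, and on smaller ones Hoelder
  continuity gains (2^\<tau> / 2^j)^\<beta>. The constant 3n + 1 is n (from x to the corner of its
  cube) plus n (from y to the corner of its cell) plus n + 1 (the support).\<close>

lemma integral_diff_cell_constant_le:
  fixes \<psi> :: "'a::euclidean_space \<Rightarrow> real"
  defines "n \<equiv> real DIM('a)"
  assumes \<beta>: "0 < \<beta>" "\<beta> \<le> 1" and at: "atom \<beta> j (corner j x) \<psi>" and b: "integrable lebesgue b" 
    and mj: "m \<le> j"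
    and meas: "\<And>h :: int \<Rightarrow> 'a \<Rightarrow> real. (\<lambda>x. h (\<tau> x) (corner (\<tau> x) x)) \<in> borel_measurable lebesgue"
    and zero: "\<And>h. integrable lebesgue (\<lambda>x. b x * h (\<tau> x) (corner (\<tau> x) x)) \<Longrightarrow>
       (\<integral>x. b x * h (\<tau> x) (corner (\<tau> x) x) \<partial>lebesgue) = 0"
    and x: "x \<notin> (\<Union>x\<in>{x. m < \<tau> x}. cball (corner (\<tau> x) x) ((3 * n + 1) * 2 powi (\<tau> x)))"
  shows "ennreal \<bar>\<integral>y. b y * \<psi> y \<partial>lebesgue\<bar> \<le>
    (\<integral>\<^sup>+y. ennreal (\<bar>b y\<bar> * (if \<tau> y \<le> j then n * (2 powr - \<beta>) ^ nat (j - \<tau> y) / (2 powi j) ^ DIM('a) else 0))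
        * indicator {y. norm (x - y) \<le> (3 * n + 1) * 2 powi j} y \<partial>lebesgue)"
proof -
  have n: "1 \<le> n" by (simp add: n_def Suc_le_eq)
  have [measurable]: "b \<in> borel_measurable lebesgue" using b by auto
  define z where "z = corner j x"
  have at': "atom \<beta> j z \<psi>" using at by (simp add: z_def)
  have xz: "norm (x - z) \<le> n * 2 powi j" using norm_diff_corner[of x j] by (simp add: z_def n_def)
  let ?B = "(2 * real DIM('a) + 3) / (2 powi j) ^ DIM('a)"
  let ?h = "\<lambda>y. \<psi> (corner (\<tau> y) y)"
  have hm [measurable]: "?h \<in> borel_measurable lebesgue" by (rule meas[of "\<lambda>_. \<psi>"])
  have int1: "integrable lebesgue (\<lambda>y. b y * \<psi> y)" by (rule atom_integrable_mult[OF \<beta> at b])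
  have int2: "integrable lebesgue (\<lambda>y. b y * ?h y)"
  proof (rule Bochner_Integration.integrable_bound)
    show "integrable lebesgue (\<lambda>y. ?B * b y)" using b by auto
    show "AE y in lebesgue. norm (b y * ?h y) \<le> norm (?B * b y)"
    proof (intro AE_I2)
      fix y
      have "\<bar>b y\<bar> * \<bar>?h y\<bar> \<le> \<bar>b y\<bar> * ?B"
        by (intro mult_left_mono atom_bound[OF \<beta> at]) auto
      then show "norm (b y * ?h y) \<le> norm (?B * b y)"
        by (simp add: abs_mult mult.commute)
    qed
  qed measurable
  have "(\<integral>y. b y * \<psi> y \<partial>lebesgue) = (\<integral>y. b y * \<psi> y \<partial>lebesgue) - (\<integral>y. b y * ?h y \<partial>lebesgue)"
    using zero[of "\<lambda>_. \<psi>"] int2 by simp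
  also have "\<dots> = (\<integral>y. b y * (\<psi> y - ?h y) \<partial>lebesgue)"
    using int1 int2 by (simp add: algebra_simps)
  finally have "ennreal \<bar>\<integral>y. b y * \<psi> y \<partial>lebesgue\<bar> = ennreal (norm (\<integral>y. b y * (\<psi> y - ?h y) \<partial>lebesgue))"
    by simp
  also have "\<dots> \<le> (\<integral>\<^sup>+y. norm (b y * (\<psi> y - ?h y)) \<partial>lebesgue)"
    using int1 int2 by (intro integral_norm_bound_ennreal) (simp add: algebra_simps)
  also have "\<dots> \<le> (\<integral>\<^sup>+y. ennreal (\<bar>b y\<bar> * (if \<tau> y \<le> j then n * (2 powr - \<beta>) ^ nat (j - \<tau> y) / (2 powi j) ^ DIM('a) else 0))
        * indicator {y. norm (x - y) \<le> (3 * n + 1) * 2 powi j} y \<partial>lebesgue)"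
  proof (rule nn_integral_mono)
    fix y :: 'a
    define p where "p = corner (\<tau> y) y"
    define l where "l = (2::real) powi (\<tau> y)"
    define L where "L = (2::real) powi j"
    have l: "0 < l" and L: "0 < L" by (auto simp: l_def L_def)
    have yp: "norm (y - p) \<le> n * l" using norm_diff_corner[of y "\<tau> y"] by (simp add: p_def n_def l_def)
    have pk: "(n + 1) * L < norm (v - z) \<Longrightarrow> \<psi> v = 0" for v
      using atom_support[OF at', of v] by (simp add: n_def L_def)
    have xz': "norm (x - z) \<le> n * L" using xz by (simp add: L_def)
    have t1: "norm (x - p) \<le> norm (x - z) + norm (p - z)"
      using norm_triangle_ineq4[of "x - z" "p - z"] by simp
    have t2: "norm (x - p) \<le> norm (x - z) + norm (y - z) + norm (y - p)"
      using norm_triangle_ineq[of "x - y" "y - p"] norm_triangle_ineq4[of "x - z" "y - z"] by simp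
    have t3: "norm (x - y) \<le> norm (x - z) + norm (y - z)"
      using norm_triangle_ineq4[of "x - z" "y - z"] by simp
    have t4: "norm (x - y) \<le> norm (x - z) + norm (p - z) + norm (y - p)"
      using norm_triangle_ineq4[of "x - p" "y - p"] t1 by simp
    have eqs: "(3 * n + 1) * l = 3 * (n * l) + l" "(3 * n + 1) * L = 3 * (n * L) + L" "(n + 1) * L = n * L + L"
      by (simp_all add: algebra_simps)
    have nn: "0 \<le> n * l" "0 \<le> n * L" using n l L by auto
    show "ennreal (norm (b y * (\<psi> y - ?h y))) \<le> ennreal (\<bar>b y\<bar> * (if \<tau> y \<le> j then n * (2 powr - \<beta>) ^ nat (j - \<tau> y) / (2 powi j) ^ DIM('a) else 0))
        * indicator {y. norm (x - y) \<le> (3 * n + 1) * 2 powi j} y"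
    proof (cases "\<tau> y \<le> j")
      case False
      \<comment> \<open>A cell coarser than j is coarser than m, so its enlargement is among the
        balls that x avoids.\<close>
      then have "m < \<tau> y" using mj by simp
      then have "x \<notin> cball p ((3 * n + 1) * l)" using x by (auto simp: p_def l_def)
      then have far: "(3 * n + 1) * l < norm (x - p)" by (simp add: dist_norm norm_minus_commute)
      have Ll: "L \<le> l" using False by (auto simp: L_def l_def intro: power_int_increasing)
      then have nL: "n * L \<le> n * l" using n by simp
      have "(n + 1) * L < norm (p - z)" "(n + 1) * L < norm (y - z)"
        using far t1 t2 xz' yp nL Ll nn unfolding eqs by linarith+
      then have "\<psi> p = 0" "\<psi> y = 0" using pk by auto
      then show ?thesis by (simp add: p_def)
    next
      case True
      have lL: "l \<le> L" using True by (auto simp: L_def l_def intro: power_int_increasing)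
      then have nl: "n * l \<le> n * L" using n by simp
      show ?thesis
      proof (cases "norm (x - y) \<le> (3 * n + 1) * L")
        case near: True
        have "\<bar>\<psi> y - \<psi> p\<bar> \<le> (norm (y - p) / L) powr \<beta> / L ^ DIM('a)"
          using atom_Holder[OF at', of y p] by (simp add: L_def)
        also have "\<dots> \<le> (n * (l / L)) powr \<beta> / L ^ DIM('a)"
          using yp l L \<beta> by (intro divide_right_mono powr_mono2) (auto simp: divide_right_mono)
        also have "\<dots> = n powr \<beta> * (l / L) powr \<beta> / L ^ DIM('a)"
          using n l L by (subst powr_mult) auto
        also have "\<dots> \<le> n powr 1 * (l / L) powr \<beta> / L ^ DIM('a)"
          using n \<beta> L by (intro divide_right_mono mult_right_mono powr_mono) auto
        also have "\<dots> = n * (2 powr - \<beta>) ^ nat (j - \<tau> y) / L ^ DIM('a)"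
          using n True by (simp add: l_def L_def powi_ratio_powr)
        finally have "\<bar>b y\<bar> * \<bar>\<psi> y - \<psi> p\<bar> \<le> \<bar>b y\<bar> * (n * (2 powr - \<beta>) ^ nat (j - \<tau> y) / L ^ DIM('a))"
          by (intro mult_left_mono) auto
        then show ?thesis using near True by (simp add: p_def L_def abs_mult ennreal_leI)
      next
        case far: False
        have "(n + 1) * L < norm (p - z)" "(n + 1) * L < norm (y - z)"
          using far t3 t4 xz' yp nl lL nn unfolding eqs by linarith+
        then have "\<psi> p = 0" "\<psi> y = 0" using pk by auto
        then show ?thesis by (simp add: p_def)
      qed
    qed
  qed
  finally show ?thesis .
qed

section \<open>Assembly of the unweighted weak type bound\<close>

lemma measurable_norm_diff_le:
  "{p. norm (fst p - snd p) \<le> R} \<in> sets (lebesgue \<Otimes>\<^sub>M (lebesgue :: 'a::euclidean_space measure))"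
proof -
  have "{p\<in>space (lebesgue \<Otimes>\<^sub>M lebesgue). norm (fst p - snd p::'a) \<le> R} \<in> sets (lebesgue \<Otimes>\<^sub>M lebesgue)"
    by measurable
  then show ?thesis by (simp add: space_pair_measure)
qed

lemma nn_integral_ball_average:
  fixes c :: "'a::euclidean_space \<Rightarrow> ennreal"
  assumes c [measurable]: "c \<in> borel_measurable lebesgue" and R: "0 \<le> R"
  shows "(\<integral>\<^sup>+x. (\<integral>\<^sup>+y. c y * indicator {y. norm (x - y) \<le> R} y \<partial>lebesgue) \<partial>lebesgue)
    = ennreal (vol TYPE('a) * R ^ DIM('a)) * (\<integral>\<^sup>+y. c y \<partial>lebesgue)"
proof -
  have "(\<integral>\<^sup>+x. (\<integral>\<^sup>+y. c y * indicator {y. norm (x - y) \<le> R} y \<partial>lebesgue) \<partial>lebesgue)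
     = (\<integral>\<^sup>+y. (\<integral>\<^sup>+x. c y * indicator {y. norm (x - y) \<le> R} y \<partial>lebesgue) \<partial>lebesgue)"
  proof (rule pair_sigma_finite.Fubini'[OF pair_sigma_finite_lebesgue, symmetric])
    have "(\<lambda>p. c (snd p) * indicator {p. norm (fst p - snd p) \<le> R} p) \<in> borel_measurable (lebesgue \<Otimes>\<^sub>M lebesgue)"
      by (intro borel_measurable_times_ennreal borel_measurable_indicator measurable_norm_diff_le measurable_compose[OF measurable_snd c])
    also have "(\<lambda>p. c (snd p) * indicator {p. norm (fst p - snd p) \<le> R} p)
       = (\<lambda>(x, y). c y * indicator {y. norm (x - y) \<le> R} y)"
      by (auto simp: fun_eq_iff split: split_indicator)
    finally show "(\<lambda>(x, y). c y * indicator {y. norm (x - y) \<le> R} y) \<in> borel_measurable (lebesgue \<Otimes>\<^sub>M lebesgue)" .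
  qed
  also have "\<dots> = (\<integral>\<^sup>+y. c y * emeasure lebesgue (cball y R) \<partial>lebesgue)"
  proof (rule nn_integral_cong)
    fix y :: 'a
    have "(\<integral>\<^sup>+x. c y * indicator {y. norm (x - y) \<le> R} y \<partial>lebesgue) = (\<integral>\<^sup>+x. c y * indicator (cball y R) x \<partial>lebesgue)"
      by (intro nn_integral_cong) (auto simp: dist_norm norm_minus_commute split: split_indicator)
    also have "\<dots> = c y * emeasure lebesgue (cball y R)"
      by (rule nn_integral_cmult_indicator) simp
    finally show "(\<integral>\<^sup>+x. c y * indicator {y. norm (x - y) \<le> R} y \<partial>lebesgue) = c y * emeasure lebesgue (cball y R)" .
  qed
  also have "\<dots> = ennreal (vol TYPE('a) * R ^ DIM('a)) * (\<integral>\<^sup>+y. c y \<partial>lebesgue)"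
    using R by (simp add: emeasure_lebesgue_cball nn_integral_multc mult.commute del: emeasure_completion)
  finally show ?thesis .
qed

text \<open>One summand for each piece: the good part through L^2 and Chebyshev, the enlarged cubes,
  and the bad part away from them.\<close>

definition weak_const :: "real \<Rightarrow> 'a::euclidean_space itself \<Rightarrow> real" where
  "weak_const \<beta> T = (let n = DIM('a); v = vol T * (3 * real n + 1) ^ n in
     4 * gram_const \<beta> T * 2 ^ n + v + 4 * (real n * v * (2 / (1 - 2 powr - \<beta>))))"

lemma weak_const_pos: "0 < \<beta> \<Longrightarrow> 0 < weak_const \<beta> TYPE('a::euclidean_space)"
  using two_powr_minus_less_one[of \<beta>] gram_const_pos[of \<beta>, where 'a='a]
  by (auto simp: weak_const_def Let_def intro!: add_pos_nonneg)

text \<open>The level is s^2 since \<open>sqsum\<close> is a sum of squares. The constant depends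
  neither on the atoms nor on m and M, because the choice of atoms and the limit over the scales
  come later.\<close>

lemma sqsum_weak_type_one:
  fixes \<psi> :: "int \<Rightarrow> 'a::euclidean_space \<Rightarrow> 'a \<Rightarrow> real"
  assumes \<beta>: "0 < \<beta>" "\<beta> \<le> 1" and at: "atoms \<beta> \<psi>" and f: "integrable lebesgue f" and s: "0 < s"
  shows "emeasure lebesgue {x. s\<^sup>2 < sqsum \<psi> f m M x} \<le> ennreal (weak_const \<beta> TYPE('a) / s) * (\<integral>\<^sup>+x. ennreal \<bar>f x\<bar> \<partial>lebesgue)"
proof -
  let ?n = "DIM('a)"
  define r where "r = 2 powr - \<beta>"
  have r: "0 \<le> r" "r < 1" using two_powr_minus_less_one[of \<beta>] \<beta> by (auto simp: r_def)
  have [measurable]: "f \<in> borel_measurable lebesgue" using f by auto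
  obtain g \<tau> where [measurable]: "g \<in> borel_measurable lebesgue" and gb: "\<And>x. \<bar>g x\<bar> \<le> 2 ^ ?n * s"
    and gint: "(\<integral>\<^sup>+x. ennreal \<bar>g x\<bar> \<partial>lebesgue) \<le> (\<integral>\<^sup>+x. ennreal \<bar>f x\<bar> \<partial>lebesgue)"
    and \<tau>m: "\<And>x. m \<le> \<tau> x"
    and meas: "\<And>h :: int \<Rightarrow> 'a \<Rightarrow> real. (\<lambda>x. h (\<tau> x) (corner (\<tau> x) x)) \<in> borel_measurable lebesgue"
    and zero: "\<And>h. integrable lebesgue (\<lambda>x. (f x - g x) * h (\<tau> x) (corner (\<tau> x) x)) \<Longrightarrow>
       (\<integral>x. (f x - g x) * h (\<tau> x) (corner (\<tau> x) x) \<partial>lebesgue) = 0"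
    and Om: "\<And>K. 0 \<le> K \<Longrightarrow> (\<Union>x\<in>{x. m < \<tau> x}. cball (corner (\<tau> x) x) (K * 2 powi (\<tau> x))) \<in> sets lebesgue"
    and Oe: "\<And>K. 0 \<le> K \<Longrightarrow> emeasure lebesgue (\<Union>x\<in>{x. m < \<tau> x}. cball (corner (\<tau> x) x) (K * 2 powi (\<tau> x)))
       \<le> ennreal (vol TYPE('a) * K ^ DIM('a) / s) * (\<integral>\<^sup>+x. ennreal \<bar>f x\<bar> \<partial>lebesgue)"
    by (rule Calderon_Zygmund[OF f s, where m=m]) (rule that, assumption+)
  define N where "N = (\<integral>x. \<bar>f x\<bar> \<partial>lebesgue)"
  have N: "(\<integral>\<^sup>+x. ennreal \<bar>f x\<bar> \<partial>lebesgue) = ennreal N" "0 \<le> N"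
    unfolding N_def using f by (auto intro!: nn_integral_eq_integral)
  have gi: "integrable lebesgue g"
    using gint N by (intro integrableI_bounded) (auto simp: top_unique less_top[symmetric])
  define b where "b x = f x - g x" for x
  have bi: "integrable lebesgue b" unfolding b_def using f gi by simp
  have [measurable]: "b \<in> borel_measurable lebesgue" using bi by auto
  have bN: "(\<integral>\<^sup>+x. ennreal \<bar>b x\<bar> \<partial>lebesgue) \<le> ennreal (2 * N)"
  proof -
    have "(\<integral>\<^sup>+x. ennreal \<bar>b x\<bar> \<partial>lebesgue) \<le> (\<integral>\<^sup>+x. ennreal \<bar>f x\<bar> + ennreal \<bar>g x\<bar> \<partial>lebesgue)"
      by (intro nn_integral_mono) (auto simp: b_def ennreal_plus[symmetric] simp del: ennreal_plus intro!: ennreal_leI)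
    also have "\<dots> = (\<integral>\<^sup>+x. ennreal \<bar>f x\<bar> \<partial>lebesgue) + (\<integral>\<^sup>+x. ennreal \<bar>g x\<bar> \<partial>lebesgue)"
      by (rule nn_integral_add) auto
    also have "\<dots> \<le> ennreal N + ennreal N" using gint N by (intro add_mono) auto
    also have "\<dots> = ennreal (2 * N)" using N by (simp add: ennreal_plus[symmetric] del: ennreal_plus)
    finally show ?thesis .
  qed
  define n where "n = real ?n"
  have n: "0 \<le> n" by (simp add: n_def)
  define Om where "Om = (\<Union>x\<in>{x. m < \<tau> x}. cball (corner (\<tau> x) x) ((3 * n + 1) * 2 powi (\<tau> x)))"
  have n1: "0 \<le> 3 * n + 1" using n by simp
  have Oms: "Om \<in> sets lebesgue" unfolding Om_def by (rule Om[OF n1])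
  have Ome: "emeasure lebesgue Om \<le> ennreal (vol TYPE('a) * (3 * n + 1) ^ ?n / s) * ennreal N"
    unfolding Om_def N(1)[symmetric] by (rule Oe[OF n1])
  \<comment> \<open>The thresholds come from (a + b)^2 \<le> 2 a^2 + 2 b^2: if the square sum of g
    is at most s^2 / 4 and that of b at most (s/2)^2, the total is at most s^2.\<close>
  define A1 where "A1 = {x. s\<^sup>2 / 4 < sqsum \<psi> g m M x}"
  \<comment> \<open>For the bad part the square sum is dominated by the square of the l^1 sum
    \<open>u\<close>, which can be integrated term by term.\<close>
  define u where "u x = (\<Sum>j=m..M. \<bar>coef \<psi> b j (corner j x)\<bar>)" for x
  have um [measurable]: "u \<in> borel_measurable lebesgue"
    unfolding u_def by (intro borel_measurable_sum borel_measurable_abs borel_measurable_corner_comp)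
  define A3 where "A3 = {x \<in> - Om. s / 2 < u x}"
  have setl: "{x. c < v x} \<in> sets lebesgue" if "v \<in> borel_measurable lebesgue" for v :: "'a \<Rightarrow> real" and c
  proof -
    have "{x \<in> space lebesgue. c < v x} \<in> sets lebesgue" using that by measurable
    then show ?thesis by simp
  qed
  have A1s: "A1 \<in> sets lebesgue" unfolding A1_def by (intro setl borel_measurable_sqsum)
  have A3s: "A3 \<in> sets lebesgue"
  proof -
    have "A3 = {x. s / 2 < u x} - Om" by (auto simp: A3_def)
    then show ?thesis using setl[OF um, of "s/2"] Oms by auto
  qed
  have coef_split: "coef \<psi> f j z = coef \<psi> g j z + coef \<psi> b j z" if "corner j z = z" for j z
  proof -
    note a = atomsD[OF at that]
    show ?thesis
      unfolding coef_def using atom_integrable_mult[OF \<beta> a gi] atom_integrable_mult[OF \<beta> a bi]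
      by (subst Bochner_Integration.integral_add[symmetric]) (auto simp: b_def algebra_simps)
  qed
  have sub: "{x. s\<^sup>2 < sqsum \<psi> f m M x} \<subseteq> A1 \<union> Om \<union> A3"
  proof (rule ccontr)
    assume "\<not> ?thesis"
    then obtain x where "s\<^sup>2 < sqsum \<psi> f m M x" "x \<notin> A1" "x \<notin> Om" "x \<notin> A3"
      by blast
    then have x: "s\<^sup>2 < sqsum \<psi> f m M x" "sqsum \<psi> g m M x \<le> s\<^sup>2 / 4" "u x \<le> s / 2"
      unfolding A1_def A3_def by (simp_all add: not_less)
    have "sqsum \<psi> f m M x \<le> (\<Sum>j=m..M. 2 * (coef \<psi> g j (corner j x))\<^sup>2 + 2 * (coef \<psi> b j (corner j x))\<^sup>2)"
      unfolding sqsum_def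
    proof (intro sum_mono)
      fix j
      have "0 \<le> (coef \<psi> g j (corner j x) - coef \<psi> b j (corner j x))\<^sup>2" by simp
      then show "(coef \<psi> f j (corner j x))\<^sup>2 \<le> 2 * (coef \<psi> g j (corner j x))\<^sup>2 + 2 * (coef \<psi> b j (corner j x))\<^sup>2"
        by (simp add: coef_split power2_eq_square algebra_simps)
    qed
    also have "\<dots> = 2 * sqsum \<psi> g m M x + 2 * (\<Sum>j=m..M. (coef \<psi> b j (corner j x))\<^sup>2)"
      by (simp add: sqsum_def sum.distrib sum_distrib_left)
    also have "(\<Sum>j=m..M. (coef \<psi> b j (corner j x))\<^sup>2) \<le> (u x)\<^sup>2"
    proof -
      have "(\<Sum>j=m..M. (coef \<psi> b j (corner j x))\<^sup>2) = (\<Sum>j=m..M. \<bar>coef \<psi> b j (corner j x)\<bar> * \<bar>coef \<psi> b j (corner j x)\<bar>)"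
        by (simp add: power2_eq_square)
      also have "\<dots> \<le> (\<Sum>j=m..M. \<bar>coef \<psi> b j (corner j x)\<bar> * u x)"
        unfolding u_def by (intro sum_mono mult_left_mono member_le_sum) auto
      finally show ?thesis by (simp add: u_def sum_distrib_right power2_eq_square)
    qed
    also have "(u x)\<^sup>2 \<le> (s / 2)\<^sup>2"
      using x by (intro power_mono) (auto simp: u_def sum_nonneg)
    finally show False using x by (simp add: power2_eq_square)
  qed
  \<comment> \<open>Chebyshev at level s^2 / 4, which gives the factor 4; the squared L^2 norm of g
    is at most 2^n s times its L^1 norm.\<close>
  have A1e: "emeasure lebesgue A1 \<le> ennreal (4 * gram_const \<beta> TYPE('a) * 2 ^ ?n / s * N)"
  proof -
    have gg: "(\<integral>\<^sup>+x. ennreal ((g x)\<^sup>2) \<partial>lebesgue) \<le> ennreal (2 ^ ?n * s * N)"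
    proof -
      have "(\<integral>\<^sup>+x. ennreal ((g x)\<^sup>2) \<partial>lebesgue) \<le> (\<integral>\<^sup>+x. ennreal (2 ^ ?n * s) * ennreal \<bar>g x\<bar> \<partial>lebesgue)"
      proof (intro nn_integral_mono)
        fix x
        have "\<bar>g x\<bar> * \<bar>g x\<bar> \<le> 2 ^ ?n * s * \<bar>g x\<bar>" by (intro mult_right_mono gb) auto
        then show "ennreal ((g x)\<^sup>2) \<le> ennreal (2 ^ ?n * s) * ennreal \<bar>g x\<bar>"
          using s by (simp add: power2_eq_square ennreal_mult[symmetric] ennreal_leI)
      qed
      also have "\<dots> = ennreal (2 ^ ?n * s) * (\<integral>\<^sup>+x. ennreal \<bar>g x\<bar> \<partial>lebesgue)"
        by (rule nn_integral_cmult) auto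
      also have "\<dots> \<le> ennreal (2 ^ ?n * s) * ennreal N" using gint N by (intro mult_left_mono) auto
      finally show ?thesis using s N by (simp add: ennreal_mult[symmetric])
    qed
    then have gi2: "integrable lebesgue (\<lambda>x. (g x)\<^sup>2)"
      by (intro integrableI_bounded) (auto simp: less_top[symmetric] top_unique)
    have ig: "(\<integral>x. (g x)\<^sup>2 \<partial>lebesgue) \<le> 2 ^ ?n * s * N"
      using gg gi2 s N by (subst (asm) nn_integral_eq_integral) (auto simp: ennreal_le_iff)
    have "emeasure lebesgue A1 \<le> (\<integral>\<^sup>+x. ennreal (4 / s\<^sup>2) * ennreal (sqsum \<psi> g m M x) \<partial>lebesgue)"
    proof -
      have "emeasure lebesgue A1 = (\<integral>\<^sup>+x. indicator A1 x \<partial>lebesgue)" using A1s by simp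
      also have "\<dots> \<le> (\<integral>\<^sup>+x. ennreal (4 / s\<^sup>2) * ennreal (sqsum \<psi> g m M x) \<partial>lebesgue)"
        using s by (intro nn_integral_mono)
          (auto simp: A1_def ennreal_mult[symmetric] sqsum_def sum_nonneg field_simps split: split_indicator)
      finally show ?thesis .
    qed
    also have "\<dots> = ennreal (4 / s\<^sup>2) * (\<integral>\<^sup>+x. ennreal (sqsum \<psi> g m M x) \<partial>lebesgue)"
      by (rule nn_integral_cmult) measurable
    also have "\<dots> \<le> ennreal (4 / s\<^sup>2) * ennreal (gram_const \<beta> TYPE('a) * (2 ^ ?n * s * N))"
    proof (rule mult_left_mono)
      have "(\<integral>\<^sup>+x. ennreal (sqsum \<psi> g m M x) \<partial>lebesgue) \<le> ennreal (gram_const \<beta> TYPE('a) * (\<integral>x. (g x)\<^sup>2 \<partial>lebesgue))"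
        by (rule sqsum_L2_le[OF \<beta> at _ gi2]) simp
      also have "\<dots> \<le> ennreal (gram_const \<beta> TYPE('a) * (2 ^ ?n * s * N))"
        using ig gram_const_pos[OF \<beta>(1), where 'a='a] by (intro ennreal_leI mult_left_mono) auto
      finally show "(\<integral>\<^sup>+x. ennreal (sqsum \<psi> g m M x) \<partial>lebesgue) \<le> ennreal (gram_const \<beta> TYPE('a) * (2 ^ ?n * s * N))" .
    qed simp
    also have "\<dots> = ennreal (4 * gram_const \<beta> TYPE('a) * 2 ^ ?n / s * N)"
      using s N gram_const_pos[OF \<beta>(1), where 'a='a]
      by (simp add: ennreal_mult[symmetric] power2_eq_square)
    finally show ?thesis .
  qed
  define V where "V = vol TYPE('a) * (3 * n + 1) ^ ?n"
  have V_eq: "V = unit_ball_vol n * (3 * n + 1) ^ ?n" by (simp add: V_def n_def)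
  have V: "0 \<le> V" using n by (simp add: V_def)
  have A3e: "emeasure lebesgue A3 \<le> ennreal (4 * (n * V * (2 / (1 - r))) / s * N)"
  proof -
    define c where "c j y = (if \<tau> y \<le> j then n * r ^ nat (j - \<tau> y) / (2 powi j) ^ ?n else 0)" for j y
    have cm [measurable]: "c j \<in> borel_measurable lebesgue" for j
      unfolding c_def by (rule meas[of "\<lambda>t _. if t \<le> j then n * r ^ nat (j - t) / (2 powi j) ^ ?n else 0"])
    have cn: "0 \<le> c j y" for j y using r n by (simp add: c_def)
    let ?k = "\<lambda>j x y. ennreal (\<bar>b y\<bar> * c j y) * indicator {y. norm (x - y) \<le> (3 * n + 1) * 2 powi j} y"
    have "emeasure lebesgue A3 = (\<integral>\<^sup>+x. indicator A3 x \<partial>lebesgue)" using A3s by simp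
    also have "\<dots> \<le> (\<integral>\<^sup>+x. ennreal (2 / s) * (\<Sum>j=m..M. \<integral>\<^sup>+y. ?k j x y \<partial>lebesgue) \<partial>lebesgue)"
    proof (intro nn_integral_mono)
      fix x :: 'a
      show "indicator A3 x \<le> ennreal (2 / s) * (\<Sum>j=m..M. \<integral>\<^sup>+y. ?k j x y \<partial>lebesgue)"
      proof (cases "x \<in> A3")
        case True
        then have x: "x \<notin> Om" "s / 2 < u x" by (auto simp: A3_def)
        have "ennreal \<bar>coef \<psi> b j (corner j x)\<bar> \<le> (\<integral>\<^sup>+y. ?k j x y \<partial>lebesgue)" if "j \<in> {m..M}" for j
          unfolding coef_def c_def r_def n_def
          by (rule integral_diff_cell_constant_le[OF \<beta> atomsD[OF at corner_idem] bi _ meas])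
             (use that zero x in \<open>auto simp: b_def Om_def n_def\<close>)
        then have "(\<Sum>j=m..M. ennreal \<bar>coef \<psi> b j (corner j x)\<bar>) \<le> (\<Sum>j=m..M. \<integral>\<^sup>+y. ?k j x y \<partial>lebesgue)"
          by (rule sum_mono)
        then have "ennreal (u x) \<le> (\<Sum>j=m..M. \<integral>\<^sup>+y. ?k j x y \<partial>lebesgue)"
          by (simp add: u_def)
        then have "ennreal (2 / s) * ennreal (u x) \<le> ennreal (2 / s) * (\<Sum>j=m..M. \<integral>\<^sup>+y. ?k j x y \<partial>lebesgue)"
          by (intro mult_left_mono) auto
        moreover have "1 \<le> ennreal (2 / s) * ennreal (u x)"
          using x s by (simp add: ennreal_mult[symmetric] field_simps)
        ultimately show ?thesis using True by simp
      qed simp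
    qed
    also have "\<dots> = ennreal (2 / s) * (\<Sum>j=m..M. \<integral>\<^sup>+x. \<integral>\<^sup>+y. ?k j x y \<partial>lebesgue \<partial>lebesgue)"
    proof -
      have km: "(\<lambda>x. \<integral>\<^sup>+y. ?k j x y \<partial>lebesgue) \<in> borel_measurable lebesgue" for j
      proof -
        have "(\<lambda>p. ennreal (\<bar>b (snd p)\<bar> * c j (snd p)) * indicator {p. norm (fst p - snd p) \<le> (3 * n + 1) * 2 powi j} p) \<in> borel_measurable (lebesgue \<Otimes>\<^sub>M lebesgue)"
          by (intro borel_measurable_times_ennreal borel_measurable_indicator measurable_norm_diff_le measurable_compose[OF measurable_snd, of "\<lambda>y. ennreal (\<bar>b y\<bar> * c j y)"]) measurable
        also have "(\<lambda>p. ennreal (\<bar>b (snd p)\<bar> * c j (snd p)) * indicator {p. norm (fst p - snd p) \<le> (3 * n + 1) * 2 powi j} p)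
           = (\<lambda>(x, y). ?k j x y)"
          by (auto simp: fun_eq_iff split: split_indicator)
        finally show ?thesis
          by (intro sigma_finite_measure.borel_measurable_nn_integral[OF sigma_finite_lebesgue])
      qed
      show ?thesis
        by (subst nn_integral_cmult, intro borel_measurable_sum km, subst nn_integral_sum, rule km, rule refl)
    qed
    \<comment> \<open>Integration over the centres x gives the volume V 2^(jn), which cancels the
      2^(-jn) in \<open>c j\<close>; what remains is, for each y, a geometric series in j starting
      at \<tau> y.\<close>
    also have "(\<Sum>j=m..M. \<integral>\<^sup>+x. \<integral>\<^sup>+y. ?k j x y \<partial>lebesgue \<partial>lebesgue)
       = (\<Sum>j=m..M. \<integral>\<^sup>+y. ennreal (V * (2 powi j) ^ ?n) * ennreal (\<bar>b y\<bar> * c j y) \<partial>lebesgue)"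
    proof (intro sum.cong refl)
      fix j
      have "(\<integral>\<^sup>+x. \<integral>\<^sup>+y. ?k j x y \<partial>lebesgue \<partial>lebesgue)
          = ennreal (vol TYPE('a) * ((3 * n + 1) * 2 powi j) ^ ?n) * (\<integral>\<^sup>+y. ennreal (\<bar>b y\<bar> * c j y) \<partial>lebesgue)"
        using n by (intro nn_integral_ball_average) auto
      also have "vol TYPE('a) * ((3 * n + 1) * 2 powi j) ^ ?n = V * (2 powi j) ^ ?n"
        by (simp add: V_def power_mult_distrib)
      also have "ennreal (V * (2 powi j) ^ ?n) * (\<integral>\<^sup>+y. ennreal (\<bar>b y\<bar> * c j y) \<partial>lebesgue)
          = (\<integral>\<^sup>+y. ennreal (V * (2 powi j) ^ ?n) * ennreal (\<bar>b y\<bar> * c j y) \<partial>lebesgue)"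
        by (rule nn_integral_cmult[symmetric]) measurable
      finally show "(\<integral>\<^sup>+x. \<integral>\<^sup>+y. ?k j x y \<partial>lebesgue \<partial>lebesgue)
          = (\<integral>\<^sup>+y. ennreal (V * (2 powi j) ^ ?n) * ennreal (\<bar>b y\<bar> * c j y) \<partial>lebesgue)" .
    qed
    also have "\<dots> = (\<integral>\<^sup>+y. (\<Sum>j=m..M. ennreal (V * (2 powi j) ^ ?n) * ennreal (\<bar>b y\<bar> * c j y)) \<partial>lebesgue)"
      by (subst nn_integral_sum) auto
    also have "\<dots> \<le> (\<integral>\<^sup>+y. ennreal (n * V * (2 / (1 - r))) * ennreal \<bar>b y\<bar> \<partial>lebesgue)"
    proof (intro nn_integral_mono)
      fix y
      have "(\<Sum>j=m..M. (V * (2 powi j) ^ ?n) * c j y) \<le> (\<Sum>j=m..M. n * V * r ^ nat \<bar>j - \<tau> y\<bar>)"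
        using V n r by (intro sum_mono) (auto simp: c_def mult_ac)
      also have "\<dots> \<le> n * V * (2 / (1 - r))"
        unfolding sum_distrib_left[symmetric] using r V n by (intro mult_left_mono sum_geometric_abs_le) auto
      finally have "(\<Sum>j=m..M. (V * (2 powi j) ^ ?n) * c j y) * \<bar>b y\<bar> \<le> n * V * (2 / (1 - r)) * \<bar>b y\<bar>"
        by (intro mult_right_mono) auto
      moreover have "(\<Sum>j=m..M. ennreal (V * (2 powi j) ^ ?n) * ennreal (\<bar>b y\<bar> * c j y)) = ennreal ((\<Sum>j=m..M. (V * (2 powi j) ^ ?n) * c j y) * \<bar>b y\<bar>)"
        using V cn by (subst sum_distrib_right, subst sum_ennreal[symmetric]) (auto simp: ennreal_mult[symmetric] mult_ac)
      ultimately show "(\<Sum>j=m..M. ennreal (V * (2 powi j) ^ ?n) * ennreal (\<bar>b y\<bar> * c j y)) \<le> ennreal (n * V * (2 / (1 - r))) * ennreal \<bar>b y\<bar>"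
        using V n r by (simp add: ennreal_mult[symmetric] ennreal_leI)
    qed
    also have "\<dots> = ennreal (n * V * (2 / (1 - r))) * (\<integral>\<^sup>+y. ennreal \<bar>b y\<bar> \<partial>lebesgue)"
      by (rule nn_integral_cmult) measurable
    also have "\<dots> \<le> ennreal (n * V * (2 / (1 - r))) * ennreal (2 * N)"
      by (intro mult_left_mono bN) auto
    finally have "emeasure lebesgue A3 \<le> ennreal (2 / s) * (ennreal (n * V * (2 / (1 - r))) * ennreal (2 * N))"
      by (simp add: mult_left_mono)
    also have "\<dots> = ennreal (4 * (n * V * (2 / (1 - r))) / s * N)"
      using s V n r N by (simp add: ennreal_mult[symmetric] mult_ac)
    finally show ?thesis .
  qed
  have "emeasure lebesgue {x. s\<^sup>2 < sqsum \<psi> f m M x} \<le> emeasure lebesgue (A1 \<union> Om \<union> A3)"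
    using A1s Oms A3s by (intro emeasure_mono sub) auto
  also have "\<dots> \<le> emeasure lebesgue A1 + emeasure lebesgue Om + emeasure lebesgue A3"
    using A1s Oms A3s by (intro order_trans[OF emeasure_subadditive] add_mono) auto
  also have "\<dots> \<le> ennreal (4 * gram_const \<beta> TYPE('a) * 2 ^ ?n / s * N) + ennreal (V / s * N)
      + ennreal (4 * (n * V * (2 / (1 - r))) / s * N)"
    using A1e Ome A3e N s V by (intro add_mono) (auto simp: V_def ennreal_mult[symmetric])
  also have "\<dots> = ennreal (weak_const \<beta> TYPE('a) / s * N)"
    using s V n r N gram_const_pos[OF \<beta>(1), where 'a='a] unfolding weak_const_def Let_def n_def[symmetric] r_def[symmetric] V_eq[symmetric]
    by (simp add: ennreal_plus[symmetric] add_divide_distrib distrib_right del: ennreal_plus)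
  also have "\<dots> = ennreal (weak_const \<beta> TYPE('a) / s) * ennreal N"
    using s N weak_const_pos[OF \<beta>(1), where 'a='a] by (intro ennreal_mult) auto
  finally show ?thesis by (simp add: N)
qed

section \<open>The weighted weak type bound\<close>

text \<open>
  The form in which the \<open>A\<^sub>q\<close> condition is used: the \<open>q\<close>-th power of an average over a ball is
  controlled by the weighted average of the \<open>q\<close>-th power.
\<close>

definition averaging :: "real \<Rightarrow> real \<Rightarrow> ('a::euclidean_space \<Rightarrow> real) \<Rightarrow> bool" where
  "averaging q C w \<longleftrightarrow> (\<forall>c r t (f :: 'a \<Rightarrow> real). 0 < r \<longrightarrow> 0 \<le> t \<longrightarrow> f \<in> borel_measurable lebesgue \<longrightarrow>
     ennreal t * emeasure lebesgue (ball c r) \<le> (\<integral>\<^sup>+x\<in>ball c r. ennreal \<bar>f x\<bar> \<partial>lebesgue) \<longrightarrow>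
     ennreal (t powr q) * wmeas w (ball c r) \<le> ennreal C * (\<integral>\<^sup>+x\<in>ball c r. ennreal (\<bar>f x\<bar> powr q * w x) \<partial>lebesgue))"

text \<open>\<open>averaging\<close> for f cut off to A, with t = s / V. The radius grows from R to
  R + 1 because \<open>averaging\<close> speaks of open balls. For f = 1 this is the A_infinity
  property: a set filling a fixed share of a ball carries a fixed share of its weight.\<close>

lemma averaging_cball:
  fixes f w :: "'a::euclidean_space \<Rightarrow> real"
  assumes av: "averaging q C w" and C: "0 \<le> C"
    and f [measurable]: "f \<in> borel_measurable lebesgue" and A [measurable]: "A \<in> sets lebesgue"
    and l: "0 < l" and R: "0 \<le> R" and AR: "A \<subseteq> cball z (R * l)" and s: "0 < s"
    and le: "ennreal (s * l ^ DIM('a)) \<le> (\<integral>\<^sup>+x\<in>A. ennreal \<bar>f x\<bar> \<partial>lebesgue)"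
  shows "wmeas w (cball z (R * l)) \<le> ennreal (C * (vol TYPE('a) * (R + 1) ^ DIM('a) / s) powr q) * (\<integral>\<^sup>+x\<in>A. ennreal (\<bar>f x\<bar> powr q * w x) \<partial>lebesgue)"
proof -
  define V where "V = vol TYPE('a) * (R + 1) ^ DIM('a)"
  have V: "0 < V" using R by (simp add: V_def)
  let ?B = "ball z ((R + 1) * l)"
  have sub: "cball z (R * l) \<subseteq> ?B" using l by (auto simp: algebra_simps)
  define g where "g x = f x * indicator A x" for x
  have [measurable]: "g \<in> borel_measurable lebesgue" unfolding g_def by measurable
  have eq: "(\<integral>\<^sup>+x\<in>?B. ennreal (h \<bar>g x\<bar> x) \<partial>lebesgue) = (\<integral>\<^sup>+x\<in>A. ennreal (h \<bar>f x\<bar> x) \<partial>lebesgue)"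
    if "\<And>x. h 0 x = 0" for h :: "real \<Rightarrow> 'a \<Rightarrow> real"
    using that AR sub by (intro nn_integral_cong) (auto simp: g_def split: split_indicator)
  have "ennreal (s / V) * emeasure lebesgue ?B = ennreal (s / V) * ennreal (V * l ^ DIM('a))"
    using R l by (subst emeasure_lebesgue_ball) (auto simp: V_def power_mult_distrib mult_ac)
  also have "\<dots> = ennreal (s * l ^ DIM('a))"
    using V s l by (simp add: ennreal_mult[symmetric])
  also have "\<dots> \<le> (\<integral>\<^sup>+x\<in>?B. ennreal \<bar>g x\<bar> \<partial>lebesgue)"
    using le eq[of "\<lambda>u x. u"] by simp
  finally have "ennreal ((s / V) powr q) * wmeas w ?B \<le> ennreal C * (\<integral>\<^sup>+x\<in>?B. ennreal (\<bar>g x\<bar> powr q * w x) \<partial>lebesgue)"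
    using av R l s V unfolding averaging_def by (auto simp del: emeasure_completion)
  then have le2: "ennreal ((s / V) powr q) * wmeas w ?B \<le> ennreal C * (\<integral>\<^sup>+x\<in>A. ennreal (\<bar>f x\<bar> powr q * w x) \<partial>lebesgue)"
    using eq[of "\<lambda>u x. u powr q * w x"] by simp
  have "wmeas w (cball z (R * l)) \<le> wmeas w ?B"
    unfolding wmeas_def using sub by (intro nn_integral_mono) (auto split: split_indicator)
  also have "\<dots> = ennreal ((V / s) powr q) * (ennreal ((s / V) powr q) * wmeas w ?B)"
    using V s by (simp add: mult.assoc[symmetric] ennreal_mult[symmetric] powr_mult[symmetric])
  also have "\<dots> \<le> ennreal ((V / s) powr q) * (ennreal C * (\<integral>\<^sup>+x\<in>A. ennreal (\<bar>f x\<bar> powr q * w x) \<partial>lebesgue))"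
    by (intro mult_left_mono le2) auto
  also have "\<dots> = ennreal (C * (V / s) powr q) * (\<integral>\<^sup>+x\<in>A. ennreal (\<bar>f x\<bar> powr q * w x) \<partial>lebesgue)"
    using C by (simp add: mult.assoc[symmetric] ennreal_mult[symmetric] mult.commute)
  finally show ?thesis by (simp add: V_def)
qed

section \<open>Heavy cubes and the exceptional set\<close>

definition heavy :: "('a::euclidean_space \<Rightarrow> real) \<Rightarrow> real \<Rightarrow> int \<Rightarrow> int \<Rightarrow> 'a \<Rightarrow> bool" where
  "heavy f t m j z \<longleftrightarrow> m \<le> j \<and> ennreal (t * (2 powi j) ^ DIM('a)) < (\<integral>\<^sup>+y\<in>dcube j z. ennreal \<bar>f y\<bar> \<partial>lebesgue)"

text \<open>An enlargement of the set where the dyadic maximal function of f, over scales at least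
  m, exceeds t. The reach 5n + 1 is n (from x to the corner of its cube) plus 3n + 1 (to a point of
  the ball around that corner) plus n (to the corner of the heavy cube containing that
  point).\<close>

definition exceptional :: "('a::euclidean_space \<Rightarrow> real) \<Rightarrow> real \<Rightarrow> int \<Rightarrow> 'a set" where
  "exceptional f t m = (\<Union>(j, z)\<in>stopped (heavy f t m). cball z ((5 * real DIM('a) + 1) * 2 powi j))"

lemma exceptional_sets: "exceptional f t m \<in> sets lebesgue"
  unfolding exceptional_def using countable_stopped by (intro sets.countable_UN') auto

text \<open>A maximal heavy cube has average above t, so the A_q condition compares the weight of
  its enlargement with the integral of |f|^q w over the cube itself. The cubes are disjoint.\<close>

lemma exceptional_weight_le:
  fixes f w :: "'a::euclidean_space \<Rightarrow> real"
  assumes av: "averaging q C w" and C: "0 \<le> C"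
    and w [measurable]: "w \<in> borel_measurable lebesgue" 
    and f [measurable]: "f \<in> borel_measurable lebesgue" and t: "0 < t"
  shows "emeasure (density lebesgue (\<lambda>x. ennreal (w x))) (exceptional f t m)
    \<le> ennreal (C * (vol TYPE('a) * (5 * real DIM('a) + 2) ^ DIM('a) / t) powr q) * (\<integral>\<^sup>+x. ennreal (\<bar>f x\<bar> powr q * w x) \<partial>lebesgue)"
  unfolding exceptional_def
proof (rule enlarged_cubes_le[OF subset_refl])
  fix j and z :: 'a assume jz: "(j, z) \<in> stopped (heavy f t m)"
  let ?R = "5 * real DIM('a) + 1"
  have "real DIM('a) * 2 powi j \<le> ?R * 2 powi j" by (intro mult_right_mono) auto
  then have sub: "dcube j z \<subseteq> cball z (?R * 2 powi j)"
    by (rule order_trans[OF dcube_subset_cball subset_cball])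
  have "wmeas w (cball z (?R * 2 powi j))
     \<le> ennreal (C * (vol TYPE('a) * (?R + 1) ^ DIM('a) / t) powr q) * (\<integral>\<^sup>+x\<in>dcube j z. ennreal (\<bar>f x\<bar> powr q * w x) \<partial>lebesgue)"
    using jz t by (intro averaging_cball[OF av C f dcube_lebesgue _ _ sub]) (auto simp: stopped_def heavy_def less_imp_le)
  then show "emeasure (density lebesgue (\<lambda>x. ennreal (w x))) (cball z (?R * 2 powi j))
     \<le> ennreal (C * (vol TYPE('a) * (5 * real DIM('a) + 2) ^ DIM('a) / t) powr q) * (\<integral>\<^sup>+x\<in>dcube j z. ennreal (\<bar>f x\<bar> powr q * w x) \<partial>lebesgue)"
    by (simp add: emeasure_density wmeas_def add.commute)
qed auto

lemma heavy_bounded: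
  fixes f :: "'a::euclidean_space \<Rightarrow> real"
  assumes f: "integrable lebesgue f" and t: "0 < t"
  shows "\<exists>M. \<forall>j z. heavy f t m j z \<longrightarrow> j \<le> M"
proof -
  define N where "N = (\<integral>x. \<bar>f x\<bar> \<partial>lebesgue)"
  have N: "(\<integral>\<^sup>+x. ennreal \<bar>f x\<bar> \<partial>lebesgue) = ennreal N" "0 \<le> N"
    unfolding N_def using f by (auto intro!: nn_integral_eq_integral)
  obtain M where M: "\<And>j. t * (2 powi j) ^ DIM('a) < N \<Longrightarrow> j \<le> M"
    using scale_bounded[OF t, where 'a='a] by blast
  have "j \<le> M" if "heavy f t m j z" for j z
  proof -
    have "ennreal (t * (2 powi j) ^ DIM('a)) < (\<integral>\<^sup>+y\<in>dcube j z. ennreal \<bar>f y\<bar> \<partial>lebesgue)"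
      using that by (auto simp: heavy_def)
    also have "\<dots> \<le> (\<integral>\<^sup>+y. ennreal \<bar>f y\<bar> \<partial>lebesgue)"
      by (intro nn_integral_mono) (auto split: split_indicator)
    finally have "t * (2 powi j) ^ DIM('a) < N"
      using N t by (simp add: ennreal_less_iff)
    then show ?thesis by (rule M)
  qed
  then show ?thesis by blast
qed

text \<open>If a cube of scale j meeting the ball were heavy, the enlargement of the maximal heavy
  cube above it would contain x. So all these cubes have small averages, and together they lie in
  the ball of radius (5n + 1) 2^j.\<close>

lemma not_exceptional_average:
  fixes f :: "'a::euclidean_space \<Rightarrow> real"
  defines "n \<equiv> real DIM('a)"
  assumes f: "integrable lebesgue f" and t: "0 < t" and x: "x \<notin> exceptional f t m" and j: "m \<le> j"
  shows "(\<integral>\<^sup>+y\<in>cball (corner j x) ((3 * n + 1) * 2 powi j). ennreal \<bar>f y\<bar> \<partial>lebesgue)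
     \<le> ennreal (t * (vol TYPE('a) * (5 * n + 1) ^ DIM('a) * (2 powi j) ^ DIM('a)))"
proof -
  have [measurable]: "f \<in> borel_measurable lebesgue" using f by auto
  have n: "1 \<le> n" by (simp add: n_def Suc_le_eq)
  obtain M where M: "\<And>j z. heavy f t m j z \<Longrightarrow> j \<le> M" using heavy_bounded[OF f t] by blast
  define z where "z = corner j x"
  define l where "l = (2::real) powi j"
  have l: "0 < l" by (simp add: l_def)
  have xz: "dist x z \<le> n * l" using norm_diff_corner[of x j] by (simp add: z_def n_def l_def dist_norm)
  define I where "I = {v. corner j v = v \<and> dcube j v \<inter> cball z ((3 * n + 1) * l) \<noteq> {}}"
  have cI: "countable I" unfolding I_def by (rule countable_subset[OF _ countable_corners[of j]]) auto
  have light: "(\<integral>\<^sup>+y\<in>dcube j v. ennreal \<bar>f y\<bar> \<partial>lebesgue) \<le> ennreal (t * l ^ DIM('a))" if v: "v \<in> I" for v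
  proof (rule ccontr)
    assume "\<not> ?thesis"
    then have h: "heavy f t m j v" using j by (simp add: heavy_def l_def)
    obtain y where "y \<in> dcube j v" "y \<in> cball z ((3 * n + 1) * l)" using v unfolding I_def by blast
    then have y: "corner j y = v" "dist z y \<le> (3 * n + 1) * l" by (auto simp: dcube_def)
    have "y \<in> {y. \<exists>j. heavy f t m j (corner j y)}" using h y by auto
    then have "y \<in> (\<Union>(j, z)\<in>stopped (heavy f t m). dcube j z)"
      by (subst stopped_cover[of _ M]) (auto intro: M)
    then obtain i u where iu: "(i, u) \<in> stopped (heavy f t m)" "corner i y = u" by (auto simp: dcube_def)
    \<comment> \<open>Otherwise the heavy cube of scale j containing y would be an ancestor of the
      maximal one.\<close>
    have "j \<le> i"
    proof (rule ccontr)
      assume "\<not> j \<le> i"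
      then have ij: "i < j" "corner j u = v" using corner_corner[of i j y] iu y by auto
      then show False using iu(1) h by (auto simp: stopped_def)
    qed
    then have li: "l \<le> 2 powi i" by (auto simp: l_def intro: power_int_increasing)
    have "dist y u \<le> n * 2 powi i" using norm_diff_corner[of y i] iu by (simp add: n_def dist_norm)
    moreover have "dist x u \<le> dist x z + dist z y + dist y u"
      by (metis add_right_mono dist_triangle order_trans)
    ultimately have "dist x u \<le> (4 * n + 1) * l + n * 2 powi i"
      using xz y by (simp add: algebra_simps)
    also have "\<dots> \<le> (4 * n + 1) * 2 powi i + n * 2 powi i"
      using li n by (intro add_right_mono mult_left_mono) auto
    finally have "x \<in> cball u ((5 * n + 1) * 2 powi i)" by (simp add: dist_commute algebra_simps)
    then show False using x iu(1) by (auto simp: exceptional_def n_def)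
  qed
  have disj: "disjoint_family_on (dcube j) I" by (auto simp: disjoint_family_on_def dcube_def)
  have "(\<integral>\<^sup>+y\<in>cball z ((3 * n + 1) * l). ennreal \<bar>f y\<bar> \<partial>lebesgue) \<le> (\<integral>\<^sup>+y\<in>(\<Union>v\<in>I. dcube j v). ennreal \<bar>f y\<bar> \<partial>lebesgue)"
  proof (intro nn_integral_mono mult_left_mono)
    fix y :: 'a
    have "y \<in> dcube j (corner j y)" by (simp add: dcube_def)
    then have "y \<in> cball z ((3 * n + 1) * l) \<Longrightarrow> y \<in> (\<Union>v\<in>I. dcube j v)"
      by (intro UN_I[of "corner j y"]) (auto simp: I_def)
    then show "indicator (cball z ((3 * n + 1) * l)) y \<le> (indicator (\<Union>v\<in>I. dcube j v) y :: ennreal)"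
      by (auto split: split_indicator)
  qed simp
  also have "\<dots> \<le> ennreal t * (\<integral>\<^sup>+y\<in>(\<Union>v\<in>I. dcube j v). 1 \<partial>lebesgue)"
  proof (rule nn_integral_UN_countable_le[OF cI dcube_lebesgue disj])
    fix v assume v: "v \<in> I"
    have "(\<integral>\<^sup>+y\<in>dcube j v. 1 \<partial>lebesgue) = emeasure lebesgue (dcube j v)" by simp
    also have "\<dots> = ennreal (l ^ DIM('a))" unfolding l_def using v by (intro emeasure_dcube) (simp add: I_def)
    finally show "(\<integral>\<^sup>+y\<in>dcube j v. ennreal \<bar>f y\<bar> \<partial>lebesgue) \<le> ennreal t * (\<integral>\<^sup>+y\<in>dcube j v. 1 \<partial>lebesgue)"
      using light[OF v] t l by (simp add: ennreal_mult)
  qed auto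
  also have "\<dots> \<le> ennreal t * (\<integral>\<^sup>+y\<in>cball z ((5 * n + 1) * l). 1 \<partial>lebesgue)"
  proof (intro mult_left_mono nn_integral_mono)
    fix y' :: 'a
    have "y' \<in> cball z ((5 * n + 1) * l)" if v: "y' \<in> dcube j v" "v \<in> I" for v
    proof -
      obtain y where "y \<in> dcube j v" "y \<in> cball z ((3 * n + 1) * l)" using v(2) unfolding I_def by blast
      then have y: "corner j y = v" "dist z y \<le> (3 * n + 1) * l" by (auto simp: dcube_def)
      have "dist y v \<le> n * l" "dist y' v \<le> n * l"
        using norm_diff_corner[of y j] norm_diff_corner[of y' j] y v by (auto simp: n_def l_def dist_norm dcube_def)
      moreover have "dist z y' \<le> dist z y + dist y v + dist v y'"
        by (metis add_right_mono dist_triangle order_trans)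
      ultimately show ?thesis using y by (simp add: algebra_simps dist_commute)
    qed
    then show "indicator (\<Union>v\<in>I. dcube j v) y' \<le> (indicator (cball z ((5 * n + 1) * l)) y' :: ennreal)"
      by (auto split: split_indicator simp del: mem_cball)
  qed auto
  also have "(\<integral>\<^sup>+y\<in>cball z ((5 * n + 1) * l). 1 \<partial>lebesgue) = emeasure lebesgue (cball z ((5 * n + 1) * l))"
    by simp
  also have "ennreal t * emeasure lebesgue (cball z ((5 * n + 1) * l)) = ennreal (t * (vol TYPE('a) * (5 * n + 1) ^ DIM('a) * l ^ DIM('a)))"
    using n l t by (subst emeasure_lebesgue_cball) (auto simp: ennreal_mult power_mult_distrib mult_ac)
  finally show ?thesis by (simp add: z_def l_def)
qed

section \<open>Truncated square sums and the good-lambda inequality\<close>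

lemma sqsum_corner: "sqsum \<psi> f j M (corner j x) = sqsum \<psi> f j M x"
  unfolding sqsum_def by (intro sum.cong refl) (simp add: corner_corner)

lemma sqsum_mono: "m \<le> j \<Longrightarrow> sqsum \<psi> f j M x \<le> sqsum \<psi> f m M x"
  unfolding sqsum_def by (intro sum_mono2) auto

lemma sqsum_split:
  assumes "m \<le> j" "j \<le> M"
  shows "sqsum \<psi> f m M x = sqsum \<psi> f m (j - 1) x + (coef \<psi> f j (corner j x))\<^sup>2 + sqsum \<psi> f (j + 1) M x"
proof -
  have "{m..M} = insert j ({m..j-1} \<union> {j+1..M})" using assms by auto
  then show ?thesis
    unfolding sqsum_def by (simp, subst sum.union_disjoint) auto
qed

lemma coef_cong_ball:
  fixes \<psi> :: "int \<Rightarrow> 'a::euclidean_space \<Rightarrow> 'a \<Rightarrow> real"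
  assumes at: "atom \<beta> j z (\<psi> j z)" and eq: "\<And>y. dist y z \<le> (real DIM('a) + 1) * 2 powi j \<Longrightarrow> f y = g y"
  shows "coef \<psi> f j z = coef \<psi> g j z"
  unfolding coef_def
proof (intro Bochner_Integration.integral_cong refl)
  fix y
  show "f y * \<psi> j z y = g y * \<psi> j z y"
    using eq[of y] atom_support[OF at, of y] by (cases "dist y z \<le> (real DIM('a) + 1) * 2 powi j") (auto simp: dist_norm)
qed

lemma coef_bound:
  fixes \<psi> :: "int \<Rightarrow> 'a::euclidean_space \<Rightarrow> 'a \<Rightarrow> real"
  assumes \<beta>: "0 < \<beta>" "\<beta> \<le> 1" and at: "atom \<beta> j z (\<psi> j z)" and f: "integrable lebesgue f"
    and R: "real DIM('a) + 1 \<le> R"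
  shows "ennreal (\<bar>coef \<psi> f j z\<bar> * (2 powi j) ^ DIM('a)) \<le> ennreal (2 * real DIM('a) + 3) * (\<integral>\<^sup>+y\<in>cball z (R * 2 powi j). ennreal \<bar>f y\<bar> \<partial>lebesgue)"
proof -
  let ?l = "(2 powi j) ^ DIM('a) :: real"
  have [measurable]: "f \<in> borel_measurable lebesgue" using f by auto
  have "ennreal \<bar>coef \<psi> f j z\<bar> \<le> (\<integral>\<^sup>+y. norm (f y * \<psi> j z y) \<partial>lebesgue)"
    unfolding coef_def real_norm_def[symmetric] by (rule integral_norm_bound_ennreal[OF atom_integrable_mult[OF \<beta> at f]])
  also have "\<dots> \<le> (\<integral>\<^sup>+y. ennreal ((2 * real DIM('a) + 3) / ?l) * (ennreal \<bar>f y\<bar> * indicator (cball z (R * 2 powi j)) y) \<partial>lebesgue)"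
  proof (intro nn_integral_mono)
    fix y
    show "ennreal (norm (f y * \<psi> j z y)) \<le> ennreal ((2 * real DIM('a) + 3) / ?l) * (ennreal \<bar>f y\<bar> * indicator (cball z (R * 2 powi j)) y)"
    proof (cases "y \<in> cball z (R * 2 powi j)")
      case True
      have "\<bar>f y\<bar> * \<bar>\<psi> j z y\<bar> \<le> \<bar>f y\<bar> * ((2 * real DIM('a) + 3) / ?l)"
        by (intro mult_left_mono atom_bound[OF \<beta> at]) auto
      then show ?thesis using True by (simp add: abs_mult ennreal_mult[symmetric] mult.commute ennreal_leI)
    next
      case False
      have "(real DIM('a) + 1) * 2 powi j \<le> R * 2 powi j" using R by (intro mult_right_mono) auto
      moreover have "R * 2 powi j < norm (y - z)"
        using False by (simp add: dist_norm norm_minus_commute)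
      ultimately have "(real DIM('a) + 1) * 2 powi j < norm (y - z)" by (rule le_less_trans)
      then show ?thesis using atom_support[OF at] by simp
    qed
  qed
  also have "\<dots> = ennreal ((2 * real DIM('a) + 3) / ?l) * (\<integral>\<^sup>+y\<in>cball z (R * 2 powi j). ennreal \<bar>f y\<bar> \<partial>lebesgue)"
    by (rule nn_integral_cmult) (intro borel_measurable_times_ennreal borel_measurable_indicator, auto)
  finally have "ennreal ?l * ennreal \<bar>coef \<psi> f j z\<bar> \<le> ennreal ?l * (ennreal ((2 * real DIM('a) + 3) / ?l) * (\<integral>\<^sup>+y\<in>cball z (R * 2 powi j). ennreal \<bar>f y\<bar> \<partial>lebesgue))"
    by (rule mult_left_mono) simp
  also have "\<dots> = ennreal (2 * real DIM('a) + 3) * (\<integral>\<^sup>+y\<in>cball z (R * 2 powi j). ennreal \<bar>f y\<bar> \<partial>lebesgue)"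
    by (simp add: mult.assoc[symmetric] ennreal_mult[symmetric])
  finally show ?thesis by (simp add: ennreal_mult mult.commute)
qed

lemma sets_superlevel: "v \<in> borel_measurable lebesgue \<Longrightarrow> {x. c < (v x :: real)} \<in> sets lebesgue"
proof -
  assume [measurable]: "v \<in> borel_measurable lebesgue"
  have "{x \<in> space lebesgue. c < v x} \<in> sets lebesgue" by measurable
  then show ?thesis by simp
qed

text \<open>Averages of |f| at most \<gamma> c have to make two things small: the coefficient at
  scale j (factor 2n + 3, from \<open>coef_bound\<close>) and the weak type bound for the finer
  scales (factor \<open>weak_const\<close>). With this \<gamma> each of them costs at most half of
  sqrt \<delta>; the remaining factor is the volume from
  \<open>not_exceptional_average\<close>.\<close>

definition gamma_const :: "real \<Rightarrow> real \<Rightarrow> 'a::euclidean_space itself \<Rightarrow> real" where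
  "gamma_const \<beta> \<delta> T = (let n = real DIM('a) in
     sqrt \<delta> / (2 * (vol T * (5 * n + 1) ^ DIM('a)) * (weak_const \<beta> T + (2 * n + 3))))"

lemma gamma_const_pos: "0 < \<beta> \<Longrightarrow> 0 < \<delta> \<Longrightarrow> 0 < gamma_const \<beta> \<delta> TYPE('a::euclidean_space)"
  using weak_const_pos[of \<beta>, where 'a='a]
  by (auto simp: gamma_const_def Let_def intro!: divide_pos_pos mult_pos_pos add_pos_pos)

text \<open>A cube is stopped once the scales j..M alone exceed the level, and the maximal such
  cubes decompose the level set of the full sum. \<open>sqsum \<psi> f j M\<close> is constant on
  the cube, so its value at the corner decides.\<close>

definition level_stop :: "(int \<Rightarrow> 'a \<Rightarrow> 'a::euclidean_space \<Rightarrow> real) \<Rightarrow> ('a \<Rightarrow> real) \<Rightarrow> real \<Rightarrow> int \<Rightarrow> int \<Rightarrow> int \<Rightarrow> 'a \<Rightarrow> bool" where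
  "level_stop \<psi> f c m M j z \<longleftrightarrow> m \<le> j \<and> j \<le> M \<and> c\<^sup>2 < sqsum \<psi> f j M z"

text \<open>On a maximal cube the scales above j contribute at most c^2 by maximality, and scale j
  at most \<delta> c^2 because f has small averages around a non-exceptional point. Where the sum
  exceeds ((1 + \<delta>) c)^2 the rest comes from scales below j. These see f only near the cube,
  so the weak type (1,1) bound for f cut off to a ball leaves at most half of the cube.\<close>

lemma bad_part_le:
  fixes \<psi> :: "int \<Rightarrow> 'a::euclidean_space \<Rightarrow> 'a \<Rightarrow> real"
  assumes \<beta>: "0 < \<beta>" "\<beta> \<le> 1" and at: "atoms \<beta> \<psi>" and f: "integrable lebesgue f"
    and c: "0 < c" and \<delta>: "0 < \<delta>"
    and jz: "(j, z) \<in> stopped (level_stop \<psi> f c m M)"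
  shows "emeasure lebesgue {x \<in> dcube j z. ((1 + \<delta>) * c)\<^sup>2 < sqsum \<psi> f m M x \<and> x \<notin> exceptional f (gamma_const \<beta> \<delta> TYPE('a) * c) m}
     \<le> ennreal ((2 powi j) ^ DIM('a) / 2)" (is "emeasure _ ?bad \<le> _")
proof (cases "?bad = {}")
  case False
  \<comment> \<open>One non-exceptional point bounds the average of |f| around the whole cube,
    because that bound depends on the point only through its corner.\<close>
  then obtain x0 where x0: "x0 \<in> ?bad" by blast
  have [measurable]: "f \<in> borel_measurable lebesgue" using f by auto
  define n where "n = real DIM('a)"
  define V where "V = vol TYPE('a) * (5 * n + 1) ^ DIM('a)"
  define \<gamma> where "\<gamma> = gamma_const \<beta> \<delta> TYPE('a)"
  define Wc where "Wc = weak_const \<beta> TYPE('a)"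
  define l where "l = (2::real) powi j"
  have l: "0 < l" by (simp add: l_def)
  have n: "1 \<le> n" by (simp add: n_def Suc_le_eq)
  have V: "0 < V" using n by (simp add: V_def)
  have Wc: "0 < Wc" unfolding Wc_def by (rule weak_const_pos[OF \<beta>(1)])
  have \<gamma>: "0 < \<gamma>" unfolding \<gamma>_def by (rule gamma_const_pos[OF \<beta>(1) \<delta>])
  have \<gamma>eq: "\<gamma> = sqrt \<delta> / (2 * V * (Wc + (2 * n + 3)))"
    by (simp add: \<gamma>_def gamma_const_def Let_def V_def n_def Wc_def)
  have \<gamma>V: "\<gamma> * V * (Wc + (2 * n + 3)) = sqrt \<delta> / 2"
  proof -
    define S where "S = Wc + (2 * n + 3)"
    have "S \<noteq> 0" using Wc n by (simp add: S_def)
    then show ?thesis unfolding \<gamma>eq S_def[symmetric] using V by simp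
  qed
  have \<gamma>1: "\<gamma> * V * Wc \<le> sqrt \<delta> / 2" and \<gamma>2: "\<gamma> * V * (2 * n + 3) \<le> sqrt \<delta> / 2"
  proof -
    have "\<gamma> * V * Wc \<le> \<gamma> * V * (Wc + (2 * n + 3))" "\<gamma> * V * (2 * n + 3) \<le> \<gamma> * V * (Wc + (2 * n + 3))"
      using \<gamma> V Wc n by (auto intro!: mult_left_mono)
    then show "\<gamma> * V * Wc \<le> sqrt \<delta> / 2" "\<gamma> * V * (2 * n + 3) \<le> sqrt \<delta> / 2" by (simp_all add: \<gamma>V)
  qed
  have mj: "m \<le> j" "j \<le> M" "corner j z = z" using jz by (auto simp: stopped_def level_stop_def)
  let ?B = "cball z ((3 * n + 1) * l)"
  define f1 where "f1 y = f y * indicator ?B y" for y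
  have f1: "integrable lebesgue f1"
    unfolding f1_def using integrable_mult_indicator[of ?B lebesgue f] f by (simp add: mult.commute)
  have small: "(\<integral>\<^sup>+y\<in>?B. ennreal \<bar>f y\<bar> \<partial>lebesgue) \<le> ennreal (\<gamma> * c * (V * l ^ DIM('a)))"
  proof -
    have "corner j x0 = z" using x0 by (auto simp: dcube_def)
    then show ?thesis
      using not_exceptional_average[OF f _ _ mj(1), of "\<gamma> * c" x0] x0 \<gamma> c
      by (auto simp: n_def l_def V_def \<gamma>_def)
  qed
  have top: "sqsum \<psi> f (j + 1) M z \<le> c\<^sup>2"
  proof (cases "j + 1 \<le> M")
    case True
    have "\<not> level_stop \<psi> f c m M (j + 1) (corner (j + 1) z)" using jz by (auto simp: stopped_def)
    then show ?thesis using True mj by (auto simp: level_stop_def sqsum_corner)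
  next
    case False
    then show ?thesis by (simp add: sqsum_def)
  qed
  have mid: "(coef \<psi> f j z)\<^sup>2 \<le> \<delta> * c\<^sup>2"
  proof -
    have "ennreal (\<bar>coef \<psi> f j z\<bar> * l ^ DIM('a)) \<le> ennreal (2 * n + 3) * (\<integral>\<^sup>+y\<in>?B. ennreal \<bar>f y\<bar> \<partial>lebesgue)"
      using coef_bound[where R="3 * n + 1", OF \<beta> _ f] atomsD[OF at mj(3)] n by (auto simp: n_def l_def)
    also have "\<dots> \<le> ennreal (2 * n + 3) * ennreal (\<gamma> * c * (V * l ^ DIM('a)))"
      by (intro mult_left_mono small) auto
    also have "\<dots> = ennreal (\<gamma> * V * (2 * n + 3) * c * l ^ DIM('a))"
      using n \<gamma> c V l by (simp add: ennreal_mult[symmetric] mult_ac del: ennreal_plus)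
    finally have "\<bar>coef \<psi> f j z\<bar> * l ^ DIM('a) \<le> \<gamma> * V * (2 * n + 3) * c * l ^ DIM('a)"
      using n \<gamma> c V l by (subst (asm) ennreal_le_iff) auto
    then have "\<bar>coef \<psi> f j z\<bar> \<le> \<gamma> * V * (2 * n + 3) * c" using l by simp
    also have "\<dots> \<le> sqrt \<delta> / 2 * c" using \<gamma>2 c by (intro mult_right_mono) auto
    also have "\<dots> \<le> sqrt \<delta> * c" using c \<delta> by simp
    finally have "\<bar>coef \<psi> f j z\<bar>\<^sup>2 \<le> (sqrt \<delta> * c)\<^sup>2" by (intro power_mono) auto
    then show ?thesis using \<delta> by (simp add: power_mult_distrib)
  qed
  have sub: "?bad \<subseteq> {x. (sqrt \<delta> * c)\<^sup>2 < sqsum \<psi> f1 m (j - 1) x}"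
  proof
    fix x assume x: "x \<in> ?bad"
    then have cx: "corner j x = z" by (auto simp: dcube_def)
    have "sqsum \<psi> f m M x = sqsum \<psi> f m (j - 1) x + (coef \<psi> f j z)\<^sup>2 + sqsum \<psi> f (j + 1) M x"
      using sqsum_split[OF mj(1,2), of \<psi> f x] unfolding cx .
    moreover have "sqsum \<psi> f (j + 1) M x = sqsum \<psi> f (j + 1) M z"
      using sqsum_corner[of \<psi> f "j + 1" M x] sqsum_corner[of \<psi> f "j + 1" M z] corner_corner[of j "j + 1" x] cx by simp
    moreover have "((1 + \<delta>) * c)\<^sup>2 < sqsum \<psi> f m M x" using x by simp
    \<comment> \<open>Of the surplus 2 \<delta> c^2 the scale j uses at most one half; the other
      half is left to the finer scales.\<close>
    moreover have "c\<^sup>2 + 2 * \<delta> * c\<^sup>2 \<le> ((1 + \<delta>) * c)\<^sup>2"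
      using \<delta> c by (simp add: power2_eq_square algebra_simps)
    ultimately have "\<delta> * c\<^sup>2 < sqsum \<psi> f m (j - 1) x" using top mid by linarith
    also have "sqsum \<psi> f m (j - 1) x = sqsum \<psi> f1 m (j - 1) x"
      unfolding sqsum_def
    proof (intro sum.cong refl arg_cong[where f="\<lambda>u. u\<^sup>2"])
      fix i assume i: "i \<in> {m..j - 1}"
      show "coef \<psi> f i (corner i x) = coef \<psi> f1 i (corner i x)"
      proof (rule coef_cong_ball[where \<psi>=\<psi>, OF atomsD[OF at corner_idem]])
        fix y assume y: "dist y (corner i x) \<le> (real DIM('a) + 1) * 2 powi i"
        have il: "(2::real) powi i \<le> l" using i unfolding l_def by (intro power_int_increasing) auto
        have "dist y z \<le> dist y (corner i x) + dist (corner i x) x + dist x z"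
          by (metis add_right_mono dist_triangle order_trans)
        also have "\<dots> \<le> (n + 1) * 2 powi i + n * 2 powi i + n * l"
          using y norm_diff_corner[of x i] norm_diff_corner[of x j] cx
          by (intro add_mono) (auto simp: n_def l_def dist_norm norm_minus_commute)
        also have "\<dots> \<le> (n + 1) * l + n * l + n * l"
          using n il by (intro add_mono mult_left_mono) auto
        finally have "y \<in> ?B" by (simp add: dist_commute algebra_simps)
        then show "f y = f1 y" by (simp add: f1_def)
      qed
    qed
    finally show "x \<in> {x. (sqrt \<delta> * c)\<^sup>2 < sqsum \<psi> f1 m (j - 1) x}"
      using \<delta> by (simp add: power_mult_distrib)
  qed
  have "emeasure lebesgue ?bad \<le> emeasure lebesgue {x. (sqrt \<delta> * c)\<^sup>2 < sqsum \<psi> f1 m (j - 1) x}"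
    by (intro emeasure_mono sub sets_superlevel borel_measurable_sqsum)
  also have "\<dots> \<le> ennreal (Wc / (sqrt \<delta> * c)) * (\<integral>\<^sup>+x. ennreal \<bar>f1 x\<bar> \<partial>lebesgue)"
    unfolding Wc_def using c \<delta> by (intro sqsum_weak_type_one[OF \<beta> at f1]) auto
  also have "(\<integral>\<^sup>+x. ennreal \<bar>f1 x\<bar> \<partial>lebesgue) = (\<integral>\<^sup>+y\<in>?B. ennreal \<bar>f y\<bar> \<partial>lebesgue)"
    by (intro nn_integral_cong) (auto simp: f1_def split: split_indicator)
  also have "ennreal (Wc / (sqrt \<delta> * c)) * \<dots> \<le> ennreal (Wc / (sqrt \<delta> * c)) * ennreal (\<gamma> * c * (V * l ^ DIM('a)))"
    by (intro mult_left_mono small) auto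
  also have "\<dots> = ennreal ((\<gamma> * V * Wc) / sqrt \<delta> * l ^ DIM('a))"
    using c \<delta> Wc \<gamma> V l by (simp add: ennreal_mult[symmetric] mult_ac)
  also have "\<dots> \<le> ennreal ((sqrt \<delta> / 2) / sqrt \<delta> * l ^ DIM('a))"
    using \<gamma>1 \<delta> l by (intro ennreal_leI mult_right_mono divide_right_mono) auto
  also have "(sqrt \<delta> / 2) / sqrt \<delta> * l ^ DIM('a) = l ^ DIM('a) / 2" using \<delta> by simp
  finally show ?thesis by (simp add: l_def)
next
  case True
  show ?thesis unfolding True by simp
qed

text \<open>On each maximal cube the good part fills at least half of the volume, hence by the A_q
  condition carries at least 1/D of the weight. Summation gives w(\<Omega>) \<le> D w(G), so at most
  the share 1 - 1/D of w(\<Omega>) is bad.\<close>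

lemma good_lambda:
  fixes \<psi> :: "int \<Rightarrow> 'a::euclidean_space \<Rightarrow> 'a \<Rightarrow> real"
  assumes \<beta>: "0 < \<beta>" "\<beta> \<le> 1" and at: "atoms \<beta> \<psi>" and f: "integrable lebesgue f"
    and c: "0 < c" and \<delta>: "0 < \<delta>"
    and av: "averaging q C w" and C: "0 \<le> C"
    and w [measurable]: "w \<in> borel_measurable lebesgue" and w0: "\<And>x. 0 \<le> w x"
    and D: "C * (vol TYPE('a) * (real DIM('a) + 1) ^ DIM('a) / (1/2)) powr q \<le> D" "1 \<le> D"
    and fin: "emeasure (density lebesgue (\<lambda>x. ennreal (w x))) {x. c\<^sup>2 < sqsum \<psi> f m M x} < \<infinity>"
  shows "emeasure (density lebesgue (\<lambda>x. ennreal (w x))) {x. ((1 + \<delta>) * c)\<^sup>2 < sqsum \<psi> f m M x}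
    \<le> ennreal (1 - 1 / D) * emeasure (density lebesgue (\<lambda>x. ennreal (w x))) {x. c\<^sup>2 < sqsum \<psi> f m M x}
      + emeasure (density lebesgue (\<lambda>x. ennreal (w x))) (exceptional f (gamma_const \<beta> \<delta> TYPE('a) * c) m)"
proof -
  define W where "W = density lebesgue (\<lambda>x. ennreal (w x))"
  have [simp]: "sets W = sets lebesgue" by (simp add: W_def)
  define \<Omega> where "\<Omega> = {x. c\<^sup>2 < sqsum \<psi> f m M x}"
  define E where "E = exceptional f (gamma_const \<beta> \<delta> TYPE('a) * c) m"
  define \<Omega>' where "\<Omega>' = {x. ((1 + \<delta>) * c)\<^sup>2 < sqsum \<psi> f m M x}"
  have sets: "\<Omega> \<in> sets lebesgue" "E \<in> sets lebesgue" "\<Omega>' \<in> sets lebesgue"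
    unfolding \<Omega>_def E_def \<Omega>'_def by (intro sets_superlevel borel_measurable_sqsum exceptional_sets)+
  have sub: "\<Omega>' \<subseteq> \<Omega>"
  proof
    fix x assume "x \<in> \<Omega>'"
    moreover have "c\<^sup>2 \<le> ((1 + \<delta>) * c)\<^sup>2" using c \<delta> by (intro power_mono) auto
    ultimately show "x \<in> \<Omega>" by (auto simp: \<Omega>_def \<Omega>'_def)
  qed
  define G where "G = \<Omega> - (\<Omega>' - E)"
  have Gs: "G \<in> sets lebesgue" using sets by (auto simp: G_def)
  define S where "S = stopped (level_stop \<psi> f c m M)"
  have cover: "(\<Union>i\<in>S. (\<lambda>(j, z). dcube j z) i) = \<Omega>"
  proof -
    have "(\<Union>(j, z)\<in>S. dcube j z) = {x. \<exists>j. level_stop \<psi> f c m M j (corner j x)}"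
      unfolding S_def by (rule stopped_cover[of _ M]) (auto simp: level_stop_def)
    also have "\<dots> = \<Omega>"
    proof (intro set_eqI iffI)
      fix x assume "x \<in> {x. \<exists>j. level_stop \<psi> f c m M j (corner j x)}"
      then obtain j where "m \<le> j" "c\<^sup>2 < sqsum \<psi> f j M x" by (auto simp: level_stop_def sqsum_corner)
      then show "x \<in> \<Omega>" using sqsum_mono[of m j \<psi> f M x] by (auto simp: \<Omega>_def)
    next
      fix x assume x: "x \<in> \<Omega>"
      \<comment> \<open>An empty range of scales would make the sum 0, which is not above
        c^2.\<close>
      then have "m \<le> M" using c by (cases "m \<le> M") (auto simp: \<Omega>_def sqsum_def not_less zero_le_power2)
      then have "level_stop \<psi> f c m M m (corner m x)" using x by (auto simp: level_stop_def \<Omega>_def sqsum_corner)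
      then show "x \<in> {x. \<exists>j. level_stop \<psi> f c m M j (corner j x)}" by blast
    qed
    finally show ?thesis .
  qed
  have setS: "(\<lambda>(j, z). dcube j z) i \<in> sets lebesgue" for i :: "int \<times> 'a" by (cases i) simp
  have one: "(\<integral>\<^sup>+x\<in>(\<lambda>(j, z). dcube j z) i. ennreal (w x) \<partial>lebesgue)
      \<le> ennreal D * (\<integral>\<^sup>+x\<in>(\<lambda>(j, z). dcube j z) i. ennreal (w x) * indicator G x \<partial>lebesgue)" if i: "i \<in> S" for i
  proof -
    obtain j z where jz: "i = (j, z)" by (cases i)
    let ?l = "(2::real) powi j" and ?P = "dcube j z"
    have z: "corner j z = z" using i jz by (auto simp: S_def stopped_def)
    have P\<Omega>: "?P \<subseteq> \<Omega>" using cover i jz by auto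
    let ?bad = "{x \<in> ?P. ((1 + \<delta>) * c)\<^sup>2 < sqsum \<psi> f m M x \<and> x \<notin> E}"
    have badeq: "?bad = ?P \<inter> (\<Omega>' - E)" by (auto simp: \<Omega>'_def)
    have bads: "?bad \<in> sets lebesgue" unfolding badeq using sets by auto
    have bad: "emeasure lebesgue ?bad \<le> ennreal (?l ^ DIM('a) / 2)"
      unfolding E_def using i jz by (intro bad_part_le[OF \<beta> at f c \<delta>]) (simp add: S_def)
    have PG: "?P \<inter> G \<in> sets lebesgue" using Gs by auto
    have "?P = ?bad \<union> (?P \<inter> G)" using P\<Omega> unfolding badeq by (auto simp: G_def)
    then have "ennreal (?l ^ DIM('a)) \<le> emeasure lebesgue ?bad + emeasure lebesgue (?P \<inter> G)"
      using emeasure_dcube[OF z] emeasure_subadditive[OF bads PG] by simp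
    also have "\<dots> \<le> ennreal (?l ^ DIM('a) / 2) + emeasure lebesgue (?P \<inter> G)"
      using bad by (rule add_right_mono)
    finally have "ennreal (?l ^ DIM('a) / 2) + ennreal (?l ^ DIM('a) / 2) \<le> ennreal (?l ^ DIM('a) / 2) + emeasure lebesgue (?P \<inter> G)"
      by (simp add: ennreal_plus[symmetric] del: ennreal_plus emeasure_completion)
    then have half: "ennreal (1/2 * ?l ^ DIM('a)) \<le> emeasure lebesgue (?P \<inter> G)"
      by (subst (asm) ennreal_add_left_cancel_le) simp
    have "wmeas w (cball z (real DIM('a) * ?l)) \<le>
       ennreal (C * (vol TYPE('a) * (real DIM('a) + 1) ^ DIM('a) / (1/2)) powr q) * (\<integral>\<^sup>+x\<in>?P \<inter> G. ennreal (\<bar>1\<bar> powr q * w x) \<partial>lebesgue)"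
    proof (rule averaging_cball[OF av C _ PG])
      show "?P \<inter> G \<subseteq> cball z (real DIM('a) * ?l)" using dcube_subset_cball[of j z] by auto
      have "(\<integral>\<^sup>+x\<in>?P \<inter> G. ennreal \<bar>1\<bar> \<partial>lebesgue) = emeasure lebesgue (?P \<inter> G)" using PG by simp
      then show "ennreal (1/2 * ?l ^ DIM('a)) \<le> (\<integral>\<^sup>+x\<in>?P \<inter> G. ennreal \<bar>1\<bar> \<partial>lebesgue)" using half by simp
    qed auto
    also have "\<dots> \<le> ennreal D * (\<integral>\<^sup>+x\<in>?P \<inter> G. ennreal (\<bar>1\<bar> powr q * w x) \<partial>lebesgue)"
      using D by (intro mult_right_mono ennreal_leI) auto
    also have "(\<integral>\<^sup>+x\<in>?P \<inter> G. ennreal (\<bar>1\<bar> powr q * w x) \<partial>lebesgue) = (\<integral>\<^sup>+x\<in>?P. ennreal (w x) * indicator G x \<partial>lebesgue)"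
      by (intro nn_integral_cong) (auto split: split_indicator)
    finally have "wmeas w (cball z (real DIM('a) * ?l)) \<le> ennreal D * (\<integral>\<^sup>+x\<in>?P. ennreal (w x) * indicator G x \<partial>lebesgue)" .
    moreover have "(\<integral>\<^sup>+x\<in>?P. ennreal (w x) \<partial>lebesgue) \<le> wmeas w (cball z (real DIM('a) * ?l))"
      unfolding wmeas_def
      by (intro nn_integral_mono mult_left_mono)
         (auto simp del: mem_cball split: split_indicator dest: subsetD[OF dcube_subset_cball])
    ultimately have "(\<integral>\<^sup>+x\<in>?P. ennreal (w x) \<partial>lebesgue) \<le> ennreal D * (\<integral>\<^sup>+x\<in>?P. ennreal (w x) * indicator G x \<partial>lebesgue)"
      by (rule order_trans[rotated])
    then show ?thesis by (simp add: jz)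
  qed
  have "(\<integral>\<^sup>+x\<in>\<Omega>. ennreal (w x) \<partial>lebesgue) \<le> ennreal D * (\<integral>\<^sup>+x\<in>\<Omega>. ennreal (w x) * indicator G x \<partial>lebesgue)"
    unfolding cover[symmetric]
    by (rule nn_integral_UN_countable_le[OF _ setS _ _ _ one])
       (use Gs in \<open>auto simp: S_def countable_stopped disjoint_stopped intro!: borel_measurable_times_ennreal\<close>)
  also have "(\<integral>\<^sup>+x\<in>\<Omega>. ennreal (w x) * indicator G x \<partial>lebesgue) = emeasure W G"
    using Gs unfolding W_def
    by (subst emeasure_density) (auto simp: G_def intro!: nn_integral_cong split: split_indicator)
  also have "(\<integral>\<^sup>+x\<in>\<Omega>. ennreal (w x) \<partial>lebesgue) = emeasure W \<Omega>"
    using sets unfolding W_def by (subst emeasure_density) auto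
  finally have le: "emeasure W \<Omega> \<le> ennreal D * emeasure W G" .
  define B where "B = \<Omega>' - E"
  have Bs: "B \<in> sets lebesgue" using sets by (auto simp: B_def)
  have "\<Omega> = G \<union> B" "G \<inter> B = {}" using sub by (auto simp: G_def B_def)
  then have sum: "emeasure W \<Omega> = emeasure W G + emeasure W B"
    using plus_emeasure[of G W B] Gs Bs by simp
  \<comment> \<open>Finiteness permits subtracting the weight of the good part in the inequality
    \<open>le\<close>.\<close>
  have "emeasure W \<Omega> < \<infinity>" using fin by (simp add: W_def \<Omega>_def)
  then have finGB: "emeasure W G < top" "emeasure W B < top" unfolding sum by (auto simp: less_top)
  define g b where "g = enn2real (emeasure W G)" and "b = enn2real (emeasure W B)"
  have gb: "emeasure W G = ennreal g" "emeasure W B = ennreal b" "0 \<le> g" "0 \<le> b"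
    using finGB by (auto simp: g_def b_def)
  have "g + b \<le> D * g"
    using le unfolding sum gb using gb D
    by (simp add: ennreal_mult[symmetric] ennreal_plus[symmetric] del: ennreal_plus)
  then have "b \<le> (1 - 1 / D) * (g + b)" using D by (simp add: field_simps)
  then have Ble: "emeasure W B \<le> ennreal (1 - 1 / D) * emeasure W \<Omega>"
    unfolding sum gb using gb D
    by (simp add: ennreal_mult[symmetric] ennreal_plus[symmetric] ennreal_leI del: ennreal_plus)
  have "emeasure W \<Omega>' \<le> emeasure W (B \<union> E)"
    using Bs sets by (intro emeasure_mono) (auto simp: B_def)
  also have "\<dots> \<le> emeasure W B + emeasure W E"
    using Bs sets by (intro emeasure_subadditive) auto
  also have "\<dots> \<le> ennreal (1 - 1 / D) * emeasure W \<Omega> + emeasure W E"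
    using Ble by (rule add_right_mono)
  finally show ?thesis by (simp add: W_def \<Omega>_def \<Omega>'_def E_def)
qed

text \<open>The good-lambda inequality is iterated from level c / (1 + \<delta>)^k up to c. Bounded
  support of f gives one finite a priori bound for all level sets; its contribution disappears in
  the limit, so the constant does not depend on \<rho>.\<close>

lemma sqsum_weighted_weak_type:
  fixes w :: "'a::euclidean_space \<Rightarrow> real"
  assumes \<beta>: "0 < \<beta>" "\<beta> \<le> 1" and q: "1 \<le> q" and av: "averaging q C w" and C: "0 \<le> C"
    and w [measurable]: "w \<in> borel_measurable lebesgue" and w0: "\<And>x. 0 \<le> w x"
    and loc: "\<And>R. wmeas w (cball 0 R) < \<infinity>"
  shows "\<exists>K>0. \<forall>\<psi> f m M c \<rho>. atoms \<beta> \<psi> \<longrightarrow> integrable lebesgue f \<longrightarrow> (\<forall>x. \<rho> < norm x \<longrightarrow> f x = 0) \<longrightarrow> 0 < c \<longrightarrow>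
     wmeas w {x. c\<^sup>2 < sqsum \<psi> f m M x} \<le> ennreal (K * c powr - q) * (\<integral>\<^sup>+x. ennreal (\<bar>f x\<bar> powr q * w x) \<partial>lebesgue)"
proof -
  define D where "D = max 2 (C * (vol TYPE('a) * (real DIM('a) + 1) ^ DIM('a) / (1/2)) powr q)"
  have D: "2 \<le> D" "C * (vol TYPE('a) * (real DIM('a) + 1) ^ DIM('a) / (1/2)) powr q \<le> D"
    by (auto simp: D_def)
  define \<theta> where "\<theta> = 1 - 1 / D"
  have \<theta>: "0 < \<theta>" "\<theta> < 1" using D by (auto simp: \<theta>_def)
  \<comment> \<open>Each step loses (1 + \<delta>)^q, which has to be beaten by \<theta> = 1 - 1/D.
    With this choice (1 + \<delta>)^q \<theta> is the square root of \<theta>, hence below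
    1.\<close>
  define \<delta> where "\<delta> = \<theta> powr (- 1 / (2 * q)) - 1"
  have \<delta>1: "1 + \<delta> = \<theta> powr (- 1 / (2 * q))" by (simp add: \<delta>_def)
  have \<delta>: "0 < \<delta>"
  proof -
    have "1 powr (- 1 / (2 * q)) < \<theta> powr (- 1 / (2 * q))"
      using \<theta> q by (intro powr_less_mono2_neg) auto
    then show ?thesis by (simp add: \<delta>_def)
  qed
  define \<theta>' where "\<theta>' = \<theta> powr (1/2)"
  have \<theta>': "0 < \<theta>'" "\<theta>' < 1"
    using \<theta> powr_less_mono2[of "1/2" \<theta> 1] by (auto simp: \<theta>'_def)
  have key: "(1 + \<delta>) powr q * \<theta> = \<theta>'"
  proof -
    have "(1 + \<delta>) powr q = \<theta> powr (- 1 / 2)" using q by (simp add: \<delta>1 powr_powr)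
    then have "(1 + \<delta>) powr q * \<theta> = \<theta> powr (- 1 / 2) * \<theta> powr 1" using \<theta> by simp
    also have "\<dots> = \<theta>'" by (simp only: powr_add[symmetric] \<theta>'_def) simp
    finally show ?thesis .
  qed
  define \<gamma> where "\<gamma> = gamma_const \<beta> \<delta> TYPE('a)"
  have \<gamma>: "0 < \<gamma>" unfolding \<gamma>_def by (rule gamma_const_pos[OF \<beta>(1) \<delta>])
  define V where "V = vol TYPE('a) * (5 * real DIM('a) + 2) ^ DIM('a)"
  have V: "0 < V" by (simp add: V_def)
  define A where "A = (1 + \<delta>) powr q * (C * (V / \<gamma>) powr q)"
  have A: "0 \<le> A" using C by (simp add: A_def)
  define K where "K = A / (1 - \<theta>') + 1"
  have K: "0 < K" using A \<theta>' by (auto simp: K_def intro!: add_nonneg_pos)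
  have main: "wmeas w {x. c\<^sup>2 < sqsum \<psi> f m M x} \<le> ennreal (K * c powr - q) * (\<integral>\<^sup>+x. ennreal (\<bar>f x\<bar> powr q * w x) \<partial>lebesgue)"
    if at: "atoms \<beta> \<psi>" and f: "integrable lebesgue f" and supp: "\<And>x. \<rho> < norm x \<Longrightarrow> f x = 0" and c: "0 < c"
    for \<psi> f m M c \<rho>
  proof (cases "(\<integral>\<^sup>+x. ennreal (\<bar>f x\<bar> powr q * w x) \<partial>lebesgue) = top")
    case True
    then show ?thesis using K c by (simp add: ennreal_mult_top)
  next
    case False
    have [measurable]: "f \<in> borel_measurable lebesgue" using f by auto
    define F where "F = enn2real (\<integral>\<^sup>+x. ennreal (\<bar>f x\<bar> powr q * w x) \<partial>lebesgue)"
    have F: "(\<integral>\<^sup>+x. ennreal (\<bar>f x\<bar> powr q * w x) \<partial>lebesgue) = ennreal F" "0 \<le> F"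
      using False by (auto simp: F_def less_top)
    define W where "W = density lebesgue (\<lambda>x. ennreal (w x))"
    have Wm: "emeasure W X = wmeas w X" if "X \<in> sets lebesgue" for X
      unfolding W_def wmeas_def by (rule emeasure_density[OF _ that]) measurable
    have Os: "{x. c\<^sup>2 < sqsum \<psi> f m M x} \<in> sets lebesgue" for c
      by (intro sets_superlevel borel_measurable_sqsum)
    \<comment> \<open>Atoms of scale at most M that meet the support of f belong to cubes inside
      this ball, so every level set lies in it and has finite weight.\<close>
    define R where "R = \<rho> + (2 * real DIM('a) + 1) * 2 powi M"
    have sub: "{x. c\<^sup>2 < sqsum \<psi> f m M x} \<subseteq> cball 0 R" if "0 < c" for c
    proof
      fix x assume x: "x \<in> {x. c\<^sup>2 < sqsum \<psi> f m M x}"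
      then have "sqsum \<psi> f m M x \<noteq> 0" using that by (auto simp: not_less zero_le_power2)
      then obtain j where j: "j \<in> {m..M}" "coef \<psi> f j (corner j x) \<noteq> 0"
        unfolding sqsum_def by (metis (mono_tags, lifting) power_zero_numeral sum.not_neutral_contains_not_neutral)
      then have "\<exists>y. f y * \<psi> j (corner j x) y \<noteq> 0"
        unfolding coef_def by (metis (mono_tags, lifting) Bochner_Integration.integral_cong Bochner_Integration.integral_zero)
      then obtain y where "f y \<noteq> 0" "\<psi> j (corner j x) y \<noteq> 0" by auto
      then have y: "norm y \<le> \<rho>" "norm (y - corner j x) \<le> (real DIM('a) + 1) * 2 powi j"
        using supp[of y] atom_support[OF atomsD[OF at corner_idem[of j x]], of y] by (auto simp: not_less[symmetric])
      have jM: "(2::real) powi j \<le> 2 powi M" using j by (auto intro: power_int_increasing)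
      have "norm x \<le> norm (x - corner j x) + norm (y - corner j x) + norm y"
        using norm_triangle_ineq4[of "x - corner j x" "y - corner j x"] norm_triangle_ineq[of "x - y" y] by simp
      also have "\<dots> \<le> real DIM('a) * 2 powi j + (real DIM('a) + 1) * 2 powi j + \<rho>"
        using y norm_diff_corner[of x j] by (intro add_mono) auto
      also have "\<dots> = (2 * real DIM('a) + 1) * 2 powi j + \<rho>" by (simp add: algebra_simps)
      also have "\<dots> \<le> (2 * real DIM('a) + 1) * 2 powi M + \<rho>"
        using jM by (intro add_right_mono mult_left_mono) auto
      finally show "x \<in> cball 0 R" by (simp add: R_def)
    qed
    have Bfin: "emeasure W (cball 0 R) < \<infinity>" using loc[of R] by (simp add: Wm)
    have fin: "emeasure W {x. c\<^sup>2 < sqsum \<psi> f m M x} < \<infinity>" if "0 < c" for c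
      using emeasure_mono[OF sub[OF that], of W] Bfin by (auto simp: W_def intro: le_less_trans)
    define u where "u c = enn2real (emeasure W {x. c\<^sup>2 < sqsum \<psi> f m M x})" for c
    define b where "b = enn2real (emeasure W (cball 0 R))"
    have u: "emeasure W {x. c\<^sup>2 < sqsum \<psi> f m M x} = ennreal (u c)" "0 \<le> u c" "u c \<le> b" if "0 < c" for c
    proof -
      show "emeasure W {x. c\<^sup>2 < sqsum \<psi> f m M x} = ennreal (u c)" "0 \<le> u c"
        using fin[OF that] by (auto simp: u_def less_top)
      show "u c \<le> b"
        unfolding u_def b_def using emeasure_mono[OF sub[OF that], of W] Bfin
        by (intro enn2real_mono) (auto simp: W_def)
    qed
    have step: "u ((1 + \<delta>) * c) \<le> \<theta> * u c + C * (V / (\<gamma> * c)) powr q * F" if c: "0 < c" for c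
    proof -
      have c': "0 < (1 + \<delta>) * c" using c \<delta> by simp
      have "ennreal (u ((1 + \<delta>) * c)) \<le> ennreal \<theta> * ennreal (u c)
          + emeasure W (exceptional f (\<gamma> * c) m)"
        unfolding u(1)[OF c, symmetric] u(1)[OF c', symmetric] \<theta>_def \<gamma>_def W_def
        using D fin[OF c] by (intro good_lambda[OF \<beta> at f c \<delta> av C w w0]) (auto simp: W_def)
      also have "emeasure W (exceptional f (\<gamma> * c) m) \<le> ennreal (C * (V / (\<gamma> * c)) powr q) * ennreal F"
        unfolding W_def V_def F(1)[symmetric] using \<gamma> c by (intro exceptional_weight_le[OF av C w]) auto
      finally have "ennreal (u ((1 + \<delta>) * c)) \<le> ennreal \<theta> * ennreal (u c) + ennreal (C * (V / (\<gamma> * c)) powr q) * ennreal F"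
        by (simp add: add_left_mono)
      also have "\<dots> = ennreal (\<theta> * u c + C * (V / (\<gamma> * c)) powr q * F)"
        using \<theta> u(2)[OF c] C F by (simp add: ennreal_mult[symmetric] ennreal_plus[symmetric] del: ennreal_plus)
      finally show ?thesis
        using \<theta> u(2)[OF c] C F by (subst (asm) ennreal_le_iff) auto
    qed
    define v where "v c = c powr q * u c" for c
    have vstep: "v ((1 + \<delta>) * c) \<le> \<theta>' * v c + A * F" if c: "0 < c" for c
    proof -
      have "v ((1 + \<delta>) * c) = (1 + \<delta>) powr q * c powr q * u ((1 + \<delta>) * c)"
        using c \<delta> by (simp add: v_def powr_mult)
      also have "\<dots> \<le> (1 + \<delta>) powr q * c powr q * (\<theta> * u c + C * (V / (\<gamma> * c)) powr q * F)"
        by (intro mult_left_mono step[OF c]) auto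
      also have "\<dots> = ((1 + \<delta>) powr q * \<theta>) * v c + (1 + \<delta>) powr q * C * (c powr q * (V / (\<gamma> * c)) powr q) * F"
        by (simp add: v_def algebra_simps)
      also have "c powr q * (V / (\<gamma> * c)) powr q = (V / \<gamma>) powr q"
        using c \<gamma> V by (subst powr_mult[symmetric]) auto
      finally show ?thesis unfolding key by (simp add: A_def mult_ac)
    qed
    \<comment> \<open>The a priori bound b carries the factor \<theta>'^k, which tends to 0; the
      remaining term is the sum of a geometric series.\<close>
    have iter: "v c \<le> \<theta>' ^ k * (c powr q * b) + A * F / (1 - \<theta>')" if c: "0 < c" for k c
      using c
    proof (induction k arbitrary: c)
      case 0
      have "v c \<le> c powr q * b" unfolding v_def by (intro mult_left_mono u(3) 0) auto
      moreover have "0 \<le> A * F / (1 - \<theta>')" using A F \<theta>' by simp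
      ultimately show ?case by simp
    next
      case (Suc k)
      define d where "d = c / (1 + \<delta>)"
      have d: "0 < d" "d \<le> c" "c = (1 + \<delta>) * d" using Suc.prems \<delta> by (auto simp: d_def field_simps)
      have "v c \<le> \<theta>' * v d + A * F" unfolding d(3) by (rule vstep[OF d(1)])
      also have "\<dots> \<le> \<theta>' * (\<theta>' ^ k * (d powr q * b) + A * F / (1 - \<theta>')) + A * F"
        using \<theta>' by (intro add_right_mono mult_left_mono Suc.IH d) auto
      also have "\<dots> \<le> \<theta>' * (\<theta>' ^ k * (c powr q * b) + A * F / (1 - \<theta>')) + A * F"
        using \<theta>' d q by (intro add_right_mono mult_left_mono mult_right_mono powr_mono2) (auto simp: b_def)
      also have "\<dots> = \<theta>' ^ Suc k * (c powr q * b) + A * F / (1 - \<theta>')"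
        using \<theta>' by (simp add: field_simps)
      finally show ?case .
    qed
    have "v c \<le> A * F / (1 - \<theta>')"
    proof (rule LIMSEQ_le_const)
      have "(\<lambda>k. \<theta>' ^ k * (c powr q * b) + A * F / (1 - \<theta>')) \<longlonglongrightarrow> 0 * (c powr q * b) + A * F / (1 - \<theta>')"
        using \<theta>' by (intro tendsto_intros LIMSEQ_realpow_zero) auto
      then show "(\<lambda>k. \<theta>' ^ k * (c powr q * b) + A * F / (1 - \<theta>')) \<longlonglongrightarrow> A * F / (1 - \<theta>')" by simp
      show "\<exists>N. \<forall>k\<ge>N. v c \<le> \<theta>' ^ k * (c powr q * b) + A * F / (1 - \<theta>')"
        using iter[OF c] by blast
    qed
    then have "c powr q * u c \<le> K * F" using F \<theta>' by (simp add: K_def v_def algebra_simps)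
    then have "u c \<le> K * c powr - q * F"
      using c by (simp add: powr_minus field_simps)
    then have "ennreal (u c) \<le> ennreal (K * c powr - q) * ennreal F"
      using K F by (simp add: ennreal_mult[symmetric] ennreal_leI)
    then show ?thesis using u(1)[OF c] by (simp add: F Wm[OF Os])
  qed
  show ?thesis using K main by blast
qed

section \<open>Consequences of the Muckenhoupt condition\<close>

text \<open>Local integrability gives measurability of w on each ball, and w is the pointwise limit
  of its restrictions to growing balls.\<close>

lemma weight_borel_measurable:
  fixes w :: "'a::euclidean_space \<Rightarrow> real"
  assumes "weight w" shows "w \<in> borel_measurable lebesgue"
proof -
  define u where "u k x = indicator (cball 0 (real k)) x * w x" for k :: nat and x :: 'a
  have "u k \<in> borel_measurable lebesgue" for k
    using assms unfolding weight_def set_integrable_def u_def by (auto intro!: borel_measurable_integrable)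
  moreover have "(\<lambda>k. u k x) \<longlonglongrightarrow> w x" for x
  proof (rule tendsto_eventually)
    obtain k where "norm x \<le> real k" using real_arch_simple by blast
    then have "\<forall>i\<ge>k. u i x = w x" by (auto simp: u_def)
    then show "\<forall>\<^sub>F k in sequentially. u k x = w x" unfolding eventually_sequentially by blast
  qed
  ultimately show ?thesis by (rule borel_measurable_LIMSEQ_metric)
qed

lemma weight_nonneg: "weight w \<Longrightarrow> 0 \<le> w x"
  by (simp add: weight_def)

lemma wmeas_cball_finite:
  fixes w :: "'a::euclidean_space \<Rightarrow> real"
  assumes "weight w" shows "wmeas w (cball c r) < \<infinity>"
proof -
  have "integrable lebesgue (\<lambda>x. indicator (cball c r) x * w x)"
    using assms unfolding weight_def set_integrable_def by auto
  then have "(\<integral>\<^sup>+x. ennreal (indicator (cball c r) x * w x) \<partial>lebesgue) < \<infinity>"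
    using weight_nonneg[OF assms] by (subst nn_integral_eq_integral) auto
  also have "(\<integral>\<^sup>+x. ennreal (indicator (cball c r) x * w x) \<partial>lebesgue) = wmeas w (cball c r)"
    unfolding wmeas_def by (intro nn_integral_cong) (auto split: split_indicator)
  finally show ?thesis .
qed

lemma wmeas_mono: "A \<subseteq> B \<Longrightarrow> wmeas w A \<le> wmeas w B"
  unfolding wmeas_def by (intro nn_integral_mono mult_left_mono) (auto split: split_indicator)

lemma wmeas_ball_finite:
  fixes w :: "'a::euclidean_space \<Rightarrow> real"
  assumes "weight w" shows "wmeas w (ball c r) < \<infinity>"
  using wmeas_mono[OF ball_subset_cball[of c r], of w] wmeas_cball_finite[OF assms, of c r] by (rule le_less_trans)

lemma ennpow_ennreal: "0 < x \<Longrightarrow> ennpow (ennreal x) r = ennreal (x powr r)"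
  by (simp add: ennpow_def)

lemma ennpow_ennreal_pos: "0 \<le> x \<Longrightarrow> 0 < r \<Longrightarrow> ennpow (ennreal x) r = ennreal (x powr r)"
  by (cases "x = 0") (auto simp: ennpow_def)

lemma borel_measurable_ennpow: "(\<lambda>x. ennpow x r) \<in> borel_measurable borel"
  unfolding ennpow_def by measurable

lemma AE_Liminf_gt:
  fixes g :: "'a \<Rightarrow> ennreal"
  assumes "y < Liminf F g" shows "eventually (\<lambda>x. y < g x) F"
  using assms less_LiminfD by blast

text \<open>For every y below the essential infimum of w on the ball, y |f| \<le> w |f| almost
  everywhere there. Letting y rise bounds the infimum by a quotient of integrals, and A_1 compares
  the average of w with the infimum.\<close>

lemma muckenhoupt_one_averaging:
  fixes w :: "'a::euclidean_space \<Rightarrow> real"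
  assumes w: "weight w" and A1: "w \<in> muckenhoupt 1"
  shows "\<exists>C>0. averaging 1 C w"
proof -
  note [measurable] = weight_borel_measurable[OF w]
  obtain C where C: "0 < C" and A: "\<And>c r. 0 < r \<Longrightarrow> average (ball c r) (\<lambda>x. ennreal (w x)) \<le> ennreal C * essinf_on (ball c r) (\<lambda>x. ennreal (w x))"
    using A1 by (auto simp: muckenhoupt_def)
  have "ennreal (t powr 1) * wmeas w (ball c r) \<le> ennreal C * (\<integral>\<^sup>+x\<in>ball c r. ennreal (\<bar>f x\<bar> powr 1 * w x) \<partial>lebesgue)"
    if r: "0 < r" and t: "0 \<le> t" and f [measurable]: "f \<in> borel_measurable lebesgue"
      and le: "ennreal t * emeasure lebesgue (ball c r) \<le> (\<integral>\<^sup>+x\<in>ball c r. ennreal \<bar>f x\<bar> \<partial>lebesgue)"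
    for c :: 'a and r t and f :: "'a \<Rightarrow> real"
  proof (cases "t = 0")
    case True then show ?thesis by simp
  next
    case False
    then have t: "0 < t" using t by simp
    define v where "v = vol TYPE('a) * r ^ DIM('a)"
    have v: "0 < v" "emeasure lebesgue (ball c r) = ennreal v"
      using r by (auto simp: v_def emeasure_lebesgue_ball simp del: emeasure_completion)
    define m where "m = essinf_on (ball c r) (\<lambda>x. ennreal (w x))"
    define X where "X = (\<integral>\<^sup>+x\<in>ball c r. ennreal (\<bar>f x\<bar> powr 1 * w x) \<partial>lebesgue)"
    have y: "y \<le> X / ennreal (t * v)" if "y < m" for y
    proof -
      have "AE x in restrict_space lebesgue (ball c r). y < ennreal (w x)"
        using that unfolding m_def essinf_on_def by (rule AE_Liminf_gt)
      then have ae: "AE x in lebesgue. x \<in> ball c r \<longrightarrow> y < ennreal (w x)"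
        by (subst (asm) AE_restrict_space_iff) auto
      have "y * ennreal (t * v) = y * (ennreal t * emeasure lebesgue (ball c r))"
        using t v by (simp add: ennreal_mult)
      also have "\<dots> \<le> y * (\<integral>\<^sup>+x\<in>ball c r. ennreal \<bar>f x\<bar> \<partial>lebesgue)"
        by (intro mult_left_mono le) auto
      also have "\<dots> = (\<integral>\<^sup>+x. y * (ennreal \<bar>f x\<bar> * indicator (ball c r) x) \<partial>lebesgue)"
        by (rule nn_integral_cmult[symmetric]) (intro borel_measurable_times_ennreal borel_measurable_indicator, auto)
      also have "\<dots> \<le> X" unfolding X_def
      proof (rule nn_integral_mono_AE)
        show "AE x in lebesgue. y * (ennreal \<bar>f x\<bar> * indicator (ball c r) x) \<le> ennreal (\<bar>f x\<bar> powr 1 * w x) * indicator (ball c r) x"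
          using ae
        proof eventually_elim
          case (elim x)
          show ?case
          proof (cases "x \<in> ball c r")
            case True
            then have "y * ennreal \<bar>f x\<bar> \<le> ennreal (w x) * ennreal \<bar>f x\<bar>"
              using elim by (intro mult_right_mono) auto
            then show ?thesis using True weight_nonneg[OF w, of x] by (simp add: ennreal_mult[symmetric] mult.commute)
          qed simp
        qed
      qed
      finally have le: "y * ennreal (t * v) \<le> X" .
      have "ennreal (t * v) / ennreal (t * v) = 1"
        using t v by (intro ennreal_divide_self) auto
      then have "y = y * ennreal (t * v) / ennreal (t * v)"
        by (metis ennreal_times_divide mult.right_neutral)
      also have "\<dots> \<le> X / ennreal (t * v)" using le by (rule divide_right_mono_ennreal)
      finally show ?thesis .
    qed
    have "m \<le> X / ennreal (t * v)" using y by (rule dense_le)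
    then have "m * ennreal (t * v) \<le> X / ennreal (t * v) * ennreal (t * v)" by (rule mult_right_mono) simp
    also have "\<dots> = X"
      using t v by (simp add: ennreal_divide_times ennreal_divide_self mult_divide_eq_ennreal)
    finally have mX: "m * ennreal (t * v) \<le> X" .
    have "wmeas w (ball c r) = average (ball c r) (\<lambda>x. ennreal (w x)) * ennreal v"
      using v by (simp add: average_def wmeas_def ennreal_divide_times mult_divide_eq_ennreal del: emeasure_completion)
    also have "\<dots> \<le> ennreal C * m * ennreal v"
      unfolding m_def by (intro mult_right_mono A r) auto
    finally have "ennreal t * wmeas w (ball c r) \<le> ennreal t * (ennreal C * m * ennreal v)"
      by (rule mult_left_mono) simp
    also have "\<dots> = ennreal C * (m * ennreal (t * v))"
      using t v by (simp add: ennreal_mult mult_ac)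
    also have "\<dots> \<le> ennreal C * X" by (intro mult_left_mono mX) auto
    finally show ?thesis using t by (simp add: X_def)
  qed
  then show ?thesis using C unfolding averaging_def by blast
qed

text \<open>Hoelder's inequality for the factorisation of |f| into |f| w^(1/s) and w^(-1/s); the
  second factor is controlled by the dual average in the A_s condition.\<close>

lemma muckenhoupt_gt_one_averaging:
  fixes w :: "'a::euclidean_space \<Rightarrow> real"
  assumes w: "weight w" and s: "1 < s" and As: "w \<in> muckenhoupt s"
  shows "\<exists>C>0. averaging s C w"
proof -
  note [measurable] = weight_borel_measurable[OF w]
  note w0 = weight_nonneg[OF w]
  obtain C where C: "0 < C" and A: "\<And>c r. 0 < r \<Longrightarrow> average (ball c r) (\<lambda>x. ennreal (w x)) *
                ennpow (average (ball c r) (\<lambda>x. ennpow (ennreal (w x)) (- 1 / (s - 1)))) (s - 1)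
                \<le> ennreal C"
    using As s by (auto simp: muckenhoupt_def)
  have "ennreal (t powr s) * wmeas w (ball c r) \<le> ennreal C * (\<integral>\<^sup>+x\<in>ball c r. ennreal (\<bar>f x\<bar> powr s * w x) \<partial>lebesgue)"
    if r: "0 < r" and t: "0 \<le> t" and f [measurable]: "f \<in> borel_measurable lebesgue"
      and le: "ennreal t * emeasure lebesgue (ball c r) \<le> (\<integral>\<^sup>+x\<in>ball c r. ennreal \<bar>f x\<bar> \<partial>lebesgue)"
    for c :: 'a and r t and f :: "'a \<Rightarrow> real"
  proof (cases "t = 0 \<or> wmeas w (ball c r) = 0 \<or> (\<integral>\<^sup>+x\<in>ball c r. ennreal (\<bar>f x\<bar> powr s * w x) \<partial>lebesgue) = top")
    case True then show ?thesis using C by (auto simp: ennreal_mult_top)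
  next
    case False
    let ?B = "ball c r"
    have [measurable]: "?B \<in> sets lebesgue" by simp
    have t: "0 < t" using False t by simp
    define v where "v = vol TYPE('a) * r ^ DIM('a)"
    have v: "0 < v" "emeasure lebesgue ?B = ennreal v"
      using r by (auto simp: v_def emeasure_lebesgue_ball simp del: emeasure_completion)
    define F where "F = enn2real (\<integral>\<^sup>+x\<in>?B. ennreal (\<bar>f x\<bar> powr s * w x) \<partial>lebesgue)"
    have F: "(\<integral>\<^sup>+x\<in>?B. ennreal (\<bar>f x\<bar> powr s * w x) \<partial>lebesgue) = ennreal F" "0 \<le> F"
      using False by (auto simp: F_def less_top)
    define b where "b = enn2real (wmeas w ?B)"
    have b: "wmeas w ?B = ennreal b" "0 < b"
    proof -
      show eq: "wmeas w ?B = ennreal b" using wmeas_ball_finite[OF w, of c r] by (simp add: b_def less_top)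
      show "0 < b" using False eq by (metis ennreal_eq_0_iff not_less)
    qed
    define Z where "Z = (\<integral>\<^sup>+x\<in>?B. ennpow (ennreal (w x)) (- 1 / (s - 1)) \<partial>lebesgue)"
    have avw: "average ?B (\<lambda>x. ennreal (w x)) = ennreal (b / v)"
      unfolding average_def v(2) using b v by (simp add: wmeas_def divide_ennreal)
    have avz: "average ?B (\<lambda>x. ennpow (ennreal (w x)) (- 1 / (s - 1))) = Z / ennreal v"
      unfolding average_def v(2) Z_def ..
    have bv: "0 < b / v" using b v by simp
    \<comment> \<open>Since w(B) > 0, the product in the A_s condition can be finite only if the
      dual integral is.\<close>
    have Ztop: "Z \<noteq> top"
    proof
      assume "Z = top"
      then have "ennpow (average ?B (\<lambda>x. ennpow (ennreal (w x)) (- 1 / (s - 1)))) (s - 1) = top"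
        unfolding avz using s by (simp add: ennpow_def ennreal_top_divide)
      then show False using A[OF r, of c] b v unfolding avw by (simp add: ennreal_mult_top top_unique)
    qed
    define z where "z = enn2real Z"
    have z: "Z = ennreal z" "0 \<le> z" using Ztop by (auto simp: z_def less_top)
    \<comment> \<open>\<open>ennpow\<close> sends 0 to infinity at negative exponents, so finiteness
      of \<open>Z\<close> excludes zeros of w up to a null set. This justifies cancelling w^(1/s)
      against w^(-1/s).\<close>
    have wpos: "AE x in lebesgue. x \<in> ?B \<longrightarrow> 0 < w x"
    proof -
      have m: "(\<lambda>x. ennpow (ennreal (w x)) (- 1 / (s - 1)) * indicator ?B x) \<in> borel_measurable lebesgue"
        by (intro borel_measurable_times_ennreal borel_measurable_indicator
            measurable_compose[OF _ borel_measurable_ennpow, of "\<lambda>x. ennreal (w x)"]) auto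
      have "AE x in lebesgue. ennpow (ennreal (w x)) (- 1 / (s - 1)) * indicator ?B x \<noteq> \<infinity>"
        using Ztop unfolding Z_def by (intro nn_integral_PInf_AE m) auto
      then show ?thesis
      proof eventually_elim
        case (elim x)
        then show ?case using w0[of x] s by (cases "w x = 0") (auto simp: ennpow_def)
      qed
    qed
    have zle: "b * z powr (s - 1) \<le> C * v powr s"
    proof -
      have "ennpow (ennreal (z / v)) (s - 1) = ennreal ((z / v) powr (s - 1))"
        using z v s by (intro ennpow_ennreal_pos) auto
      then have "ennreal (b / v) * ennreal ((z / v) powr (s - 1)) \<le> ennreal C"
        using A[OF r, of c] z v unfolding avw avz by (simp add: divide_ennreal)
      then have "(b / v) * (z / v) powr (s - 1) \<le> C"
        using bv C by (simp add: ennreal_mult[symmetric])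
      moreover have "v powr s = v * v powr (s - 1)" using v by (simp add: powr_mult_base)
      ultimately show ?thesis using v z by (simp add: powr_divide field_simps)
    qed
    define s' where "s' = s / (s - 1)"
    have s': "1 < s'" "1 / s + 1 / s' = 1" using s by (auto simp: s'_def field_simps)
    have "ennreal (t * v) = ennreal t * emeasure lebesgue ?B" using t v by (simp add: ennreal_mult)
    also note le
    also have "(\<integral>\<^sup>+x\<in>?B. ennreal \<bar>f x\<bar> \<partial>lebesgue)
        = (\<integral>\<^sup>+x. ennreal ((\<bar>f x\<bar> * w x powr (1 / s) * indicator ?B x) * (w x powr (- 1 / s) * indicator ?B x)) \<partial>lebesgue)"
    proof (rule nn_integral_cong_AE)
      show "AE x in lebesgue. ennreal \<bar>f x\<bar> * indicator ?B x = ennreal ((\<bar>f x\<bar> * w x powr (1 / s) * indicator ?B x) * (w x powr (- 1 / s) * indicator ?B x))"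
        using wpos by eventually_elim (auto simp: powr_minus split: split_indicator)
    qed
    also have "\<dots> \<le> ennreal (F powr (1 / s) * z powr (1 / s'))"
    proof (rule nn_integral_Holder[OF _ _ _ _ s s'(1,2)])
      have "(\<integral>\<^sup>+x. ennreal ((\<bar>f x\<bar> * w x powr (1 / s) * indicator ?B x) powr s) \<partial>lebesgue) = ennreal F"
        unfolding F(1)[symmetric] using s w0
        by (intro nn_integral_cong) (auto simp: powr_mult powr_powr split: split_indicator)
      then show "(\<integral>\<^sup>+x. ennreal ((\<bar>f x\<bar> * w x powr (1 / s) * indicator ?B x) powr s) \<partial>lebesgue) \<le> ennreal F" by simp
      have "(\<integral>\<^sup>+x. ennreal ((w x powr (- 1 / s) * indicator ?B x) powr s') \<partial>lebesgue) = Z"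
        unfolding Z_def
      proof (rule nn_integral_cong_AE)
        have e: "- 1 / s * s' = - 1 / (s - 1)" using s by (simp add: s'_def field_simps)
        show "AE x in lebesgue. ennreal ((w x powr (- 1 / s) * indicator ?B x) powr s') = ennpow (ennreal (w x)) (- 1 / (s - 1)) * indicator ?B x"
          using wpos
        proof eventually_elim
          case (elim x)
          then show ?case
            using e by (auto simp: powr_powr ennpow_ennreal split: split_indicator)
        qed
      qed
      then show "(\<integral>\<^sup>+x. ennreal ((w x powr (- 1 / s) * indicator ?B x) powr s') \<partial>lebesgue) \<le> ennreal z" by (simp add: z)
    qed (use F z w0 in auto)
    finally have "t * v \<le> F powr (1 / s) * z powr (1 / s')" by (subst (asm) ennreal_le_iff) auto
    then have "(t * v) powr s \<le> (F powr (1 / s) * z powr (1 / s')) powr s"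
      using t v s by (intro powr_mono2) auto
    also have "\<dots> = F * z powr (s - 1)"
    proof -
      have "1 / s' * s = s - 1" using s by (simp add: s'_def)
      then show ?thesis using F z s by (simp add: powr_mult powr_powr)
    qed
    finally have "b * ((t * v) powr s) \<le> b * (F * z powr (s - 1))" using b by (intro mult_left_mono) auto
    also have "\<dots> = F * (b * z powr (s - 1))" by simp
    also have "\<dots> \<le> F * (C * v powr s)" using F by (intro mult_left_mono zle) auto
    finally have "(t powr s * b) * v powr s \<le> (C * F) * v powr s"
      using t v by (simp add: powr_mult mult_ac)
    then have "t powr s * b \<le> C * F" using v by simp
    then show ?thesis
      unfolding F(1) b(1) using C b F by (simp add: ennreal_mult[symmetric] ennreal_leI)
  qed
  then show ?thesis using C unfolding averaging_def by blast
qed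

lemma muckenhoupt_averaging:
  fixes w :: "'a::euclidean_space \<Rightarrow> real"
  assumes "weight w" "1 \<le> s" "w \<in> muckenhoupt s"
  shows "\<exists>C>0. averaging s C w"
  using assms muckenhoupt_one_averaging[of w] muckenhoupt_gt_one_averaging[of w s] by (cases "s = 1") auto

text \<open>The inclusion of A_s in A_q in the present formulation: Hoelder's inequality with
  exponent q/s for the measure w dx on the ball, applied to |f|^s.\<close>

lemma averaging_mono:
  fixes w :: "'a::euclidean_space \<Rightarrow> real"
  assumes w: "weight w" and av: "averaging s C w" and C: "0 < C" and s: "1 \<le> s" "s \<le> q"
  shows "\<exists>C'>0. averaging q C' w"
proof (cases "s = q")
  case True then show ?thesis using av C by auto
next
  case False
  then have sq: "s < q" using s by simp
  note [measurable] = weight_borel_measurable[OF w]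
  note w0 = weight_nonneg[OF w]
  define C' where "C' = C powr (q / s)"
  have C': "0 < C'" using C by (simp add: C'_def)
  have "ennreal (t powr q) * wmeas w (ball c r) \<le> ennreal C' * (\<integral>\<^sup>+x\<in>ball c r. ennreal (\<bar>f x\<bar> powr q * w x) \<partial>lebesgue)"
    if r: "0 < r" and t: "0 \<le> t" and f [measurable]: "f \<in> borel_measurable lebesgue"
      and le: "ennreal t * emeasure lebesgue (ball c r) \<le> (\<integral>\<^sup>+x\<in>ball c r. ennreal \<bar>f x\<bar> \<partial>lebesgue)"
    for c :: 'a and r t and f :: "'a \<Rightarrow> real"
  proof (cases "t = 0 \<or> wmeas w (ball c r) = 0 \<or> (\<integral>\<^sup>+x\<in>ball c r. ennreal (\<bar>f x\<bar> powr q * w x) \<partial>lebesgue) = top")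
    case True then show ?thesis using C' by (auto simp: ennreal_mult_top)
  next
    case False
    let ?B = "ball c r"
    have [measurable]: "?B \<in> sets lebesgue" by simp
    have t: "0 < t" using False t by simp
    define F where "F = enn2real (\<integral>\<^sup>+x\<in>?B. ennreal (\<bar>f x\<bar> powr q * w x) \<partial>lebesgue)"
    have F: "(\<integral>\<^sup>+x\<in>?B. ennreal (\<bar>f x\<bar> powr q * w x) \<partial>lebesgue) = ennreal F" "0 \<le> F"
      using False by (auto simp: F_def less_top)
    define b where "b = enn2real (wmeas w ?B)"
    have b: "wmeas w ?B = ennreal b" "0 < b"
    proof -
      show eq: "wmeas w ?B = ennreal b" using wmeas_ball_finite[OF w, of c r] by (simp add: b_def less_top)
      show "0 < b" using False eq by (metis ennreal_eq_0_iff not_less)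
    qed
    define p where "p = q / s"
    define p' where "p' = p / (p - 1)"
    have p: "1 < p" using sq s by (simp add: p_def)
    have p': "1 < p'" "1 / p + 1 / p' = 1" using p by (auto simp: p'_def field_simps)
    define N where "N = density lebesgue (\<lambda>x. ennreal (w x) * indicator ?B x)"
    have Nm: "g \<in> borel_measurable N" if "g \<in> borel_measurable lebesgue" for g :: "'a \<Rightarrow> real"
      using that by (simp add: N_def)
    have Nint: "(\<integral>\<^sup>+x. ennreal (g x) \<partial>N) = (\<integral>\<^sup>+x\<in>?B. ennreal (g x * w x) \<partial>lebesgue)" if "g \<in> borel_measurable lebesgue" "\<And>x. 0 \<le> g x" for g
    proof -
      have "(\<lambda>x. ennreal (w x) * indicator ?B x) \<in> borel_measurable lebesgue"
        by (intro borel_measurable_times_ennreal borel_measurable_indicator) auto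
      then have "(\<integral>\<^sup>+x. ennreal (g x) \<partial>N) = (\<integral>\<^sup>+x. ennreal (w x) * indicator ?B x * ennreal (g x) \<partial>lebesgue)"
        unfolding N_def by (rule nn_integral_density[OF _ measurable_compose[OF that(1) measurable_ennreal]])
      also have "\<dots> = (\<integral>\<^sup>+x\<in>?B. ennreal (g x * w x) \<partial>lebesgue)"
        using that(2) w0 by (intro nn_integral_cong) (auto simp: ennreal_mult mult.commute split: split_indicator)
      finally show ?thesis .
    qed
    have "(\<integral>\<^sup>+x. ennreal (\<bar>f x\<bar> powr s * 1) \<partial>N) \<le> ennreal (F powr (1 / p) * b powr (1 / p'))"
    proof (rule nn_integral_Holder[OF Nm Nm _ _ p p'(1,2)])
      have e: "s * p = q" using s by (simp add: p_def)
      show "(\<integral>\<^sup>+x. ennreal ((\<bar>f x\<bar> powr s) powr p) \<partial>N) \<le> ennreal F"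
        by (subst Nint) (auto simp: powr_powr e F)
      show "(\<integral>\<^sup>+x. ennreal (1 powr p') \<partial>N) \<le> ennreal b"
        using Nint[of "\<lambda>_. 1 powr p'"] b by (simp add: wmeas_def)
    qed (use F b in auto)
    then have "(\<integral>\<^sup>+x\<in>?B. ennreal (\<bar>f x\<bar> powr s * w x) \<partial>lebesgue) \<le> ennreal (F powr (1 / p) * b powr (1 / p'))"
      by (subst (asm) Nint) auto
    then have "ennreal C * (\<integral>\<^sup>+x\<in>?B. ennreal (\<bar>f x\<bar> powr s * w x) \<partial>lebesgue) \<le> ennreal C * ennreal (F powr (1 / p) * b powr (1 / p'))"
      by (rule mult_left_mono) simp
    moreover have "ennreal (t powr s) * wmeas w ?B \<le> ennreal C * (\<integral>\<^sup>+x\<in>?B. ennreal (\<bar>f x\<bar> powr s * w x) \<partial>lebesgue)"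
      using av r t f le unfolding averaging_def by (auto simp del: emeasure_completion)
    ultimately have "ennreal (t powr s) * ennreal b \<le> ennreal C * ennreal (F powr (1 / p) * b powr (1 / p'))"
      unfolding b(1) by (rule order_trans[rotated])
    then have "t powr s * b \<le> C * (F powr (1 / p) * b powr (1 / p'))"
      using C b by (simp add: ennreal_mult[symmetric])
    moreover have "b = b powr (1 / p) * b powr (1 / p')"
      using b p' by (simp add: powr_add[symmetric])
    ultimately have "(t powr s * b powr (1 / p)) * b powr (1 / p') \<le> (C * F powr (1 / p)) * b powr (1 / p')"
      by (metis mult.assoc)
    then have "t powr s * b powr (1 / p) \<le> C * F powr (1 / p)" using b by simp
    then have "(t powr s * b powr (1 / p)) powr p \<le> (C * F powr (1 / p)) powr p"
      using p by (intro powr_mono2) auto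
    moreover have "(t powr s * b powr (1 / p)) powr p = t powr q * b"
    proof -
      have "s * p = q" using s by (simp add: p_def)
      then show ?thesis using p b t by (simp add: powr_mult powr_powr)
    qed
    moreover have "(C * F powr (1 / p)) powr p = C' * F"
      using p C F unfolding C'_def p_def[symmetric] by (simp add: powr_mult powr_powr)
    ultimately have "t powr q * b \<le> C' * F" by simp
    then show ?thesis
      unfolding F(1) b(1) using C' b F by (simp add: ennreal_mult[symmetric] ennreal_leI)
  qed
  then show ?thesis using C' unfolding averaging_def by blast
qed

section \<open>Discretization of the square function\<close>

lemma test_class_support:
  assumes "\<phi> \<in> test_class \<beta>" "1 < norm u" shows "\<phi> u = 0"
proof (rule ccontr)
  assume "\<phi> u \<noteq> 0"
  then have "u \<in> closure {x. \<phi> x \<noteq> 0}" using closure_subset[of "{x. \<phi> x \<noteq> 0}"] by auto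
  then show False using assms by (auto simp: test_class_def)
qed

lemma test_class_Holder: "\<phi> \<in> test_class \<beta> \<Longrightarrow> norm (\<phi> u - \<phi> u') \<le> norm (u - u') powr \<beta>"
  by (simp add: test_class_def)

lemma test_class_continuous: "0 < \<beta> \<Longrightarrow> \<phi> \<in> test_class \<beta> \<Longrightarrow> continuous_on UNIV \<phi>"
  using Holder_imp_continuous[of \<beta> \<phi> 1] test_class_Holder[of \<phi> \<beta>] by simp

text \<open>For u in the unit ball and a basis vector b the point u + 3b has norm at least 2, so
  \<phi> vanishes there, and 3^\<beta> \<le> 3.\<close>

lemma test_class_bound:
  fixes \<phi> :: "'a::euclidean_space \<Rightarrow> complex"
  assumes \<beta>: "0 < \<beta>" "\<beta> \<le> 1" and \<phi>: "\<phi> \<in> test_class \<beta>" shows "norm (\<phi> u) \<le> 3"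
proof (cases "1 < norm u")
  case True then show ?thesis using test_class_support[OF \<phi>] by simp
next
  case False
  obtain b :: 'a where b: "b \<in> Basis" using nonempty_Basis by blast
  define u' where "u' = u + 3 *\<^sub>R b"
  have "norm (3 *\<^sub>R b) = 3" using b by simp
  then have "3 - norm u \<le> norm u'" unfolding u'_def using norm_triangle_ineq4[of "u + 3 *\<^sub>R b" u] by simp
  then have "\<phi> u' = 0" using False by (intro test_class_support[OF \<phi>]) auto
  moreover have "norm (\<phi> u - \<phi> u') \<le> norm (u - u') powr \<beta>" by (rule test_class_Holder[OF \<phi>])
  moreover have "norm (u - u') = 3" using b by (simp add: u'_def)
  moreover have "(3::real) powr \<beta> \<le> 3 powr 1" using \<beta> by (intro powr_mono) auto
  ultimately show ?thesis by simp
qed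

lemma test_class_integrable:
  fixes \<phi> :: "'a::euclidean_space \<Rightarrow> complex"
  assumes \<beta>: "0 < \<beta>" "\<beta> \<le> 1" and \<phi>: "\<phi> \<in> test_class \<beta>" shows "integrable lebesgue \<phi>"
proof (rule Bochner_Integration.integrable_bound)
  show "integrable lebesgue (\<lambda>x::'a. 3 * indicator (cball 0 1) x :: real)"
    by (intro integrable_mult_right integrable_indicator_cball)
  show "\<phi> \<in> borel_measurable lebesgue"
    using borel_measurable_continuous_onI[OF test_class_continuous[OF \<beta>(1) \<phi>]] by (simp add: measurable_completion)
  show "AE x in lebesgue. norm (\<phi> x) \<le> norm (3 * indicator (cball 0 1) x :: real)"
    using test_class_bound[OF \<beta> \<phi>] test_class_support[OF \<phi>] by (intro AE_I2) (auto split: split_indicator)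
qed

lemma lborel_integral_affine:
  fixes g :: "'a::euclidean_space \<Rightarrow> real"
  assumes [measurable]: "g \<in> borel_measurable borel" and c: "c \<noteq> 0"
  shows "(\<integral>y. g y \<partial>lborel) = \<bar>c\<bar> ^ DIM('a) * (\<integral>u. g (x + c *\<^sub>R u) \<partial>lborel)"
  by (subst lborel_affine[OF c, of x]) (simp add: integral_density integral_distr)

text \<open>The factor 2^(n+1) consists of 2^n for replacing t^(-n) by 2^(-jn) and of 2 \<ge>
  2^\<beta> for the Hoelder condition. Real and imaginary parts are taken because atoms are
  real.\<close>

lemma test_atom:
  fixes \<phi> :: "'a::euclidean_space \<Rightarrow> complex" and p :: "complex \<Rightarrow> real"
  assumes \<beta>: "0 < \<beta>" "\<beta> \<le> 1" and \<phi>: "\<phi> \<in> test_class \<beta>" and p: "p = Re \<or> p = Im"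
    and t: "2 powi (j - 1) < t" "t \<le> 2 powi j"
  shows "atom \<beta> j (corner j x) (\<lambda>y. p (dilate t \<phi> (x - y)) / 2 ^ (DIM('a) + 1))"
proof -
  let ?n = "DIM('a)"
  define L where "L = (2::real) powi j"
  have L: "0 < L" by (simp add: L_def)
  have Lt: "L < 2 * t" using t(1) by (simp add: L_def power_int_diff)
  have t0: "0 < t" using Lt L by simp
  have tL: "t \<le> L" using t by (simp add: L_def)
  have pb: "\<bar>p z - p z'\<bar> \<le> norm (z - z')" for z z'
    using p abs_Re_le_cmod[of "z - z'"] abs_Im_le_cmod[of "z - z'"] by auto
  have p0: "p 0 = 0" using p by auto
  have psc: "p (z /\<^sub>R a) = p z / a" for z a using p by (auto simp: divide_inverse mult.commute)
  show ?thesis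
    unfolding atom_def
  proof (intro conjI allI impI)
    fix y :: 'a assume "(real ?n + 1) * 2 powi j < norm (y - corner j x)"
    also have "\<dots> \<le> norm (x - y) + norm (x - corner j x)"
      using norm_triangle_ineq4[of "x - corner j x" "x - y"] by simp
    also have "norm (x - corner j x) \<le> real ?n * L" using norm_diff_corner[of x j] by (simp add: L_def)
    finally have "L < norm (x - y)" by (simp add: L_def algebra_simps)
    then have "t < norm (x - y)" using tL by simp
    moreover have "norm ((x - y) /\<^sub>R t) = norm (x - y) / t" using t0 by (simp add: divide_inverse mult.commute)
    ultimately have "1 < norm ((x - y) /\<^sub>R t)" using t0 by simp
    then show "p (dilate t \<phi> (x - y)) / 2 ^ (?n + 1) = 0"
      using test_class_support[OF \<phi>] p0 by (simp add: dilate_def)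
  next
    have "continuous_on UNIV (\<lambda>u. p (\<phi> u))"
      using p test_class_continuous[OF \<beta>(1) \<phi>] by (auto intro: continuous_intros)
    then have [measurable]: "(\<lambda>u. p (\<phi> u)) \<in> borel_measurable borel" by (rule borel_measurable_continuous_onI)
    have comp [measurable]: "(\<lambda>y. p (\<phi> ((x - y) /\<^sub>R t))) \<in> borel_measurable borel"
      by (rule measurable_compose[of "\<lambda>y. (x - y) /\<^sub>R t" _ borel "\<lambda>u. p (\<phi> u)"]) measurable
    have "(\<integral>y. p (\<phi> ((x - y) /\<^sub>R t)) \<partial>lebesgue) = (\<integral>y. p (\<phi> ((x - y) /\<^sub>R t)) \<partial>lborel)"
      by (rule integral_completion) simp
    also have "\<dots> = \<bar>- t\<bar> ^ ?n * (\<integral>u. p (\<phi> ((x - (x + (- t) *\<^sub>R u)) /\<^sub>R t)) \<partial>lborel)"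
      using t0 by (intro lborel_integral_affine) auto
    also have "(\<integral>u. p (\<phi> ((x - (x + (- t) *\<^sub>R u)) /\<^sub>R t)) \<partial>lborel) = (\<integral>u. p (\<phi> u) \<partial>lborel)"
      using t0 by simp
    also have "\<dots> = (\<integral>u. p (\<phi> u) \<partial>lebesgue)"
      by (rule integral_completion[symmetric]) simp
    also have "\<dots> = p (\<integral>u. \<phi> u \<partial>lebesgue)"
      using p test_class_integrable[OF \<beta> \<phi>] by auto
    also have "\<dots> = 0" using \<phi> p0 by (simp add: test_class_def)
    finally show "(\<integral>y. p (dilate t \<phi> (x - y)) / 2 ^ (?n + 1) \<partial>lebesgue) = 0"
      by (simp add: dilate_def psc)
  next
    fix y y' :: 'a
    let ?d = "norm (y - y')"
    have "\<bar>p (\<phi> ((x - y) /\<^sub>R t)) - p (\<phi> ((x - y') /\<^sub>R t))\<bar> \<le> norm ((x - y) /\<^sub>R t - (x - y') /\<^sub>R t) powr \<beta>"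
      by (rule order_trans[OF pb test_class_Holder[OF \<phi>]])
    also have "(x - y) /\<^sub>R t - (x - y') /\<^sub>R t = (y' - y) /\<^sub>R t" by (simp add: scaleR_diff_right[symmetric])
    also have "norm ((y' - y) /\<^sub>R t) = ?d / t" using t0 by (simp add: norm_minus_commute divide_inverse mult.commute)
    also have "(?d / t) powr \<beta> \<le> (2 * (?d / L)) powr \<beta>"
    proof (intro powr_mono2)
      have "?d * L \<le> ?d * (2 * t)" using Lt by (intro mult_left_mono) auto
      then show "?d / t \<le> 2 * (?d / L)" using t0 L by (simp add: field_simps)
    qed (use \<beta> t0 in auto)
    also have "\<dots> = 2 powr \<beta> * (?d / L) powr \<beta>" using L by (subst powr_mult) auto
    also have "\<dots> \<le> 2 powr 1 * (?d / L) powr \<beta>" using \<beta> by (intro mult_right_mono powr_mono) auto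
    finally have 1: "\<bar>p (\<phi> ((x - y) /\<^sub>R t)) - p (\<phi> ((x - y') /\<^sub>R t))\<bar> \<le> 2 * (?d / L) powr \<beta>" by simp
    have "L ^ ?n \<le> (2 * t) ^ ?n" using Lt L by (intro power_mono) auto
    then have 2: "1 / t ^ ?n \<le> 2 ^ ?n / L ^ ?n" using t0 L by (simp add: power_mult_distrib field_simps)
    have "\<bar>p (\<phi> ((x - y) /\<^sub>R t)) - p (\<phi> ((x - y') /\<^sub>R t))\<bar> * (1 / t ^ ?n) \<le> 2 * (?d / L) powr \<beta> * (2 ^ ?n / L ^ ?n)"
      using 1 2 t0 L by (intro mult_mono) auto
    then have "\<bar>p (\<phi> ((x - y) /\<^sub>R t)) / t ^ ?n - p (\<phi> ((x - y') /\<^sub>R t)) / t ^ ?n\<bar> / 2 ^ (?n + 1) \<le> (?d / L) powr \<beta> / L ^ ?n"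
      using t0 by (simp add: diff_divide_distrib[symmetric] abs_divide field_simps)
    then show "\<bar>p (dilate t \<phi> (x - y)) / 2 ^ (?n + 1) - p (dilate t \<phi> (x - y')) / 2 ^ (?n + 1)\<bar>
        \<le> (norm (y - y') / 2 powi j) powr \<beta> / (2 powi j) ^ ?n"
      by (simp only: dilate_def psc diff_divide_distrib[symmetric] abs_divide L_def) simp
  qed
qed

text \<open>Replaces the supremum over test functions by one atom per cube. The supremum is finite
  by \<open>atom_bound\<close>; if it is positive some atom exceeds half of it, and otherwise the
  zero atom serves. The family depends on h, which is harmless because the weak type bounds are
  uniform over atom families.\<close>

lemma near_maximal_atoms:
  fixes h :: "'a::euclidean_space \<Rightarrow> real"
  assumes \<beta>: "0 < \<beta>" "\<beta> \<le> 1" and h: "integrable lebesgue h"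
  shows "\<exists>\<psi>. atoms \<beta> \<psi> \<and> (\<forall>j z \<phi>. corner j z = z \<longrightarrow> atom \<beta> j z \<phi> \<longrightarrow> \<bar>\<integral>y. h y * \<phi> y \<partial>lebesgue\<bar> \<le> 2 * \<bar>coef \<psi> h j z\<bar>)"
proof -
  have ex: "\<exists>\<psi>. atom \<beta> j z \<psi> \<and> (\<forall>\<phi>. atom \<beta> j z \<phi> \<longrightarrow> \<bar>\<integral>y. h y * \<phi> y \<partial>lebesgue\<bar> \<le> 2 * \<bar>\<integral>y. h y * \<psi> y \<partial>lebesgue\<bar>)" for j and z :: 'a
  proof -
    define S where "S = (\<lambda>\<phi>. \<bar>\<integral>y. h y * \<phi> y \<partial>lebesgue\<bar>) ` {\<phi>. atom \<beta> j z \<phi>}"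
    let ?B = "(2 * real DIM('a) + 3) / (2 powi j) ^ DIM('a)"
    have bdd: "bdd_above S"
    proof (rule bdd_aboveI)
      fix s assume "s \<in> S"
      then obtain \<phi> where \<phi>: "atom \<beta> j z \<phi>" and s: "s = norm (\<integral>y. h y * \<phi> y \<partial>lebesgue)" by (auto simp: S_def)
      have "s \<le> (\<integral>y. norm (h y * \<phi> y) \<partial>lebesgue)" unfolding s by (rule integral_norm_bound)
      also have "\<dots> \<le> (\<integral>y. ?B * \<bar>h y\<bar> \<partial>lebesgue)"
      proof (rule integral_mono)
        show "integrable lebesgue (\<lambda>y. norm (h y * \<phi> y))"
          by (intro integrable_norm atom_integrable_mult[OF \<beta> \<phi> h])
        show "integrable lebesgue (\<lambda>y. ?B * \<bar>h y\<bar>)" using h by auto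
        fix y
        have "\<bar>h y\<bar> * \<bar>\<phi> y\<bar> \<le> \<bar>h y\<bar> * ?B" by (intro mult_left_mono atom_bound[OF \<beta> \<phi>]) auto
        then show "norm (h y * \<phi> y) \<le> ?B * \<bar>h y\<bar>" by (simp add: abs_mult mult.commute)
      qed
      finally show "s \<le> (\<integral>y. ?B * \<bar>h y\<bar> \<partial>lebesgue)" .
    qed
    have atom0: "atom \<beta> j z (\<lambda>_. 0)" by (simp add: atom_def)
    have le: "s \<le> Sup S" if "s \<in> S" for s using that bdd by (rule cSup_upper)
    show ?thesis
    proof (cases "Sup S \<le> 0")
      case True
      then have "\<bar>\<integral>y. h y * \<phi> y \<partial>lebesgue\<bar> \<le> 0" if "atom \<beta> j z \<phi>" for \<phi>
        using le[of "\<bar>\<integral>y. h y * \<phi> y \<partial>lebesgue\<bar>"] that by (fastforce simp: S_def)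
      then show ?thesis using atom0 by fastforce
    next
      case False
      then have "Sup S / 2 < Sup S" by simp
      moreover have "S \<noteq> {}" using atom0 by (auto simp: S_def)
      ultimately obtain s where s: "s \<in> S" "Sup S / 2 < s" using less_cSup_iff[OF _ bdd] by blast
      then obtain \<psi> where \<psi>: "atom \<beta> j z \<psi>" "s = \<bar>\<integral>y. h y * \<psi> y \<partial>lebesgue\<bar>" by (auto simp: S_def)
      have "\<bar>\<integral>y. h y * \<phi> y \<partial>lebesgue\<bar> \<le> 2 * \<bar>\<integral>y. h y * \<psi> y \<partial>lebesgue\<bar>" if "atom \<beta> j z \<phi>" for \<phi>
        using le[of "\<bar>\<integral>y. h y * \<phi> y \<partial>lebesgue\<bar>"] that s \<psi> by (fastforce simp: S_def)
      then show ?thesis using \<psi> by blast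
    qed
  qed
  then obtain \<psi> where "\<And>j z. atom \<beta> j z (\<psi> j z) \<and> (\<forall>\<phi>. atom \<beta> j z \<phi> \<longrightarrow> \<bar>\<integral>y. h y * \<phi> y \<partial>lebesgue\<bar> \<le> 2 * \<bar>\<integral>y. h y * \<psi> j z y \<partial>lebesgue\<bar>)"
    by metis
  then show ?thesis by (intro exI[of _ \<psi>]) (auto simp: atoms_def coef_def)
qed

text \<open>A complex product consists of four real products, two involving Re f and two involving
  Im f. Each costs 2 for near-optimality and 2^(n+1) from \<open>test_atom\<close>, so r and s both
  receive the factor 2^(n+3).\<close>

lemma A_fun_le_coef:
  fixes f :: "'a::euclidean_space \<Rightarrow> complex"
  assumes \<beta>: "0 < \<beta>" "\<beta> \<le> 1" and f: "integrable lebesgue f"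
    and \<psi>: "\<And>j z \<phi>. corner j z = z \<Longrightarrow> atom \<beta> j z \<phi> \<Longrightarrow> \<bar>\<integral>y. Re (f y) * \<phi> y \<partial>lebesgue\<bar> \<le> 2 * \<bar>coef \<psi> (\<lambda>y. Re (f y)) j z\<bar>"
    and \<psi>': "\<And>j z \<phi>. corner j z = z \<Longrightarrow> atom \<beta> j z \<phi> \<Longrightarrow> \<bar>\<integral>y. Im (f y) * \<phi> y \<partial>lebesgue\<bar> \<le> 2 * \<bar>coef \<psi>' (\<lambda>y. Im (f y)) j z\<bar>"
    and t: "2 powi (j - 1) < t" "t \<le> 2 powi j"
  shows "A_fun \<beta> f x t \<le> ennreal (2 ^ (DIM('a) + 3) * (\<bar>coef \<psi> (\<lambda>y. Re (f y)) j (corner j x)\<bar> + \<bar>coef \<psi>' (\<lambda>y. Im (f y)) j (corner j x)\<bar>))"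
  unfolding A_fun_def
proof (rule SUP_least)
  fix \<phi> :: "'a \<Rightarrow> complex" assume \<phi>: "\<phi> \<in> test_class \<beta>"
  let ?N = "2 ^ (DIM('a) + 1) :: real"
  define D where "D y = dilate t \<phi> (x - y)" for y
  define r where "r = \<bar>coef \<psi> (\<lambda>y. Re (f y)) j (corner j x)\<bar>"
  define s where "s = \<bar>coef \<psi>' (\<lambda>y. Im (f y)) j (corner j x)\<bar>"
  have at: "atom \<beta> j (corner j x) (\<lambda>y. Re (D y) / ?N)" "atom \<beta> j (corner j x) (\<lambda>y. Im (D y) / ?N)"
    unfolding D_def by (intro test_atom[OF \<beta> \<phi> _ t]; simp)+
  have fR: "integrable lebesgue (\<lambda>y. Re (f y))" "integrable lebesgue (\<lambda>y. Im (f y))" using f by auto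
  have bd: "\<bar>\<integral>y. Re (f y) * P y \<partial>lebesgue\<bar> \<le> 2 * ?N * r" "\<bar>\<integral>y. Im (f y) * P y \<partial>lebesgue\<bar> \<le> 2 * ?N * s"
    "integrable lebesgue (\<lambda>y. Re (f y) * P y)" "integrable lebesgue (\<lambda>y. Im (f y) * P y)"
    if a: "atom \<beta> j (corner j x) (\<lambda>y. P y / ?N)" for P
  proof -
    show "\<bar>\<integral>y. Re (f y) * P y \<partial>lebesgue\<bar> \<le> 2 * ?N * r"
      using \<psi>[OF corner_idem a] by (simp add: r_def field_simps)
    show "\<bar>\<integral>y. Im (f y) * P y \<partial>lebesgue\<bar> \<le> 2 * ?N * s"
      using \<psi>'[OF corner_idem a] by (simp add: s_def field_simps)
    have "integrable lebesgue (\<lambda>y. ?N * (Re (f y) * (P y / ?N)))"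
      by (intro integrable_mult_right atom_integrable_mult[OF \<beta> a] fR)
    then show "integrable lebesgue (\<lambda>y. Re (f y) * P y)" by simp
    have "integrable lebesgue (\<lambda>y. ?N * (Im (f y) * (P y / ?N)))"
      by (intro integrable_mult_right atom_integrable_mult[OF \<beta> a] fR)
    then show "integrable lebesgue (\<lambda>y. Im (f y) * P y)" by simp
  qed
  note b1 = bd[OF at(1)] and b2 = bd[OF at(2)]
  have int: "integrable lebesgue (\<lambda>y. f y * D y)"
  proof -
    have "integrable lebesgue (\<lambda>y. complex_of_real (Re (f y) * Re (D y) - Im (f y) * Im (D y))
        + \<i> * complex_of_real (Re (f y) * Im (D y) + Im (f y) * Re (D y)))"
      using b1 b2 by (intro Bochner_Integration.integrable_add integrable_mult_right integrable_of_real Bochner_Integration.integrable_diff)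
    also have "(\<lambda>y. complex_of_real (Re (f y) * Re (D y) - Im (f y) * Im (D y))
        + \<i> * complex_of_real (Re (f y) * Im (D y) + Im (f y) * Re (D y))) = (\<lambda>y. f y * D y)"
      by (auto simp: fun_eq_iff complex_eq_iff)
    finally show ?thesis .
  qed
  have "norm (convol f (dilate t \<phi>) x) = norm (\<integral>y. f y * D y \<partial>lebesgue)"
    by (simp add: convol_def D_def)
  also have "\<dots> \<le> \<bar>Re (\<integral>y. f y * D y \<partial>lebesgue)\<bar> + \<bar>Im (\<integral>y. f y * D y \<partial>lebesgue)\<bar>"
    by (rule cmod_le)
  also have "Re (\<integral>y. f y * D y \<partial>lebesgue) = (\<integral>y. Re (f y) * Re (D y) \<partial>lebesgue) - (\<integral>y. Im (f y) * Im (D y) \<partial>lebesgue)"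
    using int b1 b2 by (simp add: integral_Re[symmetric])
  also have "Im (\<integral>y. f y * D y \<partial>lebesgue) = (\<integral>y. Re (f y) * Im (D y) \<partial>lebesgue) + (\<integral>y. Im (f y) * Re (D y) \<partial>lebesgue)"
    using int b1 b2 by (simp add: integral_Im[symmetric])
  also have "\<bar>(\<integral>y. Re (f y) * Re (D y) \<partial>lebesgue) - (\<integral>y. Im (f y) * Im (D y) \<partial>lebesgue)\<bar>
      + \<bar>(\<integral>y. Re (f y) * Im (D y) \<partial>lebesgue) + (\<integral>y. Im (f y) * Re (D y) \<partial>lebesgue)\<bar> \<le> 4 * ?N * (r + s)"
    using b1(1,2) b2(1,2) by (simp add: distrib_left)
  also have "\<dots> = 2 ^ (DIM('a) + 3) * (r + s)" by (simp add: power_add)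
  finally show "ennreal (norm (convol f (dilate t \<phi>) x)) \<le> ennreal (2 ^ (DIM('a) + 3) * (\<bar>coef \<psi> (\<lambda>y. Re (f y)) j (corner j x)\<bar> + \<bar>coef \<psi>' (\<lambda>y. Im (f y)) j (corner j x)\<bar>))"
    by (intro ennreal_leI) (simp add: r_def s_def)
qed

section \<open>From coefficients to the weak type bound for G\<close>

lemma ex_scale:
  fixes t :: real assumes "0 < t" shows "\<exists>j. 2 powi (j - 1) < t \<and> t \<le> 2 powi j"
proof (intro exI conjI)
  let ?j = "\<lceil>log 2 t\<rceil>"
  have t: "t = 2 powr (log 2 t)" using assms by simp
  have "2 powi (?j - 1) = 2 powr (real_of_int (?j - 1))" by (rule powr_real_of_int'[symmetric]) simp_all
  also have "\<dots> < 2 powr (log 2 t)" by (intro powr_less_mono) linarith+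
  finally show "2 powi (?j - 1) < t" using t by simp
  have "2 powr (log 2 t) \<le> 2 powr (real_of_int ?j)" by (intro powr_mono) auto
  also have "\<dots> = 2 powi ?j" by (rule powr_real_of_int') simp_all
  finally show "t \<le> 2 powi ?j" using t by simp
qed

text \<open>The square of G, so that estimates and level sets can be handled without roots.\<close>

definition G_integral :: "real \<Rightarrow> ('a::euclidean_space \<Rightarrow> complex) \<Rightarrow> 'a \<Rightarrow> ennreal" where
  "G_integral \<beta> f x = (\<integral>\<^sup>+t\<in>{0<..}. (A_fun \<beta> f x t)\<^sup>2 / ennreal t \<partial>lebesgue)"

lemma less_ennpow_half_iff:
  assumes c: "0 \<le> c" shows "ennreal c < ennpow X (1 / 2) \<longleftrightarrow> ennreal (c\<^sup>2) < X"
proof (cases X)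
  case (real y)
  show ?thesis
  proof (cases "y = 0")
    case False
    then have y: "0 < y" using real by simp
    have "c < y powr (1/2) \<longleftrightarrow> c\<^sup>2 < y"
      using y c by (simp add: powr_half_sqrt real_less_rsqrt) (metis real_less_rsqrt real_sqrt_less_iff real_sqrt_unique)
    then show ?thesis using y c real by (simp add: ennpow_ennreal ennreal_less_iff)
  qed (use real c in \<open>auto simp: ennpow_def\<close>)
qed (auto simp: ennpow_def)

lemma less_G_fun_iff: "0 \<le> c \<Longrightarrow> ennreal c < G_fun \<beta> f x \<longleftrightarrow> ennreal (c\<^sup>2) < G_integral \<beta> f x"
  unfolding G_fun_def G_integral_def by (rule less_ennpow_half_iff)

text \<open>On (2^(j-1), 2^j] one has 1/t \<le> 2 / 2^j, and the interval has length 2^j / 2. So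
  each scale contributes its squared bound with factor 1.\<close>

lemma G_integral_le:
  fixes f :: "'a::euclidean_space \<Rightarrow> complex"
  assumes A: "\<And>j t. 2 powi (j - 1) < t \<Longrightarrow> t \<le> 2 powi j \<Longrightarrow> A_fun \<beta> f x t \<le> ennreal (a j)" and a: "\<And>j. 0 \<le> a j"
  shows "G_integral \<beta> f x \<le> (\<integral>\<^sup>+j. ennreal ((a j)\<^sup>2) \<partial>count_space UNIV)"
proof -
  let ?I = "\<lambda>j::int. {2 powi (j - 1)<..2 powi j} :: real set"
  let ?h = "\<lambda>j t. ennreal ((a j)\<^sup>2 * 2 / 2 powi j) * indicator (?I j) t"
  have "G_integral \<beta> f x \<le> (\<integral>\<^sup>+t. (\<integral>\<^sup>+j. ?h j t \<partial>count_space UNIV) \<partial>lebesgue)"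
    unfolding G_integral_def
  proof (intro nn_integral_mono)
    fix t :: real
    show "(A_fun \<beta> f x t)\<^sup>2 / ennreal t * indicator {0<..} t \<le> (\<integral>\<^sup>+j. ?h j t \<partial>count_space UNIV)"
    proof (cases "0 < t")
      case True
      then obtain j where j: "2 powi (j - 1) < t" "t \<le> 2 powi j" using ex_scale by blast
      have lt: "2 powi j < 2 * t" using j(1) by (simp add: power_int_diff)
      have "(A_fun \<beta> f x t)\<^sup>2 \<le> (ennreal (a j))\<^sup>2" by (intro power_mono A j) auto
      also have "\<dots> = ennreal ((a j)\<^sup>2)" using a by (simp add: ennreal_power)
      finally have "(A_fun \<beta> f x t)\<^sup>2 / ennreal t \<le> ennreal ((a j)\<^sup>2) / ennreal t" by (rule divide_right_mono_ennreal)
      also have "\<dots> = ennreal ((a j)\<^sup>2 / t)" using True by (simp add: divide_ennreal)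
      also have "\<dots> \<le> ennreal ((a j)\<^sup>2 * 2 / 2 powi j)"
      proof (intro ennreal_leI)
        have "(a j)\<^sup>2 * 2 powi j \<le> (a j)\<^sup>2 * (2 * t)" using lt by (intro mult_left_mono) auto
        then show "(a j)\<^sup>2 / t \<le> (a j)\<^sup>2 * 2 / 2 powi j" using True by (simp add: field_simps)
      qed
      also have "\<dots> = (\<integral>\<^sup>+i. ?h j t * indicator {j} i \<partial>count_space UNIV)"
        using j by (subst nn_integral_count_space'[where A="{j}"]) auto
      also have "\<dots> \<le> (\<integral>\<^sup>+i. ?h i t \<partial>count_space UNIV)"
        by (intro nn_integral_mono) (auto split: split_indicator)
      finally show ?thesis using True by simp
    qed simp
  qed
  also have "\<dots> = (\<integral>\<^sup>+j. (\<integral>\<^sup>+t. ?h j t \<partial>lebesgue) \<partial>count_space UNIV)"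
    by (intro nn_integral_count_space_nn_integral borel_measurable_times_ennreal borel_measurable_indicator) auto
  also have "\<dots> = (\<integral>\<^sup>+j. ennreal ((a j)\<^sup>2) \<partial>count_space UNIV)"
  proof (intro nn_integral_cong)
    fix j :: int
    have le: "(2::real) powi (j - 1) \<le> 2 powi j" by (intro power_int_increasing) auto
    have "(\<integral>\<^sup>+t. ?h j t \<partial>lebesgue) = ennreal ((a j)\<^sup>2 * 2 / 2 powi j) * emeasure lebesgue (?I j)"
      by (rule nn_integral_cmult_indicator) simp
    also have "\<dots> = ennreal ((a j)\<^sup>2 * 2 / 2 powi j) * ennreal (2 powi j - 2 powi (j - 1))"
      using le by simp
    also have "\<dots> = ennreal ((a j)\<^sup>2 * 2 / 2 powi j * (2 powi j - 2 powi (j - 1)))"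
      using le by (intro ennreal_mult[symmetric]) auto
    also have "(a j)\<^sup>2 * 2 / 2 powi j * (2 powi j - 2 powi (j - 1)) = (a j)\<^sup>2"
      by (simp add: power_int_diff field_simps)
    finally show "(\<integral>\<^sup>+t. ?h j t \<partial>lebesgue) = ennreal ((a j)\<^sup>2)" .
  qed
  finally show ?thesis .
qed

text \<open>Real and imaginary part of f receive their own atoms, and the weak bound is applied to
  each truncated square sum. The truncated level sets increase, so continuity from below removes the
  truncation.\<close>

lemma G_weak_type:
  fixes w :: "'a::euclidean_space \<Rightarrow> real"
  assumes \<beta>: "0 < \<beta>" "\<beta> \<le> 1" and q: "1 \<le> q" and av: "averaging q C w" and C: "0 \<le> C" and w: "weight w"
  shows "\<exists>K>0. \<forall>f \<rho> c. integrable lebesgue f \<longrightarrow> (\<forall>x. \<rho> < norm x \<longrightarrow> f x = 0) \<longrightarrow> 0 < c \<longrightarrow>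
    wmeas w {x. ennreal c < G_fun \<beta> f x} \<le> ennreal (K * c powr - q) * (\<integral>\<^sup>+x. ennreal (norm (f x) powr q * w x) \<partial>lebesgue)"
proof -
  note w0 = weight_nonneg[OF w]
  have [measurable]: "w \<in> borel_measurable lebesgue" by (rule weight_borel_measurable[OF w])
  obtain K where K: "0 < K" and weak0: "\<forall>\<psi> f m M c \<rho>. atoms \<beta> \<psi> \<longrightarrow> integrable lebesgue f \<longrightarrow> (\<forall>x. \<rho> < norm x \<longrightarrow> f x = 0) \<longrightarrow> 0 < c \<longrightarrow>
     wmeas w {x. c\<^sup>2 < sqsum \<psi> f m M x} \<le> ennreal (K * c powr - q) * (\<integral>\<^sup>+x. ennreal (\<bar>f x\<bar> powr q * w x) \<partial>lebesgue)"
    using sqsum_weighted_weak_type[OF \<beta> q av C \<open>w \<in> borel_measurable lebesgue\<close> w0 wmeas_cball_finite[OF w]] by blast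
  note weak = weak0[rule_format]
  \<comment> \<open>2^(n+3) is the cost of \<open>A_fun_le_coef\<close>. The extra factor 2 pays for
    (r + s)^2 \<le> 2 (r^2 + s^2) and for one of the two square sums having to exceed half of the
    total.\<close>
  define \<kappa> where "\<kappa> = (2 * 2 ^ (DIM('a) + 3) :: real)"
  have \<kappa>: "0 < \<kappa>" by (simp add: \<kappa>_def)
  have main: "wmeas w {x. ennreal c < G_fun \<beta> f x} \<le> ennreal (2 * K * \<kappa> powr q * c powr - q) * (\<integral>\<^sup>+x. ennreal (norm (f x) powr q * w x) \<partial>lebesgue)"
    if f: "integrable lebesgue f" and supp: "\<And>x. \<rho> < norm x \<Longrightarrow> f x = 0" and c: "0 < c" for f \<rho> c
  proof -
    let ?R = "\<lambda>y. Re (f y)" and ?I = "\<lambda>y. Im (f y)"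
    have fR: "integrable lebesgue ?R" "integrable lebesgue ?I" using f by auto
    obtain \<psi> where \<psi>: "atoms \<beta> \<psi>" "\<And>j z \<phi>. corner j z = z \<Longrightarrow> atom \<beta> j z \<phi> \<Longrightarrow> \<bar>\<integral>y. ?R y * \<phi> y \<partial>lebesgue\<bar> \<le> 2 * \<bar>coef \<psi> ?R j z\<bar>"
      using near_maximal_atoms[OF \<beta> fR(1)] by blast
    obtain \<psi>' where \<psi>': "atoms \<beta> \<psi>'" "\<And>j z \<phi>. corner j z = z \<Longrightarrow> atom \<beta> j z \<phi> \<Longrightarrow> \<bar>\<integral>y. ?I y * \<phi> y \<partial>lebesgue\<bar> \<le> 2 * \<bar>coef \<psi>' ?I j z\<bar>"
      using near_maximal_atoms[OF \<beta> fR(2)] by blast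
    define d where "d = c / \<kappa>"
    have d: "0 < d" using c \<kappa> by (simp add: d_def)
    define X where "X M = {x. d\<^sup>2 < sqsum \<psi> ?R (- int M) (int M) x} \<union> {x. d\<^sup>2 < sqsum \<psi>' ?I (- int M) (int M) x}" for M
    have Xs: "X M \<in> sets lebesgue" for M
      unfolding X_def by (intro sets.Un sets_superlevel borel_measurable_sqsum)
    have sqm: "sqsum \<psi> g (- int M) (int M) x \<le> sqsum \<psi> g (- int N) (int N) x" if "M \<le> N" for \<psi> g M N and x :: 'a
      unfolding sqsum_def using that by (intro sum_mono2) auto
    have Xm: "incseq X"
    proof (rule incseq_SucI)
      fix M show "X M \<subseteq> X (Suc M)"
        using sqm[of M "Suc M"] unfolding X_def by (auto intro: less_le_trans)
    qed
    have sub: "{x. ennreal c < G_fun \<beta> f x} \<subseteq> (\<Union>M. X M)"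
    proof
      fix x assume "x \<in> {x. ennreal c < G_fun \<beta> f x}"
      then have G: "ennreal (c\<^sup>2) < G_integral \<beta> f x" using c by (simp add: less_G_fun_iff)
      define r where "r j = \<bar>coef \<psi> ?R j (corner j x)\<bar>" for j
      define s where "s j = \<bar>coef \<psi>' ?I j (corner j x)\<bar>" for j
      have "G_integral \<beta> f x \<le> (\<integral>\<^sup>+j. ennreal ((2 ^ (DIM('a) + 3) * (r j + s j))\<^sup>2) \<partial>count_space UNIV)"
      proof (rule G_integral_le)
        show "A_fun \<beta> f x t \<le> ennreal (2 ^ (DIM('a) + 3) * (r j + s j))" if "2 powi (j - 1) < t" "t \<le> 2 powi j" for j t
          unfolding r_def s_def by (rule A_fun_le_coef[OF \<beta> f \<psi>(2) \<psi>'(2) that])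
      qed (simp add: r_def s_def)
      then have above: "\<not> (\<integral>\<^sup>+j. ennreal ((2 ^ (DIM('a) + 3) * (r j + s j))\<^sup>2) \<partial>count_space UNIV) \<le> ennreal (c\<^sup>2)"
        using G by auto
      have "\<exists>F. finite F \<and> ennreal (c\<^sup>2) < (\<Sum>j\<in>F. ennreal ((2 ^ (DIM('a) + 3) * (r j + s j))\<^sup>2))"
      proof (rule ccontr)
        assume "\<not> ?thesis"
        then have *: "(\<Sum>j\<in>F. ennreal ((2 ^ (DIM('a) + 3) * (r j + s j))\<^sup>2)) \<le> ennreal (c\<^sup>2)" if "finite F" for F
          using that by (meson not_less)
        have "(\<integral>\<^sup>+j. ennreal ((2 ^ (DIM('a) + 3) * (r j + s j))\<^sup>2) \<partial>count_space UNIV) \<le> ennreal (c\<^sup>2)"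
          by (rule nn_integral_count_space_le[OF _ *]) auto
        then show False using above by blast
      qed
      then obtain F where F: "finite F" "ennreal (c\<^sup>2) < (\<Sum>j\<in>F. ennreal ((2 ^ (DIM('a) + 3) * (r j + s j))\<^sup>2))"
        by blast
      define M where "M = nat (Max (insert 0 (abs ` F)))"
      have FM: "F \<subseteq> {- int M..int M}"
      proof
        fix j assume "j \<in> F"
        then have "\<bar>j\<bar> \<le> Max (insert 0 (abs ` F))" using F by (intro Max_ge) auto
        then show "j \<in> {- int M..int M}" by (auto simp: M_def)
      qed
      have "c\<^sup>2 < (\<Sum>j\<in>F. (2 ^ (DIM('a) + 3) * (r j + s j))\<^sup>2)"
        using F(2) by (simp add: ennreal_less_iff)
      also have "\<dots> \<le> (\<Sum>j=- int M..int M. (2 ^ (DIM('a) + 3) * (r j + s j))\<^sup>2)"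
        using FM by (intro sum_mono2) auto
      also have "\<dots> \<le> (\<Sum>j=- int M..int M. \<kappa>\<^sup>2 / 2 * ((r j)\<^sup>2 + (s j)\<^sup>2))"
      proof (intro sum_mono)
        fix j
        have "(r j + s j)\<^sup>2 \<le> 2 * ((r j)\<^sup>2 + (s j)\<^sup>2)"
          using sum_squares_bound[of "r j" "s j"] by (simp add: power2_eq_square algebra_simps)
        then have "(2 ^ (DIM('a) + 3))\<^sup>2 * (r j + s j)\<^sup>2 \<le> (2 ^ (DIM('a) + 3))\<^sup>2 * (2 * ((r j)\<^sup>2 + (s j)\<^sup>2))"
          by (rule mult_left_mono) simp
        then show "(2 ^ (DIM('a) + 3) * (r j + s j))\<^sup>2 \<le> \<kappa>\<^sup>2 / 2 * ((r j)\<^sup>2 + (s j)\<^sup>2)"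
          by (simp add: power_mult_distrib \<kappa>_def)
      qed
      also have "\<dots> = \<kappa>\<^sup>2 / 2 * (sqsum \<psi> ?R (- int M) (int M) x + sqsum \<psi>' ?I (- int M) (int M) x)"
        unfolding sum_distrib_left[symmetric] sum.distrib by (simp add: sqsum_def r_def s_def)
      finally have "2 * d\<^sup>2 < sqsum \<psi> ?R (- int M) (int M) x + sqsum \<psi>' ?I (- int M) (int M) x"
        using \<kappa> by (simp add: d_def power_divide field_simps)
      then have "x \<in> X M" unfolding X_def by (auto simp: not_less)
      then show "x \<in> (\<Union>M. X M)" by blast
    qed
    define B where "B = ennreal (2 * K * \<kappa> powr q * c powr - q) * (\<integral>\<^sup>+x. ennreal (norm (f x) powr q * w x) \<partial>lebesgue)"
    define W where "W = density lebesgue (\<lambda>x. ennreal (w x))"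
    have Wm: "emeasure W Y = wmeas w Y" if "Y \<in> sets lebesgue" for Y
      unfolding W_def wmeas_def by (rule emeasure_density[OF _ that]) measurable
    have le: "emeasure W (X M) \<le> B" for M
    proof -
      let ?F = "\<integral>\<^sup>+x. ennreal (norm (f x) powr q * w x) \<partial>lebesgue"
      let ?A1 = "{x. d\<^sup>2 < sqsum \<psi> ?R (- int M) (int M) x}" and ?A2 = "{x. d\<^sup>2 < sqsum \<psi>' ?I (- int M) (int M) x}"
      have s: "?A1 \<in> sets lebesgue" "?A2 \<in> sets lebesgue"
        by (intro sets_superlevel borel_measurable_sqsum)+
      have "wmeas w ?A1 \<le> ennreal (K * d powr - q) * (\<integral>\<^sup>+x. ennreal (\<bar>?R x\<bar> powr q * w x) \<partial>lebesgue)"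
        using supp by (intro weak[where \<rho>=\<rho>, OF \<psi>(1) fR(1) _ d]) auto
      also have "\<dots> \<le> ennreal (K * d powr - q) * ?F"
        using w0 q abs_Re_le_cmod by (intro mult_left_mono nn_integral_mono ennreal_leI mult_right_mono powr_mono2) auto
      finally have 1: "emeasure W ?A1 \<le> ennreal (K * d powr - q) * ?F" using s by (simp add: Wm)
      have "wmeas w ?A2 \<le> ennreal (K * d powr - q) * (\<integral>\<^sup>+x. ennreal (\<bar>?I x\<bar> powr q * w x) \<partial>lebesgue)"
        using supp by (intro weak[where \<rho>=\<rho>, OF \<psi>'(1) fR(2) _ d]) auto
      also have "\<dots> \<le> ennreal (K * d powr - q) * ?F"
        using w0 q abs_Im_le_cmod by (intro mult_left_mono nn_integral_mono ennreal_leI mult_right_mono powr_mono2) auto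
      finally have 2: "emeasure W ?A2 \<le> ennreal (K * d powr - q) * ?F" using s by (simp add: Wm)
      have "emeasure W (X M) \<le> emeasure W ?A1 + emeasure W ?A2"
        unfolding X_def using s by (intro emeasure_subadditive) (auto simp: W_def)
      also have "\<dots> \<le> ennreal (K * d powr - q) * ?F + ennreal (K * d powr - q) * ?F"
        by (intro add_mono 1 2)
      also have "\<dots> = ennreal (2 * (K * d powr - q)) * ?F"
        using K by (simp add: distrib_right[symmetric] ennreal_plus[symmetric] mult.assoc del: ennreal_plus)
      also have "2 * (K * d powr - q) = 2 * K * \<kappa> powr q * c powr - q"
        using c \<kappa> by (simp add: d_def powr_divide powr_minus field_simps)
      finally show ?thesis by (simp add: B_def)
    qed
    have "wmeas w {x. ennreal c < G_fun \<beta> f x} \<le> wmeas w (\<Union>M. X M)" by (rule wmeas_mono[OF sub])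
    also have "\<dots> = emeasure W (\<Union>M. X M)" using Xs by (intro Wm[symmetric]) auto
    also have "\<dots> = (SUP M. emeasure W (X M))"
      using Xs Xm by (intro SUP_emeasure_incseq[symmetric]) (auto simp: W_def)
    also have "\<dots> \<le> B" by (intro SUP_least le)
    finally show ?thesis by (simp add: B_def)
  qed
  show ?thesis
    using K \<kappa> main by (intro exI[of _ "2 * K * \<kappa> powr q"]) auto
qed

section \<open>Pointwise size estimate and measurability\<close>

lemma ennreal_divide_real: "0 < t \<Longrightarrow> X / ennreal t = X * ennreal (1 / t)"
  by (simp add: divide_ennreal_def inverse_ennreal inverse_eq_divide)

lemma G_fun_le_iff: "0 \<le> c \<Longrightarrow> G_fun \<beta> f x \<le> ennreal c \<longleftrightarrow> G_integral \<beta> f x \<le> ennreal (c\<^sup>2)"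
  using less_G_fun_iff[of c \<beta> f x] by (simp add: not_less[symmetric])

lemma norm_dilate_le:
  fixes \<phi> :: "'a::euclidean_space \<Rightarrow> complex"
  assumes \<beta>: "0 < \<beta>" "\<beta> \<le> 1" and \<phi>: "\<phi> \<in> test_class \<beta>" and t: "0 < t"
  shows "norm (dilate t \<phi> u) \<le> 3 / t ^ DIM('a) * indicator {u. norm u \<le> t} u"
proof (cases "norm u \<le> t")
  case True
  then show ?thesis using test_class_bound[OF \<beta> \<phi>] t by (simp add: dilate_def divide_inverse mult.commute)
next
  case False
  have "norm (u /\<^sub>R t) = norm u / t" using t by (simp add: divide_inverse mult.commute)
  then have "1 < norm (u /\<^sub>R t)" using False t by simp
  then show ?thesis using test_class_support[OF \<phi>] t by (simp add: dilate_def)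
qed

lemma nn_integral_inverse_power_le:
  fixes d :: real assumes d: "0 < d" and n: "0 < n"
  shows "(\<integral>\<^sup>+t\<in>{d..}. ennreal (1 / t ^ (n + 1)) \<partial>lborel) \<le> ennreal (1 / d ^ n)"
proof -
  have "(\<integral>\<^sup>+t\<in>{d..}. ennreal (1 / t ^ (n + 1)) \<partial>lborel) = ennreal (0 - (- 1 / (real n * d ^ n)))"
  proof (rule nn_integral_FTC_atLeast)
    show "(\<lambda>t::real. 1 / t ^ (n + 1)) \<in> borel_measurable borel" by measurable
    fix t assume t: "d \<le> t"
    then have t0: "0 < t" using d by simp
    show "0 \<le> 1 / t ^ (n + 1)" using t0 by simp
    have n1: "n = Suc (n - 1)" using n by simp
    have p: "t ^ n = t * t ^ (n - 1)" by (subst n1) simp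
    show "((\<lambda>t. - 1 / (real n * t ^ n)) has_real_derivative 1 / t ^ (n + 1)) (at t)"
      using t0 n by (auto intro!: derivative_eq_intros simp: p field_simps power2_eq_square)
  next
    show "((\<lambda>t. - 1 / (real n * t ^ n)) \<longlongrightarrow> 0) at_top"
      using n by (intro tendsto_divide_0[OF tendsto_const] filterlim_at_top_imp_at_infinity
        filterlim_tendsto_pos_mult_at_top[OF tendsto_const] filterlim_pow_at_top filterlim_ident) auto
  qed
  also have "\<dots> \<le> ennreal (1 / d ^ n)"
    using d n by (intro ennreal_leI) (simp add: field_simps)
  finally show ?thesis .
qed

lemma A_fun_le_average:
  fixes f :: "'a::euclidean_space \<Rightarrow> complex"
  assumes \<beta>: "0 < \<beta>" "\<beta> \<le> 1" and t: "0 < t" and f [measurable]: "f \<in> borel_measurable lebesgue"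
  shows "A_fun \<beta> f x t \<le> ennreal 3 * (\<integral>\<^sup>+y. ennreal (norm (f y) / t ^ DIM('a)) * indicator {y. norm (x - y) \<le> t} y \<partial>lebesgue)"
  unfolding A_fun_def
proof (rule SUP_least)
  fix \<phi> :: "'a \<Rightarrow> complex" assume \<phi>: "\<phi> \<in> test_class \<beta>"
  have "ennreal (norm (convol f (dilate t \<phi>) x)) \<le> (\<integral>\<^sup>+y. norm (f y * dilate t \<phi> (x - y)) \<partial>lebesgue)"
    unfolding convol_def by (cases "integrable lebesgue (\<lambda>y. f y * dilate t \<phi> (x - y))")
      (auto intro!: integral_norm_bound_ennreal simp: not_integrable_integral_eq)
  also have "\<dots> \<le> (\<integral>\<^sup>+y. ennreal 3 * (ennreal (norm (f y) / t ^ DIM('a)) * indicator {y. norm (x - y) \<le> t} y) \<partial>lebesgue)"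
  proof (rule nn_integral_mono)
    fix y
    have le: "norm (f y) * norm (dilate t \<phi> (x - y)) \<le> norm (f y) * (3 / t ^ DIM('a) * indicator {u. norm u \<le> t} (x - y))"
      by (intro mult_left_mono norm_dilate_le[OF \<beta> \<phi> t]) auto
    show "ennreal (norm (f y * dilate t \<phi> (x - y))) \<le> ennreal 3 * (ennreal (norm (f y) / t ^ DIM('a)) * indicator {y. norm (x - y) \<le> t} y)"
    proof (cases "norm (x - y) \<le> t")
      case True
      have "ennreal (norm (f y * dilate t \<phi> (x - y))) \<le> ennreal (3 * (norm (f y) / t ^ DIM('a)))"
        using le True by (intro ennreal_leI) (simp add: norm_mult mult.commute)
      also have "\<dots> = ennreal 3 * ennreal (norm (f y) / t ^ DIM('a))"
        using t by (intro ennreal_mult) auto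
      finally show ?thesis using True by simp
    next
      case False
      then have "norm (f y * dilate t \<phi> (x - y)) \<le> 0" using le by (simp add: norm_mult del: mult_le_0_iff)
      then show ?thesis by auto
    qed
  qed
  also have "\<dots> = ennreal 3 * (\<integral>\<^sup>+y. ennreal (norm (f y) / t ^ DIM('a)) * indicator {y. norm (x - y) \<le> t} y \<partial>lebesgue)"
  proof (rule nn_integral_cmult)
    have "{y. norm (x - y) \<le> t} = cball x t" by (auto simp: dist_norm)
    then have [measurable]: "{y. norm (x - y) \<le> t} \<in> sets lebesgue" by simp
    show "(\<lambda>y. ennreal (norm (f y) / t ^ DIM('a)) * indicator {y. norm (x - y) \<le> t} y) \<in> borel_measurable lebesgue"
      by measurable
  qed
  finally show "ennreal (norm (convol f (dilate t \<phi>) x)) \<le> ennreal 3 * (\<integral>\<^sup>+y. ennreal (norm (f y) / t ^ DIM('a)) * indicator {y. norm (x - y) \<le> t} y \<partial>lebesgue)" .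
qed

text \<open>The average \<open>a t\<close> never exceeds the potential S, because |x - y| \<le> t on
  its domain. So one factor of A^2 \<le> 9 a(t)^2 is replaced by S and only the other is integrated
  in t. By Fubini the integral of t^(-n-1) over t \<ge> |x - y| restores |x - y|^(-n), and G^2 \<le>
  9 S^2.\<close>

lemma G_fun_le_potential:
  fixes f :: "'a::euclidean_space \<Rightarrow> complex"
  assumes \<beta>: "0 < \<beta>" "\<beta> \<le> 1" and f [measurable]: "f \<in> borel_measurable lebesgue" and fx: "f x = 0"
  shows "G_fun \<beta> f x \<le> ennreal 3 * (\<integral>\<^sup>+y. ennreal (norm (f y) / norm (x - y) ^ DIM('a)) \<partial>lebesgue)"
proof -
  let ?n = "DIM('a)"
  define S where "S = (\<integral>\<^sup>+y. ennreal (norm (f y) / norm (x - y) ^ ?n) \<partial>lebesgue)"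
  show ?thesis
  proof (cases "S = top")
    case True then show ?thesis by (simp add: S_def[symmetric] ennreal_mult_top)
  next
    case False
    define s where "s = enn2real S"
    have s: "S = ennreal s" "0 \<le> s" using False by (auto simp: s_def less_top)
    define a where "a t = (\<integral>\<^sup>+y. ennreal (norm (f y) / t ^ ?n) * indicator {y. norm (x - y) \<le> t} y \<partial>lebesgue)" for t
    have aS: "a t \<le> S" if t: "0 < t" for t
      unfolding a_def S_def
    proof (rule nn_integral_mono)
      fix y
      show "ennreal (norm (f y) / t ^ ?n) * indicator {y. norm (x - y) \<le> t} y \<le> ennreal (norm (f y) / norm (x - y) ^ ?n)"
      \<comment> \<open>At y = x the right-hand side is 0, being a division by zero; the assumption
        f x = 0 makes the left-hand side 0 too.\<close>
      proof (cases "norm (x - y) \<le> t \<and> x \<noteq> y")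
        case True
        then show ?thesis
          by (auto intro!: ennreal_leI divide_left_mono power_mono mult_pos_pos zero_less_power t)
      qed (use fx in auto)
    qed
    let ?k = "\<lambda>t y. ennreal (norm (f y) / t ^ (?n + 1)) * indicator {y. 0 < t \<and> norm (x - y) \<le> t} y"
    have ball: "{y. norm (x - y) \<le> t} \<in> sets lebesgue" for t
    proof -
      have "{y. norm (x - y) \<le> t} = cball x t" by (auto simp: dist_norm)
      then show ?thesis by simp
    qed
    have "G_integral \<beta> f x \<le> (\<integral>\<^sup>+t. ennreal (9 * s) * (\<integral>\<^sup>+y. ?k t y \<partial>lebesgue) \<partial>lebesgue)"
      unfolding G_integral_def
    proof (rule nn_integral_mono)
      fix t :: real
      show "(A_fun \<beta> f x t)\<^sup>2 / ennreal t * indicator {0<..} t \<le> ennreal (9 * s) * (\<integral>\<^sup>+y. ?k t y \<partial>lebesgue)"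
      proof (cases "0 < t")
        case t: True
        have A: "A_fun \<beta> f x t \<le> ennreal 3 * a t" unfolding a_def by (rule A_fun_le_average[OF \<beta> t f])
        also have "\<dots> \<le> ennreal 3 * S" by (intro mult_left_mono aS t) auto
        finally have A2: "A_fun \<beta> f x t \<le> ennreal (3 * s)" by (simp add: s ennreal_mult)
        have "(A_fun \<beta> f x t)\<^sup>2 \<le> ennreal (3 * s) * (ennreal 3 * a t)"
          unfolding power2_eq_square by (intro mult_mono A A2) auto
        also have "\<dots> = ennreal (9 * s) * a t"
        proof -
          have "ennreal (3 * s) * ennreal 3 = ennreal (9 * s)"
            using s by (simp add: ennreal_mult[symmetric] del: ennreal_numeral)
          then show ?thesis by (simp only: mult.assoc[symmetric])
        qed
        finally have "(A_fun \<beta> f x t)\<^sup>2 / ennreal t \<le> ennreal (9 * s) * a t / ennreal t" by (rule divide_right_mono_ennreal)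
        also have "\<dots> = ennreal (9 * s) * (a t * ennreal (1 / t))"
          by (simp only: ennreal_divide_real[OF t] mult.assoc)
        also have "a t * ennreal (1 / t) = (\<integral>\<^sup>+y. ennreal (norm (f y) / t ^ ?n) * indicator {y. norm (x - y) \<le> t} y * ennreal (1 / t) \<partial>lebesgue)"
          unfolding a_def using ball[of t] by (intro nn_integral_multc[symmetric] borel_measurable_times_ennreal borel_measurable_indicator) auto
        also have "\<dots> = (\<integral>\<^sup>+y. ?k t y \<partial>lebesgue)"
          using t by (intro nn_integral_cong) (auto simp: ennreal_mult[symmetric] mult_ac split: split_indicator)
        finally show ?thesis using t by simp
      qed simp
    qed
    also have "\<dots> = ennreal (9 * s) * (\<integral>\<^sup>+y. (\<integral>\<^sup>+t. ?k t y \<partial>lebesgue) \<partial>lebesgue)"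
    proof -
      have "{p\<in>space (lebesgue \<Otimes>\<^sub>M lebesgue). 0 < fst p \<and> norm (x - snd p) \<le> fst p} \<in> sets ((lebesgue::real measure) \<Otimes>\<^sub>M (lebesgue :: 'a measure))"
        by measurable
      then have ind: "{p. 0 < fst p \<and> norm (x - snd p) \<le> fst p} \<in> sets ((lebesgue::real measure) \<Otimes>\<^sub>M (lebesgue :: 'a measure))"
        by (simp add: space_pair_measure)
      have 1: "(\<lambda>p. f (snd p)) \<in> borel_measurable ((lebesgue::real measure) \<Otimes>\<^sub>M (lebesgue :: 'a measure))"
        by (rule measurable_compose[OF measurable_snd f])
      have 2: "(\<lambda>p. norm (f (snd p))) \<in> borel_measurable ((lebesgue::real measure) \<Otimes>\<^sub>M (lebesgue :: 'a measure))"
        by (rule measurable_compose[OF 1 borel_measurable_norm])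
      have "(\<lambda>p. ennreal (norm (f (snd p)) / (fst p) ^ (?n + 1)) * indicator {p. 0 < fst p \<and> norm (x - snd p) \<le> fst p} p) \<in> borel_measurable ((lebesgue::real measure) \<Otimes>\<^sub>M (lebesgue :: 'a measure))"
        by (intro borel_measurable_times_ennreal borel_measurable_indicator ind measurable_compose[OF _ measurable_ennreal] borel_measurable_divide 2 borel_measurable_power measurable_fst_lebesgue)
      also have "(\<lambda>p. ennreal (norm (f (snd p)) / (fst p) ^ (?n + 1)) * indicator {p. 0 < fst p \<and> norm (x - snd p) \<le> fst p} p) = (\<lambda>(t, y). ?k t y)"
        by (auto simp: fun_eq_iff split: split_indicator)
      finally have m: "(\<lambda>(t, y). ?k t y) \<in> borel_measurable ((lebesgue::real measure) \<Otimes>\<^sub>M (lebesgue :: 'a measure))" .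
      have "(\<integral>\<^sup>+t. ennreal (9 * s) * (\<integral>\<^sup>+y. ?k t y \<partial>lebesgue) \<partial>lebesgue) = ennreal (9 * s) * (\<integral>\<^sup>+t. (\<integral>\<^sup>+y. ?k t y \<partial>lebesgue) \<partial>lebesgue)"
        by (intro nn_integral_cmult sigma_finite_measure.borel_measurable_nn_integral[OF sigma_finite_lebesgue m])
      also have "(\<integral>\<^sup>+t. (\<integral>\<^sup>+y. ?k t y \<partial>lebesgue) \<partial>lebesgue) = (\<integral>\<^sup>+y. (\<integral>\<^sup>+t. ?k t y \<partial>lebesgue) \<partial>lebesgue)"
        by (rule pair_sigma_finite.Fubini'[OF pair_sigma_finite_lebesgue m, symmetric])
      finally show ?thesis .
    qed
    also have "(\<integral>\<^sup>+y. (\<integral>\<^sup>+t. ?k t y \<partial>lebesgue) \<partial>lebesgue) \<le> S"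
      unfolding S_def
    proof (rule nn_integral_mono)
      fix y
      show "(\<integral>\<^sup>+t. ?k t y \<partial>lebesgue) \<le> ennreal (norm (f y) / norm (x - y) ^ ?n)"
      proof (cases "x = y")
        case True then show ?thesis using fx by simp
      next
        case False
        define d where "d = norm (x - y)"
        have d: "0 < d" using False by (simp add: d_def)
        have "(\<integral>\<^sup>+t. ?k t y \<partial>lebesgue) = (\<integral>\<^sup>+t. ennreal (norm (f y)) * (ennreal (1 / t ^ (?n + 1)) * indicator {d..} t) \<partial>lebesgue)"
        proof (rule nn_integral_cong)
          fix t :: real
          show "?k t y = ennreal (norm (f y)) * (ennreal (1 / t ^ (?n + 1)) * indicator {d..} t)"
          proof (cases "d \<le> t")
            case True
            then have "0 < t" using d by simp
            then show ?thesis using True by (simp add: d_def ennreal_mult[symmetric])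
          qed (simp add: d_def)
        qed
        also have "\<dots> = (\<integral>\<^sup>+t. ennreal (norm (f y)) * (ennreal (1 / t ^ (?n + 1)) * indicator {d..} t) \<partial>lborel)"
          by (rule nn_integral_completion)
        also have "\<dots> = ennreal (norm (f y)) * (\<integral>\<^sup>+t\<in>{d..}. ennreal (1 / t ^ (?n + 1)) \<partial>lborel)"
          by (rule nn_integral_cmult) measurable
        also have "\<dots> \<le> ennreal (norm (f y)) * ennreal (1 / d ^ ?n)"
          using d by (intro mult_left_mono nn_integral_inverse_power_le) auto
        also have "\<dots> = ennreal (norm (f y) / norm (x - y) ^ ?n)" using d by (simp add: ennreal_mult[symmetric] d_def)
        finally show ?thesis .
      qed
    qed
    finally have "G_integral \<beta> f x \<le> ennreal (9 * s) * S" by (simp add: mult_left_mono)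
    also have "\<dots> = ennreal ((3 * s)\<^sup>2)" using s by (simp add: ennreal_mult[symmetric] power2_eq_square)
    finally have "G_integral \<beta> f x \<le> ennreal ((3 * s)\<^sup>2)" .
    then have "G_fun \<beta> f x \<le> ennreal (3 * s)"
      using s by (subst G_fun_le_iff) auto
    then show ?thesis using s by (simp add: S_def[symmetric] ennreal_mult)
  qed
qed

section \<open>Measurability and subadditivity of G\<close>

definition loc_integrable :: "('a::euclidean_space \<Rightarrow> complex) \<Rightarrow> bool" where
  "loc_integrable f \<longleftrightarrow> f \<in> borel_measurable lebesgue \<and> (\<forall>R. integrable lebesgue (\<lambda>y. indicator (cball 0 R) y *\<^sub>R f y))"

lemma convol_integrable:
  fixes f :: "'a::euclidean_space \<Rightarrow> complex"
  assumes \<beta>: "0 < \<beta>" "\<beta> \<le> 1" and \<phi>: "\<phi> \<in> test_class \<beta>" and t: "0 < t" and f: "loc_integrable f"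
  shows "integrable lebesgue (\<lambda>y. f y * dilate t \<phi> (x - y))"
proof (rule Bochner_Integration.integrable_bound)
  let ?R = "norm x + t"
  show "integrable lebesgue (\<lambda>y. (3 / t ^ DIM('a)) *\<^sub>R (indicator (cball 0 ?R) y *\<^sub>R f y))"
    using f unfolding loc_integrable_def by (intro integrable_scaleR_right) blast
  have [measurable]: "f \<in> borel_measurable lebesgue" using f by (simp add: loc_integrable_def)
  have cont: "continuous_on UNIV (\<lambda>y. dilate t \<phi> (x - y))"
    unfolding dilate_def by (intro continuous_intros continuous_on_compose2[OF test_class_continuous[OF \<beta>(1) \<phi>]]) auto
  have [measurable]: "(\<lambda>y. dilate t \<phi> (x - y)) \<in> borel_measurable lebesgue"
    using borel_measurable_continuous_onI[OF cont] by (simp add: measurable_completion)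
  show "(\<lambda>y. f y * dilate t \<phi> (x - y)) \<in> borel_measurable lebesgue" by measurable
  show "AE y in lebesgue. norm (f y * dilate t \<phi> (x - y)) \<le> norm ((3 / t ^ DIM('a)) *\<^sub>R (indicator (cball 0 ?R) y *\<^sub>R f y))"
  proof (intro AE_I2)
    fix y
    have "norm y \<le> ?R" if "norm (x - y) \<le> t" using that norm_triangle_ineq4[of x "x - y"] by simp
    then have "indicator {u. norm u \<le> t} (x - y) \<le> (indicator (cball 0 ?R) y :: real)" by (auto split: split_indicator)
    then have "3 / t ^ DIM('a) * indicator {u. norm u \<le> t} (x - y) \<le> 3 / t ^ DIM('a) * (indicator (cball 0 ?R) y :: real)"
      using t by (intro mult_left_mono) auto
    then have "norm (dilate t \<phi> (x - y)) \<le> 3 / t ^ DIM('a) * indicator (cball 0 ?R) y"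
      using norm_dilate_le[OF \<beta> \<phi> t, of "x - y"] by simp
    then have "norm (f y) * norm (dilate t \<phi> (x - y)) \<le> norm (f y) * (3 / t ^ DIM('a) * indicator (cball 0 ?R) y)"
      by (rule mult_left_mono) simp
    then show "norm (f y * dilate t \<phi> (x - y)) \<le> norm ((3 / t ^ DIM('a)) *\<^sub>R (indicator (cball 0 ?R) y *\<^sub>R f y))"
      using t by (simp add: norm_mult mult_ac)
  qed
qed

text \<open>Dominated convergence along sequences: a sequence of points (x, t) converging to one
  with t > 0 keeps x, t and 1/t bounded, which gives the dilates a common supporting ball and a
  common bound.\<close>

lemma convol_continuous:
  fixes f :: "'a::euclidean_space \<Rightarrow> complex"
  assumes \<beta>: "0 < \<beta>" "\<beta> \<le> 1" and \<phi>: "\<phi> \<in> test_class \<beta>" and f: "loc_integrable f"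
  shows "continuous_on (UNIV \<times> {0<..}) (\<lambda>p. convol f (dilate (snd p) \<phi>) (fst p))"
  unfolding continuous_on_sequentially
proof (intro allI impI ballI, elim conjE)
  fix u :: "nat \<Rightarrow> 'a \<times> real" and a
  assume a: "a \<in> UNIV \<times> {0<..}" and u: "\<forall>n. u n \<in> UNIV \<times> {0<..}" and lim: "u \<longlonglongrightarrow> a"
  have t0: "0 < snd a" "0 < snd (u n)" for n using a u by (auto simp: mem_Times_iff)
  have lim1: "(\<lambda>n. fst (u n)) \<longlonglongrightarrow> fst a" and lim2: "(\<lambda>n. snd (u n)) \<longlonglongrightarrow> snd a"
    using lim by (auto intro: tendsto_fst tendsto_snd)
  have lim3: "(\<lambda>n. inverse (snd (u n))) \<longlonglongrightarrow> inverse (snd a)" using lim2 t0 by (intro tendsto_inverse) auto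
  obtain B1 where B1: "\<And>n. norm (fst (u n)) \<le> B1" using convergentI[OF lim1, THEN convergent_imp_Bseq] unfolding Bseq_def by blast
  obtain B2 where B2: "\<And>n. norm (snd (u n)) \<le> B2" using convergentI[OF lim2, THEN convergent_imp_Bseq] unfolding Bseq_def by blast
  obtain B3 where B3: "\<And>n. norm (inverse (snd (u n))) \<le> B3" using convergentI[OF lim3, THEN convergent_imp_Bseq] unfolding Bseq_def by blast
  have B30: "0 \<le> B3" using B3[of 0] by (meson norm_ge_zero order_trans)
  have [measurable]: "f \<in> borel_measurable lebesgue" using f by (simp add: loc_integrable_def)
  have cont: "continuous_on UNIV (\<lambda>y. dilate t \<phi> (x - y))" for t x
    unfolding dilate_def by (intro continuous_intros continuous_on_compose2[OF test_class_continuous[OF \<beta>(1) \<phi>]]) auto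
  have [measurable]: "(\<lambda>y. dilate t \<phi> (x - y)) \<in> borel_measurable lebesgue" for t x
    using borel_measurable_continuous_onI[OF cont] by (simp add: measurable_completion)
  have "(\<lambda>n. \<integral>y. f y * dilate (snd (u n)) \<phi> (fst (u n) - y) \<partial>lebesgue) \<longlonglongrightarrow> (\<integral>y. f y * dilate (snd a) \<phi> (fst a - y) \<partial>lebesgue)"
  proof (rule integral_dominated_convergence[where w="\<lambda>y. 3 * B3 ^ DIM('a) * norm (indicator (cball 0 (B1 + B2)) y *\<^sub>R f y)"])
    show "integrable lebesgue (\<lambda>y. 3 * B3 ^ DIM('a) * norm (indicator (cball 0 (B1 + B2)) y *\<^sub>R f y))"
      using f by (intro integrable_mult_right integrable_norm) (simp add: loc_integrable_def)
    show "AE y in lebesgue. (\<lambda>n. f y * dilate (snd (u n)) \<phi> (fst (u n) - y)) \<longlonglongrightarrow> f y * dilate (snd a) \<phi> (fst a - y)"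
    proof (intro AE_I2 tendsto_mult tendsto_const)
      fix y
      have "isCont \<phi> v" for v using test_class_continuous[OF \<beta>(1) \<phi>] by (simp add: continuous_on_eq_continuous_at)
      then have "(\<lambda>n. \<phi> ((fst (u n) - y) /\<^sub>R snd (u n))) \<longlonglongrightarrow> \<phi> ((fst a - y) /\<^sub>R snd a)"
        by (rule isCont_tendsto_compose) (intro tendsto_intros lim1 lim3)
      then show "(\<lambda>n. dilate (snd (u n)) \<phi> (fst (u n) - y)) \<longlonglongrightarrow> dilate (snd a) \<phi> (fst a - y)"
        unfolding dilate_def using t0 by (intro tendsto_intros lim2) auto
    qed
    fix n
    show "AE y in lebesgue. norm (f y * dilate (snd (u n)) \<phi> (fst (u n) - y)) \<le> 3 * B3 ^ DIM('a) * norm (indicator (cball 0 (B1 + B2)) y *\<^sub>R f y)"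
    proof (intro AE_I2)
      fix y
      let ?t = "snd (u n)" and ?x = "fst (u n)"
      have "norm y \<le> B1 + B2" if "norm (?x - y) \<le> ?t"
      proof -
        have "norm y \<le> norm ?x + norm (?x - y)" using norm_triangle_ineq4[of ?x "?x - y"] by simp
        also have "\<dots> \<le> B1 + B2" using B1[of n] B2[of n] that t0(2)[of n] by (intro add_mono) auto
        finally show ?thesis .
      qed
      then have i: "indicator {u. norm u \<le> ?t} (?x - y) \<le> (indicator (cball 0 (B1 + B2)) y :: real)" by (auto split: split_indicator)
      have "inverse ?t ^ DIM('a) \<le> B3 ^ DIM('a)" using B3[of n] t0(2)[of n] by (intro power_mono) auto
      then have "3 / ?t ^ DIM('a) \<le> 3 * B3 ^ DIM('a)" by (simp add: divide_inverse power_inverse)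
      then have "3 / ?t ^ DIM('a) * indicator {u. norm u \<le> ?t} (?x - y) \<le> 3 * B3 ^ DIM('a) * (indicator (cball 0 (B1 + B2)) y :: real)"
        using i B30 by (intro mult_mono) auto
      then have "norm (dilate ?t \<phi> (?x - y)) \<le> 3 * B3 ^ DIM('a) * indicator (cball 0 (B1 + B2)) y"
        using norm_dilate_le[OF \<beta> \<phi> t0(2), of n "?x - y"] by linarith
      then have "norm (f y) * norm (dilate ?t \<phi> (?x - y)) \<le> norm (f y) * (3 * B3 ^ DIM('a) * indicator (cball 0 (B1 + B2)) y)"
        by (rule mult_left_mono) simp
      then show "norm (f y * dilate ?t \<phi> (?x - y)) \<le> 3 * B3 ^ DIM('a) * norm (indicator (cball 0 (B1 + B2)) y *\<^sub>R f y)"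
        by (simp add: norm_mult mult_ac)
    qed
  qed measurable
  then show "((\<lambda>p. convol f (dilate (snd p) \<phi>) (fst p)) \<circ> u) \<longlonglongrightarrow> convol f (dilate (snd a) \<phi>) (fst a)"
    by (simp add: convol_def o_def)
qed

text \<open>The supremum in \<open>A_fun\<close> runs over an uncountable family, so measurability
  is not inherited termwise. A superlevel set of a supremum of continuous functions is a union of
  open sets.\<close>

lemma A_fun_lower_semicontinuous:
  fixes f :: "'a::euclidean_space \<Rightarrow> complex"
  assumes \<beta>: "0 < \<beta>" "\<beta> \<le> 1" and f: "loc_integrable f"
  shows "open {p. 0 < snd p \<and> c < A_fun \<beta> f (fst p) (snd p)}"
proof -
  have "open ((UNIV \<times> {0<..}) \<inter> (\<lambda>p. ennreal (norm (convol f (dilate (snd p) \<phi>) (fst p)))) -` {c<..})" if "\<phi> \<in> test_class \<beta>" for \<phi>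
    by (intro continuous_open_preimage continuous_on_ennreal continuous_on_norm convol_continuous[OF \<beta> that f] open_Times) auto
  then have "open (\<Union>\<phi>\<in>test_class \<beta>. (UNIV \<times> {0<..}) \<inter> (\<lambda>p. ennreal (norm (convol f (dilate (snd p) \<phi>) (fst p)))) -` {c<..})"
    by (intro open_UN) auto
  also have "\<dots> = {p. 0 < snd p \<and> c < A_fun \<beta> f (fst p) (snd p)}"
    by (auto simp: A_fun_def less_SUP_iff)
  finally show ?thesis .
qed

lemma A_fun_measurable:
  fixes f :: "'a::euclidean_space \<Rightarrow> complex"
  assumes \<beta>: "0 < \<beta>" "\<beta> \<le> 1" and f: "loc_integrable f"
  shows "(\<lambda>p. A_fun \<beta> f (fst p) (snd p) * indicator {0<..} (snd p)) \<in> borel_measurable (borel \<Otimes>\<^sub>M borel)"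
  unfolding borel_prod
proof (rule borel_measurableI_greater)
  fix c
  have "{p \<in> space borel. c < A_fun \<beta> f (fst p) (snd p) * indicator {0<..} (snd p)} = {p. 0 < snd p \<and> c < A_fun \<beta> f (fst p) (snd p)}"
    by (auto split: split_indicator_asm split_indicator)
  then show "{p \<in> space borel. c < A_fun \<beta> f (fst p) (snd p) * indicator {0<..} (snd p)} \<in> sets borel"
    using A_fun_lower_semicontinuous[OF assms] by simp
qed

lemma G_integrand_measurable:
  fixes f :: "'a::euclidean_space \<Rightarrow> complex"
  assumes \<beta>: "0 < \<beta>" "\<beta> \<le> 1" and f: "loc_integrable f"
  shows "(\<lambda>p. (A_fun \<beta> f (fst p) (snd p))\<^sup>2 / ennreal (snd p) * indicator {0<..} (snd p)) \<in> borel_measurable (borel \<Otimes>\<^sub>M borel)"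
proof -
  note [measurable] = A_fun_measurable[OF assms]
  have "(\<lambda>p. (A_fun \<beta> f (fst p) (snd p) * indicator {0<..} (snd p))\<^sup>2 / ennreal (snd p)) \<in> borel_measurable (borel \<Otimes>\<^sub>M borel)"
    by measurable
  also have "(\<lambda>p. (A_fun \<beta> f (fst p) (snd p) * indicator {0<..} (snd p))\<^sup>2 / ennreal (snd p))
     = (\<lambda>p. (A_fun \<beta> f (fst p) (snd p))\<^sup>2 / ennreal (snd p) * indicator {0<..} (snd p))"
    by (auto simp: fun_eq_iff split: split_indicator)
  finally show ?thesis .
qed

lemma G_integrand_measurable_section:
  fixes f :: "'a::euclidean_space \<Rightarrow> complex"
  assumes \<beta>: "0 < \<beta>" "\<beta> \<le> 1" and f: "loc_integrable f"
  shows "(\<lambda>t. (A_fun \<beta> f x t)\<^sup>2 / ennreal t * indicator {0<..} t) \<in> borel_measurable lebesgue"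
proof -
  have "(\<lambda>t. (A_fun \<beta> f x t)\<^sup>2 / ennreal t * indicator {0<..} t) \<in> borel_measurable borel"
    using measurable_compose[OF measurable_Pair1'[of x borel borel] G_integrand_measurable[OF assms]] by simp
  then show ?thesis by (simp add: measurable_completion)
qed

lemma G_fun_measurable:
  fixes f :: "'a::euclidean_space \<Rightarrow> complex"
  assumes \<beta>: "0 < \<beta>" "\<beta> \<le> 1" and f: "loc_integrable f"
  shows "G_fun \<beta> f \<in> borel_measurable lebesgue"
proof -
  have "(\<lambda>x. \<integral>\<^sup>+t. (A_fun \<beta> f x t)\<^sup>2 / ennreal t * indicator {0<..} t \<partial>lborel) \<in> borel_measurable borel"
    by (rule sigma_finite_measure.borel_measurable_nn_integral[OF sigma_finite_lborel])
       (use G_integrand_measurable[OF assms] in \<open>simp add: case_prod_unfold cong: measurable_cong_sets sets_pair_measure_cong\<close>)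
  moreover have "G_integral \<beta> f x = (\<integral>\<^sup>+t. (A_fun \<beta> f x t)\<^sup>2 / ennreal t * indicator {0<..} t \<partial>lborel)" for x
    unfolding G_integral_def by (rule nn_integral_completion)
  ultimately have "G_integral \<beta> f \<in> borel_measurable borel" by (simp add: fun_eq_iff[symmetric] cong: measurable_cong)
  then have "(\<lambda>x. ennpow (G_integral \<beta> f x) (1 / 2)) \<in> borel_measurable borel"
    by (rule measurable_compose[OF _ borel_measurable_ennpow])
  then show ?thesis
    unfolding G_fun_def[abs_def] G_integral_def by (simp add: measurable_completion)
qed

lemma A_fun_triangle:
  fixes f g h :: "'a::euclidean_space \<Rightarrow> complex"
  assumes \<beta>: "0 < \<beta>" "\<beta> \<le> 1" and f: "loc_integrable f" "loc_integrable g" "loc_integrable h" and t: "0 < t"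
  shows "A_fun \<beta> (\<lambda>y. f y + g y + h y) x t \<le> A_fun \<beta> f x t + A_fun \<beta> g x t + A_fun \<beta> h x t"
  unfolding A_fun_def[of _ "\<lambda>y. f y + g y + h y"]
proof (rule SUP_least)
  fix \<phi> :: "'a \<Rightarrow> complex" assume \<phi>: "\<phi> \<in> test_class \<beta>"
  have "convol (\<lambda>y. f y + g y + h y) (dilate t \<phi>) x = convol f (dilate t \<phi>) x + convol g (dilate t \<phi>) x + convol h (dilate t \<phi>) x"
    unfolding convol_def using f[THEN convol_integrable[OF \<beta> \<phi> t]] by (simp add: distrib_right)
  then have "norm (convol (\<lambda>y. f y + g y + h y) (dilate t \<phi>) x) \<le> norm (convol f (dilate t \<phi>) x) + norm (convol g (dilate t \<phi>) x) + norm (convol h (dilate t \<phi>) x)"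
    using norm_triangle_ineq[of "convol f (dilate t \<phi>) x + convol g (dilate t \<phi>) x" "convol h (dilate t \<phi>) x"]
      norm_triangle_ineq[of "convol f (dilate t \<phi>) x" "convol g (dilate t \<phi>) x"] by simp
  then have "ennreal (norm (convol (\<lambda>y. f y + g y + h y) (dilate t \<phi>) x)) \<le> ennreal (norm (convol f (dilate t \<phi>) x)) + ennreal (norm (convol g (dilate t \<phi>) x)) + ennreal (norm (convol h (dilate t \<phi>) x))"
    by (simp add: ennreal_plus[symmetric] ennreal_leI del: ennreal_plus)
  also have "\<dots> \<le> A_fun \<beta> f x t + A_fun \<beta> g x t + A_fun \<beta> h x t"
    unfolding A_fun_def using \<phi> by (intro add_mono SUP_upper)
  finally show "ennreal (norm (convol (\<lambda>y. f y + g y + h y) (dilate t \<phi>) x)) \<le> A_fun \<beta> f x t + A_fun \<beta> g x t + A_fun \<beta> h x t" .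
qed

lemma ennreal_square_sum3_le: "(a + b + c)\<^sup>2 \<le> 3 * (a\<^sup>2 + b\<^sup>2 + (c::ennreal)\<^sup>2)"
proof (cases a; cases b; cases c)
  fix x y z assume r: "a = ennreal x" "0 \<le> x" "b = ennreal y" "0 \<le> y" "c = ennreal z" "0 \<le> z"
  have "(x + y + z)\<^sup>2 \<le> 3 * (x\<^sup>2 + y\<^sup>2 + z\<^sup>2)"
  proof -
    have "3 * (x\<^sup>2 + y\<^sup>2 + z\<^sup>2) - (x + y + z)\<^sup>2 = (x - y)\<^sup>2 + (y - z)\<^sup>2 + (x - z)\<^sup>2"
      by (simp add: power2_eq_square algebra_simps)
    then show ?thesis by (smt (verit) zero_le_power2)
  qed
  then have "ennreal ((x + y + z)\<^sup>2) \<le> ennreal (3 * (x\<^sup>2 + y\<^sup>2 + z\<^sup>2))" by (rule ennreal_leI)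
  then show ?thesis
    using r by (simp add: ennreal_power[symmetric] ennreal_mult ennreal_plus)
qed (auto simp: power2_eq_square ennreal_mult_top ennreal_top_mult)

text \<open>Pigeonhole based on (a + b + c)^2 \<le> 3 (a^2 + b^2 + c^2): if all three parts were at
  most c/3, then G^2 would be at most 3 times 3 times (c/3)^2, which is c^2.\<close>

lemma G_fun_split:
  fixes f g h :: "'a::euclidean_space \<Rightarrow> complex"
  assumes \<beta>: "0 < \<beta>" "\<beta> \<le> 1" and f: "loc_integrable f" "loc_integrable g" "loc_integrable h" and c: "0 \<le> c"
    and G: "ennreal c < G_fun \<beta> (\<lambda>y. f y + g y + h y) x"
  shows "ennreal (c / 3) < G_fun \<beta> f x \<or> ennreal (c / 3) < G_fun \<beta> g x \<or> ennreal (c / 3) < G_fun \<beta> h x"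
proof (rule ccontr)
  assume "\<not> ?thesis"
  then have small: "G_integral \<beta> f x \<le> ennreal ((c / 3)\<^sup>2)" "G_integral \<beta> g x \<le> ennreal ((c / 3)\<^sup>2)" "G_integral \<beta> h x \<le> ennreal ((c / 3)\<^sup>2)"
    using c by (simp_all add: not_less G_fun_le_iff)
  let ?k = "\<lambda>f t. (A_fun \<beta> f x t)\<^sup>2 / ennreal t * indicator {0<..} t"
  have "G_integral \<beta> (\<lambda>y. f y + g y + h y) x \<le> (\<integral>\<^sup>+t. 3 * (?k f t + ?k g t + ?k h t) \<partial>lebesgue)"
    unfolding G_integral_def
  proof (rule nn_integral_mono)
    fix t :: real
    show "?k (\<lambda>y. f y + g y + h y) t \<le> 3 * (?k f t + ?k g t + ?k h t)"
    proof (cases "0 < t")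
      case True
      have "(A_fun \<beta> (\<lambda>y. f y + g y + h y) x t)\<^sup>2 \<le> (A_fun \<beta> f x t + A_fun \<beta> g x t + A_fun \<beta> h x t)\<^sup>2"
        by (intro power_mono A_fun_triangle[OF \<beta> f True]) auto
      also have "\<dots> \<le> 3 * ((A_fun \<beta> f x t)\<^sup>2 + (A_fun \<beta> g x t)\<^sup>2 + (A_fun \<beta> h x t)\<^sup>2)"
        by (rule ennreal_square_sum3_le)
      finally have "(A_fun \<beta> (\<lambda>y. f y + g y + h y) x t)\<^sup>2 / ennreal t \<le> 3 * ((A_fun \<beta> f x t)\<^sup>2 + (A_fun \<beta> g x t)\<^sup>2 + (A_fun \<beta> h x t)\<^sup>2) / ennreal t"
        by (rule divide_right_mono_ennreal)
      then show ?thesis using True by (simp add: ennreal_divide_real distrib_right mult.assoc)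
    qed simp
  qed
  also have "\<dots> = 3 * (G_integral \<beta> f x + G_integral \<beta> g x + G_integral \<beta> h x)"
    using f[THEN G_integrand_measurable_section[OF \<beta>], of x] unfolding G_integral_def
    by (subst nn_integral_cmult, simp) (simp add: nn_integral_add)
  also have "\<dots> \<le> 3 * (ennreal ((c / 3)\<^sup>2) + ennreal ((c / 3)\<^sup>2) + ennreal ((c / 3)\<^sup>2))"
    by (intro mult_left_mono add_mono small) auto
  also have "\<dots> = ennreal (c\<^sup>2)"
  proof -
    define e where "e = (c / 3)\<^sup>2 + (c / 3)\<^sup>2 + (c / 3)\<^sup>2"
    have "ennreal ((c / 3)\<^sup>2) + ennreal ((c / 3)\<^sup>2) + ennreal ((c / 3)\<^sup>2) = ennreal e"
      unfolding e_def by (simp only: ennreal_plus add_nonneg_nonneg zero_le_power2)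
    moreover have "3 * ennreal e = ennreal (3 * e)"
      using ennreal_mult[of 3 e] by (simp add: e_def)
    moreover have "3 * e = c\<^sup>2" by (simp add: e_def power2_eq_square)
    ultimately show ?thesis by simp
  qed
  finally show False using G less_G_fun_iff[OF c, of \<beta> "\<lambda>y. f y + g y + h y" x] by auto
qed

section \<open>Extended real powers and sums\<close>

lemma ennpow_mono:
  assumes r: "0 < r" and le: "x \<le> y" shows "ennpow x r \<le> ennpow y r"
proof (cases x; cases y)
  fix a b assume "x = ennreal a" "0 \<le> a" "y = ennreal b" "0 \<le> b"
  then show ?thesis using le r by (simp add: ennpow_ennreal_pos ennreal_leI powr_mono2)
qed (use le r in \<open>auto simp: ennpow_def top_unique\<close>)

lemma ennpow_mult:
  assumes r: "0 < r" shows "ennpow (x * y) r = ennpow x r * ennpow y r"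
proof (cases x; cases y)
  fix a b assume "x = ennreal a" "0 \<le> a" "y = ennreal b" "0 \<le> b"
  then show ?thesis using r by (simp add: ennreal_mult[symmetric] ennpow_ennreal_pos powr_mult)
next
  fix a assume "x = ennreal a" "0 \<le> a" "y = top"
  then show ?thesis using r by (cases "a = 0") (auto simp: ennpow_def ennreal_mult_top)
next
  fix b assume "x = top" "y = ennreal b" "0 \<le> b"
  then show ?thesis using r by (cases "b = 0") (auto simp: ennpow_def ennreal_top_mult)
qed (use r in \<open>auto simp: ennpow_def\<close>)

lemma ennpow_ennpow:
  assumes "0 < r" "0 < s" shows "ennpow (ennpow x r) s = ennpow x (r * s)"
proof (cases x)
  case (real a)
  then show ?thesis using assms by (simp add: ennpow_ennreal_pos powr_powr)
qed (use assms in \<open>auto simp: ennpow_def mult_less_0_iff\<close>)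

lemma ennpow_zero: "0 < r \<Longrightarrow> ennpow 0 r = 0"
  by (simp add: ennpow_def)

lemma ennpow_one_left: "ennpow 1 r = 1"
  by (simp add: ennpow_def)

lemma ennpow_one [simp]: "ennpow x 1 = x"
  by (cases x) (auto simp: ennpow_def less_top)

text \<open>Moves an exponent to the other side, so that a bound on a power of an infinite sum
  reduces to its finite partial sums.\<close>

lemma ennpow_le_iff:
  assumes r: "0 < r" shows "ennpow x r \<le> y \<longleftrightarrow> x \<le> ennpow y (1 / r)"
proof
  assume "ennpow x r \<le> y"
  then have "ennpow (ennpow x r) (1 / r) \<le> ennpow y (1 / r)" using r by (intro ennpow_mono) auto
  then show "x \<le> ennpow y (1 / r)" using r by (simp add: ennpow_ennpow)
next
  assume "x \<le> ennpow y (1 / r)"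
  then have "ennpow x r \<le> ennpow (ennpow y (1 / r)) r" using r by (intro ennpow_mono) auto
  then show "ennpow x r \<le> y" using r by (simp add: ennpow_ennpow)
qed

text \<open>After division by a + b both terms lie in the unit interval, where u \<le> u^r.\<close>

lemma powr_add_le:
  fixes a b :: real
  assumes "0 \<le> a" "0 \<le> b" "0 < r" "r \<le> 1" shows "(a + b) powr r \<le> a powr r + b powr r"
proof (cases "a + b = 0")
  case True then show ?thesis using assms by simp
next
  case False
  then have s: "0 < a + b" using assms by simp
  have *: "u \<le> u powr r" if "0 \<le> u" "u \<le> 1" for u :: real
    using that assms powr_mono'[of r 1 u] by (cases "u = 0") auto
  have "1 = a / (a + b) + b / (a + b)" using s by (simp add: add_divide_distrib[symmetric])
  also have "\<dots> \<le> (a / (a + b)) powr r + (b / (a + b)) powr r"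
    using assms s by (intro add_mono *) auto
  also have "\<dots> = (a powr r + b powr r) / (a + b) powr r"
    using assms s by (simp add: powr_divide add_divide_distrib)
  finally show ?thesis using s by (simp add: field_simps)
qed

lemma ennpow_add_le:
  assumes r: "0 < r" "r \<le> 1" shows "ennpow (x + y) r \<le> ennpow x r + ennpow y r"
proof (cases x; cases y)
  fix a b assume "x = ennreal a" "0 \<le> a" "y = ennreal b" "0 \<le> b"
  then show ?thesis using r powr_add_le[of a b r]
    by (simp add: ennreal_plus[symmetric] ennpow_ennreal_pos ennreal_leI del: ennreal_plus)
qed (use r in \<open>auto simp: ennpow_def\<close>)

lemma ennpow_sum_le:
  assumes "finite F" "0 < r" "r \<le> 1" shows "ennpow (sum f F) r \<le> (\<Sum>i\<in>F. ennpow (f i) r)"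
  using assms
proof (induction F rule: finite_induct)
  case (insert i F)
  then show ?case using ennpow_add_le[of r "f i" "sum f F"] by (auto intro: order_trans add_left_mono)
qed (simp add: ennpow_def)

section \<open>Countable sums\<close>

lemma sum_le_nn_integral_count_space:
  assumes "finite F" "F \<subseteq> I" shows "sum f F \<le> (\<integral>\<^sup>+i. f i \<partial>count_space I)"
proof -
  have "sum f F = (\<integral>\<^sup>+i. f i * indicator F i \<partial>count_space I)"
    using assms by (subst nn_integral_count_space'[where A=F]) auto
  also have "\<dots> \<le> (\<integral>\<^sup>+i. f i \<partial>count_space I)"
    by (intro nn_integral_mono) (auto split: split_indicator)
  finally show ?thesis .
qed

lemma infsum_eq_nn_integral_count_space:
  fixes f :: "'i \<Rightarrow> ennreal"
  assumes I: "countable I" shows "(\<Sum>\<^sub>\<infinity>i\<in>I. f i) = (\<integral>\<^sup>+i. f i \<partial>count_space I)"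
proof (rule antisym)
  have eq: "(\<Sum>\<^sub>\<infinity>i\<in>I. f i) = (SUP F\<in>{F. finite F \<and> F \<subseteq> I}. sum f F)"
    by (rule nonneg_infsum_complete) simp
  show "(\<Sum>\<^sub>\<infinity>i\<in>I. f i) \<le> (\<integral>\<^sup>+i. f i \<partial>count_space I)"
    unfolding eq by (intro SUP_least sum_le_nn_integral_count_space) auto
  show "(\<integral>\<^sup>+i. f i \<partial>count_space I) \<le> (\<Sum>\<^sub>\<infinity>i\<in>I. f i)"
    unfolding eq using I by (intro nn_integral_count_space_le SUP_upper) auto
qed

text \<open>Subadditivity of the r-th power passes to countable sums. This is how p \<le> 1 enters
  the summation over cells.\<close>

lemma ennpow_nn_integral_count_space_le:
  assumes I: "countable I" and r: "0 < r" "r \<le> 1"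
  shows "ennpow (\<integral>\<^sup>+i. f i \<partial>count_space I) r \<le> (\<integral>\<^sup>+i. ennpow (f i) r \<partial>count_space I)"
  unfolding ennpow_le_iff[OF r(1)]
proof (rule nn_integral_count_space_le[OF I])
  fix F assume F: "finite F" "F \<subseteq> I"
  have "ennpow (sum f F) r \<le> (\<Sum>i\<in>F. ennpow (f i) r)" by (rule ennpow_sum_le[OF F(1) r])
  also have "\<dots> \<le> (\<integral>\<^sup>+i. ennpow (f i) r \<partial>count_space I)" by (rule sum_le_nn_integral_count_space[OF F])
  finally show "sum f F \<le> ennpow (\<integral>\<^sup>+i. ennpow (f i) r \<partial>count_space I) (1 / r)"
    unfolding ennpow_le_iff[OF r(1)] .
qed

text \<open>Schur's test on l^1, where bounded column sums of the kernel suffice.\<close>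

lemma nn_integral_count_space_kernel_le:
  fixes \<kappa> :: "'i \<Rightarrow> 'j \<Rightarrow> ennreal"
  assumes I: "countable I" "countable J" and le: "\<And>j. j \<in> J \<Longrightarrow> (\<integral>\<^sup>+i. \<kappa> i j \<partial>count_space I) \<le> M"
  shows "(\<integral>\<^sup>+i. (\<integral>\<^sup>+j. \<kappa> i j * y j \<partial>count_space J) \<partial>count_space I) \<le> M * (\<integral>\<^sup>+j. y j \<partial>count_space J)"
proof -
  have "(\<integral>\<^sup>+i. (\<integral>\<^sup>+j. \<kappa> i j * y j \<partial>count_space J) \<partial>count_space I) = (\<integral>\<^sup>+j. (\<integral>\<^sup>+i. \<kappa> i j * y j \<partial>count_space I) \<partial>count_space J)"
    by (rule nn_integral_count_space_nn_integral[OF I(2)]) simp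
  also have "\<dots> = (\<integral>\<^sup>+j. (\<integral>\<^sup>+i. \<kappa> i j \<partial>count_space I) * y j \<partial>count_space J)"
    by (intro nn_integral_cong nn_integral_multc) simp
  also have "\<dots> \<le> (\<integral>\<^sup>+j. M * y j \<partial>count_space J)"
    using le by (intro nn_integral_mono mult_right_mono) auto
  also have "\<dots> = M * (\<integral>\<^sup>+j. y j \<partial>count_space J)" by (rule nn_integral_cmult) simp
  finally show ?thesis .
qed

section \<open>Weights of dyadic balls\<close>

lemma dyadic_ball_sets [simp]: "dyadic_ball k \<in> sets lebesgue"
  by (simp add: dyadic_ball_def)

lemma dyadic_ball_mono: "j \<le> k \<Longrightarrow> dyadic_ball j \<subseteq> dyadic_ball k"
  unfolding dyadic_ball_def by (intro subset_cball power_int_increasing) auto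

lemma emeasure_dyadic_ball:
  "emeasure lebesgue (dyadic_ball k :: 'a::euclidean_space set) = ennreal (vol TYPE('a) * (2 powi k) ^ DIM('a))"
  unfolding dyadic_ball_def by (rule emeasure_lebesgue_cball) simp

lemma vol_nonzero: "vol TYPE('a::euclidean_space) \<noteq> 0"
  using unit_ball_vol_pos[of "real DIM('a)"] by linarith

definition ballweight :: "('a::euclidean_space \<Rightarrow> real) \<Rightarrow> int \<Rightarrow> real" where
  "ballweight w k = enn2real (wmeas w (dyadic_ball k))"

lemma dyadic_weight_le:
  fixes w :: "'a::euclidean_space \<Rightarrow> real"
  assumes av: "averaging s C w" and C: "0 \<le> C" and A: "A \<in> sets lebesgue" "A \<subseteq> dyadic_ball k"
    and e: "0 < e" "ennreal (e * (2 powi k) ^ DIM('a)) \<le> emeasure lebesgue A"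
  shows "wmeas w (dyadic_ball k) \<le> ennreal (C * (vol TYPE('a) * 2 ^ DIM('a) / e) powr s) * wmeas w A"
proof -
  have "wmeas w (cball 0 (1 * 2 powi k)) \<le> ennreal (C * (vol TYPE('a) * (1 + 1) ^ DIM('a) / e) powr s) * (\<integral>\<^sup>+x\<in>A. ennreal (\<bar>1\<bar> powr s * w x) \<partial>lebesgue)"
    using A e by (intro averaging_cball[OF av C]) (auto simp: dyadic_ball_def)
  then show ?thesis by (simp add: wmeas_def dyadic_ball_def)
qed

text \<open>If one dyadic ball had weight 0, the averaging property would pass this on to all larger
  ones and hence to the whole space, whereas a weight is not zero almost everywhere.\<close>

lemma ballweight:
  fixes w :: "'a::euclidean_space \<Rightarrow> real"
  assumes w: "weight w" and av: "averaging s C w" and C: "0 < C"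
  shows "wmeas w (dyadic_ball k) = ennreal (ballweight w k)" "0 < ballweight w k"
proof -
  show eq: "wmeas w (dyadic_ball k) = ennreal (ballweight w k)" for k
    using wmeas_cball_finite[OF w, of 0 "2 powi k"] by (simp add: ballweight_def dyadic_ball_def less_top)
  have [measurable]: "w \<in> borel_measurable lebesgue" by (rule weight_borel_measurable[OF w])
  have "wmeas w (dyadic_ball k) \<noteq> 0" for k
  proof
    assume 0: "wmeas w (dyadic_ball k) = 0"
    have z: "wmeas w (dyadic_ball j) = 0" if "k \<le> j" for j
    proof -
      define e where "e = vol TYPE('a) * (2 powi k / 2 powi j) ^ DIM('a)"
      have "0 < e" by (simp add: e_def)
      moreover have "e * (2 powi j) ^ DIM('a) = vol TYPE('a) * (2 powi k) ^ DIM('a)"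
        by (simp add: e_def power_divide)
      ultimately have "wmeas w (dyadic_ball j) \<le> ennreal (C * (vol TYPE('a) * 2 ^ DIM('a) / e) powr s) * wmeas w (dyadic_ball k)"
        using C that by (intro dyadic_weight_le[OF av]) (auto simp: emeasure_dyadic_ball dyadic_ball_mono simp del: emeasure_completion)
      then show ?thesis by (simp add: 0)
    qed
    have "AE x in lebesgue. \<forall>i. w x * indicator (dyadic_ball (int i)) x = 0"
    proof (subst AE_all_countable, intro allI)
      fix i :: nat
      have "wmeas w (dyadic_ball (int i)) = 0"
      proof (cases "k \<le> int i")
        case False
        then have "wmeas w (dyadic_ball (int i)) \<le> wmeas w (dyadic_ball k)" by (intro wmeas_mono dyadic_ball_mono) auto
        then show ?thesis by (simp add: 0)
      qed (rule z)
      then have "AE x in lebesgue. ennreal (w x) * indicator (dyadic_ball (int i)) x = 0"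
        unfolding wmeas_def by (subst (asm) nn_integral_0_iff_AE) (auto intro!: borel_measurable_times_ennreal borel_measurable_indicator)
      then show "AE x in lebesgue. w x * indicator (dyadic_ball (int i)) x = 0"
      proof eventually_elim
        case (elim x)
        then show ?case using weight_nonneg[OF w, of x] by (auto simp: ennreal_eq_0_iff split: split_indicator_asm split_indicator)
      qed
    qed
    then have "AE x in lebesgue. w x = 0"
    proof eventually_elim
      case (elim x)
      obtain i where "norm x \<le> 2 ^ i" using real_arch_pow[of 2 "norm x"] by (auto intro: less_imp_le)
      then have "x \<in> dyadic_ball (int i)" by (simp add: dyadic_ball_def)
      then show ?case using elim[rule_format, of i] by simp
    qed
    then show False using w by (simp add: weight_def)
  qed
  then have "ennreal (ballweight w k) \<noteq> 0" using eq by metis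
  then show "0 < ballweight w k" by (simp add: ennreal_eq_0_iff not_le)
qed

lemma ballweight_mono:
  fixes w :: "'a::euclidean_space \<Rightarrow> real"
  assumes w: "weight w" and "j \<le> k" shows "ballweight w j \<le> ballweight w k"
  unfolding ballweight_def
  using wmeas_mono[OF dyadic_ball_mono[OF assms(2)], of w] wmeas_cball_finite[OF w, of 0 "2 powi k"]
  by (intro enn2real_mono) (auto simp: dyadic_ball_def)

text \<open>The class exponent s is the growth rate of the weight in terms of volume. These rates
  for w1 and w2 are what the condition on \<alpha> balances.\<close>

lemma ballweight_doubling:
  fixes w :: "'a::euclidean_space \<Rightarrow> real"
  assumes w: "weight w" and av: "averaging s C w" and C: "0 < C" and jk: "j \<le> k"
  shows "ballweight w k \<le> C * (2 ^ DIM('a)) powr s * ((2 powi k / 2 powi j) ^ DIM('a)) powr s * ballweight w j"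
proof -
  define e where "e = vol TYPE('a) * (2 powi j / 2 powi k) ^ DIM('a)"
  have e: "0 < e" by (simp add: e_def)
  have ee: "e * (2 powi k) ^ DIM('a) = vol TYPE('a) * (2 powi j) ^ DIM('a)"
    by (simp add: e_def power_divide)
  have "wmeas w (dyadic_ball k) \<le> ennreal (C * (vol TYPE('a) * 2 ^ DIM('a) / e) powr s) * wmeas w (dyadic_ball j)"
    using C jk e ee by (intro dyadic_weight_le[OF av]) (auto simp: emeasure_dyadic_ball dyadic_ball_mono simp del: emeasure_completion)
  also have "vol TYPE('a) * 2 ^ DIM('a) / e = 2 ^ DIM('a) * (2 powi k / 2 powi j) ^ DIM('a)"
    by (simp add: e_def power_divide vol_nonzero)
  also have "(2 ^ DIM('a) * (2 powi k / 2 powi j) ^ DIM('a)) powr s = (2 ^ DIM('a)) powr s * ((2 powi k / 2 powi j) ^ DIM('a)) powr s"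
    by (rule powr_mult)
  finally have "ennreal (ballweight w k) \<le> ennreal (C * (2 ^ DIM('a)) powr s * ((2 powi k / 2 powi j) ^ DIM('a)) powr s * ballweight w j)"
    using ballweight[OF w av C, of j] ballweight[OF w av C, of k] C by (simp add: ennreal_mult mult.assoc)
  then show ?thesis
    using ballweight[OF w av C, of j] C by (subst (asm) ennreal_le_iff) auto
qed

text \<open>The annulus has at least half of the volume of the ball, hence at least 1/D of its
  weight, and the inner ball keeps at most 1 - 1/D.\<close>

lemma ballweight_reverse_doubling:
  fixes w :: "'a::euclidean_space \<Rightarrow> real"
  assumes w: "weight w" and av: "averaging s C w" and C: "0 < C"
  shows "\<exists>\<theta>. 0 < \<theta> \<and> \<theta> < 1 \<and> (\<forall>k. ballweight w (k - 1) \<le> \<theta> * ballweight w k)"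
proof -
  note [measurable] = weight_borel_measurable[OF w]
  define D where "D = max 2 (C * (vol TYPE('a) * 2 ^ DIM('a) / (vol TYPE('a) / 2)) powr s)"
  have D: "2 \<le> D" "C * (vol TYPE('a) * 2 ^ DIM('a) / (vol TYPE('a) / 2)) powr s \<le> D" by (auto simp: D_def)
  have "ballweight w (k - 1) \<le> (1 - 1 / D) * ballweight w k" for k
  proof -
    define A where "A = (annulus k :: 'a set)"
    have As: "A \<in> sets lebesgue" by (auto simp: A_def annulus_def)
    have sub: "dyadic_ball (k - 1) \<subseteq> (dyadic_ball k :: 'a set)" by (rule dyadic_ball_mono) simp
    have un: "dyadic_ball k = A \<union> dyadic_ball (k - 1)" "A \<inter> dyadic_ball (k - 1) = {}"
      using sub by (auto simp: A_def annulus_def)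
    define l where "l = ((2::real) powi k) ^ DIM('a)"
    have l: "0 < l" by (simp add: l_def)
    have "(1/2::real) ^ DIM('a) \<le> (1/2) ^ 1" by (intro power_decreasing) (auto simp: Suc_le_eq)
    then have half: "((2::real) powi (k - 1)) ^ DIM('a) \<le> l / 2"
      by (simp add: l_def power_int_diff power_divide field_simps)
    have "ennreal (vol TYPE('a) * l) = emeasure lebesgue A + emeasure lebesgue (dyadic_ball (k - 1) :: 'a set)"
      using emeasure_dyadic_ball[of k, where 'a='a] plus_emeasure[of A lebesgue "dyadic_ball (k - 1)"] un As by (simp add: l_def del: emeasure_completion)
    also have "\<dots> \<le> emeasure lebesgue A + ennreal (vol TYPE('a) * (l / 2))"
      unfolding emeasure_dyadic_ball using half by (intro add_left_mono ennreal_leI mult_left_mono) auto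
    finally have "ennreal (vol TYPE('a) * (l / 2)) + ennreal (vol TYPE('a) / 2 * l) \<le> ennreal (vol TYPE('a) * (l / 2)) + emeasure lebesgue A"
      using l by (simp add: ennreal_plus[symmetric] mult.commute add.commute del: ennreal_plus emeasure_completion)
    then have "ennreal (vol TYPE('a) / 2 * l) \<le> emeasure lebesgue A"
      by (subst (asm) ennreal_add_left_cancel_le) simp
    then have "wmeas w (dyadic_ball k) \<le> ennreal (C * (vol TYPE('a) * 2 ^ DIM('a) / (vol TYPE('a) / 2)) powr s) * wmeas w A"
      using C As un(1) by (intro dyadic_weight_le[OF av]) (auto simp: l_def)
    also have "\<dots> \<le> ennreal D * wmeas w A"
      using D by (intro mult_right_mono ennreal_leI) auto
    finally have le: "wmeas w (dyadic_ball k) \<le> ennreal D * wmeas w A" .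
    have sum: "wmeas w (dyadic_ball k) = wmeas w A + wmeas w (dyadic_ball (k - 1))"
      unfolding wmeas_def un(1) using As un(2) by (intro nn_integral_disjoint_pair) auto
    define x where "x = enn2real (wmeas w A)"
    have "wmeas w A \<le> wmeas w (dyadic_ball k)" by (rule wmeas_mono) (use un in auto)
    then have x: "wmeas w A = ennreal x" "0 \<le> x"
      using ballweight(1)[OF w av C, of k] by (auto simp: x_def intro!: ennreal_enn2real[symmetric] dest: le_less_trans[OF _ ennreal_less_top])
    note b = ballweight[OF w av C]
    have "ballweight w k = x + ballweight w (k - 1)"
      using sum x b(2)[of k] b(2)[of "k - 1"] unfolding b(1) x(1)
      by (simp add: ennreal_plus[symmetric] del: ennreal_plus)
    moreover have "ballweight w k \<le> D * x"
      using le x D unfolding b(1) x(1) by (simp add: ennreal_mult[symmetric])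
    ultimately show ?thesis using D by (simp add: field_simps)
  qed
  then show ?thesis using D by (intro exI[of _ "1 - 1 / D"]) auto
qed

text \<open>Bounds an L^1 norm by the weighted L^q norm without passing to the dual weight, since
  \<open>averaging\<close> already contains Hoelder's inequality. If the estimate failed,
  \<open>averaging\<close> with a suitable t would be contradicted.\<close>

lemma dyadic_Holder:
  fixes w :: "'a::euclidean_space \<Rightarrow> real" and f :: "'a \<Rightarrow> complex"
  assumes w: "weight w" and av: "averaging q C w" and C: "0 < C" and q: "1 \<le> q"
    and f [measurable]: "f \<in> borel_measurable lebesgue" and E: "E \<in> sets lebesgue" "E \<subseteq> dyadic_ball k"
  shows "(\<integral>\<^sup>+y\<in>E. ennreal (norm (f y)) \<partial>lebesgue)
    \<le> ennreal (C powr (1 / q) * (vol TYPE('a) * 2 ^ DIM('a)) * (2 powi k) ^ DIM('a) * ballweight w k powr (- 1 / q)) * Lq_norm q w (restr E f)"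
proof (rule ccontr)
  define V where "V = vol TYPE('a) * 2 ^ DIM('a)"
  have V: "0 < V" by (simp add: V_def)
  define l where "l = ((2::real) powi k) ^ DIM('a)"
  have l: "0 < l" by (simp add: l_def)
  note b = ballweight[OF w av C, of k]
  define B where "B = ballweight w k"
  have B: "0 < B" using b by (simp add: B_def)
  define P where "P = C powr (1 / q) * V * l * B powr (- 1 / q)"
  have P: "0 < P" using C V l B by (simp add: P_def)
  define J where "J = (\<integral>\<^sup>+x\<in>E. ennreal (norm (f x) powr q * w x) \<partial>lebesgue)"
  have J: "Lq_norm q w (restr E f) = ennpow J (1 / q)"
    unfolding Lq_norm_def J_def restr_def using q
    by (intro arg_cong2[where f=ennpow] nn_integral_cong refl) (auto split: split_indicator)
  assume "\<not> ?thesis"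
  then have less: "ennreal P * ennpow J (1 / q) < (\<integral>\<^sup>+y\<in>E. ennreal (norm (f y)) \<partial>lebesgue)"
    by (simp add: J P_def V_def l_def B_def not_le)
  then have "J \<noteq> top" using P q by (auto simp: ennpow_def ennreal_mult_top)
  then obtain j where j: "J = ennreal j" "0 \<le> j" by (cases J) auto
  have pj: "ennpow J (1 / q) = ennreal (j powr (1 / q))" using j q by (simp add: ennpow_ennreal_pos)
  \<comment> \<open>The integral may be infinite, so a finite value strictly between the two sides
    is used as the lower bound.\<close>
  obtain y where y: "ennreal P * ennpow J (1 / q) < y" "y < (\<integral>\<^sup>+y\<in>E. ennreal (norm (f y)) \<partial>lebesgue)"
    using dense[OF less] by blast
  then obtain c where c: "y = ennreal c" "0 \<le> c" by (cases y) auto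
  have Pc: "P * j powr (1 / q) < c"
    using y(1) P j c unfolding pj by (simp add: ennreal_mult[symmetric] ennreal_less_iff)
  then have c0: "0 < c" using P by (smt (verit) mult_nonneg_nonneg powr_ge_zero)
  define e where "e = c / l"
  have e: "0 < e" using c0 l by (simp add: e_def)
  have "wmeas w (cball 0 (1 * 2 powi k)) \<le> ennreal (C * (vol TYPE('a) * (1 + 1) ^ DIM('a) / e) powr q) * (\<integral>\<^sup>+x\<in>E. ennreal (\<bar>norm (f x)\<bar> powr q * w x) \<partial>lebesgue)"
  proof (rule averaging_cball[OF av])
    have "e * (2 powi k) ^ DIM('a) = c" using l by (simp add: e_def l_def)
    then show "ennreal (e * (2 powi k) ^ DIM('a)) \<le> (\<integral>\<^sup>+x\<in>E. ennreal \<bar>norm (f x)\<bar> \<partial>lebesgue)"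
      using y(2) c by simp
  qed (use E C e in \<open>auto simp: dyadic_ball_def\<close>)
  then have "ennreal B \<le> ennreal (C * (V / e) powr q) * ennreal j"
    using b(1) by (simp add: dyadic_ball_def B_def V_def j(1)[symmetric] J_def)
  then have "B \<le> C * (V / e) powr q * j"
    using C j by (simp add: ennreal_mult[symmetric])
  then have "e powr q * B \<le> C * V powr q * j"
    using e V by (simp add: powr_divide field_simps)
  moreover have "C * V powr q * j < e powr q * B"
  proof -
    have "P / l * j powr (1 / q) < e" using Pc l by (simp add: e_def field_simps)
    then have "(P / l * j powr (1 / q)) powr q < e powr q"
      using q P l by (intro powr_less_mono2) auto
    moreover have eq: "(P / l * j powr (1 / q)) powr q = C * V powr q * j / B"
    proof -
      have "P / l = C powr (1 / q) * V * B powr (- 1 / q)" using l by (simp add: P_def)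
      then have "(P / l * j powr (1 / q)) powr q = (C powr (1 / q)) powr q * V powr q * (B powr (- 1 / q)) powr q * (j powr (1 / q)) powr q"
        using C V B j by (simp add: powr_mult)
      moreover have "(C powr (1 / q)) powr q = C" "(j powr (1 / q)) powr q = j"
        using C j q by (simp_all add: powr_powr)
      moreover have "(B powr (- 1 / q)) powr q = 1 / B"
      proof -
        have "(B powr (- 1 / q)) powr q = B powr (- 1 / q * q)" by (rule powr_powr)
        also have "- 1 / q * q = - 1" using q by simp
        finally show ?thesis using B by (simp add: powr_minus_divide)
      qed
      ultimately show ?thesis by simp
    qed
    ultimately have "C * V powr q * j / B < e powr q" by (simp only: eq)
    then show ?thesis using B by (simp add: pos_divide_less_eq)
  qed
  ultimately show False by simp
qed

section \<open>Summation over the cells of a Herz space\<close>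

definition herz_b :: "real \<Rightarrow> ('a::euclidean_space \<Rightarrow> real) \<Rightarrow> int \<Rightarrow> real" where
  "herz_b \<alpha> w k = ballweight w k powr (\<alpha> / real DIM('a))"

text \<open>An upper bound for the k-th term of the weak norm, before the p-th power, attained when
  the level set fills the ball; see \<open>cell_term_le\<close>.\<close>

definition herz_a :: "real \<Rightarrow> real \<Rightarrow> ('a::euclidean_space \<Rightarrow> real) \<Rightarrow> ('a \<Rightarrow> real) \<Rightarrow> int \<Rightarrow> real" where
  "herz_a \<alpha> q w1 w2 k = herz_b \<alpha> w1 k * ballweight w2 k powr (1 / q)"

text \<open>Treats both spaces at once: the annuli C_k over all integers, and B_0, C_1, C_2, ...
  over k \<ge> 0. The cell B_0 contains all smaller balls, so avoiding B_(k-1) is demanded only of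
  cells with a predecessor in I. The origin lies in no annulus and is therefore left out of the
  covering.\<close>

definition cells :: "int set \<Rightarrow> (int \<Rightarrow> 'a::euclidean_space set) \<Rightarrow> bool" where
  "cells I E \<longleftrightarrow> (I = UNIV \<or> I = {0..}) \<and> (\<forall>k\<in>I. E k \<in> sets lebesgue \<and> E k \<subseteq> dyadic_ball k) \<and>
     (\<forall>j\<in>I. \<forall>k\<in>I. j < k \<longrightarrow> E k \<inter> dyadic_ball (k - 1) = {}) \<and> - {0} \<subseteq> (\<Union>k\<in>I. E k)"

lemma loc_integrable_restr:
  assumes f: "loc_integrable f" and A: "A \<in> sets lebesgue" shows "loc_integrable (restr A f)"
proof -
  note [measurable] = A
  have [measurable]: "f \<in> borel_measurable lebesgue" using f by (simp add: loc_integrable_def)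
  have "restr A f \<in> borel_measurable lebesgue" unfolding restr_def by measurable
  moreover have "integrable lebesgue (\<lambda>y. indicator (cball 0 R) y *\<^sub>R restr A f y)" for R
  proof -
    have "integrable lebesgue (\<lambda>y. indicator (cball 0 R) y *\<^sub>R f y)"
      using f unfolding loc_integrable_def by blast
    then have "integrable lebesgue (\<lambda>y. indicator A y *\<^sub>R (indicator (cball 0 R) y *\<^sub>R f y))"
      by (rule integrable_mult_indicator[OF A])
    also have "(\<lambda>y. indicator A y *\<^sub>R (indicator (cball 0 R) y *\<^sub>R f y)) = (\<lambda>y. indicator (cball 0 R) y *\<^sub>R restr A f y)"
      by (auto simp: fun_eq_iff restr_def split: split_indicator)
    finally show ?thesis .
  qed
  ultimately show ?thesis by (simp add: loc_integrable_def)
qed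

text \<open>Collects what the summation uses of the weights. \<open>growth\<close> comes from
  reverse doubling of w2, \<open>doubling\<close> is the endpoint condition in the form a k / a j
  \<le> D 2^((k-j)n), \<open>b_le\<close> moves b between neighbouring cells, and
  \<open>Holder\<close> and \<open>weak\<close> carry the A_q condition.\<close>

locale herz_setting =
  fixes w1 w2 :: "'a::euclidean_space \<Rightarrow> real" and \<beta> p q \<alpha> \<theta> D H K :: real
  assumes \<beta>: "0 < \<beta>" "\<beta> \<le> 1" and p: "0 < p" "p \<le> 1" and q: "1 < q"
    and w1: "\<And>k. wmeas w1 (dyadic_ball k) = ennreal (ballweight w1 k)" "\<And>k. 0 < ballweight w1 k"
    and w2: "\<And>k. wmeas w2 (dyadic_ball k) = ennreal (ballweight w2 k)" "\<And>k. 0 < ballweight w2 k"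
    and weight: "weight w2"
    and \<theta>: "0 < \<theta>" "\<theta> < 1" and D: "1 \<le> D" and H: "0 \<le> H" and K: "0 < K"
    and growth: "\<And>k. herz_a \<alpha> q w1 w2 (k - 1) \<le> \<theta> * herz_a \<alpha> q w1 w2 k"
    and doubling: "\<And>j k. j \<le> k \<Longrightarrow> herz_a \<alpha> q w1 w2 k * (2 powi j) ^ DIM('a) \<le> D * (2 powi k) ^ DIM('a) * herz_a \<alpha> q w1 w2 j"
    and b_le: "\<And>j k. j \<le> k + 1 \<Longrightarrow> herz_b \<alpha> w1 j \<le> D * herz_b \<alpha> w1 k"
    and Holder: "\<And>f E k. f \<in> borel_measurable lebesgue \<Longrightarrow> E \<in> sets lebesgue \<Longrightarrow> E \<subseteq> dyadic_ball k \<Longrightarrow>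
      (\<integral>\<^sup>+y\<in>E. ennreal (norm (f y)) \<partial>lebesgue) \<le> ennreal (H * (2 powi k) ^ DIM('a) * ballweight w2 k powr (- 1 / q)) * Lq_norm q w2 (restr E f)"
    and weak: "\<And>f \<rho> c. integrable lebesgue f \<Longrightarrow> (\<And>x. \<rho> < norm x \<Longrightarrow> f x = 0) \<Longrightarrow> 0 < c \<Longrightarrow>
      wmeas w2 {x. ennreal c < G_fun \<beta> f x} \<le> ennreal (K * c powr - q) * (\<integral>\<^sup>+x. ennreal (norm (f x) powr q * w2 x) \<partial>lebesgue)"
begin

abbreviation "a \<equiv> herz_a \<alpha> q w1 w2"
abbreviation "b \<equiv> herz_b \<alpha> w1"

lemma b_pos: "0 < b k" using w1(2)[of k] by (simp add: herz_b_def)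
lemma a_pos: "0 < a k" using b_pos[of k] w2(2)[of k] by (simp add: herz_a_def)

lemma a_geometric:
  assumes "k \<le> j" shows "a k \<le> \<theta> ^ nat (j - k) * a j"
proof -
  have "a (j - int m) \<le> \<theta> ^ m * a j" for m
  proof (induction m)
    case (Suc m)
    have "a (j - int (Suc m)) = a (j - int m - 1)" by (simp add: algebra_simps)
    also have "\<dots> \<le> \<theta> * a (j - int m)" by (rule growth)
    also have "\<dots> \<le> \<theta> * (\<theta> ^ m * a j)" using \<theta> Suc by (intro mult_left_mono) auto
    finally show ?case by simp
  qed simp
  from this[of "nat (j - k)"] show ?thesis using assms by simp
qed

lemma \<theta>p: "0 < \<theta> powr p" "\<theta> powr p < 1"
  using \<theta> p powr_less_mono2[of p \<theta> 1] by auto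

definition G0 :: real where "G0 = 2 / (1 - \<theta> powr p)"

lemma G0_pos: "0 < G0" using \<theta>p by (simp add: G0_def)

text \<open>The source of the weak type estimate: a grows geometrically, so the terms with a k \<le>
  T are dominated by the one of largest index, and that one is at most T^p.\<close>

lemma a_sum_le:
  assumes T: "0 \<le> T"
  shows "(\<integral>\<^sup>+k. ennreal (a k powr p) * indicator {k. a k \<le> T} k \<partial>count_space I) \<le> ennreal (T powr p * G0)"
proof (rule nn_integral_count_space_le)
  fix F assume F: "finite F" "F \<subseteq> I"
  define F' where "F' = F \<inter> {k. a k \<le> T}"
  have F': "finite F'" using F by (simp add: F'_def)
  have "(\<Sum>k\<in>F. ennreal (a k powr p) * indicator {k. a k \<le> T} k) = (\<Sum>k\<in>F'. ennreal (a k powr p))"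
    unfolding F'_def using F by (intro sum.mono_neutral_cong_right) (auto split: split_indicator)
  also have "\<dots> = ennreal (\<Sum>k\<in>F'. a k powr p)" by (rule sum_ennreal) simp
  also have "\<dots> \<le> ennreal (T powr p * G0)"
  proof (cases "F' = {}")
    case True then show ?thesis by simp
  next
    case False
    define m where "m = Max F'"
    have m: "m \<in> F'" "\<And>k. k \<in> F' \<Longrightarrow> k \<le> m" using F' False by (auto simp: m_def)
    have "(\<Sum>k\<in>F'. a k powr p) \<le> (\<Sum>k\<in>F'. T powr p * (\<theta> powr p) ^ nat \<bar>k - m\<bar>)"
    proof (rule sum_mono)
      fix k assume k: "k \<in> F'"
      have "a k \<le> \<theta> ^ nat (m - k) * a m" by (rule a_geometric[OF m(2)[OF k]])
      also have "\<dots> \<le> \<theta> ^ nat (m - k) * T" using m(1) \<theta> by (intro mult_left_mono) (auto simp: F'_def)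
      finally have "a k powr p \<le> (\<theta> ^ nat (m - k) * T) powr p" using a_pos[of k] p by (intro powr_mono2) auto
      also have "\<dots> = (\<theta> powr p) ^ nat (m - k) * T powr p"
      proof -
        have "(\<theta> ^ nat (m - k)) powr p = (\<theta> powr p) ^ nat (m - k)"
          using \<theta> by (simp add: powr_realpow[symmetric] powr_powr mult.commute)
        then show ?thesis by (simp add: powr_mult)
      qed
      also have "nat (m - k) = nat \<bar>k - m\<bar>" using m(2)[OF k] by simp
      finally show "a k powr p \<le> T powr p * (\<theta> powr p) ^ nat \<bar>k - m\<bar>" by (simp add: mult.commute)
    qed
    also have "\<dots> = T powr p * (\<Sum>k\<in>F'. (\<theta> powr p) ^ nat \<bar>k - m\<bar>)" by (simp add: sum_distrib_left)
    also have "\<dots> \<le> T powr p * G0"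
      unfolding G0_def using \<theta>p F' by (intro mult_left_mono sum_geometric_abs_le) auto
    finally show ?thesis by (rule ennreal_leI)
  qed
  finally show "(\<Sum>k\<in>F. ennreal (a k powr p) * indicator {k. a k \<le> T} k) \<le> ennreal (T powr p * G0)" .
qed simp

text \<open>3 from the potential estimate, 4^n from |x - y| \<ge> 2^k / 4 for separated cells, H
  from \<open>Holder\<close> and D from \<open>doubling\<close>.\<close>

definition Q :: real where "Q = 3 * 4 ^ DIM('a) * H * D"

lemma Q_nonneg: "0 \<le> Q" using H D by (simp add: Q_def)

text \<open>3^p comes from splitting at height \<sigma> / 3, the doubled term from the inner and
  outer parts, and the other 3 from the three neighbouring cells of the middle part.\<close>

definition M0 :: real where "M0 = 3 powr p * (2 * (Q powr p * G0) + 3 * (K powr (p / q) * D powr p))"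

lemma M0_nonneg: "0 \<le> M0"
  using G0_pos by (simp add: M0_def)

text \<open>The k-th term of the Herz norm before p-th powers are taken.\<close>

definition mass :: "(int \<Rightarrow> 'a set) \<Rightarrow> ('a \<Rightarrow> complex) \<Rightarrow> int \<Rightarrow> ennreal" where
  "mass E f k = ennreal (b k) * Lq_norm q w2 (restr (E k) f)"

lemma ennpow_mass: "ennpow (mass E f k) p = ennreal (b k powr p) * ennpow (Lq_norm q w2 (restr (E k) f)) p"
  using b_pos[of k] p by (simp add: mass_def ennpow_mult ennpow_ennreal)

section \<open>Estimates for one function over one family of cells\<close>

context
  fixes I :: "int set" and E :: "int \<Rightarrow> 'a set" and f :: "'a \<Rightarrow> complex"
  assumes cells: "cells I E" and fm [measurable]: "f \<in> borel_measurable lebesgue"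
begin

lemma I_cases: "I = UNIV \<or> I = {0..}" using cells by (simp add: cells_def)
lemma E_sets: "k \<in> I \<Longrightarrow> E k \<in> sets lebesgue" using cells by (simp add: cells_def)
lemma E_sub: "k \<in> I \<Longrightarrow> E k \<subseteq> dyadic_ball k" using cells by (simp add: cells_def)
lemma E_avoid: "j \<in> I \<Longrightarrow> k \<in> I \<Longrightarrow> j < k \<Longrightarrow> E k \<inter> dyadic_ball (k - 1) = {}" using cells by (simp add: cells_def)
lemma E_cover: "x \<noteq> 0 \<Longrightarrow> \<exists>k\<in>I. x \<in> E k" using cells by (auto simp: cells_def)

lemma E_disjoint: "disjoint_family_on E I"
proof -
  have "E j \<inter> E k = {}" if "j \<in> I" "k \<in> I" "j < k" for j k
    using E_avoid[OF that] E_sub[OF that(1)] dyadic_ball_mono[of j "k - 1"] that by auto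
  then show ?thesis unfolding disjoint_family_on_def by (metis Int_commute linorder_neqE)
qed

lemma cell_mass_le:
  assumes k: "k \<in> I"
  shows "(\<integral>\<^sup>+y\<in>E k. ennreal (norm (f y)) \<partial>lebesgue) \<le> ennreal (H * (2 powi k) ^ DIM('a) / a k) * mass E f k"
proof -
  have "H * (2 powi k) ^ DIM('a) * ballweight w2 k powr (- 1 / q) = H * (2 powi k) ^ DIM('a) / a k * b k"
    using b_pos[of k] w2(2)[of k] by (simp add: herz_a_def powr_minus_divide)
  moreover have "ennreal (H * (2 powi k) ^ DIM('a) / a k * b k) = ennreal (H * (2 powi k) ^ DIM('a) / a k) * ennreal (b k)"
    using H a_pos[of k] b_pos[of k] by (intro ennreal_mult) auto
  ultimately have "ennreal (H * (2 powi k) ^ DIM('a) * ballweight w2 k powr (- 1 / q)) = ennreal (H * (2 powi k) ^ DIM('a) / a k) * ennreal (b k)"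
    by (simp only:)
  then show ?thesis
    using Holder[OF fm E_sets[OF k] E_sub[OF k]] by (simp add: mass_def mult.assoc)
qed

lemma cells_integral_le:
  assumes S: "S \<subseteq> I" and A: "A \<subseteq> insert 0 (\<Union>j\<in>S. E j)" and g: "g \<in> borel_measurable lebesgue"
  shows "(\<integral>\<^sup>+y\<in>A. g y \<partial>lebesgue) \<le> (\<integral>\<^sup>+j. (\<integral>\<^sup>+y\<in>E j. g y \<partial>lebesgue) \<partial>count_space S)"
proof -
  have ae: "AE y in lebesgue. y \<noteq> (0::'a)" 
    using AE_not_in[of "{0}" lebesgue] by simp
  have "(\<integral>\<^sup>+y\<in>A. g y \<partial>lebesgue) \<le> (\<integral>\<^sup>+y\<in>(\<Union>j\<in>S. E j). g y \<partial>lebesgue)"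
    by (rule nn_integral_mono_AE) (use ae in eventually_elim, use A in \<open>auto split: split_indicator\<close>)
  also have "\<dots> = (\<integral>\<^sup>+j. (\<integral>\<^sup>+y\<in>E j. g y \<partial>lebesgue) \<partial>count_space S)"
    using S E_sets E_disjoint g
    by (intro nn_integral_UN_countable disjoint_family_on_mono[OF S]) auto
  finally show ?thesis .
qed

text \<open>By \<open>doubling\<close>, 2^(jn) / a j is at most D 2^(kn) / a k for every j \<le> k.
  All inner cells receive the same factor, without decay in k - j; this is where the endpoint
  shows.\<close>

lemma inner_cells_le:
  assumes S: "S \<subseteq> I" "\<And>j. j \<in> S \<Longrightarrow> j \<le> k" and A: "A \<subseteq> insert 0 (\<Union>j\<in>S. E j)"
  shows "(\<integral>\<^sup>+y\<in>A. ennreal (norm (f y)) \<partial>lebesgue) \<le> ennreal (H * D * (2 powi k) ^ DIM('a) / a k) * (\<integral>\<^sup>+j. mass E f j \<partial>count_space I)"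
proof -
  have "(\<integral>\<^sup>+y\<in>A. ennreal (norm (f y)) \<partial>lebesgue) \<le> (\<integral>\<^sup>+j. (\<integral>\<^sup>+y\<in>E j. ennreal (norm (f y)) \<partial>lebesgue) \<partial>count_space S)"
    by (rule cells_integral_le[OF S(1) A]) simp
  also have "\<dots> \<le> (\<integral>\<^sup>+j. ennreal (H * D * (2 powi k) ^ DIM('a) / a k) * mass E f j \<partial>count_space S)"
  proof (intro nn_integral_mono)
    fix j assume j: "j \<in> space (count_space S)"
    have "a k * (2 powi j) ^ DIM('a) \<le> D * (2 powi k) ^ DIM('a) * a j" using j S by (intro doubling) auto
    then have "(2 powi j) ^ DIM('a) / a j \<le> D * (2 powi k) ^ DIM('a) / a k"
      using a_pos[of j] a_pos[of k] by (simp add: field_simps)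
    then have "H * ((2 powi j) ^ DIM('a) / a j) \<le> H * (D * (2 powi k) ^ DIM('a) / a k)" using H by (rule mult_left_mono)
    then have "ennreal (H * (2 powi j) ^ DIM('a) / a j) * mass E f j \<le> ennreal (H * D * (2 powi k) ^ DIM('a) / a k) * mass E f j"
      by (intro mult_right_mono ennreal_leI) (auto simp: mult.assoc)
    then show "(\<integral>\<^sup>+y\<in>E j. ennreal (norm (f y)) \<partial>lebesgue) \<le> ennreal (H * D * (2 powi k) ^ DIM('a) / a k) * mass E f j"
      using cell_mass_le[of j] j S by (auto intro: order_trans)
  qed
  also have "\<dots> = ennreal (H * D * (2 powi k) ^ DIM('a) / a k) * (\<integral>\<^sup>+j. mass E f j \<partial>count_space S)"
    by (rule nn_integral_cmult) simp
  also have "(\<integral>\<^sup>+j. mass E f j \<partial>count_space S) \<le> (\<integral>\<^sup>+j. mass E f j \<partial>count_space I)"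
  proof (rule nn_integral_count_space_le)
    show "sum (mass E f) F \<le> (\<integral>\<^sup>+j. mass E f j \<partial>count_space I)" if "finite F" "F \<subseteq> S" for F
      using that S by (intro sum_le_nn_integral_count_space) auto
  qed simp
  finally show ?thesis by (simp add: mult_left_mono)
qed

lemma mass_sum_le: "ennpow (\<integral>\<^sup>+j. mass E f j \<partial>count_space I) p \<le> (\<integral>\<^sup>+j. ennpow (mass E f j) p \<partial>count_space I)"
  by (rule ennpow_nn_integral_count_space_le[OF _ p]) simp

lemma mass_sum_finite:
  assumes "(\<integral>\<^sup>+j. ennpow (mass E f j) p \<partial>count_space I) < top"
  shows "(\<integral>\<^sup>+j. mass E f j \<partial>count_space I) < top"
proof -
  have "ennpow (\<integral>\<^sup>+j. mass E f j \<partial>count_space I) p < top" by (rule le_less_trans[OF mass_sum_le assms])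
  then show ?thesis using p by (cases "(\<integral>\<^sup>+j. mass E f j \<partial>count_space I) = top") (auto simp: ennpow_def less_top)
qed

text \<open>The homogeneous space controls f locally only away from the origin; integrability near 0
  comes from the bound on the sum of all inner cells. It makes the convolutions in G integrals of
  integrable functions.\<close>

lemma herz_loc_integrable:
  assumes fin: "(\<integral>\<^sup>+j. ennpow (mass E f j) p \<partial>count_space I) < top"
  shows "loc_integrable f"
  unfolding loc_integrable_def
proof (intro conjI allI fm)
  fix R :: real
  obtain i where i: "R < 2 ^ i" using real_arch_pow[of 2 R] by auto
  define k where "k = int i"
  have kI: "k \<in> I" using I_cases by (auto simp: k_def)
  have Rk: "cball 0 R \<subseteq> (dyadic_ball k :: 'a set)" using i by (auto simp: dyadic_ball_def k_def)
  have sub: "cball 0 R \<subseteq> insert 0 (\<Union>j\<in>{j\<in>I. j \<le> k}. E j)"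
  proof
    fix x :: 'a assume x: "x \<in> cball 0 R"
    show "x \<in> insert 0 (\<Union>j\<in>{j\<in>I. j \<le> k}. E j)"
    proof (cases "x = 0")
      case False
      then obtain j where j: "j \<in> I" "x \<in> E j" using E_cover by blast
      have "j \<le> k"
      proof (rule ccontr)
        assume "\<not> j \<le> k"
        then have "E j \<inter> dyadic_ball (j - 1) = {}" "x \<in> dyadic_ball (j - 1)"
          using E_avoid[OF kI j(1)] x Rk dyadic_ball_mono[of k "j - 1"] by auto
        then show False using j by auto
      qed
      then show ?thesis using j by auto
    qed simp
  qed
  have bound: "(\<integral>\<^sup>+y\<in>cball 0 R. ennreal (norm (f y)) \<partial>lebesgue) < top"
    by (rule le_less_trans[OF inner_cells_le[OF _ _ sub, of k]])
       (use mass_sum_finite[OF fin] in \<open>auto simp: ennreal_mult_less_top\<close>)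
  have [measurable]: "cball 0 R \<in> sets (lebesgue :: 'a measure)" by simp
  show "integrable lebesgue (\<lambda>y. indicator (cball 0 R) y *\<^sub>R f y)"
  proof (rule integrableI_bounded)
    have "(\<integral>\<^sup>+y. ennreal (norm (indicator (cball 0 R) y *\<^sub>R f y)) \<partial>lebesgue) = (\<integral>\<^sup>+y\<in>cball 0 R. ennreal (norm (f y)) \<partial>lebesgue)"
      by (intro nn_integral_cong) (auto split: split_indicator)
    then show "(\<integral>\<^sup>+y. ennreal (norm (indicator (cball 0 R) y *\<^sub>R f y)) \<partial>lebesgue) < \<infinity>" using bound by simp
  qed measurable
qed

lemma restr_potential:
  assumes [measurable]: "A \<in> sets lebesgue" and x: "x \<notin> A"
  shows "G_fun \<beta> (restr A f) x \<le> ennreal 3 * (\<integral>\<^sup>+y\<in>A. ennreal (norm (f y) / norm (x - y) ^ DIM('a)) \<partial>lebesgue)"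
proof -
  have "G_fun \<beta> (restr A f) x \<le> ennreal 3 * (\<integral>\<^sup>+y. ennreal (norm (restr A f y) / norm (x - y) ^ DIM('a)) \<partial>lebesgue)"
    by (rule G_fun_le_potential[OF \<beta>]) (use x in \<open>simp_all add: restr_def\<close>)
  also have "(\<integral>\<^sup>+y. ennreal (norm (restr A f y) / norm (x - y) ^ DIM('a)) \<partial>lebesgue) = (\<integral>\<^sup>+y\<in>A. ennreal (norm (f y) / norm (x - y) ^ DIM('a)) \<partial>lebesgue)"
    by (intro nn_integral_cong) (auto simp: restr_def split: split_indicator)
  finally show ?thesis .
qed

lemma UN_cells_sets: "S \<subseteq> I \<Longrightarrow> (\<Union>j\<in>S. E j) \<in> sets lebesgue"
  using E_sets by (intro sets.countable_UN') auto

lemma measurable_potential: "(\<lambda>y. ennreal (norm (f y) / norm (x - y) ^ DIM('a))) \<in> borel_measurable lebesgue"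
proof -
  have "(\<lambda>y. norm (x - y) ^ DIM('a)) \<in> borel_measurable lebesgue"
    by (intro measurable_completion) measurable
  then show ?thesis by measurable
qed

text \<open>A point y of a cell up to k - 2 has |y| \<le> 2^(k-2), while |x| > 2^(k-1), so the
  kernel is at most (4 / 2^k)^n. The inner part is the complement of all other cells, so that the
  three parts add up to f at every point, the origin included.\<close>

lemma inner_part_le:
  assumes k: "k \<in> I" and x: "x \<in> E k"
  shows "G_fun \<beta> (restr (- (\<Union>j\<in>{j\<in>I. k - 1 \<le> j}. E j)) f) x \<le> ennreal (Q / a k) * (\<integral>\<^sup>+j. mass E f j \<partial>count_space I)"
proof -
  define A where "A = - (\<Union>j\<in>{j\<in>I. k - 1 \<le> j}. E j)"
  have "(\<Union>j\<in>{j\<in>I. k - 1 \<le> j}. E j) \<in> sets lebesgue" by (intro UN_cells_sets) auto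
  from sets.compl_sets[OF this] have As: "A \<in> sets lebesgue"
    unfolding A_def Compl_eq_Diff_UNIV by (simp only: space_completion space_lborel space_borel)
  have xA: "x \<notin> A" using k x by (auto simp: A_def)
  define S where "S = {j\<in>I. j \<le> k - 2}"
  have sub: "A \<subseteq> insert 0 (\<Union>j\<in>S. E j)"
  proof
    fix y assume y: "y \<in> A"
    show "y \<in> insert 0 (\<Union>j\<in>S. E j)"
    proof (cases "y = 0")
      case False
      then obtain j where j: "j \<in> I" "y \<in> E j" using E_cover by blast
      then have "\<not> k - 1 \<le> j" using y by (auto simp: A_def)
      then show ?thesis using j by (auto simp: S_def)
    qed simp
  qed
  let ?l = "((2::real) powi k) ^ DIM('a)"
  have "(\<integral>\<^sup>+y\<in>A. ennreal (norm (f y) / norm (x - y) ^ DIM('a)) \<partial>lebesgue) \<le> (\<integral>\<^sup>+y\<in>A. ennreal (4 ^ DIM('a) / ?l) * ennreal (norm (f y)) \<partial>lebesgue)"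
  proof (rule nn_integral_mono_AE)
    have "AE y in lebesgue. y \<noteq> (0::'a)" using AE_not_in[of "{0}" lebesgue] by simp
    then show "AE y in lebesgue. ennreal (norm (f y) / norm (x - y) ^ DIM('a)) * indicator A y \<le> ennreal (4 ^ DIM('a) / ?l) * ennreal (norm (f y)) * indicator A y"
    proof eventually_elim
      case (elim y)
      show ?case
      proof (cases "y \<in> A")
        case True
        then obtain j where j: "j \<in> I" "j \<le> k - 2" "y \<in> E j" using sub elim by (auto simp: S_def)
        have "norm y \<le> 2 powi j" using E_sub[OF j(1)] j(3) by (auto simp: dyadic_ball_def)
        also have "\<dots> \<le> 2 powi (k - 2)" using j(2) by (intro power_int_increasing) auto
        also have "\<dots> = 2 powi k / 4" by (simp add: power_int_diff)
        finally have ny: "norm y \<le> 2 powi k / 4" .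
        have "x \<notin> dyadic_ball (k - 1)" using E_avoid[OF j(1) k] j(2) x by auto
        then have nx: "2 powi k / 2 < norm x" by (simp add: dyadic_ball_def power_int_diff)
        have "2 powi k / 4 \<le> norm (x - y)" using norm_triangle_ineq2[of x y] nx ny by simp
        then have pw: "(2 powi k / 4) ^ DIM('a) \<le> norm (x - y) ^ DIM('a)" by (intro power_mono) auto
        then have "0 < norm (x - y) ^ DIM('a)" by (rule less_le_trans[rotated]) simp
        then have "norm (f y) / norm (x - y) ^ DIM('a) \<le> norm (f y) / (2 powi k / 4) ^ DIM('a)"
          using pw by (intro divide_left_mono mult_pos_pos) auto
        also have "\<dots> = 4 ^ DIM('a) / ?l * norm (f y)" by (simp add: power_divide)
        finally show ?thesis using True by (simp add: ennreal_mult[symmetric] ennreal_leI)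
      qed simp
    qed
  qed
  also have "\<dots> = ennreal (4 ^ DIM('a) / ?l) * (\<integral>\<^sup>+y\<in>A. ennreal (norm (f y)) \<partial>lebesgue)"
    unfolding mult.assoc using As by (intro nn_integral_cmult borel_measurable_times_ennreal borel_measurable_indicator) auto
  also have "(\<integral>\<^sup>+y\<in>A. ennreal (norm (f y)) \<partial>lebesgue) \<le> ennreal (H * D * ?l / a k) * (\<integral>\<^sup>+j. mass E f j \<partial>count_space I)"
    by (rule inner_cells_le[OF _ _ sub]) (auto simp: S_def)
  finally have le: "(\<integral>\<^sup>+y\<in>A. ennreal (norm (f y) / norm (x - y) ^ DIM('a)) \<partial>lebesgue)
      \<le> ennreal (4 ^ DIM('a) / ?l) * (ennreal (H * D * ?l / a k) * (\<integral>\<^sup>+j. mass E f j \<partial>count_space I))"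
    by (simp add: mult_left_mono)
  have "G_fun \<beta> (restr A f) x \<le> ennreal 3 * (\<integral>\<^sup>+y\<in>A. ennreal (norm (f y) / norm (x - y) ^ DIM('a)) \<partial>lebesgue)"
    by (rule restr_potential[OF As xA])
  also have "\<dots> \<le> ennreal 3 * (ennreal (4 ^ DIM('a) / ?l) * (ennreal (H * D * ?l / a k) * (\<integral>\<^sup>+j. mass E f j \<partial>count_space I)))"
    by (intro mult_left_mono le) auto
  also have "\<dots> = ennreal (3 * (4 ^ DIM('a) / ?l) * (H * D * ?l / a k)) * (\<integral>\<^sup>+j. mass E f j \<partial>count_space I)"
  proof -
    have "0 \<le> H * D * ?l / a k" using H D a_pos[of k] by simp
    then have "ennreal (3 * (4 ^ DIM('a) / ?l) * (H * D * ?l / a k)) = ennreal 3 * ennreal (4 ^ DIM('a) / ?l) * ennreal (H * D * ?l / a k)"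
      by (subst ennreal_mult, simp, simp, subst ennreal_mult, simp_all)
    then show ?thesis by (simp only: mult.assoc)
  qed
  also have "3 * (4 ^ DIM('a) / ?l) * (H * D * ?l / a k) = Q / a k" by (simp add: Q_def)
  finally show ?thesis unfolding A_def .
qed

text \<open>The mirror image of the inner part: now |y| > 2^(j-1) dominates |x| \<le> 2^(j-2). The
  bound contains a j for the outer cell and not a k, which leaves the decaying factor a k / a j for
  the summation.\<close>

lemma outer_part_le:
  assumes k: "k \<in> I" and x: "x \<in> E k"
  shows "G_fun \<beta> (restr (\<Union>j\<in>{j\<in>I. k + 2 \<le> j}. E j) f) x \<le> (\<integral>\<^sup>+j. ennreal (Q / a j) * indicator {k + 2..} j * mass E f j \<partial>count_space I)"
proof -
  define S where "S = {j\<in>I. k + 2 \<le> j}"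
  define A where "A = (\<Union>j\<in>S. E j)"
  have SI: "S \<subseteq> I" by (auto simp: S_def)
  have As: "A \<in> sets lebesgue" unfolding A_def by (rule UN_cells_sets[OF SI])
  have xA: "x \<notin> A"
  proof
    assume "x \<in> A"
    then obtain j where "j \<in> I" "k + 2 \<le> j" "x \<in> E j" by (auto simp: A_def S_def)
    moreover from this have "E j \<inter> E k = {}"
      using E_disjoint k unfolding disjoint_family_on_def by force
    ultimately show False using x by auto
  qed
  have one: "ennreal 3 * (\<integral>\<^sup>+y\<in>E j. ennreal (norm (f y) / norm (x - y) ^ DIM('a)) \<partial>lebesgue) \<le> ennreal (Q / a j) * mass E f j" if j: "j \<in> S" for j
  proof -
    have jI: "j \<in> I" "k + 2 \<le> j" using j by (auto simp: S_def)
    let ?l = "((2::real) powi j) ^ DIM('a)"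
    have "(\<integral>\<^sup>+y\<in>E j. ennreal (norm (f y) / norm (x - y) ^ DIM('a)) \<partial>lebesgue) \<le> (\<integral>\<^sup>+y\<in>E j. ennreal (4 ^ DIM('a) / ?l) * ennreal (norm (f y)) \<partial>lebesgue)"
    proof (rule nn_integral_mono)
      fix y
      show "ennreal (norm (f y) / norm (x - y) ^ DIM('a)) * indicator (E j) y \<le> ennreal (4 ^ DIM('a) / ?l) * ennreal (norm (f y)) * indicator (E j) y"
      proof (cases "y \<in> E j")
        case True
        have "norm x \<le> 2 powi k" using E_sub[OF k] x by (auto simp: dyadic_ball_def)
        also have "\<dots> \<le> 2 powi (j - 2)" using jI(2) by (intro power_int_increasing) auto
        also have "\<dots> = 2 powi j / 4" by (simp add: power_int_diff)
        finally have nx: "norm x \<le> 2 powi j / 4" .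
        have "y \<notin> dyadic_ball (j - 1)" using E_avoid[OF k jI(1)] jI(2) True by auto
        then have ny: "2 powi j / 2 < norm y" by (simp add: dyadic_ball_def power_int_diff)
        have "2 powi j / 4 \<le> norm (x - y)" using norm_triangle_ineq2[of y x] nx ny by (simp add: norm_minus_commute)
        then have pw: "(2 powi j / 4) ^ DIM('a) \<le> norm (x - y) ^ DIM('a)" by (intro power_mono) auto
        then have "0 < norm (x - y) ^ DIM('a)" by (rule less_le_trans[rotated]) simp
        then have "norm (f y) / norm (x - y) ^ DIM('a) \<le> norm (f y) / (2 powi j / 4) ^ DIM('a)"
          using pw by (intro divide_left_mono mult_pos_pos) auto
        also have "\<dots> = 4 ^ DIM('a) / ?l * norm (f y)" by (simp add: power_divide)
        finally show ?thesis using True by (simp add: ennreal_mult[symmetric] ennreal_leI)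
      qed simp
    qed
    also have "\<dots> = ennreal (4 ^ DIM('a) / ?l) * (\<integral>\<^sup>+y\<in>E j. ennreal (norm (f y)) \<partial>lebesgue)"
      unfolding mult.assoc using E_sets[OF jI(1)] by (intro nn_integral_cmult borel_measurable_times_ennreal borel_measurable_indicator) auto
    also have "\<dots> \<le> ennreal (4 ^ DIM('a) / ?l) * (ennreal (H * ?l / a j) * mass E f j)"
      by (intro mult_left_mono cell_mass_le jI) auto
    finally have "ennreal 3 * (\<integral>\<^sup>+y\<in>E j. ennreal (norm (f y) / norm (x - y) ^ DIM('a)) \<partial>lebesgue)
        \<le> ennreal 3 * (ennreal (4 ^ DIM('a) / ?l) * (ennreal (H * ?l / a j) * mass E f j))"
      by (rule mult_left_mono) simp
    also have "\<dots> = ennreal (3 * (4 ^ DIM('a) / ?l) * (H * ?l / a j)) * mass E f j"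
    proof -
      have "0 \<le> H * ?l / a j" using H a_pos[of j] by simp
      then have "ennreal (3 * (4 ^ DIM('a) / ?l) * (H * ?l / a j)) = ennreal 3 * ennreal (4 ^ DIM('a) / ?l) * ennreal (H * ?l / a j)"
        by (subst ennreal_mult, simp, simp, subst ennreal_mult, simp_all)
      then show ?thesis by (simp only: mult.assoc)
    qed
    also have "3 * (4 ^ DIM('a) / ?l) * (H * ?l / a j) = 3 * 4 ^ DIM('a) * H / a j" by simp
    also have "ennreal (3 * 4 ^ DIM('a) * H / a j) * mass E f j \<le> ennreal (Q / a j) * mass E f j"
    proof -
      have "3 * 4 ^ DIM('a) * H * 1 \<le> 3 * 4 ^ DIM('a) * H * D" using H D by (intro mult_left_mono) auto
      then show ?thesis using a_pos[of j] by (intro mult_right_mono ennreal_leI divide_right_mono) (auto simp: Q_def)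
    qed
    finally show ?thesis .
  qed
  have "G_fun \<beta> (restr A f) x \<le> ennreal 3 * (\<integral>\<^sup>+y\<in>A. ennreal (norm (f y) / norm (x - y) ^ DIM('a)) \<partial>lebesgue)"
    by (rule restr_potential[OF As xA])
  also have "\<dots> \<le> ennreal 3 * (\<integral>\<^sup>+j. (\<integral>\<^sup>+y\<in>E j. ennreal (norm (f y) / norm (x - y) ^ DIM('a)) \<partial>lebesgue) \<partial>count_space S)"
    by (intro mult_left_mono cells_integral_le[OF SI] measurable_potential) (auto simp: A_def)
  also have "\<dots> = (\<integral>\<^sup>+j. ennreal 3 * (\<integral>\<^sup>+y\<in>E j. ennreal (norm (f y) / norm (x - y) ^ DIM('a)) \<partial>lebesgue) \<partial>count_space S)"
    by (rule nn_integral_cmult[symmetric]) simp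
  also have "\<dots> \<le> (\<integral>\<^sup>+j. ennreal (Q / a j) * mass E f j \<partial>count_space S)"
    by (intro nn_integral_mono one) simp
  also have "\<dots> \<le> (\<integral>\<^sup>+j. ennreal (Q / a j) * indicator {k + 2..} j * mass E f j \<partial>count_space I)"
  proof (rule nn_integral_count_space_le)
    fix F assume F: "finite F" "F \<subseteq> S"
    have "(\<Sum>j\<in>F. ennreal (Q / a j) * mass E f j) = (\<Sum>j\<in>F. ennreal (Q / a j) * indicator {k + 2..} j * mass E f j)"
      using F by (intro sum.cong) (auto simp: S_def)
    also have "\<dots> \<le> (\<integral>\<^sup>+j. ennreal (Q / a j) * indicator {k + 2..} j * mass E f j \<partial>count_space I)"
      using F SI by (intro sum_le_nn_integral_count_space) auto
    finally show "(\<Sum>j\<in>F. ennreal (Q / a j) * mass E f j) \<le> \<dots>" .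
  qed simp
  finally show ?thesis unfolding A_def S_def .
qed

text \<open>The weak type bound applied to f on the cells k - 1, k, k + 1, where it is integrable
  with bounded support. Then p/q \<le> 1 separates the cells and \<open>b_le\<close> replaces b k by
  b j.\<close>

lemma middle_part_le:
  assumes fin: "(\<integral>\<^sup>+j. ennpow (mass E f j) p \<partial>count_space I) < top" and c: "0 < c"
  shows "ennreal (b k powr p) * ennpow (wmeas w2 {x. ennreal c < G_fun \<beta> (restr (\<Union>j\<in>{j\<in>I. k - 1 \<le> j \<and> j < k + 2}. E j) f) x}) (p / q)
    \<le> (\<integral>\<^sup>+j. ennreal (K powr (p / q) * D powr p * c powr - p) * indicator {k - 1..k + 1} j * ennpow (mass E f j) p \<partial>count_space I)"
proof -
  define S where "S = {j\<in>I. k - 1 \<le> j \<and> j < k + 2}"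
  define A where "A = (\<Union>j\<in>S. E j)"
  have SI: "S \<subseteq> I" by (auto simp: S_def)
  have As: "A \<in> sets lebesgue" unfolding A_def by (rule UN_cells_sets[OF SI])
  have Sfin: "finite S" by (rule finite_subset[of _ "{k - 1..k + 1}"]) (auto simp: S_def)
  define R where "R = (2::real) powi (k + 1)"
  have supp: "restr A f x = 0" if "R < norm x" for x
  proof -
    have "x \<notin> E j" if "j \<in> S" for j
    proof
      assume "x \<in> E j"
      then have "x \<in> dyadic_ball j" using E_sub[of j] that SI by auto
      then have "x \<in> dyadic_ball (k + 1)" using dyadic_ball_mono[of j "k + 1"] that by (auto simp: S_def)
      then show False using \<open>R < norm x\<close> by (simp add: dyadic_ball_def R_def)
    qed
    then show ?thesis by (simp add: restr_def A_def)
  qed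
  have int: "integrable lebesgue (restr A f)"
  proof -
    have "integrable lebesgue (\<lambda>y. indicator (cball 0 R) y *\<^sub>R restr A f y)"
      using loc_integrable_restr[OF herz_loc_integrable[OF fin] As] by (simp add: loc_integrable_def)
    also have "(\<lambda>y. indicator (cball 0 R) y *\<^sub>R restr A f y) = restr A f"
      using supp by (auto simp: fun_eq_iff split: split_indicator)
    finally show ?thesis .
  qed
  have w2m [measurable]: "w2 \<in> borel_measurable lebesgue" by (rule weight_borel_measurable[OF weight])
  have Lq: "ennpow (Lq_norm q w2 (restr (E j) f)) q = (\<integral>\<^sup>+x\<in>E j. ennreal (norm (f x) powr q * w2 x) \<partial>lebesgue)" for j
  proof -
    have "ennpow (Lq_norm q w2 (restr (E j) f)) q = (\<integral>\<^sup>+x. ennreal (norm (restr (E j) f x) powr q * w2 x) \<partial>lebesgue)"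
      unfolding Lq_norm_def using q by (simp add: ennpow_ennpow)
    also have "\<dots> = (\<integral>\<^sup>+x\<in>E j. ennreal (norm (f x) powr q * w2 x) \<partial>lebesgue)"
      by (intro nn_integral_cong) (auto simp: restr_def split: split_indicator)
    finally show ?thesis .
  qed
  have "(\<integral>\<^sup>+x. ennreal (norm (restr A f x) powr q * w2 x) \<partial>lebesgue) = (\<integral>\<^sup>+x\<in>A. ennreal (norm (f x) powr q * w2 x) \<partial>lebesgue)"
    by (intro nn_integral_cong) (auto simp: restr_def split: split_indicator)
  also have "\<dots> = (\<integral>\<^sup>+j. (\<integral>\<^sup>+x\<in>E j. ennreal (norm (f x) powr q * w2 x) \<partial>lebesgue) \<partial>count_space S)"
    unfolding A_def using SI E_sets E_disjoint by (intro nn_integral_UN_countable disjoint_family_on_mono[OF SI]) auto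
  also have "\<dots> = (\<Sum>j\<in>S. ennpow (Lq_norm q w2 (restr (E j) f)) q)"
    using Sfin by (simp add: nn_integral_count_space_finite Lq)
  finally have eq: "(\<integral>\<^sup>+x. ennreal (norm (restr A f x) powr q * w2 x) \<partial>lebesgue) = (\<Sum>j\<in>S. ennpow (Lq_norm q w2 (restr (E j) f)) q)" .
  have pq: "0 < p / q" "p / q \<le> 1" using p q by auto
  have "wmeas w2 {x. ennreal c < G_fun \<beta> (restr A f) x} \<le> ennreal (K * c powr - q) * (\<Sum>j\<in>S. ennpow (Lq_norm q w2 (restr (E j) f)) q)"
    unfolding eq[symmetric] by (rule weak[OF int supp c])
  then have "ennpow (wmeas w2 {x. ennreal c < G_fun \<beta> (restr A f) x}) (p / q) \<le> ennpow (ennreal (K * c powr - q) * (\<Sum>j\<in>S. ennpow (Lq_norm q w2 (restr (E j) f)) q)) (p / q)"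
    by (rule ennpow_mono[OF pq(1)])
  also have "\<dots> = ennreal ((K * c powr - q) powr (p / q)) * ennpow (\<Sum>j\<in>S. ennpow (Lq_norm q w2 (restr (E j) f)) q) (p / q)"
    using pq K c by (simp add: ennpow_mult ennpow_ennreal)
  also have "\<dots> \<le> ennreal ((K * c powr - q) powr (p / q)) * (\<Sum>j\<in>S. ennpow (ennpow (Lq_norm q w2 (restr (E j) f)) q) (p / q))"
    using Sfin pq by (intro mult_left_mono ennpow_sum_le) auto
  also have "\<dots> = ennreal ((K * c powr - q) powr (p / q)) * (\<Sum>j\<in>S. ennpow (Lq_norm q w2 (restr (E j) f)) p)"
    using p q by (simp add: ennpow_ennpow)
  also have "(K * c powr - q) powr (p / q) = K powr (p / q) * c powr - p"
    using K c q by (simp add: powr_mult powr_powr)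
  finally have "ennreal (b k powr p) * ennpow (wmeas w2 {x. ennreal c < G_fun \<beta> (restr A f) x}) (p / q)
      \<le> ennreal (b k powr p) * (ennreal (K powr (p / q) * c powr - p) * (\<Sum>j\<in>S. ennpow (Lq_norm q w2 (restr (E j) f)) p))"
    by (rule mult_left_mono) simp
  also have "\<dots> = (\<Sum>j\<in>S. ennreal (K powr (p / q) * c powr - p) * (ennreal (b k powr p) * ennpow (Lq_norm q w2 (restr (E j) f)) p))"
    by (simp add: sum_distrib_left mult_ac)
  also have "\<dots> \<le> (\<Sum>j\<in>S. ennreal (K powr (p / q) * D powr p * c powr - p) * indicator {k - 1..k + 1} j * ennpow (mass E f j) p)"
  proof (rule sum_mono)
    fix j assume j: "j \<in> S"
    have "b k \<le> D * b j" using j by (intro b_le) (auto simp: S_def)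
    then have "b k powr p \<le> (D * b j) powr p" using b_pos[of k] p by (intro powr_mono2) auto
    also have "\<dots> = D powr p * b j powr p" by (rule powr_mult)
    finally have "ennreal (b k powr p) * ennpow (Lq_norm q w2 (restr (E j) f)) p \<le> ennreal (D powr p * b j powr p) * ennpow (Lq_norm q w2 (restr (E j) f)) p"
      by (intro mult_right_mono ennreal_leI) auto
    also have "\<dots> = ennreal (D powr p) * ennpow (mass E f j) p" by (simp add: ennpow_mass ennreal_mult mult.assoc)
    finally have "ennreal (K powr (p / q) * c powr - p) * (ennreal (b k powr p) * ennpow (Lq_norm q w2 (restr (E j) f)) p)
       \<le> ennreal (K powr (p / q) * c powr - p) * (ennreal (D powr p) * ennpow (mass E f j) p)"
      by (rule mult_left_mono) simp
    also have "\<dots> = ennreal (K powr (p / q) * D powr p * c powr - p) * ennpow (mass E f j) p"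
    proof -
      have "ennreal (K powr (p / q) * c powr - p) * ennreal (D powr p) = ennreal (K powr (p / q) * D powr p * c powr - p)"
        by (simp add: ennreal_mult[symmetric] mult_ac)
      then show ?thesis by (simp only: mult.assoc[symmetric])
    qed
    finally show "ennreal (K powr (p / q) * c powr - p) * (ennreal (b k powr p) * ennpow (Lq_norm q w2 (restr (E j) f)) p)
       \<le> ennreal (K powr (p / q) * D powr p * c powr - p) * indicator {k - 1..k + 1} j * ennpow (mass E f j) p"
      using j by (auto simp: S_def)
  qed
  also have "\<dots> \<le> (\<integral>\<^sup>+j. ennreal (K powr (p / q) * D powr p * c powr - p) * indicator {k - 1..k + 1} j * ennpow (mass E f j) p \<partial>count_space I)"
    using Sfin SI by (rule sum_le_nn_integral_count_space)
  finally show ?thesis unfolding A_def S_def .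
qed

lemma wmeas_Un_le:
  assumes "A \<in> sets lebesgue" "B \<in> sets lebesgue" shows "wmeas w2 (A \<union> B) \<le> wmeas w2 A + wmeas w2 B"
proof -
  have [measurable]: "w2 \<in> borel_measurable lebesgue" by (rule weight_borel_measurable[OF weight])
  have "wmeas w2 (A \<union> B) \<le> (\<integral>\<^sup>+x. ennreal (w2 x) * indicator A x + ennreal (w2 x) * indicator B x \<partial>lebesgue)"
    unfolding wmeas_def by (intro nn_integral_mono) (auto split: split_indicator)
  also have "\<dots> = wmeas w2 A + wmeas w2 B"
    unfolding wmeas_def using assms by (intro nn_integral_add borel_measurable_times_ennreal borel_measurable_indicator) auto
  finally show ?thesis .
qed

lemma a_powr: "a k powr p = b k powr p * ballweight w2 k powr (p / q)"
  by (simp add: herz_a_def powr_mult powr_powr)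

lemma cell_term_le: 
  assumes "A \<subseteq> dyadic_ball k" shows "ennreal (b k powr p) * ennpow (wmeas w2 A) (p / q) \<le> ennreal (a k powr p)"
proof -
  have "ennpow (wmeas w2 A) (p / q) \<le> ennpow (wmeas w2 (dyadic_ball k)) (p / q)"
    using p q assms by (intro ennpow_mono wmeas_mono) auto
  also have "\<dots> = ennreal (ballweight w2 k powr (p / q))" using w2[of k] by (simp add: ennpow_ennreal)
  finally have "ennreal (b k powr p) * ennpow (wmeas w2 A) (p / q) \<le> ennreal (b k powr p) * ennreal (ballweight w2 k powr (p / q))"
    by (rule mult_left_mono) simp
  then show ?thesis by (simp add: a_powr ennreal_mult)
qed

text \<open>The bounds for the inner and outer parts are uniform on a cell, so their level sets in E
  k are either empty or estimated by the whole cell, that is by (a k)^p. For the inner part, being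
  non-empty forces a k \<le> T, and \<open>a_sum_le\<close> applies. For the outer part it bounds
  c^p by a sum over j \<ge> k + 2, which divided by c^p is inserted as a factor at least 1.\<close>

lemma herz_weak_estimate:
  assumes fin: "(\<integral>\<^sup>+j. ennpow (mass E f j) p \<partial>count_space I) < top" and \<sigma>: "0 < \<sigma>"
  shows "(\<integral>\<^sup>+k. ennreal (b k powr p) * ennpow (wmeas w2 {x \<in> E k. ennreal \<sigma> < G_fun \<beta> f x}) (p / q) \<partial>count_space I)
    \<le> ennreal (M0 * \<sigma> powr - p) * (\<integral>\<^sup>+j. ennpow (mass E f j) p \<partial>count_space I)"
proof -
  define N where "N = (\<integral>\<^sup>+j. ennpow (mass E f j) p \<partial>count_space I)"
  define c where "c = \<sigma> / 3"
  have c: "0 < c" using \<sigma> by (simp add: c_def)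
  define X where "X = enn2real (\<integral>\<^sup>+j. mass E f j \<partial>count_space I)"
  have X: "(\<integral>\<^sup>+j. mass E f j \<partial>count_space I) = ennreal X" "0 \<le> X"
    using mass_sum_finite[OF fin] by (auto simp: X_def)
  have XN: "ennreal (X powr p) \<le> N" using mass_sum_le p unfolding N_def X(1) by (simp add: ennpow_ennreal_pos X(2))
  note loc = herz_loc_integrable[OF fin]
  \<comment> \<open>The bound of \<open>inner_part_le\<close> can exceed c only if a k is below this
    value.\<close>
  define T where "T = Q * X / c"
  have T: "0 \<le> T" using Q_nonneg X c by (simp add: T_def)
  define P where "P k j = ennreal (K powr (p / q) * D powr p * c powr - p) * indicator {k - 1..k + 1} j" for k j :: int
  define L where "L k j = ennreal (Q powr p * c powr - p * (a k powr p / a j powr p)) * indicator {k + 2..} j" for k j :: int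
  have cell_bound: "ennreal (b k powr p) * ennpow (wmeas w2 {x \<in> E k. ennreal \<sigma> < G_fun \<beta> f x}) (p / q)
     \<le> ennreal (a k powr p) * indicator {k. a k \<le> T} k + (\<integral>\<^sup>+j. P k j * ennpow (mass E f j) p \<partial>count_space I)
       + (\<integral>\<^sup>+j. L k j * ennpow (mass E f j) p \<partial>count_space I)" if k: "k \<in> I" for k
  proof -
    define A1 where "A1 = - (\<Union>j\<in>{j\<in>I. k - 1 \<le> j}. E j)"
    define A2 where "A2 = (\<Union>j\<in>{j\<in>I. k - 1 \<le> j \<and> j < k + 2}. E j)"
    define A3 where "A3 = (\<Union>j\<in>{j\<in>I. k + 2 \<le> j}. E j)"
    have A: "A2 \<in> sets lebesgue" "A3 \<in> sets lebesgue" unfolding A2_def A3_def by (intro UN_cells_sets; auto)+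
    have "(\<Union>j\<in>{j\<in>I. k - 1 \<le> j}. E j) \<in> sets lebesgue" by (intro UN_cells_sets) auto
    from sets.compl_sets[OF this] have A1: "A1 \<in> sets lebesgue"
      unfolding A1_def Compl_eq_Diff_UNIV by (simp only: space_completion space_lborel space_borel)
    have "{j\<in>I. k - 1 \<le> j} = {j\<in>I. k - 1 \<le> j \<and> j < k + 2} \<union> {j\<in>I. k + 2 \<le> j}" by auto
    then have un: "A1 = - (A2 \<union> A3)" unfolding A1_def A2_def A3_def by (simp only: UN_Un)
    have "E i \<inter> E j = {}" if "i \<in> I" "j \<in> I" "i < k + 2" "k + 2 \<le> j" for i j
      using E_disjoint that unfolding disjoint_family_on_def by force
    then have disj: "A2 \<inter> A3 = {}" unfolding A2_def A3_def by blast
    let ?f1 = "restr A1 f" and ?f2 = "restr A2 f" and ?f3 = "restr A3 f"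
    have feq: "(\<lambda>y. ?f1 y + ?f2 y + ?f3 y) = f"
      using un disj by (auto simp: fun_eq_iff restr_def split: split_indicator)
    have loc': "loc_integrable ?f1" "loc_integrable ?f2" "loc_integrable ?f3"
      using loc A A1 by (auto intro: loc_integrable_restr)
    have meas: "{x. ennreal c < G_fun \<beta> g x} \<in> sets lebesgue" if "loc_integrable g" for g
    proof -
      have [measurable]: "G_fun \<beta> g \<in> borel_measurable lebesgue" by (rule G_fun_measurable[OF \<beta> that])
      have "{x \<in> space lebesgue. ennreal c < G_fun \<beta> g x} \<in> sets lebesgue" by measurable
      then show ?thesis by simp
    qed
    define B1 where "B1 = {x \<in> E k. ennreal c < G_fun \<beta> ?f1 x}"
    define B2 where "B2 = {x. ennreal c < G_fun \<beta> ?f2 x}"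
    define B3 where "B3 = {x \<in> E k. ennreal c < G_fun \<beta> ?f3 x}"
    have "B1 = E k \<inter> {x. ennreal c < G_fun \<beta> ?f1 x}" "B3 = E k \<inter> {x. ennreal c < G_fun \<beta> ?f3 x}"
      by (auto simp: B1_def B3_def)
    then have B: "B1 \<in> sets lebesgue" "B2 \<in> sets lebesgue" "B3 \<in> sets lebesgue"
      using meas loc' E_sets[OF k] by (auto simp: B2_def)
    have "{x \<in> E k. ennreal \<sigma> < G_fun \<beta> f x} \<subseteq> B1 \<union> B2 \<union> B3"
    proof
      fix x assume x: "x \<in> {x \<in> E k. ennreal \<sigma> < G_fun \<beta> f x}"
      then have "ennreal \<sigma> < G_fun \<beta> (\<lambda>y. ?f1 y + ?f2 y + ?f3 y) x" unfolding feq by simp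
      then show "x \<in> B1 \<union> B2 \<union> B3"
        using G_fun_split[OF \<beta> loc', of \<sigma> x] \<sigma> x by (auto simp: B1_def B2_def B3_def c_def)
    qed
    then have "wmeas w2 {x \<in> E k. ennreal \<sigma> < G_fun \<beta> f x} \<le> wmeas w2 (B1 \<union> B2 \<union> B3)" by (rule wmeas_mono)
    also have "\<dots> \<le> wmeas w2 B1 + wmeas w2 B2 + wmeas w2 B3"
      using B by (intro order_trans[OF wmeas_Un_le] add_mono wmeas_Un_le) auto
    finally have "ennpow (wmeas w2 {x \<in> E k. ennreal \<sigma> < G_fun \<beta> f x}) (p / q) \<le> ennpow (wmeas w2 B1 + wmeas w2 B2 + wmeas w2 B3) (p / q)"
      using p q by (intro ennpow_mono) auto
    also have "\<dots> \<le> ennpow (wmeas w2 B1) (p / q) + ennpow (wmeas w2 B2) (p / q) + ennpow (wmeas w2 B3) (p / q)"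
      using p q by (intro order_trans[OF ennpow_add_le] add_mono ennpow_add_le) auto
    finally have "ennreal (b k powr p) * ennpow (wmeas w2 {x \<in> E k. ennreal \<sigma> < G_fun \<beta> f x}) (p / q)
        \<le> ennreal (b k powr p) * (ennpow (wmeas w2 B1) (p / q) + ennpow (wmeas w2 B2) (p / q) + ennpow (wmeas w2 B3) (p / q))"
      by (rule mult_left_mono) simp
    also have "\<dots> = ennreal (b k powr p) * ennpow (wmeas w2 B1) (p / q) + ennreal (b k powr p) * ennpow (wmeas w2 B2) (p / q)
        + ennreal (b k powr p) * ennpow (wmeas w2 B3) (p / q)"
      by (simp add: distrib_left)
    also have "\<dots> \<le> ennreal (a k powr p) * indicator {k. a k \<le> T} k + (\<integral>\<^sup>+j. P k j * ennpow (mass E f j) p \<partial>count_space I)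
       + (\<integral>\<^sup>+j. L k j * ennpow (mass E f j) p \<partial>count_space I)"
    proof (intro add_mono)
      show "ennreal (b k powr p) * ennpow (wmeas w2 B1) (p / q) \<le> ennreal (a k powr p) * indicator {k. a k \<le> T} k"
      proof (cases "B1 = {}")
        case True
        then show ?thesis using p q by (simp add: wmeas_def ennpow_zero)
      next
        case False
        then obtain x where x: "x \<in> E k" "ennreal c < G_fun \<beta> ?f1 x" by (auto simp: B1_def)
        have "G_fun \<beta> ?f1 x \<le> ennreal (Q / a k) * ennreal X"
          using inner_part_le[OF k x(1)] unfolding A1_def X(1) .
        also have "\<dots> = ennreal (Q / a k * X)" using Q_nonneg a_pos[of k] X by (intro ennreal_mult[symmetric]) auto
        finally have "c < Q / a k * X" using x(2) c by (metis ennreal_less_iff less_le_trans less_imp_le)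
        then have "a k \<le> T" using a_pos[of k] c by (simp add: T_def field_simps)
        moreover have "B1 \<subseteq> dyadic_ball k" using E_sub[OF k] by (auto simp: B1_def)
        ultimately show ?thesis using cell_term_le[of B1 k] by simp
      qed
      show "ennreal (b k powr p) * ennpow (wmeas w2 B2) (p / q) \<le> (\<integral>\<^sup>+j. P k j * ennpow (mass E f j) p \<partial>count_space I)"
        unfolding B2_def A2_def P_def by (rule middle_part_le[OF fin c])
      show "ennreal (b k powr p) * ennpow (wmeas w2 B3) (p / q) \<le> (\<integral>\<^sup>+j. L k j * ennpow (mass E f j) p \<partial>count_space I)"
      proof (cases "B3 = {}")
        case True
        then show ?thesis using p q by (simp add: wmeas_def ennpow_zero)
      next
        case False
        then obtain x where x: "x \<in> E k" "ennreal c < G_fun \<beta> ?f3 x" by (auto simp: B3_def)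
        have B3k: "B3 \<subseteq> dyadic_ball k" using E_sub[OF k] by (auto simp: B3_def)
        let ?Y = "\<integral>\<^sup>+j. ennreal (Q / a j) * indicator {k + 2..} j * mass E f j \<partial>count_space I"
        have "ennreal c \<le> ?Y"
          using x(2) outer_part_le[OF k x(1)] unfolding A3_def by (rule order_trans[OF less_imp_le])
        then have "ennpow (ennreal c) p \<le> ennpow ?Y p" using p by (intro ennpow_mono)
        also have "\<dots> \<le> (\<integral>\<^sup>+j. ennpow (ennreal (Q / a j) * indicator {k + 2..} j * mass E f j) p \<partial>count_space I)"
          by (rule ennpow_nn_integral_count_space_le[OF _ p]) simp
        also have "\<dots> = (\<integral>\<^sup>+j. ennreal (Q powr p / a j powr p) * indicator {k + 2..} j * ennpow (mass E f j) p \<partial>count_space I)"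
        proof (rule nn_integral_cong)
          fix j
          have "ennpow (ennreal (Q / a j)) p = ennreal (Q powr p / a j powr p)"
            using Q_nonneg a_pos[of j] p by (subst ennpow_ennreal_pos) (auto simp: powr_divide)
          then show "ennpow (ennreal (Q / a j) * indicator {k + 2..} j * mass E f j) p = ennreal (Q powr p / a j powr p) * indicator {k + 2..} j * ennpow (mass E f j) p"
            using p by (auto simp: ennpow_mult ennpow_zero ennpow_one_left split: split_indicator)
        qed
        finally have cY: "ennreal (c powr p) \<le> (\<integral>\<^sup>+j. ennreal (Q powr p / a j powr p) * indicator {k + 2..} j * ennpow (mass E f j) p \<partial>count_space I)"
          using c p by (simp add: ennpow_ennreal)
        have "ennreal (b k powr p) * ennpow (wmeas w2 B3) (p / q) \<le> ennreal (a k powr p)" by (rule cell_term_le[OF B3k])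
        also have "\<dots> = ennreal (a k powr p * c powr - p) * ennreal (c powr p)"
          using c by (simp add: ennreal_mult[symmetric] powr_minus)
        also have "\<dots> \<le> ennreal (a k powr p * c powr - p) * (\<integral>\<^sup>+j. ennreal (Q powr p / a j powr p) * indicator {k + 2..} j * ennpow (mass E f j) p \<partial>count_space I)"
          by (rule mult_left_mono[OF cY]) simp
        also have "\<dots> = (\<integral>\<^sup>+j. ennreal (a k powr p * c powr - p) * (ennreal (Q powr p / a j powr p) * indicator {k + 2..} j * ennpow (mass E f j) p) \<partial>count_space I)"
          by (rule nn_integral_cmult[symmetric]) simp
        also have "\<dots> = (\<integral>\<^sup>+j. L k j * ennpow (mass E f j) p \<partial>count_space I)"
        proof (rule nn_integral_cong)
          fix j
          have "ennreal (a k powr p * c powr - p) * ennreal (Q powr p / a j powr p) = ennreal (Q powr p * c powr - p * (a k powr p / a j powr p))"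
            by (simp add: ennreal_mult[symmetric] mult_ac)
          then show "ennreal (a k powr p * c powr - p) * (ennreal (Q powr p / a j powr p) * indicator {k + 2..} j * ennpow (mass E f j) p) = L k j * ennpow (mass E f j) p"
            unfolding L_def by (simp only: mult.assoc[symmetric])
        qed
        finally show ?thesis .
      qed
    qed
    finally show ?thesis .
  qed
  have s1: "(\<integral>\<^sup>+k. ennreal (a k powr p) * indicator {k. a k \<le> T} k \<partial>count_space I) \<le> ennreal (Q powr p * G0 * c powr - p) * N"
  proof -
    have "(\<integral>\<^sup>+k. ennreal (a k powr p) * indicator {k. a k \<le> T} k \<partial>count_space I) \<le> ennreal (T powr p * G0)"
      by (rule a_sum_le[OF T])
    also have "T powr p * G0 = Q powr p * G0 * c powr - p * X powr p"
      using c X Q_nonneg by (simp add: T_def powr_divide powr_mult powr_minus_divide)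
    also have "ennreal \<dots> = ennreal (Q powr p * G0 * c powr - p) * ennreal (X powr p)"
      using G0_pos by (intro ennreal_mult) auto
    also have "\<dots> \<le> ennreal (Q powr p * G0 * c powr - p) * N" by (intro mult_left_mono XN) auto
    finally show ?thesis .
  qed
  have s2: "(\<integral>\<^sup>+k. (\<integral>\<^sup>+j. P k j * ennpow (mass E f j) p \<partial>count_space I) \<partial>count_space I)
      \<le> ennreal (3 * (K powr (p / q) * D powr p) * c powr - p) * N"
    unfolding N_def
  proof (rule nn_integral_count_space_kernel_le)
    fix j assume "j \<in> I"
    let ?c = "K powr (p / q) * D powr p * c powr - p"
    show "(\<integral>\<^sup>+k. P k j \<partial>count_space I) \<le> ennreal (3 * (K powr (p / q) * D powr p) * c powr - p)"
    proof (rule nn_integral_count_space_le)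
      fix F assume F: "finite F" "F \<subseteq> I"
      have "(\<Sum>k\<in>F. P k j) = (\<Sum>k\<in>F. if k \<in> {j - 1..j + 1} then ennreal ?c else 0)"
        by (intro sum.cong) (auto simp: P_def split: split_indicator)
      also have "\<dots> = (\<Sum>k\<in>F \<inter> {j - 1..j + 1}. ennreal ?c)"
        by (rule sum.inter_restrict[OF F(1), symmetric])
      also have "\<dots> \<le> (\<Sum>k\<in>{j - 1..j + 1}. ennreal ?c)" by (intro sum_mono2) auto
      also have "\<dots> = ennreal (3 * ?c)" by (simp add: ennreal_mult)
      finally show "(\<Sum>k\<in>F. P k j) \<le> ennreal (3 * (K powr (p / q) * D powr p) * c powr - p)" by (simp add: mult.assoc)
    qed simp
  qed simp_all
  \<comment> \<open>For fixed j the column sum over k \<le> j - 2 of (a k / a j)^p is bounded by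
    \<open>a_sum_le\<close> at threshold a j.\<close>
  have s3: "(\<integral>\<^sup>+k. (\<integral>\<^sup>+j. L k j * ennpow (mass E f j) p \<partial>count_space I) \<partial>count_space I)
      \<le> ennreal (Q powr p * G0 * c powr - p) * N"
    unfolding N_def
  proof (rule nn_integral_count_space_kernel_le)
    fix j assume "j \<in> I"
    let ?c = "Q powr p * c powr - p / a j powr p"
    have "(\<integral>\<^sup>+k. L k j \<partial>count_space I) \<le> (\<integral>\<^sup>+k. ennreal ?c * (ennreal (a k powr p) * indicator {k. a k \<le> a j} k) \<partial>count_space I)"
    proof (rule nn_integral_mono)
      fix k
      show "L k j \<le> ennreal ?c * (ennreal (a k powr p) * indicator {k. a k \<le> a j} k)"
      proof (cases "k + 2 \<le> j")
        case True
        have "a k \<le> \<theta> ^ nat (j - k) * a j" using True by (intro a_geometric) auto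
        also have "\<dots> \<le> 1 * a j" using \<theta> a_pos[of j] by (intro mult_right_mono power_le_one) auto
        finally have "a k \<le> a j" by simp
        then show ?thesis using True by (simp add: L_def ennreal_mult[symmetric] mult_ac)
      qed (simp add: L_def)
    qed
    also have "\<dots> = ennreal ?c * (\<integral>\<^sup>+k. ennreal (a k powr p) * indicator {k. a k \<le> a j} k \<partial>count_space I)"
      by (rule nn_integral_cmult) simp
    also have "\<dots> \<le> ennreal ?c * ennreal (a j powr p * G0)"
      using a_pos[of j] by (intro mult_left_mono a_sum_le) auto
    also have "\<dots> = ennreal (Q powr p * G0 * c powr - p)"
      using a_pos[of j] G0_pos by (simp add: ennreal_mult[symmetric])
    finally show "(\<integral>\<^sup>+k. L k j \<partial>count_space I) \<le> ennreal (Q powr p * G0 * c powr - p)" .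
  qed simp_all
  have "(\<integral>\<^sup>+k. ennreal (b k powr p) * ennpow (wmeas w2 {x \<in> E k. ennreal \<sigma> < G_fun \<beta> f x}) (p / q) \<partial>count_space I)
    \<le> (\<integral>\<^sup>+k. ennreal (a k powr p) * indicator {k. a k \<le> T} k + (\<integral>\<^sup>+j. P k j * ennpow (mass E f j) p \<partial>count_space I)
       + (\<integral>\<^sup>+j. L k j * ennpow (mass E f j) p \<partial>count_space I) \<partial>count_space I)"
    using cell_bound by (intro nn_integral_mono) auto
  also have "\<dots> = (\<integral>\<^sup>+k. ennreal (a k powr p) * indicator {k. a k \<le> T} k \<partial>count_space I)
      + (\<integral>\<^sup>+k. (\<integral>\<^sup>+j. P k j * ennpow (mass E f j) p \<partial>count_space I) \<partial>count_space I)
      + (\<integral>\<^sup>+k. (\<integral>\<^sup>+j. L k j * ennpow (mass E f j) p \<partial>count_space I) \<partial>count_space I)"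
    by (simp add: nn_integral_add)
  also have "\<dots> \<le> ennreal (Q powr p * G0 * c powr - p) * N + ennreal (3 * (K powr (p / q) * D powr p) * c powr - p) * N
      + ennreal (Q powr p * G0 * c powr - p) * N"
    by (intro add_mono s1 s2 s3)
  also have "\<dots> = ennreal (Q powr p * G0 * c powr - p + 3 * (K powr (p / q) * D powr p) * c powr - p + Q powr p * G0 * c powr - p) * N"
  proof -
    have *: "ennreal u * N + ennreal v * N + ennreal u * N = ennreal (u + v + u) * N" if "0 \<le> u" "0 \<le> v" for u v
      using that by (simp only: ennreal_plus distrib_right add_nonneg_nonneg)
    show ?thesis by (rule *) (use G0_pos in auto)
  qed
  also have "Q powr p * G0 * c powr - p + 3 * (K powr (p / q) * D powr p) * c powr - p + Q powr p * G0 * c powr - p = M0 * \<sigma> powr - p"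
  proof -
    have "c powr - p = 3 powr p * \<sigma> powr - p" using \<sigma> by (simp add: c_def powr_divide powr_minus_divide)
    then show ?thesis by (simp add: M0_def algebra_simps)
  qed
  finally show ?thesis unfolding N_def .
qed

end

end

context herz_setting
begin

lemma ennpow_w1: "ennpow (wmeas w1 (dyadic_ball k)) (\<alpha> * p / real DIM('a)) = ennreal (b k powr p)"
  using w1[of k] by (simp add: ennpow_ennreal herz_b_def powr_powr mult_ac)

text \<open>Under the power 1/p the factor \<sigma>^(-p) becomes 1/\<sigma> and cancels the \<sigma>
  of the weak norm. The added 1 keeps the constant positive.\<close>

lemma weak_norm_le:
  fixes f :: "'a \<Rightarrow> complex"
  assumes cells: "cells I E" and f: "f \<in> borel_measurable lebesgue"
  defines "N \<equiv> ennpow (\<integral>\<^sup>+k. ennpow (wmeas w1 (dyadic_ball k)) (\<alpha> * p / real DIM('a)) * ennpow (Lq_norm q w2 (restr (E k) f)) p \<partial>count_space I) (1 / p)"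
  assumes fin: "N < top"
  shows "G_fun \<beta> f \<in> borel_measurable lebesgue"
    and "(SUP \<sigma>\<in>{0::real<..}. ennreal \<sigma> * ennpow (\<integral>\<^sup>+k. ennpow (wmeas w1 (dyadic_ball k)) (\<alpha> * p / real DIM('a)) *
      ennpow (wmeas w2 {x \<in> E k. ennreal \<sigma> < G_fun \<beta> f x}) (p / q) \<partial>count_space I) (1 / p)) \<le> ennreal (M0 powr (1 / p) + 1) * N"
proof -
  define S where "S = (\<integral>\<^sup>+j. ennpow (mass E f j) p \<partial>count_space I)"
  have N: "N = ennpow S (1 / p)" unfolding N_def S_def ennpow_mass ennpow_w1 ..
  have S: "S < top" using fin p unfolding N by (cases "S = top") (auto simp: ennpow_def less_top)
  show "G_fun \<beta> f \<in> borel_measurable lebesgue"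
    by (rule G_fun_measurable[OF \<beta> herz_loc_integrable[OF cells f S[unfolded S_def]]])
  show "(SUP \<sigma>\<in>{0::real<..}. ennreal \<sigma> * ennpow (\<integral>\<^sup>+k. ennpow (wmeas w1 (dyadic_ball k)) (\<alpha> * p / real DIM('a)) *
      ennpow (wmeas w2 {x \<in> E k. ennreal \<sigma> < G_fun \<beta> f x}) (p / q) \<partial>count_space I) (1 / p)) \<le> ennreal (M0 powr (1 / p) + 1) * N"
  proof (rule SUP_least)
    fix \<sigma> :: real assume "\<sigma> \<in> {0<..}"
    then have \<sigma>: "0 < \<sigma>" by simp
    have "(\<integral>\<^sup>+k. ennreal (b k powr p) * ennpow (wmeas w2 {x \<in> E k. ennreal \<sigma> < G_fun \<beta> f x}) (p / q) \<partial>count_space I)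
        \<le> ennreal (M0 * \<sigma> powr - p) * S"
      unfolding S_def by (rule herz_weak_estimate[OF cells f S[unfolded S_def] \<sigma>])
    then have "ennpow (\<integral>\<^sup>+k. ennreal (b k powr p) * ennpow (wmeas w2 {x \<in> E k. ennreal \<sigma> < G_fun \<beta> f x}) (p / q) \<partial>count_space I) (1 / p)
        \<le> ennpow (ennreal (M0 * \<sigma> powr - p) * S) (1 / p)"
      using p by (intro ennpow_mono) auto
    also have "\<dots> = ennreal ((M0 * \<sigma> powr - p) powr (1 / p)) * N"
      using p M0_nonneg by (simp add: ennpow_mult ennpow_ennreal_pos N)
    also have "(M0 * \<sigma> powr - p) powr (1 / p) = M0 powr (1 / p) / \<sigma>"
    proof -
      have "(M0 * \<sigma> powr - p) powr (1 / p) = M0 powr (1 / p) * \<sigma> powr (- p * (1 / p))"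
        by (simp only: powr_mult powr_powr)
      also have "- p * (1 / p) = - 1" using p by simp
      finally show ?thesis using \<sigma> by (simp add: powr_minus_divide)
    qed
    finally have "ennreal \<sigma> * ennpow (\<integral>\<^sup>+k. ennreal (b k powr p) * ennpow (wmeas w2 {x \<in> E k. ennreal \<sigma> < G_fun \<beta> f x}) (p / q) \<partial>count_space I) (1 / p)
        \<le> ennreal \<sigma> * (ennreal (M0 powr (1 / p) / \<sigma>) * N)" by (rule mult_left_mono) simp
    also have "\<dots> = ennreal (M0 powr (1 / p)) * N"
    proof -
      have "ennreal \<sigma> * ennreal (M0 powr (1 / p) / \<sigma>) = ennreal (M0 powr (1 / p))"
        using \<sigma> by (simp add: ennreal_mult[symmetric])
      then show ?thesis by (simp only: mult.assoc[symmetric])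
    qed
    also have "\<dots> \<le> ennreal (M0 powr (1 / p) + 1) * N" by (intro mult_right_mono ennreal_leI) auto
    finally show "ennreal \<sigma> * ennpow (\<integral>\<^sup>+k. ennpow (wmeas w1 (dyadic_ball k)) (\<alpha> * p / real DIM('a)) *
      ennpow (wmeas w2 {x \<in> E k. ennreal \<sigma> < G_fun \<beta> f x}) (p / q) \<partial>count_space I) (1 / p) \<le> ennreal (M0 powr (1 / p) + 1) * N"
      unfolding ennpow_w1 .
  qed
qed

end

section \<open>The two concrete families of cells and the theorem\<close>

lemma annulus_sets [simp]: "annulus k \<in> sets lebesgue"
  by (auto simp: annulus_def)

lemma cells_annulus: "cells UNIV (annulus :: int \<Rightarrow> 'a::euclidean_space set)"
  unfolding cells_def
proof (intro conjI ballI impI subsetI)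
  fix x :: 'a assume "x \<in> - {0}"
  then obtain k where "2 powi (k - 1) < norm x" "norm x \<le> 2 powi k" using ex_scale[of "norm x"] by auto
  then have "x \<in> annulus k" by (auto simp: annulus_def dyadic_ball_def)
  then show "x \<in> (\<Union>k. annulus k)" by blast
qed (auto simp: annulus_def)

lemma cells_nh_annulus: "cells {0..} (\<lambda>k. nh_annulus (nat k) :: 'a::euclidean_space set)"
  unfolding cells_def
proof (intro conjI ballI impI subsetI)
  fix x :: 'a
  obtain k where k: "x = 0 \<or> 2 powi (k - 1) < norm x \<and> norm x \<le> 2 powi k" using ex_scale[of "norm x"] by auto
  show "x \<in> (\<Union>k\<in>{0..}. nh_annulus (nat k))"
  proof (cases "x = 0 \<or> k \<le> 0")
    case True
    have "norm x \<le> 2 powi 0"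
    proof (cases "x = 0")
      case False
      then have "norm x \<le> 2 powi k" using k by auto
      also have "\<dots> \<le> 2 powi 0" using True False by (intro power_int_increasing) auto
      finally show ?thesis .
    qed simp
    then have "x \<in> nh_annulus (nat 0)" by (auto simp: nh_annulus_def dyadic_ball_def)
    then show ?thesis by (intro UN_I[of 0]) auto
  next
    case False
    then have "x \<in> nh_annulus (nat k)" using k by (auto simp: nh_annulus_def annulus_def dyadic_ball_def)
    then show ?thesis using False by (intro UN_I[of k]) auto
  qed
qed (auto simp: annulus_def nh_annulus_def split: if_splits)

lemma nn_integral_nat_int: "(\<integral>\<^sup>+k. h (int k) \<partial>count_space (UNIV :: nat set)) = (\<integral>\<^sup>+k. h k \<partial>count_space {0..})"
proof -
  have "bij_betw int UNIV {0..}"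
    by (rule bij_betw_byWitness[where f'=nat]) auto
  then show ?thesis by (rule nn_integral_bij_count_space)
qed

theorem corollary1p6:
  fixes \<beta> p q \<alpha> q1 q2 :: real
    and w1 w2 :: "'a::euclidean_space \<Rightarrow> real"
  assumes "0 < \<beta>" "\<beta> \<le> 1"
    and "0 < p" "p \<le> 1"
    and "1 < q"
    and "1 \<le> q1"
    and "1 \<le> q2" "q2 \<le> q"
    and "weight w1" "w1 \<in> muckenhoupt q1"
    and "weight w2" "w2 \<in> muckenhoupt q2"
    and "\<alpha> * q1 = real DIM('a) * (1 - q2 / q)"
  shows "\<exists>C::real. C > 0 \<and>
    (\<forall>f \<in> herz_hom \<alpha> p q w1 w2.
       G_fun \<beta> f \<in> weak_herz_hom \<alpha> p q w1 w2 \<and>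
       weak_herz_hom_norm \<alpha> p q w1 w2 (G_fun \<beta> f) \<le> ennreal C * herz_hom_norm \<alpha> p q w1 w2 f) \<and>
    (\<forall>f \<in> herz_nonhom \<alpha> p q w1 w2.
       G_fun \<beta> f \<in> weak_herz_nonhom \<alpha> p q w1 w2 \<and>
       weak_herz_nonhom_norm \<alpha> p q w1 w2 (G_fun \<beta> f) \<le> ennreal C * herz_nonhom_norm \<alpha> p q w1 w2 f)"
proof -
  note \<beta> = assms(1,2) and p = assms(3,4) and q = assms(5) and w = assms(9) assms(11)
  let ?n = "real DIM('a)"
  have n: "0 < ?n" by simp
  have q0: "0 < q" using q by simp
  have "0 \<le> 1 - q2 / q" using assms(8) q0 by simp
  then have "0 \<le> \<alpha> * q1" using assms(13) n by simp
  \<comment> \<open>Nonnegativity of \<alpha> makes w1(B_k)^(\<alpha>/n) nondecreasing in k.\<close>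
  then have \<alpha>: "0 \<le> \<alpha>" using assms(6) by (simp add: zero_le_mult_iff)
  obtain C1 where C1: "0 < C1" and av1: "averaging q1 C1 w1" using muckenhoupt_averaging[OF w(1) assms(6,10)] by blast
  obtain C2 where C2: "0 < C2" and av2: "averaging q2 C2 w2" using muckenhoupt_averaging[OF w(2) assms(7,12)] by blast
  \<comment> \<open>w2 is used with two exponents: q2 for the sharp growth of its balls, q for
    Hoelder's inequality and the weak type bound.\<close>
  obtain C where C: "0 < C" and av: "averaging q C w2" using averaging_mono[OF w(2) av2 C2 assms(7,8)] by blast
  obtain \<theta>0 where \<theta>0: "0 < \<theta>0" "\<theta>0 < 1" and rev: "\<And>k. ballweight w2 (k - 1) \<le> \<theta>0 * ballweight w2 k"
    using ballweight_reverse_doubling[OF w(2) av2 C2] by blast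
  obtain K where K: "0 < K" and weak: "\<forall>f \<rho> c. integrable lebesgue f \<longrightarrow> (\<forall>x. \<rho> < norm x \<longrightarrow> f x = 0) \<longrightarrow> 0 < c \<longrightarrow>
    wmeas w2 {x. ennreal c < G_fun \<beta> f x} \<le> ennreal (K * c powr - q) * (\<integral>\<^sup>+x. ennreal (norm (f x) powr q * w2 x) \<partial>lebesgue)"
    using G_weak_type[OF \<beta> _ av _ w(2)] q C by (auto simp: less_imp_le)
  note b1 = ballweight[OF w(1) av1 C1] and b2 = ballweight[OF w(2) av2 C2]
  define e where "e = \<alpha> / ?n"
  have e: "0 \<le> e" using \<alpha> by (simp add: e_def)
  \<comment> \<open>The condition on \<alpha> in the form used: the growth exponents of
    w1(B_k)^(\<alpha>/n) and w2(B_k)^(1/q), measured in volume, add up to 1.\<close>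
  have eq1: "q1 * e + q2 * (1 / q) = 1"
    using assms(13) n q0 by (simp add: e_def field_simps)
  define c1 where "c1 = C1 * (2 ^ DIM('a)) powr q1"
  define c2 where "c2 = C2 * (2 ^ DIM('a)) powr q2"
  have c: "0 < c1" "0 < c2" using C1 C2 by (auto simp: c1_def c2_def)
  \<comment> \<open>\<open>D1\<close> pays for one step from b (k + 1) to b k, and \<open>D2\<close>
    for the growth of a.\<close>
  define D1 where "D1 = c1 powr e * (2 ^ DIM('a)) powr (q1 * e)"
  define D2 where "D2 = c1 powr e * c2 powr (1 / q)"
  define D where "D = max 1 (max D1 D2)"
  have D: "1 \<le> D" "D1 \<le> D" "D2 \<le> D" by (auto simp: D_def)
  have hb: "herz_b \<alpha> w1 k = ballweight w1 k powr e" for k by (simp add: herz_b_def e_def)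
  have ha: "herz_a \<alpha> q w1 w2 k = ballweight w1 k powr e * ballweight w2 k powr (1 / q)" for k by (simp add: herz_a_def hb)
  have bpos: "0 < herz_b \<alpha> w1 k" for k using b1(2)[of k] by (simp add: hb)
  have apos: "0 < herz_a \<alpha> q w1 w2 k" for k using b1(2)[of k] b2(2)[of k] by (simp add: ha)
  have b_mono: "herz_b \<alpha> w1 j \<le> herz_b \<alpha> w1 k" if "j \<le> k" for j k
    unfolding hb using e b1(2)[of j] ballweight_mono[OF w(1) that] by (intro powr_mono2) auto
  have b_dbl: "herz_b \<alpha> w1 k \<le> c1 powr e * ((2 powi k / 2 powi j) ^ DIM('a)) powr (q1 * e) * herz_b \<alpha> w1 j" if jk: "j \<le> k" for j k
  proof -
    have "ballweight w1 k \<le> c1 * ((2 powi k / 2 powi j) ^ DIM('a)) powr q1 * ballweight w1 j"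
      unfolding c1_def by (rule ballweight_doubling[OF w(1) av1 C1 jk])
    then have "ballweight w1 k powr e \<le> (c1 * ((2 powi k / 2 powi j) ^ DIM('a)) powr q1 * ballweight w1 j) powr e"
      using e b1(2)[of k] by (intro powr_mono2) auto
    then show ?thesis by (simp add: hb powr_mult powr_powr)
  qed
  interpret herz_setting w1 w2 \<beta> p q \<alpha> "\<theta>0 powr (1 / q)" D "C powr (1 / q) * (vol TYPE('a) * 2 ^ DIM('a))" K
  proof
    show "\<theta>0 powr (1 / q) < 1" using powr_less_mono2[of "1 / q" \<theta>0 1] \<theta>0 q0 by simp
    \<comment> \<open>The w1 factor does not decrease in k; the gain comes from reverse doubling of
      w2.\<close>
    show "herz_a \<alpha> q w1 w2 (k - 1) \<le> \<theta>0 powr (1 / q) * herz_a \<alpha> q w1 w2 k" for k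
    proof -
      have "ballweight w2 (k - 1) powr (1 / q) \<le> (\<theta>0 * ballweight w2 k) powr (1 / q)"
        using rev[of k] b2(2)[of "k - 1"] q0 by (intro powr_mono2) auto
      also have "\<dots> = \<theta>0 powr (1 / q) * ballweight w2 k powr (1 / q)" by (rule powr_mult)
      finally have "herz_b \<alpha> w1 (k - 1) * ballweight w2 (k - 1) powr (1 / q) \<le> herz_b \<alpha> w1 k * (\<theta>0 powr (1 / q) * ballweight w2 k powr (1 / q))"
        using b_mono[of "k - 1" k] bpos[of k] by (intro mult_mono) auto
      then show ?thesis by (simp add: herz_a_def mult_ac)
    qed
    show "herz_a \<alpha> q w1 w2 k * (2 powi j) ^ DIM('a) \<le> D * (2 powi k) ^ DIM('a) * herz_a \<alpha> q w1 w2 j" if jk: "j \<le> k" for j k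
    proof -
      define s where "s = ((2::real) powi k / 2 powi j) ^ DIM('a)"
      have s: "0 < s" by (simp add: s_def)
      have "ballweight w2 k \<le> c2 * s powr q2 * ballweight w2 j"
        unfolding c2_def s_def by (rule ballweight_doubling[OF w(2) av2 C2 jk])
      then have "ballweight w2 k powr (1 / q) \<le> (c2 * s powr q2 * ballweight w2 j) powr (1 / q)"
        using b2(2)[of k] q0 by (intro powr_mono2) auto
      also have "\<dots> = c2 powr (1 / q) * s powr (q2 * (1 / q)) * ballweight w2 j powr (1 / q)"
        by (simp only: powr_mult powr_powr)
      finally have "herz_b \<alpha> w1 k * ballweight w2 k powr (1 / q)
          \<le> (c1 powr e * s powr (q1 * e) * herz_b \<alpha> w1 j) * (c2 powr (1 / q) * s powr (q2 * (1 / q)) * ballweight w2 j powr (1 / q))"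
        using b_dbl[OF jk] bpos[of k] bpos[of j] unfolding s_def[symmetric] by (intro mult_mono) auto
      also have "\<dots> = D2 * (s powr (q1 * e) * s powr (q2 * (1 / q))) * herz_a \<alpha> q w1 w2 j"
        by (simp add: D2_def herz_a_def mult_ac)
      \<comment> \<open>The endpoint identity turns the product of the two growth rates into the
        plain ratio of volumes.\<close>
      also have "s powr (q1 * e) * s powr (q2 * (1 / q)) = s"
        unfolding powr_add[symmetric] eq1 using s by simp
      also have "D2 * s * herz_a \<alpha> q w1 w2 j \<le> D * s * herz_a \<alpha> q w1 w2 j"
        using D(3) s apos[of j] by (intro mult_right_mono) auto
      finally have "herz_a \<alpha> q w1 w2 k * (2 powi j) ^ DIM('a) \<le> D * s * herz_a \<alpha> q w1 w2 j * (2 powi j) ^ DIM('a)"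
        unfolding herz_a_def[of \<alpha> q w1 w2 k, symmetric] by (rule mult_right_mono) simp
      also have "\<dots> = D * (2 powi k) ^ DIM('a) * herz_a \<alpha> q w1 w2 j" by (simp add: s_def power_divide)
      finally show ?thesis .
    qed
    show "herz_b \<alpha> w1 j \<le> D * herz_b \<alpha> w1 k" if "j \<le> k + 1" for j k
    proof -
      have "herz_b \<alpha> w1 j \<le> herz_b \<alpha> w1 (k + 1)" by (rule b_mono[OF that])
      also have "\<dots> \<le> c1 powr e * ((2 powi (k + 1) / 2 powi k) ^ DIM('a)) powr (q1 * e) * herz_b \<alpha> w1 k"
        by (rule b_dbl) simp
      also have "(2::real) powi (k + 1) / 2 powi k = 2" by (simp add: power_int_add)
      also have "c1 powr e * (2 ^ DIM('a)) powr (q1 * e) * herz_b \<alpha> w1 k \<le> D * herz_b \<alpha> w1 k"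
        using D(2) bpos[of k] unfolding D1_def by (intro mult_right_mono) auto
      finally show ?thesis .
    qed
    show "(\<integral>\<^sup>+y\<in>E. ennreal (norm (f y)) \<partial>lebesgue)
        \<le> ennreal (C powr (1 / q) * (vol TYPE('a) * 2 ^ DIM('a)) * (2 powi k) ^ DIM('a) * ballweight w2 k powr (- 1 / q)) * Lq_norm q w2 (restr E f)"
      if "f \<in> borel_measurable lebesgue" "E \<in> sets lebesgue" "E \<subseteq> dyadic_ball k" for f :: "'a \<Rightarrow> complex" and E k
      using q by (intro dyadic_Holder[OF w(2) av C _ that]) simp
    show "wmeas w2 {x. ennreal c < G_fun \<beta> f x} \<le> ennreal (K * c powr - q) * (\<integral>\<^sup>+x. ennreal (norm (f x) powr q * w2 x) \<partial>lebesgue)"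
      if "integrable lebesgue f" "\<And>x. \<rho> < norm x \<Longrightarrow> f x = 0" "0 < c" for f :: "'a \<Rightarrow> complex" and \<rho> c
      using weak[rule_format, OF that] .
  qed (use \<beta> p q b1 b2 w \<theta>0 D K C in auto)
  define M where "M = M0 powr (1 / p) + 1"
  have M: "0 < M" by (simp add: M_def add_nonneg_pos)
  have hom: "G_fun \<beta> f \<in> weak_herz_hom \<alpha> p q w1 w2 \<and>
       weak_herz_hom_norm \<alpha> p q w1 w2 (G_fun \<beta> f) \<le> ennreal M * herz_hom_norm \<alpha> p q w1 w2 f"
    if f: "f \<in> herz_hom \<alpha> p q w1 w2" for f
  proof -
    have fm: "f \<in> borel_measurable lebesgue" and fin: "herz_hom_norm \<alpha> p q w1 w2 f < top"
      using f by (auto simp: herz_hom_def Lq_loc_def)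
    note eqs = herz_hom_norm_def weak_herz_hom_norm_def infsum_eq_nn_integral_count_space[OF countableI_type]
    have le: "weak_herz_hom_norm \<alpha> p q w1 w2 (G_fun \<beta> f) \<le> ennreal M * herz_hom_norm \<alpha> p q w1 w2 f"
      unfolding M_def eqs by (rule weak_norm_le(2)[OF cells_annulus fm fin[unfolded eqs]])
    have "G_fun \<beta> f \<in> borel_measurable lebesgue"
      by (rule weak_norm_le(1)[OF cells_annulus fm fin[unfolded eqs]])
    moreover have "weak_herz_hom_norm \<alpha> p q w1 w2 (G_fun \<beta> f) < top"
      by (rule le_less_trans[OF le]) (use fin in \<open>simp add: ennreal_mult_less_top\<close>)
    ultimately show ?thesis using le by (simp add: weak_herz_hom_def)
  qed
  have nonhom: "G_fun \<beta> f \<in> weak_herz_nonhom \<alpha> p q w1 w2 \<and>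
       weak_herz_nonhom_norm \<alpha> p q w1 w2 (G_fun \<beta> f) \<le> ennreal M * herz_nonhom_norm \<alpha> p q w1 w2 f"
    if f: "f \<in> herz_nonhom \<alpha> p q w1 w2" for f
  proof -
    have fm: "f \<in> borel_measurable lebesgue" and fin: "herz_nonhom_norm \<alpha> p q w1 w2 f < top"
      using f by (auto simp: herz_nonhom_def Lq_loc_def)
    have norm: "herz_nonhom_norm \<alpha> p q w1 w2 f = ennpow (\<integral>\<^sup>+k. ennpow (wmeas w1 (dyadic_ball k)) (\<alpha> * p / ?n) *
        ennpow (Lq_norm q w2 (restr (nh_annulus (nat k)) f)) p \<partial>count_space {0..}) (1 / p)"
      unfolding herz_nonhom_norm_def infsum_eq_nn_integral_count_space[OF countableI_type] nn_integral_nat_int[symmetric] by simp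
    have wnorm: "weak_herz_nonhom_norm \<alpha> p q w1 w2 g = (SUP \<sigma>\<in>{0::real<..}. ennreal \<sigma> * ennpow (\<integral>\<^sup>+k. ennpow (wmeas w1 (dyadic_ball k)) (\<alpha> * p / ?n) *
        ennpow (wmeas w2 {x \<in> nh_annulus (nat k). ennreal \<sigma> < g x}) (p / q) \<partial>count_space {0..}) (1 / p))" for g
      unfolding weak_herz_nonhom_norm_def infsum_eq_nn_integral_count_space[OF countableI_type] nn_integral_nat_int[symmetric] by simp
    have le: "weak_herz_nonhom_norm \<alpha> p q w1 w2 (G_fun \<beta> f) \<le> ennreal M * herz_nonhom_norm \<alpha> p q w1 w2 f"
      unfolding M_def norm wnorm by (rule weak_norm_le(2)[OF cells_nh_annulus fm fin[unfolded norm]])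
    have "G_fun \<beta> f \<in> borel_measurable lebesgue"
      by (rule weak_norm_le(1)[OF cells_nh_annulus fm fin[unfolded norm]])
    moreover have "weak_herz_nonhom_norm \<alpha> p q w1 w2 (G_fun \<beta> f) < top"
      by (rule le_less_trans[OF le]) (use fin in \<open>simp add: ennreal_mult_less_top\<close>)
    ultimately show ?thesis using le by (simp add: weak_herz_nonhom_def)
  qed
  show ?thesis using M hom nonhom by blast
qed

end
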